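(* Fix $k\ge1$, $\nu_0>0$ and $\alpha\in(0,1)$, and suppose that the estimators $\hat{\boldsymbol{\mu}}^{(n)}$ (of $\boldsymbol{\mu}$) and $\hat{\boldsymbol{\Sigma}}^{(n)}$ (of $\boldsymbol{\Sigma}$) are root-$n$ consistent and locally and asymptotically discrete. Let $$Q^{(n)}_{\nu_0}:=\frac{\Delta_3^{(n)*}(\hat{\boldsymbol{\mu}}^{(n)},\hat{\boldsymbol{\Sigma}}^{(n)},\nu_0)}{\sqrt{\Gamma^*_{33}(\hat{\boldsymbol{\mu}}^{(n)},\hat{\boldsymbol{\Sigma}}^{(n)},\nu_0)}},$$ and let $\phi^{(n)}_{\nu_0}$ be the test that rejects whenever $|Q^{(n)}_{\nu_0}|>z_{\alpha/2}$, where $z_{\alpha/2}$ is the upper $\alpha/2$-quantile of the standard Gaussian distribution. Then: (i) $Q^{(n)}_{\nu_0}$ is asymptotically standard normal under $\mathrm P^{(n)}_{(\boldsymbol{\mu},\boldsymbol{\Sigma},\nu_0)}$, for every $\boldsymbol{\mu}\in\mathbb{R}^k$ and $\boldsymbol{\Sigma}\in S_k$; (ii) for every $\boldsymbol{\mu}\in\mathbb{R}^k$, every $\boldsymbol{\Sigma}\in S_k$, and every bounded real sequence $\tau_3^{(n)}$ with $\nu_0+n^{-1/2}\tau_3^{(n)}>0$ and with limit $\tau_3:=\lim_{n\to\infty}\tau_3^{(n)}$, $Q^{(n)}_{\nu_0}$ is asymptotically normal with mean $\tau_3\sqrt{\Gamma_{33}^*(\boldsymbol{\mu},\boldsymbol{\Sigma},\nu_0)}$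 and variance $1$ under $\mathrm P^{(n)}_{(\boldsymbol{\mu},\boldsymbol{\Sigma},\nu_0+n^{-1/2}\tau_3^{(n)})}$; (iii) the sequence of tests $\phi^{(n)}_{\nu_0}$ has asymptotic level $\alpha$ under $\mathcal H_0:=\bigcup_{\boldsymbol{\mu}\in\mathbb{R}^k}\bigcup_{\boldsymbol{\Sigma}\in S_k}\mathrm P^{(n)}_{(\boldsymbol{\mu},\boldsymbol{\Sigma},\nu_0)}$ and is locally and asymptotically maximin for testing $\mathcal H_0$ against $\mathcal H_1^{\neq}:=\bigcup_{\boldsymbol{\mu}\in\mathbb{R}^k}\bigcup_{\boldsymbol{\Sigma}\in S_k}\bigcup_{0<\nu\ne\nu_0}\mathrm P^{(n)}_{(\boldsymbol{\mu},\boldsymbol{\Sigma},\nu)}$.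
   Context: $M_k$ is the set of real $k\times k$ matrices and $S_k\subset M_k$ the set of symmetric positive definite ones. For $\boldsymbol{\mathcal V}=(\boldsymbol{\mu},\boldsymbol{\Sigma},\nu)\in\mathbb{R}^k\times S_k\times(0,\infty)$, the $k$-dimensional Student $t$ density is $$f_{\boldsymbol{\mu},\boldsymbol{\Sigma},\nu}(\boldsymbol x)=c_{\nu,k}|\boldsymbol{\Sigma}|^{-1/2}\left(1+\|\boldsymbol{\Sigma}^{-1/2}(\boldsymbol x-\boldsymbol{\mu})\|^2/\nu\right)^{-\frac{\nu+k}{2}},\qquad c_{\nu,k}=\frac{\Gamma(\frac{\nu+k}{2})}{(\pi\nu)^{k/2}\Gamma(\frac{\nu}{2})}.$$ $\mathrm P^{(n)}_{\boldsymbol{\mathcal V}}$ is the joint distribution of $n$ i.i.d. random vectors $\boldsymbol X_1,\dots,\boldsymbol X_n$ with density $f_{\boldsymbol{\mu},\boldsymbol{\Sigma},\nu}$. For $\boldsymbol A\in M_k$, $\mathrm{vech}(\boldsymbol A)$ is the $k(k+1)/2$-vector formed by the entries of $\boldsymbol A$ on and above the diagonal (in the order in which they appear when stacking columns). A symmetric matrix is identified with its vech, which serves as free coordinates. The score vector $\boldsymbol{\mathcal L}_{\boldsymbol{\mathcal V}}(\boldsymbol x)$ has three blocks: $\boldsymbol{\mathcal L}^{(1)}_{\boldsymbol{\mathcal V}}=\nabla_{\boldsymbol{\mu}}\log f_{\boldsymbol{\mu},\boldsymbol{\Sigma},\nu}$, $\boldsymbol{\mathcal L}^{(2)}_{\boldsymbol{\mathcal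 V}}=\nabla_{\mathrm{vech}(\boldsymbol{\Sigma})}\log f_{\boldsymbol{\mu},\boldsymbol{\Sigma},\nu}$, $\mathcal L^{(3)}_{\boldsymbol{\mathcal V}}=\partial_\nu\log f_{\boldsymbol{\mu},\boldsymbol{\Sigma},\nu}$. Put $\boldsymbol{\Delta}^{(n)}_i(\boldsymbol{\mathcal V})=n^{-1/2}\sum_{j=1}^n\boldsymbol{\mathcal L}^{(i)}_{\boldsymbol{\mathcal V}}(\boldsymbol X_j)$, $i=1,2,3$. The Fisher information matrix $\boldsymbol{\Gamma}(\boldsymbol{\mathcal V})$ is the covariance matrix of $\boldsymbol{\mathcal L}_{\boldsymbol{\mathcal V}}(\boldsymbol X)$ when $\boldsymbol X$ has density $f_{\boldsymbol{\mu},\boldsymbol{\Sigma},\nu}$, with blocks $\boldsymbol{\Gamma}_{ij}(\boldsymbol{\mathcal V})$, $i,j\in\{1,2,3\}$ (here $\boldsymbol{\Gamma}_{12}=\boldsymbol 0$, $\boldsymbol{\Gamma}_{13}=\boldsymbol 0$, and $\Gamma_{33}$ depends on $\nu$ only); it is known to be finite and non-singular for every $\boldsymbol{\mathcal V}$. The efficient central sequence and efficient Fisher information for tail weight are $$\Delta_3^{(n)*}(\boldsymbol{\mathcal V})=\Delta_3^{(n)}(\boldsymbol{\mathcal V})-(\boldsymbol{\Gamma}_{23}(\boldsymbol{\mathcal V}))'(\boldsymbol{\Gamma}_{22}(\boldsymbol{\mathcal V}))^{-1}\boldsymbol{\Delta}^{(n)}_2(\boldsymbol{\mathcal V}),\qquad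 \Gamma_{33}^*(\boldsymbol{\mathcal V})=\Gamma_{33}(\nu)-(\boldsymbol{\Gamma}_{23}(\boldsymbol{\mathcal V}))'(\boldsymbol{\Gamma}_{22}(\boldsymbol{\mathcal V}))^{-1}\boldsymbol{\Gamma}_{23}(\boldsymbol{\mathcal V}).$$ Conditions on estimators. Consider the experiments $\{\mathrm P^{(n)}_\lambda\mid\lambda\in\Lambda\}$; here $\lambda=(\boldsymbol{\mu},\boldsymbol{\Sigma})$, $\Lambda=\mathbb{R}^k\times S_k$, $\mathrm P_\lambda^{(n)}=\mathrm P^{(n)}_{(\boldsymbol{\mu},\boldsymbol{\Sigma},\nu_0)}$, and estimators (measurable functions of $\boldsymbol X_1,\dots,\boldsymbol X_n$, possibly depending on $\nu_0$) take values in $\mathbb{R}^k$ and $S_k$ respectively. A sequence of estimators $\hat\lambda^{(n)}$ is root-$n$ consistent if $n^{1/2}(\hat\lambda^{(n)}-\lambda)=O_{\mathrm P}(1)$ under $\mathrm P^{(n)}_\lambda$ for all $\lambda\in\Lambda$. It is locally and asymptotically discrete if, for every $\lambda\in\Lambda$ and $c>0$, the number of possible values of $\hat\lambda^{(n)}$ in the $\lambda$-centered ball of radius $cn^{-1/2}$ is bounded uniformly in $n$ as $n\to\infty$. Level and maximinity. A sequence of tests $\phi^{(n)}$ has asymptotic level $\alpha$ under $\mathcal H_0$ if $\limsup_n\mathrm E[\phi^{(n)}]\le\alpha$ under $\mathrm P^{(n)}_{(\boldsymbol{\mu},\boldsymbol{\Sigma},\nu_0)}$ for all $\boldsymbol{\mu},\boldsymbol{\Sigma}$.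 A test $\phi^*$ is maximin in the class $\mathcal C_\alpha$ of level-$\alpha$ tests of $\mathcal H_0$ against $\mathcal H_1$ if it has level $\alpha$ and $\inf_{\mathrm P\in\mathcal H_1}\mathrm E_{\mathrm P}[\phi^*]\ge\sup_{\phi\in\mathcal C_\alpha}\inf_{\mathrm P\in\mathcal H_1}\mathrm E_{\mathrm P}[\phi]$. "Locally and asymptotically maximin" is the version of this property for local ($n^{-1/2}$) alternatives in the limit: $\phi^{(n)}_{\nu_0}$ has asymptotic level $\alpha$ and, for every $\boldsymbol{\mu}\in\mathbb{R}^k$, $\boldsymbol{\Sigma}\in S_k$, every $c>0$, and every sequence of tests $\phi^{(n)}$ of asymptotic level $\alpha$ under $\mathcal H_0$, $$\inf_{(\boldsymbol t_1,\boldsymbol t_2,t_3)\in A_c}\liminf_{n\to\infty}\mathrm E_{n,\boldsymbol t}[\phi^{(n)}_{\nu_0}]\ \ge\ \inf_{(\boldsymbol t_1,\boldsymbol t_2,t_3)\in A_c}\liminf_{n\to\infty}\mathrm E_{n,\boldsymbol t}[\phi^{(n)}],$$ where $A_c$ is the set of $(\boldsymbol t_1,\boldsymbol t_2,t_3)$ with $\boldsymbol t_1\in\mathbb{R}^k$, $\boldsymbol t_2\in M_k$ symmetric, $t_3\in\mathbb{R}$, $|t_3|\ge c$, and $\mathrm E_{n,\boldsymbol t}$ is expectation under $\mathrm P^{(n)}_{(\boldsymbol{\mu}+n^{-1/2}\boldsymbol t_1,\,\boldsymbol{\Sigma}+n^{-1/2}\boldsymbol t_2,\,\nu_0+n^{-1/2}t_3)}$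 (defined for $n$ large). *)

theory Defs
  imports "HOL-Probability.Probability"
begin

text \<open>Synonyms for \<open>real ^ 'k\<close> and \<open>real ^ 'k ^ 'k\<close> that, unlike that notation, do not attach
  the sort \<open>finite\<close> to each occurrence of \<open>'k\<close>.\<close>

type_synonym 'k rvec = "(real, 'k) vec"
type_synonym 'k rmat = "((real, 'k) vec, 'k) vec"

definition spd :: "(real^'k^'k) set" where
  "spd = {S. transpose S = S \<and> (\<forall>x. x \<noteq> 0 \<longrightarrow> x \<bullet> (S *v x) > 0)}"

definition spd_sqrt :: "real^'k^'k \<Rightarrow> real^'k^'k" where
  "spd_sqrt S = (THE B. B \<in> spd \<and> B ** B = S)"

text \<open>Positions on and above the diagonal of a square matrix. The type has
  \<open>k (k + 1) / 2\<close> elements if \<open>'k\<close> has \<open>k\<close>; half-vectorisations are the vectors of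
  type \<open>real ^ 'k upper\<close>, with entries addressed by their
  position in the matrix rather than by their rank in the column stacking.\<close>

typedef (overloaded) ('k :: linorder) upper = "{(i :: 'k, j :: 'k). i \<le> j}"
  by auto

instance upper :: ("{finite, linorder}") finite
proof
  have "inj_on Rep_upper (UNIV :: 'a upper set)"
    by (simp add: inj_on_def Rep_upper_inject)
  then show "finite (UNIV :: 'a upper set)"
    by (rule inj_on_finite[where B = UNIV]) auto
qed

definition vech :: "'k rmat \<Rightarrow> (real, ('k :: {finite, linorder}) upper) vec" where
  "vech A = (\<chi> p. A $ fst (Rep_upper p) $ snd (Rep_upper p))"

definition unvech :: "(real, ('k :: {finite, linorder}) upper) vec \<Rightarrow> 'k rmat" where
  "unvech v = (\<chi> i j. v $ Abs_upper (min i j, max i j))"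

lemma unvech_vech:
  assumes "transpose A = A"
  shows "unvech (vech A) = A"
proof -
  have "A $ i $ j = A $ j $ i" for i j
    using assms by (metis transpose_def vec_lambda_beta)
  then show ?thesis
    by (simp add: vec_eq_iff unvech_def vech_def Abs_upper_inverse min_def max_def)
qed

definition student_density :: "real^'k \<Rightarrow> real^'k^'k \<Rightarrow> real \<Rightarrow> real^'k \<Rightarrow> real" where
  "student_density \<mu> \<Sigma> \<nu> x =
     Gamma ((\<nu> + real CARD('k)) / 2) / ((pi * \<nu>) powr (real CARD('k) / 2) * Gamma (\<nu> / 2))
     * det \<Sigma> powr (-1/2)
     * (1 + (norm (matrix_inv (spd_sqrt \<Sigma>) *v (x - \<mu>)))\<^sup>2 / \<nu>) powr (- (\<nu> + real CARD('k)) / 2)"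

definition student :: "real^'k \<Rightarrow> real^'k^'k \<Rightarrow> real \<Rightarrow> (real^'k) measure" where
  "student \<mu> \<Sigma> \<nu> = density lborel (\<lambda>x. ennreal (student_density \<mu> \<Sigma> \<nu> x))"

text \<open>A sample is a function on \<open>{..<n}\<close>, the observation \<open>X\<^sub>j\<close> being its value at
  \<open>j - 1\<close>.\<close>

definition student_sample ::
    "nat \<Rightarrow> real^'k \<Rightarrow> real^'k^'k \<Rightarrow> real \<Rightarrow> (nat \<Rightarrow> real^'k) measure" where
  "student_sample n \<mu> \<Sigma> \<nu> = (\<Pi>\<^sub>M j\<in>{..<n}. student \<mu> \<Sigma> \<nu>)"

abbreviation sample_space :: "nat \<Rightarrow> (nat \<Rightarrow> real^'k) measure" where
  "sample_space n \<equiv> (\<Pi>\<^sub>M j\<in>{..<n}. borel)"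

definition gradient :: "('a :: real_inner \<Rightarrow> real) \<Rightarrow> 'a \<Rightarrow> 'a" where
  "gradient f x = (THE D. GDERIV f x :> D)"

definition score2 ::
    "'k rvec \<Rightarrow> 'k rmat \<Rightarrow> real \<Rightarrow> 'k rvec \<Rightarrow> (real, ('k :: {finite, linorder}) upper) vec" where
  "score2 \<mu> \<Sigma> \<nu> x = gradient (\<lambda>v. ln (student_density \<mu> (unvech v) \<nu> x)) (vech \<Sigma>)"

definition score3 :: "real^'k \<Rightarrow> real^'k^'k \<Rightarrow> real \<Rightarrow> real^'k \<Rightarrow> real" where
  "score3 \<mu> \<Sigma> \<nu> x = deriv (\<lambda>t. ln (student_density \<mu> \<Sigma> t x)) \<nu>"

text \<open>Only the blocks of the Fisher information matrix for \<open>(vech \<Sigma>, \<nu>)\<close> enter the efficient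
  quantities. The location score enters none of them.\<close>

definition cov :: "'a measure \<Rightarrow> ('a \<Rightarrow> real) \<Rightarrow> ('a \<Rightarrow> real) \<Rightarrow> real" where
  "cov M X Y = (\<integral>x. (X x - (\<integral>y. X y \<partial>M)) * (Y x - (\<integral>y. Y y \<partial>M)) \<partial>M)"

definition fisher22 ::
    "'k rvec \<Rightarrow> 'k rmat \<Rightarrow> real \<Rightarrow> ((real, 'k upper) vec, ('k :: {finite, linorder}) upper) vec" where
  "fisher22 \<mu> \<Sigma> \<nu> =
     (\<chi> p q. cov (student \<mu> \<Sigma> \<nu>) (\<lambda>x. score2 \<mu> \<Sigma> \<nu> x $ p) (\<lambda>x. score2 \<mu> \<Sigma> \<nu> x $ q))"

definition fisher23 ::
    "'k rvec \<Rightarrow> 'k rmat \<Rightarrow> real \<Rightarrow> (real, ('k :: {finite, linorder}) upper) vec" where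
  "fisher23 \<mu> \<Sigma> \<nu> =
     (\<chi> p. cov (student \<mu> \<Sigma> \<nu>) (\<lambda>x. score2 \<mu> \<Sigma> \<nu> x $ p) (score3 \<mu> \<Sigma> \<nu>))"

definition fisher33 :: "real^'k \<Rightarrow> real^'k^'k \<Rightarrow> real \<Rightarrow> real" where
  "fisher33 \<mu> \<Sigma> \<nu> = cov (student \<mu> \<Sigma> \<nu>) (score3 \<mu> \<Sigma> \<nu>) (score3 \<mu> \<Sigma> \<nu>)"

definition central2 ::
    "nat \<Rightarrow> 'k rvec \<Rightarrow> 'k rmat \<Rightarrow> real \<Rightarrow> (nat \<Rightarrow> 'k rvec)
      \<Rightarrow> (real, ('k :: {finite, linorder}) upper) vec" where
  "central2 n \<mu> \<Sigma> \<nu> X = (1 / sqrt (real n)) *\<^sub>R (\<Sum>j<n. score2 \<mu> \<Sigma> \<nu> (X j))"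

definition central3 ::
    "nat \<Rightarrow> real^'k \<Rightarrow> real^'k^'k \<Rightarrow> real \<Rightarrow> (nat \<Rightarrow> real^'k) \<Rightarrow> real" where
  "central3 n \<mu> \<Sigma> \<nu> X = (1 / sqrt (real n)) * (\<Sum>j<n. score3 \<mu> \<Sigma> \<nu> (X j))"

definition eff_central3 ::
    "nat \<Rightarrow> 'k rvec \<Rightarrow> 'k rmat \<Rightarrow> real \<Rightarrow> (nat \<Rightarrow> ('k :: {finite, linorder}) rvec) \<Rightarrow> real" where
  "eff_central3 n \<mu> \<Sigma> \<nu> X = central3 n \<mu> \<Sigma> \<nu> X
     - fisher23 \<mu> \<Sigma> \<nu> \<bullet> (matrix_inv (fisher22 \<mu> \<Sigma> \<nu>) *v central2 n \<mu> \<Sigma> \<nu> X)"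

definition eff_fisher33 ::
    "('k :: {finite, linorder}) rvec \<Rightarrow> 'k rmat \<Rightarrow> real \<Rightarrow> real" where
  "eff_fisher33 \<mu> \<Sigma> \<nu> = fisher33 \<mu> \<Sigma> \<nu>
     - fisher23 \<mu> \<Sigma> \<nu> \<bullet> (matrix_inv (fisher22 \<mu> \<Sigma> \<nu>) *v fisher23 \<mu> \<Sigma> \<nu>)"

definition bounded_in_prob ::
    "(nat \<Rightarrow> 'w measure) \<Rightarrow> (nat \<Rightarrow> 'w \<Rightarrow> 'b :: real_normed_vector) \<Rightarrow> bool" where
  "bounded_in_prob P Y \<longleftrightarrow>
     (\<forall>\<epsilon>>0. \<exists>C. \<forall>\<^sub>F n in sequentially. measure (P n) {\<omega> \<in> space (P n). norm (Y n \<omega>) > C} \<le> \<epsilon>)"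

definition root_n_consistent ::
    "'p set \<Rightarrow> ('p \<Rightarrow> nat \<Rightarrow> 'w measure) \<Rightarrow> (nat \<Rightarrow> 'w \<Rightarrow> 'p :: real_normed_vector) \<Rightarrow> bool" where
  "root_n_consistent \<Theta> P est \<longleftrightarrow>
     (\<forall>\<theta>\<in>\<Theta>. bounded_in_prob (P \<theta>) (\<lambda>n \<omega>. sqrt (real n) *\<^sub>R (est n \<omega> - \<theta>)))"

definition locally_asymp_discrete ::
    "'p set \<Rightarrow> ('p \<Rightarrow> nat \<Rightarrow> 'w measure) \<Rightarrow> (nat \<Rightarrow> 'w \<Rightarrow> 'p :: real_normed_vector) \<Rightarrow> bool" where
  "locally_asymp_discrete \<Theta> P est \<longleftrightarrow>
     (\<forall>\<theta>\<in>\<Theta>. \<forall>c>0. \<exists>B::nat. \<forall>\<^sub>F n in sequentially.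
        finite (est n ` space (P \<theta> n) \<inter> cball \<theta> (c / sqrt (real n))) \<and>
        card (est n ` space (P \<theta> n) \<inter> cball \<theta> (c / sqrt (real n))) \<le> B)"

text \<open>The parameter is the pair \<open>(\<mu>, \<Sigma>)\<close>, so an estimator is a pair as well; the degrees of
  freedom \<open>\<nu>0\<close> are known, and estimators may depend on them.\<close>

definition null_model ::
    "real \<Rightarrow> (real^'k) \<times> (real^'k^'k) \<Rightarrow> nat \<Rightarrow> (nat \<Rightarrow> real^'k) measure" where
  "null_model \<nu>0 = (\<lambda>(\<mu>, \<Sigma>) n. student_sample n \<mu> \<Sigma> \<nu>0)"

definition is_estimator ::
    "(nat \<Rightarrow> (nat \<Rightarrow> real^'k) \<Rightarrow> (real^'k) \<times> (real^'k^'k)) \<Rightarrow> bool" where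
  "is_estimator est \<longleftrightarrow>
     (\<forall>n\<ge>1. est n \<in> sample_space n \<rightarrow>\<^sub>M borel \<and>
        est n ` space (sample_space n) \<subseteq> UNIV \<times> spd)"

definition is_test :: "(nat \<Rightarrow> (nat \<Rightarrow> real^'k) \<Rightarrow> real) \<Rightarrow> bool" where
  "is_test \<phi> \<longleftrightarrow>
     (\<forall>n\<ge>1. \<phi> n \<in> borel_measurable (sample_space n) \<and>
        \<phi> n ` space (sample_space n) \<subseteq> {0..1})"

definition asymp_level :: "real \<Rightarrow> real \<Rightarrow> (nat \<Rightarrow> (nat \<Rightarrow> real^'k) \<Rightarrow> real) \<Rightarrow> bool" where
  "asymp_level \<nu>0 \<alpha> \<phi> \<longleftrightarrow> is_test \<phi> \<and>
     (\<forall>\<mu>. \<forall>\<Sigma>\<in>spd.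
        limsup (\<lambda>n. ereal (\<integral>X. \<phi> n X \<partial>student_sample n \<mu> \<Sigma> \<nu>0)) \<le> ereal \<alpha>)"

definition local_alternatives :: "real \<Rightarrow> ((real^'k) \<times> (real^'k^'k) \<times> real) set" where
  "local_alternatives c = {(t1, t2, t3). transpose t2 = t2 \<and> \<bar>t3\<bar> \<ge> c}"

text \<open>For fixed \<open>t\<close>, the perturbed parameter belongs to the parameter space for all
  large \<open>n\<close> if \<open>\<Sigma> \<in> spd\<close> and \<open>\<nu>0 > 0\<close>; the other \<open>n\<close> do not affect the lower limit.\<close>

definition local_power ::
    "real^'k \<Rightarrow> real^'k^'k \<Rightarrow> real \<Rightarrow> (nat \<Rightarrow> (nat \<Rightarrow> real^'k) \<Rightarrow> real)
      \<Rightarrow> (real^'k) \<times> (real^'k^'k) \<times> real \<Rightarrow> ereal" where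
  "local_power \<mu> \<Sigma> \<nu>0 \<phi> = (\<lambda>(t1, t2, t3). liminf (\<lambda>n. ereal (\<integral>X. \<phi> n X
     \<partial>student_sample n (\<mu> + (1 / sqrt (real n)) *\<^sub>R t1) (\<Sigma> + (1 / sqrt (real n)) *\<^sub>R t2)
       (\<nu>0 + (1 / sqrt (real n)) * t3))))"

definition locally_asymp_maximin ::
    "real \<Rightarrow> real \<Rightarrow> (nat \<Rightarrow> (nat \<Rightarrow> real^'k) \<Rightarrow> real) \<Rightarrow> bool" where
  "locally_asymp_maximin \<nu>0 \<alpha> \<phi>' \<longleftrightarrow> asymp_level \<nu>0 \<alpha> \<phi>' \<and>
     (\<forall>\<mu>. \<forall>\<Sigma>\<in>spd. \<forall>c>0. \<forall>\<phi>. asymp_level \<nu>0 \<alpha> \<phi> \<longrightarrow>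
        (INF t\<in>local_alternatives c. local_power \<mu> \<Sigma> \<nu>0 \<phi>' t)
          \<ge> (INF t\<in>local_alternatives c. local_power \<mu> \<Sigma> \<nu>0 \<phi> t))"

definition std_normal_upper_quantile :: "real \<Rightarrow> real" where
  "std_normal_upper_quantile p = (THE z. measure std_normal_distribution {z<..} = p)"

definition Q_stat ::
    "real \<Rightarrow> (nat \<Rightarrow> (nat \<Rightarrow> 'k rvec) \<Rightarrow> ('k rvec) \<times> ('k rmat)) \<Rightarrow> nat
      \<Rightarrow> (nat \<Rightarrow> ('k :: {finite, linorder}) rvec) \<Rightarrow> real" where
  "Q_stat \<nu>0 est n X = (case est n X of (\<mu>, \<Sigma>) \<Rightarrow>
     eff_central3 n \<mu> \<Sigma> \<nu>0 X / sqrt (eff_fisher33 \<mu> \<Sigma> \<nu>0))"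

definition tail_weight_test ::
    "real \<Rightarrow> real \<Rightarrow> (nat \<Rightarrow> (nat \<Rightarrow> 'k rvec) \<Rightarrow> ('k rvec) \<times> ('k rmat)) \<Rightarrow> nat
      \<Rightarrow> (nat \<Rightarrow> ('k :: {finite, linorder}) rvec) \<Rightarrow> real" where
  "tail_weight_test \<nu>0 \<alpha> est n X =
     of_bool (\<bar>Q_stat \<nu>0 est n X\<bar> > std_normal_upper_quantile (\<alpha> / 2))"

definition asymp_normal ::
    "(nat \<Rightarrow> 'w measure) \<Rightarrow> (nat \<Rightarrow> 'w \<Rightarrow> real) \<Rightarrow> real \<Rightarrow> real \<Rightarrow> bool" where
  "asymp_normal P Y m v \<longleftrightarrow>
     weak_conv_m (\<lambda>n. distr (P n) borel (Y n)) (density lborel (normal_density m (sqrt v)))"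

end

theory Submission
  imports Defs "HOL-Real_Asymp.Real_Asymp"
begin

text \<open>
  By affine and orthogonal invariance of the Student family, the efficient score for tail weight is
  \<open>\<psi> = a - ln u / 2 + b / u\<close> with \<open>u = \<nu> + (x - \<mu>) \<bullet> \<Sigma>\<^sup>-\<^sup>1 (x - \<mu>)\<close> and constants \<open>a\<close>, \<open>b\<close> that depend
  on \<open>\<nu>\<close> and the dimension only: among scatter directions just the multiples of \<open>\<Sigma>\<close> correlate with
  \<open>\<partial>\<^sub>\<nu> log f\<close>. Hence \<open>\<psi>\<close> is the score in a direction \<open>(0, -c \<Sigma>, 1)\<close>, its variance \<open>G\<close> is constant, and
  it is orthogonal to location and scatter scores.

  The density ratio \<open>r\<^sub>n\<close> of a local alternative satisfies \<open>sqrt n (r\<^sub>n - 1) \<rightarrow> score\<close> in mean square. This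
  gives contiguity and the limit of characteristic functions of \<open>n\<^sup>-\<^sup>1\<^sup>/\<^sup>2 \<Sum> \<psi>(X\<^sub>j)\<close> under the alternative. By
  orthogonality, replacing \<open>(\<mu>, \<Sigma>)\<close> by a deterministic point at distance \<open>O(n\<^sup>-\<^sup>1\<^sup>/\<^sup>2)\<close> changes this sum by a
  negligible amount; discreteness of the estimator turns this into a finite union bound.

  For maximinity the power at any local alternative depends on \<open>h = t\<^sub>3\<close> only, and a competing test is
  compared at the two alternatives \<open>\<plusminus>(0, -c h \<Sigma>, h)\<close>: the likelihood ratio of their equal mixture is
  approximately \<open>exp (-h\<^sup>2 G / 2) cosh (h T)\<close>, an increasing function of \<open>\<bar>T\<bar>\<close>, where \<open>T\<close> is the normalised
  sum of the \<open>\<psi>(X\<^sub>j)\<close>, so the Neyman--Pearson argument bounds the smaller of the two powers.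
\<close>

section \<open>Mean-square convergence\<close>

text \<open>The density decays like a power of \<open>u\<close>, so a small change of the parameter
  multiplies it, up to a constant, by at most a small power of \<open>u\<close> or
  \<open>1 / u\<close>. Hence the ratio minus 1 is itself square integrable, and differentiability
  is stated for ratios rather than for their square roots. The second moment of the n-fold ratio is
  then the n-th power of \<open>1 + O(1 / n)\<close>; its boundedness gives contiguity at once.
  Characteristic functions factor over the sample under the alternative as well, so the limit law
  there is computed directly instead of from a joint limit with the log-likelihood. Since \<psi>
  grows only logarithmically, it has some exponential moments, and \<open>exp (h * T)\<close> can be
  compared with the likelihood ratio in L1, the form used by the Neyman--Pearson bound. The values
  taken by a discrete estimator move with n, so the estimate at a deterministic point has to be
  uniform over shrinking balls; compactness of the rescaled ball provides this. As \<open>G\<close>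
  is constant, the denominator of the statistic does not fluctuate with the estimate.\<close>

lemma tendsto_power_exp_complex:
  fixes a :: "nat \<Rightarrow> complex"
  assumes "(\<lambda>n. of_nat n * (a n - 1)) \<longlonglongrightarrow> c"
  shows "(\<lambda>n. a n ^ n) \<longlonglongrightarrow> exp c"
proof -
  have "(Ln has_field_derivative inverse 1) (at 1)"
    by (rule has_field_derivative_Ln) auto
  \<comment> \<open>Caratheodory's form of the derivative: \<open>Ln z\<close> is exactly
    \<open>q z * (z - 1)\<close> with \<open>q\<close> continuous at 1, so no remainder term has to
    be estimated.\<close>
  then obtain q where q: "\<And>z. Ln z - Ln 1 = q z * (z - 1)" "isCont q 1" "q 1 = inverse 1"
    unfolding CARAT_DERIV by blast
  have *: "(\<lambda>n. of_nat n * (a n - 1) * (1 / of_nat n)) \<longlonglongrightarrow> c * 0"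
    by (intro tendsto_intros assms lim_1_over_n)
  have "\<forall>\<^sub>F n in sequentially. of_nat n * (a n - 1) * (1 / of_nat n) = a n - 1"
    using eventually_gt_at_top[of 0] by eventually_elim auto
  with * have "(\<lambda>n. a n - 1) \<longlonglongrightarrow> 0"
    using Lim_transform_eventually by fastforce
  then have a1: "a \<longlonglongrightarrow> 1"
    using LIM_zero_cancel by blast
  then have "(\<lambda>n. q (a n)) \<longlonglongrightarrow> 1"
    using isCont_tendsto_compose[OF q(2) a1] q(3) by simp
  then have "(\<lambda>n. exp (q (a n) * (of_nat n * (a n - 1)))) \<longlonglongrightarrow> exp (1 * c)"
    by (intro tendsto_intros assms)
  then have "(\<lambda>n. exp (q (a n) * (of_nat n * (a n - 1)))) \<longlonglongrightarrow> exp c"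
    by simp
  moreover have "\<forall>\<^sub>F n in sequentially. a n \<noteq> 0"
    using a1 by (rule tendsto_imp_eventually_ne) simp
  then have "\<forall>\<^sub>F n in sequentially. exp (q (a n) * (of_nat n * (a n - 1))) = a n ^ n"
  proof eventually_elim
    case (elim n)
    have "exp (q (a n) * (of_nat n * (a n - 1))) = exp (of_nat n * Ln (a n))"
      using q(1)[of "a n"] by (simp add: mult_ac)
    also have "\<dots> = a n ^ n"
      using elim by (simp add: exp_of_nat_mult)
    finally show ?case .
  qed
  ultimately show ?thesis
    using Lim_transform_eventually by fastforce
qed

lemma tendsto_power_exp_real:
  fixes a :: "nat \<Rightarrow> real"
  assumes "(\<lambda>n. real n * (a n - 1)) \<longlonglongrightarrow> c"
  shows "(\<lambda>n. a n ^ n) \<longlonglongrightarrow> exp c"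
proof -
  have "(\<lambda>n. of_real (real n * (a n - 1)) :: complex) \<longlonglongrightarrow> of_real c"
    using assms by (rule tendsto_of_real)
  then have "(\<lambda>n. of_real (a n) ^ n :: complex) \<longlonglongrightarrow> exp (of_real c)"
    by (intro tendsto_power_exp_complex) simp
  then have "(\<lambda>n. of_real (a n ^ n) :: complex) \<longlonglongrightarrow> of_real (exp c)"
    by (simp add: exp_of_real)
  then show ?thesis
    by (simp only: tendsto_of_real_iff)
qed

section \<open>Elementary bounds for the exponential function\<close>

lemma abs_exp_minus_1_le: "\<bar>exp y - 1\<bar> \<le> \<bar>y\<bar> * exp \<bar>y\<bar>" for y :: real
proof (cases "y \<ge> 0")
  case True
  have "1 - y \<le> exp (- y)"
    using exp_ge_add_one_self[of "-y"] by simp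
  then have "(1 - y) * exp y \<le> exp (- y) * exp y"
    by (rule mult_right_mono) simp
  then have "exp y - 1 \<le> y * exp y"
    by (simp add: algebra_simps mult_exp_exp)
  then show ?thesis
    using True by simp
next
  case False
  then have "\<bar>exp y - 1\<bar> = 1 - exp y" by simp
  also have "\<dots> \<le> - y" using exp_ge_add_one_self[of y] by linarith
  also have "\<dots> \<le> \<bar>y\<bar> * exp \<bar>y\<bar>"
    using False by (simp add: mult_le_cancel_left1)
  finally show ?thesis .
qed

lemma abs_exp_taylor2_le: "\<bar>exp y - 1 - y\<bar> \<le> y\<^sup>2 / 2 * exp \<bar>y\<bar>" for y :: real
proof -
  have "\<exists>t. \<bar>t\<bar> \<le> \<bar>y\<bar> \<and> exp y = (\<Sum>m<2. y ^ m / fact m) + exp t / fact 2 * y ^ 2"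
    by (rule Maclaurin_exp_le)
  then obtain t where t: "\<bar>t\<bar> \<le> \<bar>y\<bar>" "exp y = (\<Sum>m<2. y ^ m / fact m) + exp t / fact 2 * y ^ 2"
    by blast
  then have "exp y - 1 - y = y\<^sup>2 / 2 * exp t"
    by (simp add: numeral_2_eq_2)
  then have "\<bar>exp y - 1 - y\<bar> = y\<^sup>2 / 2 * exp t"
    by (simp only: abs_mult) simp
  also have "\<dots> \<le> y\<^sup>2 / 2 * exp \<bar>y\<bar>"
    using t(1) by (intro mult_left_mono) auto
  finally show ?thesis .
qed

text \<open>Perturbed parameters are admissible, and the bounds on them valid, only for large n.
  Hence measurability and domination are asked eventually, and the index is shifted past the
  exceptional terms.\<close>

lemma dominated_convergence_eventually:
  fixes f :: "nat \<Rightarrow> 'a \<Rightarrow> real"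
  assumes "\<forall>\<^sub>F n in sequentially. f n \<in> borel_measurable M"
    and F: "F \<in> borel_measurable M" and w: "integrable M w"
    and "\<forall>\<^sub>F n in sequentially. \<forall>x\<in>space M. \<bar>f n x\<bar> \<le> w x"
    and lim: "\<And>x. x \<in> space M \<Longrightarrow> (\<lambda>n. f n x) \<longlonglongrightarrow> F x"
  shows "(\<lambda>n. \<integral>x. f n x \<partial>M) \<longlonglongrightarrow> (\<integral>x. F x \<partial>M)"
proof -
  from assms(1,4) have "\<forall>\<^sub>F n in sequentially. f n \<in> borel_measurable M \<and> (\<forall>x\<in>space M. \<bar>f n x\<bar> \<le> w x)"
    by eventually_elim blast
  then obtain N where N: "\<And>n. n \<ge> N \<Longrightarrow> f n \<in> borel_measurable M"
      "\<And>n x. n \<ge> N \<Longrightarrow> x \<in> space M \<Longrightarrow> \<bar>f n x\<bar> \<le> w x"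
    by (auto simp: eventually_sequentially)
  show ?thesis
  proof (rule LIMSEQ_offset, rule integral_dominated_convergence)
    show "AE x in M. (\<lambda>n. f (n + N) x) \<longlonglongrightarrow> F x"
      using lim by (intro AE_I2 LIMSEQ_ignore_initial_segment) auto
    show "AE x in M. norm (f (n + N) x) \<le> w x" for n
      using N(2) by auto
  qed (use N F w in auto)
qed

text \<open>Square integrability is part of the notion because a non-integrable function has
  integral 0 by convention, so the last conjunct alone could hold vacuously. For \<open>f n\<close>
  it is asked only eventually, as perturbed parameters may leave the parameter space for small
  n.\<close>

definition L2_conv :: "'a measure \<Rightarrow> (nat \<Rightarrow> 'a \<Rightarrow> real) \<Rightarrow> ('a \<Rightarrow> real) \<Rightarrow> bool" where
  "L2_conv M f F \<longleftrightarrow> F \<in> borel_measurable M \<and> integrable M (\<lambda>x. (F x)\<^sup>2) \<and>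
     (\<forall>\<^sub>F n in sequentially. f n \<in> borel_measurable M \<and> integrable M (\<lambda>x. (f n x)\<^sup>2)) \<and>
     (\<lambda>n. \<integral>x. (f n x - F x)\<^sup>2 \<partial>M) \<longlonglongrightarrow> 0"

lemma integrable_mult_L2:
  fixes f g :: "'a \<Rightarrow> real"
  assumes [measurable]: "f \<in> borel_measurable M" "g \<in> borel_measurable M"
    and "integrable M (\<lambda>x. (f x)\<^sup>2)" "integrable M (\<lambda>x. (g x)\<^sup>2)"
  shows "integrable M (\<lambda>x. f x * g x)"
proof (rule Bochner_Integration.integrable_bound)
  show "integrable M (\<lambda>x. (f x)\<^sup>2 + (g x)\<^sup>2)" using assms by simp
  show "AE x in M. norm (f x * g x) \<le> norm ((f x)\<^sup>2 + (g x)\<^sup>2)"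
  proof (intro AE_I2)
    fix x
    have "0 \<le> (\<bar>f x\<bar> - \<bar>g x\<bar>)\<^sup>2" by simp
    then have "2 * (\<bar>f x\<bar> * \<bar>g x\<bar>) \<le> (f x)\<^sup>2 + (g x)\<^sup>2"
      by (simp add: power2_diff)
    moreover have "0 \<le> \<bar>f x\<bar> * \<bar>g x\<bar>" by simp
    ultimately have "\<bar>f x\<bar> * \<bar>g x\<bar> \<le> (f x)\<^sup>2 + (g x)\<^sup>2"
      by linarith
    then show "norm (f x * g x) \<le> norm ((f x)\<^sup>2 + (g x)\<^sup>2)"
      by (simp add: abs_mult)
  qed
qed measurable

lemma integrable_power2_lincomb:
  fixes f g :: "'a \<Rightarrow> real"
  assumes [measurable]: "f \<in> borel_measurable M" "g \<in> borel_measurable M"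
    and "integrable M (\<lambda>x. (f x)\<^sup>2)" "integrable M (\<lambda>x. (g x)\<^sup>2)"
  shows "integrable M (\<lambda>x. (f x + c * g x)\<^sup>2)"
proof -
  have "integrable M (\<lambda>x. (f x)\<^sup>2 + 2 * c * (f x * g x) + c\<^sup>2 * (g x)\<^sup>2)"
    using assms integrable_mult_L2[OF assms] by auto
  then show ?thesis
    by (simp add: power2_eq_square algebra_simps)
qed

lemma integral_Cauchy_Schwarz:
  fixes f g :: "'a \<Rightarrow> real"
  assumes m [measurable]: "f \<in> borel_measurable M" "g \<in> borel_measurable M"
    and i: "integrable M (\<lambda>x. (f x)\<^sup>2)" "integrable M (\<lambda>x. (g x)\<^sup>2)"
  shows "\<bar>\<integral>x. f x * g x \<partial>M\<bar> \<le> sqrt (\<integral>x. (f x)\<^sup>2 \<partial>M) * sqrt (\<integral>x. (g x)\<^sup>2 \<partial>M)"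
proof -
  define A B C where "A = (\<integral>x. (f x)\<^sup>2 \<partial>M)" and "B = (\<integral>x. f x * g x \<partial>M)" and "C = (\<integral>x. (g x)\<^sup>2 \<partial>M)"
  have fg: "integrable M (\<lambda>x. f x * g x)"
    by (rule integrable_mult_L2[OF m i])
  have q: "0 \<le> A + 2 * c * B + c\<^sup>2 * C" for c
  proof -
    have "0 \<le> (\<integral>x. (f x + c * g x)\<^sup>2 \<partial>M)" by simp
    also have "\<dots> = (\<integral>x. (f x)\<^sup>2 + 2 * c * (f x * g x) + c\<^sup>2 * (g x)\<^sup>2 \<partial>M)"
      by (intro Bochner_Integration.integral_cong refl) (auto simp: power2_eq_square algebra_simps)
    also have "\<dots> = A + 2 * c * B + c\<^sup>2 * C"
      using i fg by (simp add: A_def B_def C_def)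
    finally show ?thesis .
  qed
  have C0: "0 \<le> C" and A0: "0 \<le> A" by (simp_all add: C_def A_def)
  have "B\<^sup>2 \<le> A * C"
  proof (cases "C = 0")
    case True
    have "B = 0"
    proof (rule ccontr)
      assume "B \<noteq> 0"
      \<comment> \<open>For C = 0 the quadratic is affine in c, and the chosen c would give it the
        value -1.\<close>
      then show False
        using q[of "- (A + 1) / (2 * B)"] True by (simp add: field_simps)
    qed
    then show ?thesis using True by simp
  next
    case False
    with C0 have "C > 0" by simp
    then show ?thesis
      using mult_right_mono[OF q[of "- B / C"], of C] by (simp add: field_simps power2_eq_square)
  qed
  then have "\<bar>B\<bar> \<le> sqrt (A * C)"
    using real_sqrt_le_mono by fastforce
  then show ?thesis
    by (simp add: A_def B_def C_def real_sqrt_mult)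
qed

lemma L2_conv_diff_integrable:
  assumes "L2_conv M f F"
  shows "\<forall>\<^sub>F n in sequentially. integrable M (\<lambda>x. (f n x - F x)\<^sup>2)"
proof -
  have "\<forall>\<^sub>F n in sequentially. f n \<in> borel_measurable M \<and> integrable M (\<lambda>x. (f n x)\<^sup>2)"
    using assms by (auto simp: L2_conv_def)
  then show ?thesis
    by eventually_elim
      (use assms integrable_power2_lincomb[where f = "f _" and g = F and c = "-1"] in \<open>auto simp: L2_conv_def\<close>)
qed

text \<open>Writing \<open>f n = F + (f n - F)\<close> and likewise for \<open>g n\<close> leaves
  three error terms, each small by Cauchy--Schwarz. Norms, means and the drift caused by a local
  alternative are all obtained as limits of such inner products.\<close>

lemma L2_conv_inner:
  assumes f: "L2_conv M f F" and g: "L2_conv M g G"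
  shows "(\<lambda>n. \<integral>x. f n x * g n x \<partial>M) \<longlonglongrightarrow> (\<integral>x. F x * G x \<partial>M)"
proof -
  note FD = f[unfolded L2_conv_def] and GD = g[unfolded L2_conv_def]
  define N where "N = (\<lambda>h. sqrt (\<integral>x. (h x :: real)\<^sup>2 \<partial>M))"
  have lim0: "(\<lambda>n. N (\<lambda>x. f n x - F x)) \<longlonglongrightarrow> sqrt 0" "(\<lambda>n. N (\<lambda>x. g n x - G x)) \<longlonglongrightarrow> sqrt 0"
    unfolding N_def using FD GD by (intro tendsto_real_sqrt; simp)+
  have "(\<lambda>n. N (\<lambda>x. f n x - F x) * N (\<lambda>x. g n x - G x) + N (\<lambda>x. f n x - F x) * N G
      + N F * N (\<lambda>x. g n x - G x)) \<longlonglongrightarrow> sqrt 0 * sqrt 0 + sqrt 0 * N G + N F * sqrt 0"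
    by (intro tendsto_intros lim0)
  then have b0: "(\<lambda>n. N (\<lambda>x. f n x - F x) * N (\<lambda>x. g n x - G x) + N (\<lambda>x. f n x - F x) * N G
      + N F * N (\<lambda>x. g n x - G x)) \<longlonglongrightarrow> 0"
    by simp
  have ev: "\<forall>\<^sub>F n in sequentially. f n \<in> borel_measurable M \<and> integrable M (\<lambda>x. (f n x)\<^sup>2) \<and>
     g n \<in> borel_measurable M \<and> integrable M (\<lambda>x. (g n x)\<^sup>2) \<and>
     integrable M (\<lambda>x. (f n x - F x)\<^sup>2) \<and> integrable M (\<lambda>x. (g n x - G x)\<^sup>2)"
    using FD GD L2_conv_diff_integrable[OF f] L2_conv_diff_integrable[OF g]
    by (auto simp: eventually_conj_iff)
  have "(\<lambda>n. (\<integral>x. f n x * g n x \<partial>M) - (\<integral>x. F x * G x \<partial>M)) \<longlonglongrightarrow> 0"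
  proof (rule Lim_null_comparison[OF _ b0], use ev in eventually_elim)
    case (elim n)
    then have m: "f n \<in> borel_measurable M" "g n \<in> borel_measurable M"
      "F \<in> borel_measurable M" "G \<in> borel_measurable M"
      "(\<lambda>x. f n x - F x) \<in> borel_measurable M" "(\<lambda>x. g n x - G x) \<in> borel_measurable M"
      using FD GD by auto
    have i: "integrable M (\<lambda>x. (f n x - F x) * (g n x - G x))" "integrable M (\<lambda>x. (f n x - F x) * G x)"
      "integrable M (\<lambda>x. F x * (g n x - G x))" "integrable M (\<lambda>x. F x * G x)"
      using elim FD GD m by (auto intro!: integrable_mult_L2)
    have "(\<integral>x. f n x * g n x \<partial>M) = (\<integral>x. (f n x - F x) * (g n x - G x) + (f n x - F x) * G x + F x * (g n x - G x) + F x * G x \<partial>M)"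
      by (intro Bochner_Integration.integral_cong refl) (auto simp: algebra_simps)
    also have "\<dots> = (\<integral>x. (f n x - F x) * (g n x - G x) \<partial>M) + (\<integral>x. (f n x - F x) * G x \<partial>M)
        + (\<integral>x. F x * (g n x - G x) \<partial>M) + (\<integral>x. F x * G x \<partial>M)"
      using i by simp
    finally have "(\<integral>x. f n x * g n x \<partial>M) - (\<integral>x. F x * G x \<partial>M) =
       (\<integral>x. (f n x - F x) * (g n x - G x) \<partial>M) + (\<integral>x. (f n x - F x) * G x \<partial>M)
        + (\<integral>x. F x * (g n x - G x) \<partial>M)" by simp
    moreover have "\<bar>\<integral>x. (f n x - F x) * (g n x - G x) \<partial>M\<bar> \<le> N (\<lambda>x. f n x - F x) * N (\<lambda>x. g n x - G x)"
      "\<bar>\<integral>x. (f n x - F x) * G x \<partial>M\<bar> \<le> N (\<lambda>x. f n x - F x) * N G"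
      "\<bar>\<integral>x. F x * (g n x - G x) \<partial>M\<bar> \<le> N F * N (\<lambda>x. g n x - G x)"
      unfolding N_def using elim FD GD m by (auto intro!: integral_Cauchy_Schwarz)
    ultimately show ?case by simp
  qed
  then show ?thesis
    by (rule LIM_zero_cancel)
qed

lemma L2_conv_power2:
  assumes "L2_conv M f F"
  shows "(\<lambda>n. \<integral>x. (f n x)\<^sup>2 \<partial>M) \<longlonglongrightarrow> (\<integral>x. (F x)\<^sup>2 \<partial>M)"
  using L2_conv_inner[OF assms assms] by (simp add: power2_eq_square)

lemma (in finite_measure) L2_conv_const:
  "L2_conv M (\<lambda>_ _. c) (\<lambda>_. c)"
  by (simp add: L2_conv_def)

lemma (in finite_measure) L2_conv_integral:
  assumes "L2_conv M f F"
  shows "(\<lambda>n. \<integral>x. f n x \<partial>M) \<longlonglongrightarrow> (\<integral>x. F x \<partial>M)"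
  using L2_conv_inner[OF assms L2_conv_const[of 1]] by simp

text \<open>The pointwise limit inherits the bound, so differences are at most \<open>2 * B\<close>
  and their squares at most the integrable \<open>4 * B\<^sup>2\<close>.\<close>

lemma L2_conv_dominated:
  fixes f :: "nat \<Rightarrow> 'a \<Rightarrow> real"
  assumes f: "\<forall>\<^sub>F n in sequentially. f n \<in> borel_measurable M"
    and F [measurable]: "F \<in> borel_measurable M"
    and B [measurable]: "B \<in> borel_measurable M" "integrable M (\<lambda>x. (B x)\<^sup>2)"
    and bd: "\<forall>\<^sub>F n in sequentially. \<forall>x\<in>space M. \<bar>f n x\<bar> \<le> B x"
    and lim: "\<And>x. x \<in> space M \<Longrightarrow> (\<lambda>n. f n x) \<longlonglongrightarrow> F x"
  shows "L2_conv M f F"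
proof -
  have FB: "\<bar>F x\<bar> \<le> B x" if "x \<in> space M" for x
  proof (rule tendsto_upperbound)
    show "(\<lambda>n. \<bar>f n x\<bar>) \<longlonglongrightarrow> \<bar>F x\<bar>" by (intro tendsto_intros lim that)
    show "\<forall>\<^sub>F n in sequentially. \<bar>f n x\<bar> \<le> B x" using bd by eventually_elim (use that in blast)
  qed simp
  have int: "integrable M (\<lambda>x. (h x)\<^sup>2)"
    if [measurable]: "h \<in> borel_measurable M" and "\<And>x. x \<in> space M \<Longrightarrow> \<bar>h x\<bar> \<le> B x" for h
    by (rule Bochner_Integration.integrable_bound[OF B(2)])
      (use that(2) in \<open>auto intro!: AE_I2 power_mono simp flip: abs_le_square_iff intro: order_trans[OF _ abs_ge_self]\<close>)
  have "(\<lambda>n. \<integral>x. (f n x - F x)\<^sup>2 \<partial>M) \<longlonglongrightarrow> (\<integral>x. 0 \<partial>M)"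
  proof (rule dominated_convergence_eventually)
    show "integrable M (\<lambda>x. 4 * (B x)\<^sup>2)" using B by simp
    show "\<forall>\<^sub>F n in sequentially. \<forall>x\<in>space M. \<bar>(f n x - F x)\<^sup>2\<bar> \<le> 4 * (B x)\<^sup>2"
      using bd
    proof eventually_elim
      case (elim n)
      have "\<bar>(f n x - F x)\<^sup>2\<bar> \<le> 4 * (B x)\<^sup>2" if "x \<in> space M" for x
      proof -
        have "\<bar>f n x - F x\<bar> \<le> 2 * B x" using elim FB that by (smt (verit, best))
        then have "\<bar>f n x - F x\<bar>\<^sup>2 \<le> (2 * B x)\<^sup>2" by (intro power_mono) auto
        then show ?thesis by (simp add: power_mult_distrib)
      qed
      then show ?case by blast
    qed
    show "(\<lambda>n. (f n x - F x)\<^sup>2) \<longlonglongrightarrow> 0" if "x \<in> space M" for x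
      using tendsto_power[OF tendsto_diff[OF lim[OF that] tendsto_const[of "F x"]], of 2] by simp
    show "\<forall>\<^sub>F n in sequentially. (\<lambda>x. (f n x - F x)\<^sup>2) \<in> borel_measurable M"
      using f by eventually_elim (intro borel_measurable_power borel_measurable_diff F)
  qed simp
  moreover have "\<forall>\<^sub>F n in sequentially. f n \<in> borel_measurable M \<and> integrable M (\<lambda>x. (f n x)\<^sup>2)"
    using f bd by eventually_elim (auto intro!: int)
  ultimately show ?thesis
    using FB by (auto simp: L2_conv_def intro!: int)
qed

section \<open>Products of locally perturbed densities\<close>

text \<open>A finite product measure is determined by its values on rectangles, and there both the
  density and the indicator split into one factor per coordinate.\<close>

lemma (in prob_space) PiM_density:
  fixes r :: "'a \<Rightarrow> real"
  assumes r [measurable]: "r \<in> borel_measurable M" and pos: "\<And>x. x \<in> space M \<Longrightarrow> 0 \<le> r x"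
    and r1: "(\<integral>x. r x \<partial>M) = 1" "integrable M r" and I: "finite I"
  shows "(\<Pi>\<^sub>M j\<in>I. density M r) = density (\<Pi>\<^sub>M j\<in>I. M) (\<lambda>X. \<Prod>j\<in>I. r (X j))"
proof -
  interpret R: prob_space "density M r"
    by (rule prob_spaceI) (use pos r1 in \<open>auto simp: emeasure_density nn_integral_eq_integral cong: nn_integral_cong\<close>)
  interpret P: product_prob_space "\<lambda>_. M" I ..
  interpret PR: product_prob_space "\<lambda>_. density M r" I ..
  have "density (\<Pi>\<^sub>M j\<in>I. M) (\<lambda>X. \<Prod>j\<in>I. r (X j)) = (\<Pi>\<^sub>M j\<in>I. density M r)"
  proof (rule PR.PiM_eqI[OF I])
    fix A assume A: "\<And>i. i \<in> I \<Longrightarrow> A i \<in> sets (density M r)"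
    have [measurable]: "A i \<in> sets M" if "i \<in> I" for i using A[OF that] by simp
    have "emeasure (density (\<Pi>\<^sub>M j\<in>I. M) (\<lambda>X. \<Prod>j\<in>I. r (X j))) (Pi\<^sub>E I A) =
      (\<integral>\<^sup>+X. ennreal (\<Prod>j\<in>I. r (X j)) * indicator (Pi\<^sub>E I A) X \<partial>(\<Pi>\<^sub>M j\<in>I. M))"
      using I by (intro emeasure_density) (auto intro!: sets_PiM_I_finite)
    also have "\<dots> = (\<integral>\<^sup>+X. (\<Prod>j\<in>I. ennreal (r (X j)) * indicator (A j) (X j)) \<partial>(\<Pi>\<^sub>M j\<in>I. M))"
    proof (rule nn_integral_cong)
      fix X assume X: "X \<in> space (\<Pi>\<^sub>M j\<in>I. M)"
      then have "(\<Prod>j\<in>I. indicator (A j) (X j)) = (indicator (Pi\<^sub>E I A) X :: ennreal)"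
        using I by (auto simp: space_PiM PiE_iff indicator_def)
      moreover have "ennreal (\<Prod>j\<in>I. r (X j)) = (\<Prod>j\<in>I. ennreal (r (X j)))"
        using X pos by (intro prod_ennreal[symmetric]) (auto simp: space_PiM PiE_iff)
      ultimately show "ennreal (\<Prod>j\<in>I. r (X j)) * indicator (Pi\<^sub>E I A) X =
         (\<Prod>j\<in>I. ennreal (r (X j)) * indicator (A j) (X j))"
        by (simp add: prod.distrib)
    qed
    also have "\<dots> = (\<Prod>j\<in>I. \<integral>\<^sup>+x. ennreal (r x) * indicator (A j) x \<partial>M)"
      using I by (intro P.product_nn_integral_prod) auto
    also have "\<dots> = (\<Prod>j\<in>I. emeasure (density M r) (A j))"
      by (intro prod.cong refl) (simp add: emeasure_density)
    finally show "emeasure (density (\<Pi>\<^sub>M j\<in>I. M) (\<lambda>X. \<Prod>j\<in>I. r (X j))) (Pi\<^sub>E I A) =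
        (\<Prod>j\<in>I. emeasure (density M r) (A j))" .
  qed (simp cong: sets_PiM_cong)
  then show ?thesis ..
qed

section \<open>Integrals of products and sums over independent coordinates\<close>

lemma (in prob_space) integral_PiM_power:
  fixes f :: "'a \<Rightarrow> 'b :: {real_normed_field, banach, second_countable_topology}"
  assumes "integrable M f"
  shows "(\<integral>X. (\<Prod>j<n. f (X j)) \<partial>(\<Pi>\<^sub>M j\<in>{..<n}. M)) = (\<integral>x. f x \<partial>M) ^ n"
    and "integrable (\<Pi>\<^sub>M j\<in>{..<n}. M) (\<lambda>X. \<Prod>j<n. f (X j))"
proof -
  interpret P: product_prob_space "\<lambda>_. M" "{..<n}" ..
  show "(\<integral>X. (\<Prod>j<n. f (X j)) \<partial>(\<Pi>\<^sub>M j\<in>{..<n}. M)) = (\<integral>x. f x \<partial>M) ^ n"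
    using P.product_integral_prod[of "{..<n}" "\<lambda>_. f"] assms by simp
  show "integrable (\<Pi>\<^sub>M j\<in>{..<n}. M) (\<lambda>X. \<Prod>j<n. f (X j))"
    using P.product_integrable_prod[of "{..<n}" "\<lambda>_. f"] assms by simp
qed

lemma (in prob_space) integral_PiM_product2:
  fixes f g :: "'a \<Rightarrow> real"
  assumes [measurable]: "f \<in> borel_measurable M" and f: "integrable M f" "integrable M (\<lambda>x. (f x)\<^sup>2)"
    and ij: "i < n" "j < (n :: nat)"
  shows "(\<integral>X. f (X i) * f (X j) \<partial>(\<Pi>\<^sub>M j\<in>{..<n}. M)) =
           (if i = j then (\<integral>x. (f x)\<^sup>2 \<partial>M) else (\<integral>x. f x \<partial>M)\<^sup>2)" (is ?A)
    and "integrable (\<Pi>\<^sub>M j\<in>{..<n}. M) (\<lambda>X. f (X i) * f (X j))" (is ?B)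
proof -
  interpret P: product_prob_space "\<lambda>_. M" "{..<n}" ..
  \<comment> \<open>The product of two coordinates is written as a product over all n of them, with
    the constant 1 at the others, so that the product formula applies. On the diagonal the single
    factor must be the square.\<close>
  define h where "h = (\<lambda>(l::nat) x. if i = j then (if l = i then (f x)\<^sup>2 else 1) else if l = i \<or> l = j then f x else (1::real))"
  have h: "integrable M (h l)" for l
    using f by (cases "i = j"; cases "l = i"; cases "l = j") (simp_all add: h_def)
  have eq: "(\<lambda>X :: nat \<Rightarrow> 'a. f (X i) * f (X j)) = (\<lambda>X. \<Prod>l<n. h l (X l))"
  proof
    fix X :: "nat \<Rightarrow> 'a"
    have "(\<Prod>l<n. h l (X l)) = (\<Prod>l\<in>{i,j}. h l (X l))"
      using ij by (intro prod.mono_neutral_right) (auto simp: h_def)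
    then show "f (X i) * f (X j) = (\<Prod>l<n. h l (X l))"
      by (cases "i = j") (auto simp: h_def power2_eq_square)
  qed
  show ?B
    unfolding eq using P.product_integrable_prod[of "{..<n}" h] h by simp
  have "(\<integral>X. f (X i) * f (X j) \<partial>(\<Pi>\<^sub>M j\<in>{..<n}. M)) = (\<Prod>l<n. \<integral>x. h l x \<partial>M)"
    unfolding eq using P.product_integral_prod[of "{..<n}" h] h by simp
  also have "\<dots> = (\<Prod>l\<in>{i,j}. \<integral>x. h l x \<partial>M)"
  proof (intro prod.mono_neutral_right ballI)
    fix l assume "l \<in> {..<n} - {i, j}"
    then have "h l = (\<lambda>_. 1)" by (auto simp: h_def)
    then show "(\<integral>x. h l x \<partial>M) = 1" by (simp add: prob_space)
  qed (use ij in auto)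
  also have "\<dots> = (if i = j then (\<integral>x. (f x)\<^sup>2 \<partial>M) else (\<integral>x. f x \<partial>M)\<^sup>2)"
    by (auto simp: h_def power2_eq_square)
  finally show ?A .
qed

text \<open>The summands are not assumed centred, because in the plug-in argument their scaled means
  vanish only in the limit. The \<open>n * (n - 1)\<close> off-diagonal terms are rounded up to
  \<open>n\<^sup>2\<close>.\<close>

lemma (in prob_space) integral_PiM_sum_power2:
  fixes f :: "'a \<Rightarrow> real"
  assumes m [measurable]: "f \<in> borel_measurable M" and f: "integrable M (\<lambda>x. (f x)\<^sup>2)"
  shows "(\<integral>X. (\<Sum>j<n. f (X j))\<^sup>2 \<partial>(\<Pi>\<^sub>M j\<in>{..<n}. M)) \<le>
           real n * (\<integral>x. (f x)\<^sup>2 \<partial>M) + (real n * (\<integral>x. f x \<partial>M))\<^sup>2" (is ?A)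
    and "integrable (\<Pi>\<^sub>M j\<in>{..<n}. M) (\<lambda>X. (\<Sum>j<n. f (X j))\<^sup>2)" (is ?B)
proof -
  have f1: "integrable M f"
    using m f by (rule square_integrable_imp_integrable)
  note i = integral_PiM_product2[OF m f1 f]
  have eq: "(\<lambda>X. (\<Sum>j<n. f (X j))\<^sup>2) = (\<lambda>X. \<Sum>i<n. \<Sum>j<n. f (X i) * f (X j))"
    by (auto simp: power2_eq_square sum_product)
  show ?B unfolding eq by (intro Bochner_Integration.integrable_sum) (auto intro: i)
  have "(\<integral>X. (\<Sum>j<n. f (X j))\<^sup>2 \<partial>(\<Pi>\<^sub>M j\<in>{..<n}. M)) =
      (\<Sum>i<n. \<Sum>j<n. \<integral>X. f (X i) * f (X j) \<partial>(\<Pi>\<^sub>M j\<in>{..<n}. M))"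
  proof -
    have "(\<integral>X. (\<Sum>i<n. \<Sum>j<n. f (X i) * f (X j)) \<partial>(\<Pi>\<^sub>M j\<in>{..<n}. M)) =
       (\<Sum>i<n. \<integral>X. (\<Sum>j<n. f (X i) * f (X j)) \<partial>(\<Pi>\<^sub>M j\<in>{..<n}. M))"
      by (intro Bochner_Integration.integral_sum Bochner_Integration.integrable_sum i) auto
    also have "\<dots> = (\<Sum>i<n. \<Sum>j<n. \<integral>X. f (X i) * f (X j) \<partial>(\<Pi>\<^sub>M j\<in>{..<n}. M))"
      by (intro sum.cong refl Bochner_Integration.integral_sum i) auto
    finally show ?thesis unfolding eq .
  qed
  also have "\<dots> = (\<Sum>i<n. \<Sum>j<n. (if i = j then (\<integral>x. (f x)\<^sup>2 \<partial>M) else (\<integral>x. f x \<partial>M)\<^sup>2))"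
    by (intro sum.cong refl) (auto simp: i)
  also have "\<dots> \<le> (\<Sum>i<n. \<Sum>j<n. (if i = j then (\<integral>x. (f x)\<^sup>2 \<partial>M) else 0) + (\<integral>x. f x \<partial>M)\<^sup>2)"
    by (intro sum_mono) auto
  also have "\<dots> = real n * (\<integral>x. (f x)\<^sup>2 \<partial>M) + (real n * (\<integral>x. f x \<partial>M))\<^sup>2"
    by (simp add: sum.distrib power2_eq_square algebra_simps)
  finally show ?A .
qed

lemma (in prob_space) PiM_sum_Chebyshev:
  fixes f :: "'a \<Rightarrow> real"
  assumes m [measurable]: "f \<in> borel_measurable M" and f: "integrable M (\<lambda>x. (f x)\<^sup>2)"
    and e: "e > 0" and n: "n > 0"
  shows "measure (\<Pi>\<^sub>M j\<in>{..<n}. M) {X \<in> space (\<Pi>\<^sub>M j\<in>{..<n}. M). \<bar>1 / sqrt (real n) * (\<Sum>j<n. f (X j))\<bar> \<ge> e}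
     \<le> ((\<integral>x. (f x)\<^sup>2 \<partial>M) + (sqrt (real n) * (\<integral>x. f x \<partial>M))\<^sup>2) / e\<^sup>2"
proof -
  interpret P: product_prob_space "\<lambda>_. M" "{..<n}" ..
  let ?P = "\<Pi>\<^sub>M j\<in>{..<n}. M"
  have "measure ?P {X \<in> space ?P. \<bar>1 / sqrt (real n) * (\<Sum>j<n. f (X j))\<bar> \<ge> e} =
      measure ?P {X \<in> space ?P. (\<Sum>j<n. f (X j))\<^sup>2 \<ge> real n * e\<^sup>2}"
  proof (rule arg_cong[where f = "measure ?P"], rule Collect_cong, rule conj_cong, rule refl)
    fix X
    have "e \<le> \<bar>1 / sqrt (real n) * (\<Sum>j<n. f (X j))\<bar> \<longleftrightarrow> \<bar>sqrt (real n) * e\<bar> \<le> \<bar>\<Sum>j<n. f (X j)\<bar>"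
      using n e by (simp add: abs_mult field_simps)
    also have "\<dots> \<longleftrightarrow> real n * e\<^sup>2 \<le> (\<Sum>j<n. f (X j))\<^sup>2"
      using n by (simp add: abs_le_square_iff power_mult_distrib)
    finally show "e \<le> \<bar>1 / sqrt (real n) * (\<Sum>j<n. f (X j))\<bar> \<longleftrightarrow> real n * e\<^sup>2 \<le> (\<Sum>j<n. f (X j))\<^sup>2" .
  qed
  also have "\<dots> \<le> (\<integral>X. (\<Sum>j<n. f (X j))\<^sup>2 \<partial>?P) / (real n * e\<^sup>2)"
    using e n by (intro integral_Markov_inequality_measure[where A = "{}"] integral_PiM_sum_power2 m f) auto
  also have "\<dots> \<le> (real n * (\<integral>x. (f x)\<^sup>2 \<partial>M) + (real n * (\<integral>x. f x \<partial>M))\<^sup>2) / (real n * e\<^sup>2)"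
    using e n by (intro divide_right_mono integral_PiM_sum_power2 m f) auto
  also have "\<dots> = ((\<integral>x. (f x)\<^sup>2 \<partial>M) + (sqrt (real n) * (\<integral>x. f x \<partial>M))\<^sup>2) / e\<^sup>2"
    using e n by (simp add: field_simps power_mult_distrib power2_eq_square)
  finally show ?thesis .
qed

text \<open>Mean-square differentiability, with score \<open>s\<close>, of the ratios themselves;
  this controls the second moments of products of the \<open>r n\<close>. The second part makes each
  \<open>density M (r n)\<close> a probability measure.\<close>

definition local_ratio :: "'a measure \<Rightarrow> (nat \<Rightarrow> 'a \<Rightarrow> real) \<Rightarrow> ('a \<Rightarrow> real) \<Rightarrow> bool" where
  "local_ratio M r s \<longleftrightarrow> L2_conv M (\<lambda>n x. sqrt (real n) * (r n x - 1)) s \<and>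
     (\<forall>\<^sub>F n in sequentially. r n \<in> borel_measurable M \<and> (\<forall>x\<in>space M. 0 \<le> r n x) \<and>
        integrable M (r n) \<and> (\<integral>x. r n x \<partial>M) = 1)"

lemma prob_space_density:
  fixes r :: "'a \<Rightarrow> real"
  assumes "r \<in> borel_measurable M" "\<forall>x\<in>space M. 0 \<le> r x" "integrable M r" "(\<integral>x. r x \<partial>M) = 1"
  shows "prob_space (density M r)"
  by (rule prob_spaceI) (use assms in \<open>auto simp: emeasure_density nn_integral_eq_integral cong: nn_integral_cong\<close>)

lemma local_ratioD:
  assumes "local_ratio M r s"
  shows "\<forall>\<^sub>F n in sequentially. r n \<in> borel_measurable M \<and> (\<forall>x\<in>space M. 0 \<le> r n x) \<and>
        integrable M (r n) \<and> (\<integral>x. r n x \<partial>M) = 1 \<and> prob_space (density M (r n)) \<and>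
        integrable M (\<lambda>x. (r n x - 1)\<^sup>2) \<and> n > 0"
proof -
  have 1: "\<forall>\<^sub>F n in sequentially. r n \<in> borel_measurable M \<and> (\<forall>x\<in>space M. 0 \<le> r n x) \<and>
        integrable M (r n) \<and> (\<integral>x. r n x \<partial>M) = 1"
    and 2: "\<forall>\<^sub>F n in sequentially. integrable M (\<lambda>x. (sqrt (real n) * (r n x - 1))\<^sup>2)"
    using assms by (auto simp: local_ratio_def L2_conv_def eventually_conj_iff)
  show ?thesis
    using 1 2 eventually_gt_at_top[of 0]
  proof eventually_elim
    case (elim n)
    then show ?case
      by (auto simp: power_mult_distrib intro: prob_space_density)
  qed
qed

text \<open>Along the sequence the mean is exactly 0, since \<open>r n\<close> and 1 have the same
  integral, and mean-square convergence passes this to the limit. This does the work of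
  differentiating under the integral sign.\<close>

lemma (in prob_space) local_ratio_score_mean:
  assumes "local_ratio M r s"
  shows "(\<integral>x. s x \<partial>M) = 0"
proof -
  have "(\<lambda>n. \<integral>x. sqrt (real n) * (r n x - 1) \<partial>M) \<longlonglongrightarrow> (\<integral>x. s x \<partial>M)"
    using assms by (intro L2_conv_integral) (simp add: local_ratio_def)
  moreover have "\<forall>\<^sub>F n in sequentially. 0 = (\<integral>x. sqrt (real n) * (r n x - 1) \<partial>M)"
    using local_ratioD[OF assms] by eventually_elim (simp add: prob_space)
  then have "(\<lambda>n. \<integral>x. sqrt (real n) * (r n x - 1) \<partial>M) \<longlonglongrightarrow> 0"
    by (rule Lim_transform_eventually[OF tendsto_const])
  ultimately show ?thesis
    using LIMSEQ_unique by blast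
qed

lemma (in prob_space) ratio_power2_conv:
  assumes r: "local_ratio M r s"
  shows "(\<lambda>n. real n * ((\<integral>x. (r n x)\<^sup>2 \<partial>M) - 1)) \<longlonglongrightarrow> (\<integral>x. (s x)\<^sup>2 \<partial>M)"
    and "\<forall>\<^sub>F n in sequentially. integrable M (\<lambda>x. (r n x)\<^sup>2)"
proof -
  \<comment> \<open>The part linear in \<open>r n\<close> integrates to exactly 1, so the excess of
    the second moment over 1 comes from \<open>(r n - 1)\<^sup>2\<close> alone.\<close>
  have eq: "(r n x)\<^sup>2 = (r n x - 1)\<^sup>2 + 2 * (r n x) - 1" for n x
    by (simp add: power2_diff)
  show "\<forall>\<^sub>F n in sequentially. integrable M (\<lambda>x. (r n x)\<^sup>2)"
    using local_ratioD[OF r] unfolding eq by eventually_elim auto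
  have "(\<lambda>n. \<integral>x. (sqrt (real n) * (r n x - 1))\<^sup>2 \<partial>M) \<longlonglongrightarrow> (\<integral>x. (s x)\<^sup>2 \<partial>M)"
    using r by (intro L2_conv_power2) (simp add: local_ratio_def)
  moreover have "\<forall>\<^sub>F n in sequentially. (\<integral>x. (sqrt (real n) * (r n x - 1))\<^sup>2 \<partial>M) =
      real n * ((\<integral>x. (r n x)\<^sup>2 \<partial>M) - 1)"
    using local_ratioD[OF r]
    by eventually_elim (auto simp: eq power_mult_distrib prob_space)
  ultimately show "(\<lambda>n. real n * ((\<integral>x. (r n x)\<^sup>2 \<partial>M) - 1)) \<longlonglongrightarrow> (\<integral>x. (s x)\<^sup>2 \<partial>M)"
    by (rule Lim_transform_eventually)
qed

text \<open>The second moment of the likelihood ratio of the whole sample converges, to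
  \<open>exp\<close> of the score variance. The ratios are therefore uniformly integrable, and an
  event of vanishing null probability cannot gain mass in the limit.\<close>

lemma (in prob_space) contiguity:
  assumes r: "local_ratio M r s"
    and A: "\<forall>\<^sub>F n in sequentially. A n \<in> sets (\<Pi>\<^sub>M j\<in>{..<n}. M)"
    and lim: "(\<lambda>n. measure (\<Pi>\<^sub>M j\<in>{..<n}. M) (A n)) \<longlonglongrightarrow> 0"
  shows "(\<lambda>n. measure (\<Pi>\<^sub>M j\<in>{..<n}. density M (r n)) (A n)) \<longlonglongrightarrow> 0"
proof (rule LIMSEQ_I)
  fix e :: real assume e: "e > 0"
  define C where "C = exp (\<integral>x. (s x)\<^sup>2 \<partial>M) + 1"
  have C: "C > 1" by (simp add: C_def)
  have "(\<lambda>n. (\<integral>x. (r n x)\<^sup>2 \<partial>M) ^ n) \<longlonglongrightarrow> exp (\<integral>x. (s x)\<^sup>2 \<partial>M)"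
    by (rule tendsto_power_exp_real[OF ratio_power2_conv(1)[OF r]])
  then have ev1: "\<forall>\<^sub>F n in sequentially. (\<integral>x. (r n x)\<^sup>2 \<partial>M) ^ n < C"
    by (rule order_tendstoD) (simp add: C_def)
  \<comment> \<open>\<open>K\<close> is a truncation level for the likelihood ratio
    \<open>y\<close>: the bound \<open>y \<le> K + y\<^sup>2 / K\<close> splits the probability of
    \<open>A n\<close> into \<open>K\<close> times its null probability and \<open>C / K\<close>,
    and each of the two is at most \<open>e / 2\<close>.\<close>
  define K where "K = 2 * C / e"
  have K: "K > 0" using C e by (simp add: K_def)
  have ev2: "\<forall>\<^sub>F n in sequentially. measure (\<Pi>\<^sub>M j\<in>{..<n}. M) (A n) < e / (2 * K)"
    using lim by (rule order_tendstoD) (use e K in simp)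
  have "\<forall>\<^sub>F n in sequentially. norm (measure (\<Pi>\<^sub>M j\<in>{..<n}. density M (r n)) (A n) - 0) < e"
    using ev1 ev2 local_ratioD[OF r] ratio_power2_conv(2)[OF r] A
  proof eventually_elim
    case (elim n)
    let ?P = "\<Pi>\<^sub>M j\<in>{..<n}. M"
    interpret P: prob_space ?P
      by (intro prob_space_PiM) unfold_locales
    have [measurable]: "r n \<in> borel_measurable M" "A n \<in> sets ?P" using elim by auto
    have pos: "0 \<le> (\<Prod>j<n. r n (X j))" if "X \<in> space ?P" for X
      using elim that by (intro prod_nonneg) (auto simp: space_PiM PiE_iff)
    have L2: "integrable ?P (\<lambda>X. (\<Prod>j<n. r n (X j))\<^sup>2)" "(\<integral>X. (\<Prod>j<n. r n (X j))\<^sup>2 \<partial>?P) = (\<integral>x. (r n x)\<^sup>2 \<partial>M) ^ n"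
      using integral_PiM_power[where f = "\<lambda>x. (r n x)\<^sup>2" and n = n] elim by (auto simp: prod_power_distrib)
    have "measure (\<Pi>\<^sub>M j\<in>{..<n}. density M (r n)) (A n) = measure (density ?P (\<lambda>X. \<Prod>j<n. r n (X j))) (A n)"
      using elim by (subst PiM_density) auto
    also have "\<dots> = (\<integral>X. indicator (A n) X * (\<Prod>j<n. r n (X j)) \<partial>?P)"
    proof -
      have "emeasure (density ?P (\<lambda>X. \<Prod>j<n. r n (X j))) (A n) = (\<integral>\<^sup>+X. ennreal (indicator (A n) X * (\<Prod>j<n. r n (X j))) \<partial>?P)"
        by (subst emeasure_density) (auto intro!: nn_integral_cong simp: indicator_def)
      then show ?thesis
        using pos by (simp add: measure_def integral_eq_nn_integral)
    qed
    also have "\<dots> \<le> (\<integral>X. K * indicator (A n) X + (\<Prod>j<n. r n (X j))\<^sup>2 / K \<partial>?P)"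
    proof (rule integral_mono)
      show "integrable ?P (\<lambda>X. indicator (A n) X * (\<Prod>j<n. r n (X j)))"
        using integrable_mult_indicator[OF \<open>A n \<in> sets ?P\<close> integral_PiM_power(2)[where f = "r n" and n = n]] elim
        by simp
      show "integrable ?P (\<lambda>X. K * indicator (A n) X + (\<Prod>j<n. r n (X j))\<^sup>2 / K)"
      proof (intro Bochner_Integration.integrable_add integrable_mult_right)
        show "integrable ?P (indicat_real (A n))"
          by (auto intro!: P.integrable_const_bound[where B = 1])
      qed (use L2 in simp)
      fix X assume "X \<in> space ?P"
      define y where "y = (\<Prod>j<n. r n (X j))"
      have "y \<ge> 0" using pos[OF \<open>X \<in> space ?P\<close>] by (simp add: y_def)
      have "y \<le> K + y\<^sup>2 / K"
      proof (cases "y \<le> K")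
        case False
        then have "y * K \<le> y\<^sup>2" using \<open>y \<ge> 0\<close> by (simp add: power2_eq_square mult_left_mono)
        then have "y \<le> y\<^sup>2 / K" using K by (simp add: pos_le_divide_eq)
        then show ?thesis using K by simp
      qed (use K in \<open>simp add: add_increasing2\<close>)
      then show "indicator (A n) X * y \<le> K * indicator (A n) X + y\<^sup>2 / K"
        using K by (auto simp: indicator_def)
    qed
    also have "\<dots> = K * measure ?P (A n) + (\<integral>x. (r n x)\<^sup>2 \<partial>M) ^ n / K"
    proof -
      have "integrable ?P (indicat_real (A n))"
        by (auto intro!: P.integrable_const_bound[where B = 1])
      then show ?thesis using L2 by simp
    qed
    also have "\<dots> < K * (e / (2 * K)) + C / K"
      using elim K by (intro add_strict_mono mult_strict_left_mono divide_strict_right_mono) auto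
    also have "\<dots> = e"
      using K e C by (simp add: K_def)
    finally show ?case by simp
  qed
  then show "\<exists>N. \<forall>n\<ge>N. norm (measure (\<Pi>\<^sub>M j\<in>{..<n}. density M (r n)) (A n) - 0) < e"
    by (simp add: eventually_sequentially)
qed

text \<open>The quadratic bound dominates expressions scaled by \<open>n\<close>, the linear one
  those scaled by \<open>sqrt n\<close>.\<close>

lemma abs_cos_minus_1_le:
  fixes t :: real
  shows "\<bar>cos t - 1\<bar> \<le> t\<^sup>2 / 2" "\<bar>cos t - 1\<bar> \<le> \<bar>t\<bar>"
proof -
  have eq: "\<bar>cos t - 1\<bar> = 2 * (\<bar>sin (t / 2)\<bar> * \<bar>sin (t / 2)\<bar>)"
    using cos_double_sin[of "t / 2"] by (simp add: power2_eq_square flip: abs_mult)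
  have s: "\<bar>sin (t / 2)\<bar> \<le> \<bar>t / 2\<bar>" by (rule abs_sin_x_le_abs_x)
  have "\<bar>sin (t / 2)\<bar> * \<bar>sin (t / 2)\<bar> \<le> \<bar>t / 2\<bar> * \<bar>t / 2\<bar>"
    by (intro mult_mono s) auto
  then show "\<bar>cos t - 1\<bar> \<le> t\<^sup>2 / 2"
    unfolding eq by (simp add: power2_eq_square)
  have "\<bar>sin (t / 2)\<bar> * \<bar>sin (t / 2)\<bar> \<le> \<bar>t / 2\<bar> * 1"
    by (intro mult_mono s) auto
  then show "\<bar>cos t - 1\<bar> \<le> \<bar>t\<bar>"
    unfolding eq by simp
qed

lemma abs_sin_minus_le: "\<bar>sin t - t\<bar> \<le> t\<^sup>2 / 2" for t :: real
  using Maclaurin_sin_bound[of t 2] by (simp add: numeral_2_eq_2 sin_coeff_def)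

section \<open>Taylor limits at the scale \<open>1 / sqrt n\<close>; the case \<open>q = 0\<close>
  is split off because \<open>at 0\<close> is a punctured neighbourhood\<close>

lemma lim_scaled_sqrt:
  fixes f :: "real \<Rightarrow> real"
  assumes "(f \<longlongrightarrow> l) (at 0)"
  shows "q \<noteq> 0 \<Longrightarrow> (\<lambda>n. f (q / sqrt (real n))) \<longlonglongrightarrow> l"
proof -
  assume q: "q \<noteq> 0"
  have "(\<lambda>n. q / sqrt (real n)) \<longlonglongrightarrow> 0"
    by real_asymp
  moreover have "\<forall>\<^sub>F n in sequentially. q / sqrt (real n) \<noteq> 0"
    using eventually_gt_at_top[of 0] by eventually_elim (use q in auto)
  ultimately have "filterlim (\<lambda>n. q / sqrt (real n)) (at 0) sequentially"
    by (simp add: filterlim_at)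
  then show ?thesis
    by (rule filterlim_compose[OF assms])
qed

lemma lim_scaled_cos: "(\<lambda>n. real n * (cos (q / sqrt (real n)) - 1)) \<longlonglongrightarrow> - (q)\<^sup>2 / 2"
proof (cases "q = 0")
  case False
  have "((\<lambda>t. (cos t - 1) / t\<^sup>2) \<longlongrightarrow> - (1/2)) (at (0::real))" by real_asymp
  from tendsto_mult_left[OF lim_scaled_sqrt[OF this False], of "q\<^sup>2"] show ?thesis
    by (rule Lim_transform_eventually[THEN tendsto_eq_rhs])
      (use False in \<open>auto intro!: eventually_mono[OF eventually_gt_at_top[of 0]] simp: field_simps\<close>)
qed auto

lemma lim_scaled_sin2: "(\<lambda>n. real n * (sin (q / sqrt (real n)) - q / sqrt (real n))) \<longlonglongrightarrow> 0"
proof (cases "q = 0")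
  case False
  have "((\<lambda>t. (sin t - t) / t\<^sup>2) \<longlongrightarrow> 0) (at (0::real))" by real_asymp
  from tendsto_mult_left[OF lim_scaled_sqrt[OF this False], of "q\<^sup>2"] show ?thesis
    by (rule Lim_transform_eventually[THEN tendsto_eq_rhs])
      (use False in \<open>auto intro!: eventually_mono[OF eventually_gt_at_top[of 0]] simp: field_simps\<close>)
qed auto

lemma lim_scaled_cos1: "(\<lambda>n. sqrt (real n) * (cos (q / sqrt (real n)) - 1)) \<longlonglongrightarrow> 0"
proof (cases "q = 0")
  case False
  have "((\<lambda>t. (cos t - 1) / t) \<longlongrightarrow> 0) (at (0::real))" by real_asymp
  from tendsto_mult_left[OF lim_scaled_sqrt[OF this False], of q] show ?thesis
    by (rule Lim_transform_eventually[THEN tendsto_eq_rhs])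
      (use False in \<open>auto intro!: eventually_mono[OF eventually_gt_at_top[of 0]] simp: field_simps\<close>)
qed auto

lemma lim_scaled_sin1: "(\<lambda>n. sqrt (real n) * sin (q / sqrt (real n))) \<longlonglongrightarrow> q"
proof (cases "q = 0")
  case False
  have "((\<lambda>t. sin t / t) \<longlongrightarrow> 1) (at (0::real))" by real_asymp
  from tendsto_mult_left[OF lim_scaled_sqrt[OF this False], of q] show ?thesis
    by (rule Lim_transform_eventually[THEN tendsto_eq_rhs])
      (use False in \<open>auto intro!: eventually_mono[OF eventually_gt_at_top[of 0]] simp: field_simps\<close>)
qed auto

lemma lim_scaled_exp1: "(\<lambda>n. sqrt (real n) * (exp (q / sqrt (real n)) - 1)) \<longlonglongrightarrow> q"
proof (cases "q = 0")
  case False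
  have "((\<lambda>t. (exp t - 1) / t) \<longlongrightarrow> 1) (at (0::real))" by real_asymp
  from tendsto_mult_left[OF lim_scaled_sqrt[OF this False], of q] show ?thesis
    by (rule Lim_transform_eventually[THEN tendsto_eq_rhs])
      (use False in \<open>auto intro!: eventually_mono[OF eventually_gt_at_top[of 0]] simp: field_simps\<close>)
qed auto

lemma lim_scaled_exp2: "(\<lambda>n. real n * (exp (q / sqrt (real n)) - 1 - q / sqrt (real n))) \<longlonglongrightarrow> q\<^sup>2 / 2"
proof (cases "q = 0")
  case False
  have "((\<lambda>t. (exp t - 1 - t) / t\<^sup>2) \<longlongrightarrow> 1 / 2) (at (0::real))" by real_asymp
  from tendsto_mult_left[OF lim_scaled_sqrt[OF this False], of "q\<^sup>2"] show ?thesis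
    by (rule Lim_transform_eventually[THEN tendsto_eq_rhs])
      (use False in \<open>auto intro!: eventually_mono[OF eventually_gt_at_top[of 0]] simp: field_simps\<close>)
qed auto

text \<open>The characteristic function of the sum is an n-th power also under the alternative, so
  only \<open>n * (\<phi> n - 1)\<close> has to be followed. Its part free of \<open>r n - 1\<close>
  gives the variance, as in the central limit theorem. The part with \<open>r n - 1\<close> is an
  inner product of two convergent sequences in L2 and gives the drift. The result plays the role of
  Le Cam's third lemma.\<close>

lemma (in prob_space) char_under_local_ratio:
  fixes \<psi> :: "'a \<Rightarrow> real"
  assumes r: "local_ratio M r s"
    and m [measurable]: "\<psi> \<in> borel_measurable M" and psi: "integrable M (\<lambda>x. (\<psi> x)\<^sup>2)" "(\<integral>x. \<psi> x \<partial>M) = 0"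
  shows "(\<lambda>n. char (distr (\<Pi>\<^sub>M j\<in>{..<n}. density M (r n)) borel (\<lambda>X. 1 / sqrt (real n) * (\<Sum>j<n. \<psi> (X j)))) u)
    \<longlonglongrightarrow> exp (\<i> * of_real (u * (\<integral>x. \<psi> x * s x \<partial>M)) - of_real (u\<^sup>2 * (\<integral>x. (\<psi> x)\<^sup>2 \<partial>M) / 2))"
proof -
  define y where "y = (\<lambda>n x. u * \<psi> x / sqrt (real n))"
  have [measurable]: "y n \<in> borel_measurable M" for n by (simp add: y_def[abs_def])
  define \<xi> where "\<xi> = (\<lambda>n x. sqrt (real n) * (r n x - 1))"
  have \<xi>: "L2_conv M \<xi> s" using r by (simp add: local_ratio_def \<xi>_def[abs_def])
  \<comment> \<open>\<open>R n\<close> and \<open>I n\<close> are the real and imaginary parts of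
    \<open>n * (\<phi> n - 1)\<close>, where in the terms containing \<open>r n - 1\<close> the
    factor \<open>n\<close> is shared out as \<open>sqrt n\<close> to each side. Subtracting
    \<open>y n\<close> inside \<open>I\<close> costs nothing, because \<psi> has mean 0.\<close>
  define R where "R = (\<lambda>n. (\<integral>x. real n * (cos (y n x) - 1) \<partial>M) + (\<integral>x. sqrt (real n) * (cos (y n x) - 1) * \<xi> n x \<partial>M))"
  define I where "I = (\<lambda>n. (\<integral>x. real n * (sin (y n x) - y n x) \<partial>M) + (\<integral>x. sqrt (real n) * sin (y n x) * \<xi> n x \<partial>M))"
  have psi1: "integrable M \<psi>" using m psi(1) by (rule square_integrable_imp_integrable)
  have i2: "integrable M (\<lambda>x. u\<^sup>2 * (\<psi> x)\<^sup>2 / 2)" "integrable M (\<lambda>x. (\<bar>u * \<psi> x\<bar>)\<^sup>2)"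
    using psi by (auto simp: power_mult_distrib)
  have y2: "real n * (y n x)\<^sup>2 \<le> u\<^sup>2 * (\<psi> x)\<^sup>2" for n x
    by (cases "n = 0") (auto simp: y_def power_divide power_mult_distrib)
  have y1: "sqrt (real n) * \<bar>y n x\<bar> \<le> \<bar>u * \<psi> x\<bar>" for n x
    by (cases "n = 0") (auto simp: y_def abs_mult)

  have nR: "(\<lambda>n. \<integral>x. real n * (cos (y n x) - 1) \<partial>M) \<longlonglongrightarrow> (\<integral>x. - (u * \<psi> x)\<^sup>2 / 2 \<partial>M)"
  proof (rule dominated_convergence_eventually)
    show "\<forall>\<^sub>F n in sequentially. \<forall>x\<in>space M. \<bar>real n * (cos (y n x) - 1)\<bar> \<le> u\<^sup>2 * (\<psi> x)\<^sup>2 / 2"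
    proof (intro always_eventually allI ballI)
      fix n x
      have "\<bar>real n * (cos (y n x) - 1)\<bar> \<le> real n * ((y n x)\<^sup>2 / 2)"
        unfolding abs_mult by (intro mult_mono abs_cos_minus_1_le(1)) auto
      then show "\<bar>real n * (cos (y n x) - 1)\<bar> \<le> u\<^sup>2 * (\<psi> x)\<^sup>2 / 2"
        using y2[of n x] by simp
    qed
    show "(\<lambda>n. real n * (cos (y n x) - 1)) \<longlonglongrightarrow> - (u * \<psi> x)\<^sup>2 / 2" for x
      unfolding y_def by (rule lim_scaled_cos)
  qed (use i2 in simp_all)
  have nI: "(\<lambda>n. \<integral>x. real n * (sin (y n x) - y n x) \<partial>M) \<longlonglongrightarrow> (\<integral>x. 0 \<partial>M)"
  proof (rule dominated_convergence_eventually)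
    show "\<forall>\<^sub>F n in sequentially. \<forall>x\<in>space M. \<bar>real n * (sin (y n x) - y n x)\<bar> \<le> u\<^sup>2 * (\<psi> x)\<^sup>2 / 2"
    proof (intro always_eventually allI ballI)
      fix n x
      have "\<bar>real n * (sin (y n x) - y n x)\<bar> \<le> real n * ((y n x)\<^sup>2 / 2)"
        unfolding abs_mult by (intro mult_mono abs_sin_minus_le) auto
      then show "\<bar>real n * (sin (y n x) - y n x)\<bar> \<le> u\<^sup>2 * (\<psi> x)\<^sup>2 / 2"
        using y2[of n x] by simp
    qed
    show "(\<lambda>n. real n * (sin (y n x) - y n x)) \<longlonglongrightarrow> 0" for x
      unfolding y_def by (rule lim_scaled_sin2)
  qed (use i2 in simp_all)
  have L2c: "L2_conv M (\<lambda>n x. sqrt (real n) * (cos (y n x) - 1)) (\<lambda>_. 0)"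
  proof (rule L2_conv_dominated)
    show "\<forall>\<^sub>F n in sequentially. \<forall>x\<in>space M. \<bar>sqrt (real n) * (cos (y n x) - 1)\<bar> \<le> \<bar>u * \<psi> x\<bar>"
    proof (intro always_eventually allI ballI)
      fix n x
      have "\<bar>sqrt (real n) * (cos (y n x) - 1)\<bar> \<le> sqrt (real n) * \<bar>y n x\<bar>"
        unfolding abs_mult by (intro mult_mono abs_cos_minus_1_le(2)) auto
      then show "\<bar>sqrt (real n) * (cos (y n x) - 1)\<bar> \<le> \<bar>u * \<psi> x\<bar>"
        using y1[of n x] by simp
    qed
    show "(\<lambda>n. sqrt (real n) * (cos (y n x) - 1)) \<longlonglongrightarrow> 0" for x
      unfolding y_def by (rule lim_scaled_cos1)
  qed (use i2 in simp_all)
  have L2s: "L2_conv M (\<lambda>n x. sqrt (real n) * sin (y n x)) (\<lambda>x. u * \<psi> x)"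
  proof (rule L2_conv_dominated)
    show "\<forall>\<^sub>F n in sequentially. \<forall>x\<in>space M. \<bar>sqrt (real n) * sin (y n x)\<bar> \<le> \<bar>u * \<psi> x\<bar>"
    proof (intro always_eventually allI ballI)
      fix n x
      have "\<bar>sqrt (real n) * sin (y n x)\<bar> \<le> sqrt (real n) * \<bar>y n x\<bar>"
        by (simp add: abs_mult mult_left_mono abs_sin_x_le_abs_x)
      then show "\<bar>sqrt (real n) * sin (y n x)\<bar> \<le> \<bar>u * \<psi> x\<bar>"
        using y1[of n x] by simp
    qed
    show "(\<lambda>n. sqrt (real n) * sin (y n x)) \<longlonglongrightarrow> u * \<psi> x" for x
      unfolding y_def by (rule lim_scaled_sin1)
  qed (use i2 in simp_all)
  define G H where "G = (\<integral>x. (\<psi> x)\<^sup>2 \<partial>M)" and "H = (\<integral>x. \<psi> x * s x \<partial>M)"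
  have "(\<lambda>n. complex_of_real (R n) + \<i> * complex_of_real (I n)) \<longlonglongrightarrow>
     complex_of_real ((\<integral>x. - (u * \<psi> x)\<^sup>2 / 2 \<partial>M) + (\<integral>x. 0 * s x \<partial>M)) +
       \<i> * complex_of_real ((\<integral>x. 0 \<partial>M) + (\<integral>x. u * \<psi> x * s x \<partial>M))"
    unfolding R_def I_def by (intro tendsto_intros nR nI L2_conv_inner[OF L2c \<xi>] L2_conv_inner[OF L2s \<xi>])
  also have "complex_of_real ((\<integral>x. - (u * \<psi> x)\<^sup>2 / 2 \<partial>M) + (\<integral>x. 0 * s x \<partial>M)) +
       \<i> * complex_of_real ((\<integral>x. 0 \<partial>M) + (\<integral>x. u * \<psi> x * s x \<partial>M)) =
     \<i> * of_real (u * H) - of_real (u\<^sup>2 * G / 2)"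
    by (simp add: G_def H_def power_mult_distrib mult.assoc)
  finally have lim: "(\<lambda>n. complex_of_real (R n) + \<i> * complex_of_real (I n)) \<longlonglongrightarrow> \<i> * of_real (u * H) - of_real (u\<^sup>2 * G / 2)" .
  define \<phi> where "\<phi> = (\<lambda>n. \<integral>x. iexp (y n x) \<partial>density M (r n))"
  have ev: "\<forall>\<^sub>F n in sequentially. complex_of_real (R n) + \<i> * complex_of_real (I n) = of_nat n * (\<phi> n - 1)"
    using local_ratioD[OF r] L2c[unfolded L2_conv_def, THEN conjunct2, THEN conjunct2, THEN conjunct1]
      L2s[unfolded L2_conv_def, THEN conjunct2, THEN conjunct2, THEN conjunct1]
      \<xi>[unfolded L2_conv_def, THEN conjunct2, THEN conjunct2, THEN conjunct1]
  proof eventually_elim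
    case (elim n)
    have [measurable]: "r n \<in> borel_measurable M" using elim by simp
    have ic: "integrable M (\<lambda>x. r n x * cos (y n x))" "integrable M (\<lambda>x. r n x * sin (y n x))"
      using elim by (auto intro!: Bochner_Integration.integrable_bound[of M "r n"] simp: abs_mult mult_left_le)
    have iy: "integrable M (y n)" using psi1 by (simp add: y_def[abs_def])
    have i1: "integrable M (\<lambda>x. cos (y n x))" "integrable M (\<lambda>x. sin (y n x))"
      by (auto intro!: integrable_const_bound[where B = 1])
    have y0: "(\<integral>x. y n x \<partial>M) = 0" using psi by (simp add: y_def)
    have "\<phi> n = (\<integral>x. r n x *\<^sub>R iexp (y n x) \<partial>M)"
      unfolding \<phi>_def using elim by (intro integral_density) auto
    also have "\<dots> = (\<integral>x. complex_of_real (r n x * cos (y n x)) + \<i> * complex_of_real (r n x * sin (y n x)) \<partial>M)"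
      by (intro Bochner_Integration.integral_cong refl)
        (simp add: exp_Euler scaleR_conv_of_real algebra_simps cos_of_real sin_of_real)
    also have "\<dots> = complex_of_real (\<integral>x. r n x * cos (y n x) \<partial>M) + \<i> * complex_of_real (\<integral>x. r n x * sin (y n x) \<partial>M)"
    proof -
      have "complex_integrable M (\<lambda>x. complex_of_real (r n x * cos (y n x)))"
        "complex_integrable M (\<lambda>x. complex_of_real (r n x * sin (y n x)))"
        using ic by (simp_all only: complex_of_real_integrable_eq)
      then show ?thesis
        by (simp only: Bochner_Integration.integral_add integrable_mult_right integral_mult_right_zero integral_complex_of_real)
    qed
    finally have phi: "\<phi> n = \<dots>" .
    have sq: "sqrt (real n) * t * \<xi> n x = real n * (t * (r n x - 1))" for t x
    proof -
      have "sqrt (real n) * t * \<xi> n x = (sqrt (real n) * sqrt (real n)) * (t * (r n x - 1))"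
        by (simp only: \<xi>_def mult_ac)
      then show ?thesis by simp
    qed
    have i3: "integrable M (\<lambda>x. sqrt (real n) * (cos (y n x) - 1) * \<xi> n x)"
      "integrable M (\<lambda>x. sqrt (real n) * sin (y n x) * \<xi> n x)"
      by (rule integrable_mult_L2, simp_all only: elim simp_thms)+
    have i4: "integrable M (\<lambda>x. real n * (cos (y n x) - 1))" "integrable M (\<lambda>x. real n * (sin (y n x) - y n x))"
      by (intro integrable_mult_right Bochner_Integration.integrable_diff i1 iy integrable_const)+
    have "R n = (\<integral>x. real n * (cos (y n x) - 1) + sqrt (real n) * (cos (y n x) - 1) * \<xi> n x \<partial>M)"
      unfolding R_def by (rule Bochner_Integration.integral_add[symmetric]) (fact i3 i4)+
    also have "\<dots> = (\<integral>x. real n * (r n x * cos (y n x) - r n x) \<partial>M)"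
      by (intro Bochner_Integration.integral_cong refl) (simp only: sq, simp add: algebra_simps)
    also have "\<dots> = real n * ((\<integral>x. r n x * cos (y n x) \<partial>M) - 1)"
      using ic elim by simp
    finally have Rn: "R n = \<dots>" .
    have "I n = (\<integral>x. real n * (sin (y n x) - y n x) + sqrt (real n) * sin (y n x) * \<xi> n x \<partial>M)"
      unfolding I_def by (rule Bochner_Integration.integral_add[symmetric]) (fact i3 i4)+
    also have "\<dots> = (\<integral>x. real n * (r n x * sin (y n x) - y n x) \<partial>M)"
      by (intro Bochner_Integration.integral_cong refl) (simp only: sq, simp add: algebra_simps)
    also have "\<dots> = real n * (\<integral>x. r n x * sin (y n x) \<partial>M)"
      using ic iy y0 by simp
    finally have In: "I n = \<dots>" .
    show ?case
      by (simp add: phi Rn In algebra_simps)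
  qed
  have "(\<lambda>n. \<phi> n ^ n) \<longlonglongrightarrow> exp (\<i> * of_real (u * H) - of_real (u\<^sup>2 * G / 2))"
    by (rule tendsto_power_exp_complex) (rule Lim_transform_eventually[OF lim ev])
  moreover have "\<forall>\<^sub>F n in sequentially. \<phi> n ^ n =
     char (distr (\<Pi>\<^sub>M j\<in>{..<n}. density M (r n)) borel (\<lambda>X. 1 / sqrt (real n) * (\<Sum>j<n. \<psi> (X j)))) u"
    using local_ratioD[OF r]
  proof eventually_elim
    case (elim n)
    then interpret D: prob_space "density M (r n)" by simp
    have [measurable]: "r n \<in> borel_measurable M" using elim by simp
    have "char (distr (\<Pi>\<^sub>M j\<in>{..<n}. density M (r n)) borel (\<lambda>X. 1 / sqrt (real n) * (\<Sum>j<n. \<psi> (X j)))) u =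
      (\<integral>X. iexp (u * (1 / sqrt (real n) * (\<Sum>j<n. \<psi> (X j)))) \<partial>(\<Pi>\<^sub>M j\<in>{..<n}. density M (r n)))"
      unfolding char_def by (subst integral_distr) auto
    also have "\<dots> = (\<integral>X. (\<Prod>j<n. iexp (y n (X j))) \<partial>(\<Pi>\<^sub>M j\<in>{..<n}. density M (r n)))"
      by (intro Bochner_Integration.integral_cong refl)
        (simp add: y_def exp_sum[symmetric] sum_distrib_left sum_divide_distrib)
    also have "\<dots> = \<phi> n ^ n"
      unfolding \<phi>_def by (intro D.integral_PiM_power D.integrable_const_bound[where B = 1]) auto
    finally show ?case by simp
  qed
  ultimately show ?thesis
    unfolding G_def H_def by (rule Lim_transform_eventually)
qed

section \<open>Exponential approximation of the likelihood ratio\<close>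

lemma integral_abs_le_sqrt:
  fixes f :: "'a \<Rightarrow> real"
  assumes "prob_space M" and [measurable]: "f \<in> borel_measurable M" and "integrable M (\<lambda>x. (f x)\<^sup>2)"
  shows "(\<integral>x. \<bar>f x\<bar> \<partial>M) \<le> sqrt (\<integral>x. (f x)\<^sup>2 \<partial>M)"
proof -
  interpret prob_space M by fact
  show ?thesis
    using integral_Cauchy_Schwarz[of "\<lambda>x. \<bar>f x\<bar>" M "\<lambda>_. 1"] assms by (simp add: prob_space)
qed

lemma abs_mult_divide_sqrt_le:
  assumes "\<bar>b\<bar> \<le> c * sqrt (real n)" "c > 0"
  shows "\<bar>b * p / sqrt (real n)\<bar> \<le> c * \<bar>p\<bar>"
proof (cases "n = 0")
  case True
  then show ?thesis using assms by simp
next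
  case False
  then show ?thesis
    using mult_right_mono[OF assms(1), of "\<bar>p\<bar>"] by (simp add: abs_mult field_simps)
qed

text \<open>For large n the exponent \<open>b * \<psi> / sqrt n\<close> is at most
  \<open>c * \<bar>\<psi>\<bar>\<close> in absolute value, so the one weighted exponential moment
  dominates all Taylor remainders. The conclusions treat \<open>exp (b * \<psi> / sqrt n)\<close>
  like a local likelihood ratio that is not normalised.\<close>

lemma (in prob_space)
  fixes \<psi> :: "'a \<Rightarrow> real"
  assumes m [measurable]: "\<psi> \<in> borel_measurable M"
    and c: "c > 0" and psi: "integrable M (\<lambda>x. (\<psi> x)\<^sup>2 * exp (c * \<bar>\<psi> x\<bar>))" "(\<integral>x. \<psi> x \<partial>M) = 0"
  shows exp_tilt_integrable:
      "\<forall>\<^sub>F n in sequentially. integrable M (\<lambda>x. exp (b * \<psi> x / sqrt (real n)))"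
    and exp_tilt_mean:
      "(\<lambda>n. real n * ((\<integral>x. exp (b * \<psi> x / sqrt (real n)) \<partial>M) - 1)) \<longlonglongrightarrow> b\<^sup>2 * (\<integral>x. (\<psi> x)\<^sup>2 \<partial>M) / 2"
    and exp_tilt_L2:
      "L2_conv M (\<lambda>n x. sqrt (real n) * (exp (b * \<psi> x / sqrt (real n)) - 1)) (\<lambda>x. b * \<psi> x)"
    and exp_moment_square_integrable: "integrable M (\<lambda>x. (\<psi> x)\<^sup>2)"
proof -
  have "filterlim (\<lambda>n. c * sqrt (real n)) at_top sequentially"
    using c by real_asymp
  then have large: "\<forall>\<^sub>F n in sequentially. d \<le> c * sqrt (real n)" for d
    by (simp add: filterlim_at_top)
  show sq: "integrable M (\<lambda>x. (\<psi> x)\<^sup>2)"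
  proof (rule Bochner_Integration.integrable_bound[OF psi(1)], measurable, intro AE_I2)
    fix x
    have "(\<psi> x)\<^sup>2 * 1 \<le> (\<psi> x)\<^sup>2 * exp (c * \<bar>\<psi> x\<bar>)"
      using c by (intro mult_left_mono) auto
    then show "norm ((\<psi> x)\<^sup>2) \<le> norm ((\<psi> x)\<^sup>2 * exp (c * \<bar>\<psi> x\<bar>))"
      by simp
  qed
  then have psi1: "integrable M \<psi>" by (rule square_integrable_imp_integrable[OF m])
  \<comment> \<open>Splitting at \<open>\<bar>\<psi>\<bar> = 1\<close> recovers the plain
    exponential moment from the weighted one.\<close>
  have ec0: "integrable M (\<lambda>x. exp c + (\<psi> x)\<^sup>2 * exp (c * \<bar>\<psi> x\<bar>))"
    by (rule Bochner_Integration.integrable_add[OF integrable_const psi(1)])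
  have ec: "integrable M (\<lambda>x. exp (c * \<bar>\<psi> x\<bar>))"
  proof (rule Bochner_Integration.integrable_bound[OF ec0 _ AE_I2])
    show "(\<lambda>x. exp (c * \<bar>\<psi> x\<bar>)) \<in> borel_measurable M" by measurable
    fix x
    define E where "E = exp (c * \<bar>\<psi> x\<bar>)"
    have E: "0 < E" by (simp add: E_def)
    have "E \<le> exp c + (\<psi> x)\<^sup>2 * E"
    proof (cases "\<bar>\<psi> x\<bar> \<le> 1")
      case True
      then have "E \<le> exp c" using c by (simp add: E_def)
      moreover have "0 \<le> (\<psi> x)\<^sup>2 * E" using E by simp
      ultimately show ?thesis by linarith
    next
      case False
      then have "1\<^sup>2 \<le> \<bar>\<psi> x\<bar>\<^sup>2" by (intro power_mono) linarith+
      then have "1 * E \<le> (\<psi> x)\<^sup>2 * E"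
        using E by (intro mult_right_mono) simp_all
      moreover have "0 < exp c" by simp
      ultimately show ?thesis by linarith
    qed
    then have "norm (exp (c * \<bar>\<psi> x\<bar>)) \<le> exp c + (\<psi> x)\<^sup>2 * exp (c * \<bar>\<psi> x\<bar>)"
      by (simp only: E_def real_norm_def abs_exp_cancel)
    also have "\<dots> \<le> norm (exp c + (\<psi> x)\<^sup>2 * exp (c * \<bar>\<psi> x\<bar>))"
      unfolding real_norm_def by (rule abs_ge_self)
    finally show "norm (exp (c * \<bar>\<psi> x\<bar>)) \<le> norm (exp c + (\<psi> x)\<^sup>2 * exp (c * \<bar>\<psi> x\<bar>))" .
  qed
  have ei: "\<forall>\<^sub>F n in sequentially. integrable M (\<lambda>x. exp (d * \<psi> x / sqrt (real n)))" for d
    using large[of "\<bar>d\<bar>"]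
  proof eventually_elim
    case (elim n)
    show ?case
    proof (rule Bochner_Integration.integrable_bound[OF ec _ AE_I2])
      show "(\<lambda>x. exp (d * \<psi> x / sqrt (real n))) \<in> borel_measurable M" by measurable
      show "norm (exp (d * \<psi> x / sqrt (real n))) \<le> norm (exp (c * \<bar>\<psi> x\<bar>))" for x
        using order_trans[OF abs_ge_self abs_mult_divide_sqrt_le[OF elim c, of "\<psi> x"]] by simp
    qed
  qed
  show "\<forall>\<^sub>F n in sequentially. integrable M (\<lambda>x. exp (b * \<psi> x / sqrt (real n)))" by (rule ei)
  define y where "y = (\<lambda>n x. b * \<psi> x / sqrt (real n))"
  have [measurable]: "y n \<in> borel_measurable M" for n by (simp add: y_def[abs_def])
  have y2: "real n * (y n x)\<^sup>2 \<le> b\<^sup>2 * (\<psi> x)\<^sup>2" for n x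
    by (cases "n = 0") (auto simp: y_def power_divide power_mult_distrib)
  have y1: "sqrt (real n) * \<bar>y n x\<bar> \<le> \<bar>b * \<psi> x\<bar>" for n x
    by (cases "n = 0") (auto simp: y_def abs_mult)
  have "(\<lambda>n. \<integral>x. real n * (exp (y n x) - 1 - y n x) \<partial>M) \<longlonglongrightarrow> (\<integral>x. (b * \<psi> x)\<^sup>2 / 2 \<partial>M)"
  proof (rule dominated_convergence_eventually)
    show "integrable M (\<lambda>x. b\<^sup>2 / 2 * ((\<psi> x)\<^sup>2 * exp (c * \<bar>\<psi> x\<bar>)))" using psi by simp
    show "\<forall>\<^sub>F n in sequentially. \<forall>x\<in>space M. \<bar>real n * (exp (y n x) - 1 - y n x)\<bar> \<le> b\<^sup>2 / 2 * ((\<psi> x)\<^sup>2 * exp (c * \<bar>\<psi> x\<bar>))"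
      using large[of "\<bar>b\<bar>"]
    proof eventually_elim
      case (elim n)
      have "\<bar>real n * (exp (y n x) - 1 - y n x)\<bar> \<le> b\<^sup>2 / 2 * ((\<psi> x)\<^sup>2 * exp (c * \<bar>\<psi> x\<bar>))" for x
      proof -
        have "\<bar>real n * (exp (y n x) - 1 - y n x)\<bar> \<le> real n * ((y n x)\<^sup>2 / 2 * exp \<bar>y n x\<bar>)"
          unfolding abs_mult by (intro mult_mono abs_exp_taylor2_le) auto
        also have "\<dots> = (real n * (y n x)\<^sup>2) / 2 * exp \<bar>y n x\<bar>" by simp
        also have "\<dots> \<le> (b\<^sup>2 * (\<psi> x)\<^sup>2) / 2 * exp (c * \<bar>\<psi> x\<bar>)"
          by (intro mult_mono divide_right_mono y2) (use abs_mult_divide_sqrt_le[OF elim c, of "\<psi> x"] in \<open>simp_all add: y_def\<close>)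
        finally show ?thesis by simp
      qed
      then show ?case by blast
    qed
    show "(\<lambda>n. real n * (exp (y n x) - 1 - y n x)) \<longlonglongrightarrow> (b * \<psi> x)\<^sup>2 / 2" for x
      unfolding y_def by (rule lim_scaled_exp2)
  qed simp_all
  moreover have "\<forall>\<^sub>F n in sequentially. (\<integral>x. real n * (exp (y n x) - 1 - y n x) \<partial>M) =
      real n * ((\<integral>x. exp (b * \<psi> x / sqrt (real n)) \<partial>M) - 1)"
    using ei[of b]
  proof eventually_elim
    case (elim n)
    have "integrable M (y n)" "(\<integral>x. y n x \<partial>M) = 0" using psi psi1 by (simp_all add: y_def[abs_def])
    moreover have "integrable M (\<lambda>x. exp (y n x))" using elim by (simp add: y_def)
    ultimately have "(\<integral>x. real n * (exp (y n x) - 1 - y n x) \<partial>M) = real n * ((\<integral>x. exp (y n x) \<partial>M) - 1)"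
      by (simp add: prob_space)
    then show ?case by (simp add: y_def)
  qed
  ultimately show "(\<lambda>n. real n * ((\<integral>x. exp (b * \<psi> x / sqrt (real n)) \<partial>M) - 1)) \<longlonglongrightarrow> b\<^sup>2 * (\<integral>x. (\<psi> x)\<^sup>2 \<partial>M) / 2"
    by (rule Lim_transform_eventually[THEN tendsto_eq_rhs]) (simp add: power_mult_distrib)
  show "L2_conv M (\<lambda>n x. sqrt (real n) * (exp (b * \<psi> x / sqrt (real n)) - 1)) (\<lambda>x. b * \<psi> x)"
  proof (rule L2_conv_dominated)
    \<comment> \<open>The dominating function has rate \<open>c / 2\<close>, because squaring it
      doubles the exponent.\<close>
    have "(\<lambda>x. (\<bar>b * \<psi> x\<bar> * exp (c / 2 * \<bar>\<psi> x\<bar>))\<^sup>2) = (\<lambda>x. b\<^sup>2 * ((\<psi> x)\<^sup>2 * exp (c * \<bar>\<psi> x\<bar>)))"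
      by (auto simp: power_mult_distrib exp_double[symmetric])
    then show "integrable M (\<lambda>x. (\<bar>b * \<psi> x\<bar> * exp (c / 2 * \<bar>\<psi> x\<bar>))\<^sup>2)"
      using psi by simp
    show "\<forall>\<^sub>F n in sequentially. \<forall>x\<in>space M. \<bar>sqrt (real n) * (exp (b * \<psi> x / sqrt (real n)) - 1)\<bar> \<le> \<bar>b * \<psi> x\<bar> * exp (c / 2 * \<bar>\<psi> x\<bar>)"
      using large[of "2 * \<bar>b\<bar>"]
    proof eventually_elim
      case (elim n)
      have "\<bar>sqrt (real n) * (exp (y n x) - 1)\<bar> \<le> \<bar>b * \<psi> x\<bar> * exp (c / 2 * \<bar>\<psi> x\<bar>)" for x
      proof -
        have "\<bar>sqrt (real n) * (exp (y n x) - 1)\<bar> \<le> sqrt (real n) * (\<bar>y n x\<bar> * exp \<bar>y n x\<bar>)"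
          unfolding abs_mult by (intro mult_mono abs_exp_minus_1_le) auto
        also have "\<dots> = (sqrt (real n) * \<bar>y n x\<bar>) * exp \<bar>y n x\<bar>" by simp
        also have "\<dots> \<le> \<bar>b * \<psi> x\<bar> * exp (c / 2 * \<bar>\<psi> x\<bar>)"
          by (intro mult_mono y1) (use abs_mult_divide_sqrt_le[of b "c / 2" n "\<psi> x"] elim c in \<open>simp_all add: y_def\<close>)
        finally show ?thesis .
      qed
      then show ?case by (simp add: y_def)
    qed
    show "(\<lambda>n. sqrt (real n) * (exp (b * \<psi> x / sqrt (real n)) - 1)) \<longlonglongrightarrow> b * \<psi> x" for x
      by (rule lim_scaled_exp1)
  qed simp_all
qed

text \<open>The comparison is made in L2, where each of the three terms of the expanded square is an
  n-th power of a one-dimensional integral. With \<open>G\<close> the second moment of \<psi>, they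
  tend to \<open>exp (a\<^sup>2 * G)\<close> times 1, -2 and 1 and cancel.\<close>

lemma (in prob_space) likelihood_ratio_L1:
  fixes \<psi> :: "'a \<Rightarrow> real"
  assumes m [measurable]: "\<psi> \<in> borel_measurable M"
    and c: "c > 0" and psi: "integrable M (\<lambda>x. (\<psi> x)\<^sup>2 * exp (c * \<bar>\<psi> x\<bar>))" "(\<integral>x. \<psi> x \<partial>M) = 0"
    and r: "local_ratio M r (\<lambda>x. a * \<psi> x)"
  defines "L \<equiv> \<lambda>n X. \<Prod>j<n. r n (X j)"
    and "E \<equiv> \<lambda>n X. exp (a * (1 / sqrt (real n) * (\<Sum>j<n. \<psi> (X j))) - a\<^sup>2 * (\<integral>x. (\<psi> x)\<^sup>2 \<partial>M) / 2)"
  shows "(\<lambda>n. \<integral>X. \<bar>L n X - E n X\<bar> \<partial>(\<Pi>\<^sub>M j\<in>{..<n}. M)) \<longlonglongrightarrow> 0"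
    and "\<forall>\<^sub>F n in sequentially. integrable (\<Pi>\<^sub>M j\<in>{..<n}. M) (L n) \<and> integrable (\<Pi>\<^sub>M j\<in>{..<n}. M) (E n)"
proof -
  define G where "G = (\<integral>x. (\<psi> x)\<^sup>2 \<partial>M)"
  define \<zeta> where "\<zeta> = (\<lambda>n x. exp (a * \<psi> x / sqrt (real n)))"
  have [measurable]: "\<zeta> n \<in> borel_measurable M" for n by (simp add: \<zeta>_def[abs_def])
  have \<zeta>2: "(\<zeta> n x)\<^sup>2 = exp (2 * a * \<psi> x / sqrt (real n))" for n x
    by (simp add: \<zeta>_def exp_double[symmetric])
  define \<xi> where "\<xi> = (\<lambda>n x. sqrt (real n) * (r n x - 1))"
  have \<xi>: "L2_conv M \<xi> (\<lambda>x. a * \<psi> x)" using r by (simp add: local_ratio_def \<xi>_def[abs_def])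
  have \<zeta>L: "L2_conv M (\<lambda>n x. sqrt (real n) * (\<zeta> n x - 1)) (\<lambda>x. a * \<psi> x)"
    unfolding \<zeta>_def by (rule exp_tilt_L2[OF m c psi])
  have int1: "\<forall>\<^sub>F n in sequentially. integrable M (\<zeta> n)"
    unfolding \<zeta>_def by (rule exp_tilt_integrable[OF m c psi])
  have int2: "\<forall>\<^sub>F n in sequentially. integrable M (\<lambda>x. (\<zeta> n x)\<^sup>2)"
    unfolding \<zeta>2 by (rule exp_tilt_integrable[OF m c psi])
  have l1: "(\<lambda>n. (\<integral>x. (r n x)\<^sup>2 \<partial>M) ^ n) \<longlonglongrightarrow> exp (a\<^sup>2 * G)"
    using tendsto_power_exp_real[OF ratio_power2_conv(1)[OF r]] by (simp add: G_def power_mult_distrib)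
  have l3: "(\<lambda>n. (\<integral>x. (\<zeta> n x)\<^sup>2 \<partial>M) ^ n) \<longlonglongrightarrow> exp (2 * a\<^sup>2 * G)"
    using tendsto_power_exp_real[OF exp_tilt_mean[OF m c psi, of "2 * a"]] unfolding \<zeta>2
    by (simp add: G_def power_mult_distrib mult.assoc)
  have ev: "\<forall>\<^sub>F n in sequentially. r n \<in> borel_measurable M \<and> integrable M (r n) \<and> (\<integral>x. r n x \<partial>M) = 1 \<and>
      integrable M (\<lambda>x. (r n x)\<^sup>2) \<and> integrable M (\<zeta> n) \<and> integrable M (\<lambda>x. (\<zeta> n x)\<^sup>2) \<and>
      integrable M (\<lambda>x. r n x * \<zeta> n x)"
    using local_ratioD[OF r] int1 int2 ratio_power2_conv(2)[OF r]
    by eventually_elim (auto intro: integrable_mult_L2)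
  \<comment> \<open>As \<open>r n\<close> has mean 1, the mean of \<open>r n * \<zeta> n\<close>
    minus 1 equals the mean of \<open>(r n - 1) * (\<zeta> n - 1)\<close> plus that of
    \<open>\<zeta> n - 1\<close>. Scaled by n, these tend to \<open>a\<^sup>2 * G\<close> and to
    half of it.\<close>
  have "(\<lambda>n. (\<integral>x. \<xi> n x * (sqrt (real n) * (\<zeta> n x - 1)) \<partial>M) + real n * ((\<integral>x. \<zeta> n x \<partial>M) - 1))
      \<longlonglongrightarrow> (\<integral>x. (a * \<psi> x) * (a * \<psi> x) \<partial>M) + a\<^sup>2 * G / 2"
    unfolding G_def \<zeta>_def by (intro tendsto_add exp_tilt_mean[OF m c psi] L2_conv_inner[OF \<xi> \<zeta>L[unfolded \<zeta>_def]])
  then have "(\<lambda>n. real n * ((\<integral>x. r n x * \<zeta> n x \<partial>M) - 1)) \<longlonglongrightarrow> (\<integral>x. (a * \<psi> x) * (a * \<psi> x) \<partial>M) + a\<^sup>2 * G / 2"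
  proof (rule Lim_transform_eventually, use ev in eventually_elim)
    case (elim n)
    have "(\<integral>x. \<xi> n x * (sqrt (real n) * (\<zeta> n x - 1)) \<partial>M) = (\<integral>x. real n * (r n x * \<zeta> n x - r n x - \<zeta> n x + 1) \<partial>M)"
    proof (intro Bochner_Integration.integral_cong refl)
      fix x
      have "\<xi> n x * (sqrt (real n) * (\<zeta> n x - 1)) = (sqrt (real n) * sqrt (real n)) * ((r n x - 1) * (\<zeta> n x - 1))"
        by (simp only: \<xi>_def mult_ac)
      also have "\<dots> = real n * (r n x * \<zeta> n x - r n x - \<zeta> n x + 1)"
        by (simp add: algebra_simps)
      finally show "\<xi> n x * (sqrt (real n) * (\<zeta> n x - 1)) = real n * (r n x * \<zeta> n x - r n x - \<zeta> n x + 1)" .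
    qed
    also have "\<dots> = real n * ((\<integral>x. r n x * \<zeta> n x \<partial>M) - 1 - (\<integral>x. \<zeta> n x \<partial>M) + 1)"
      using elim by (simp add: prob_space)
    finally show ?case by (simp add: algebra_simps)
  qed
  moreover have "(\<integral>x. (a * \<psi> x) * (a * \<psi> x) \<partial>M) + a\<^sup>2 * G / 2 = 3 * a\<^sup>2 * G / 2"
  proof -
    have "(\<integral>x. (a * \<psi> x) * (a * \<psi> x) \<partial>M) = (\<integral>x. a\<^sup>2 * (\<psi> x)\<^sup>2 \<partial>M)"
      by (simp add: power2_eq_square mult_ac)
    then show ?thesis by (simp add: G_def)
  qed
  ultimately have l2: "(\<lambda>n. (\<integral>x. r n x * \<zeta> n x \<partial>M) ^ n) \<longlonglongrightarrow> exp (3 * a\<^sup>2 * G / 2)"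
    by (intro tendsto_power_exp_real) simp
  define k where "k = exp (- (a\<^sup>2 * G / 2))"
  have E: "E n X = k * (\<Prod>j<n. \<zeta> n (X j))" for n X
  proof -
    have "(\<Prod>j<n. \<zeta> n (X j)) = exp (a * (1 / sqrt (real n) * (\<Sum>j<n. \<psi> (X j))))"
      by (simp add: \<zeta>_def exp_sum[symmetric] sum_distrib_left sum_divide_distrib)
    then show ?thesis
      unfolding E_def k_def G_def by (simp only: mult_exp_exp diff_conv_add_uminus) (simp add: add.commute)
  qed
  have "(\<lambda>n. sqrt ((\<integral>x. (r n x)\<^sup>2 \<partial>M) ^ n - 2 * k * (\<integral>x. r n x * \<zeta> n x \<partial>M) ^ n + k\<^sup>2 * (\<integral>x. (\<zeta> n x)\<^sup>2 \<partial>M) ^ n))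
     \<longlonglongrightarrow> sqrt (exp (a\<^sup>2 * G) - 2 * k * exp (3 * a\<^sup>2 * G / 2) + k\<^sup>2 * exp (2 * a\<^sup>2 * G))"
    by (intro tendsto_intros l1 l2 l3)
  also have "exp (a\<^sup>2 * G) - 2 * k * exp (3 * a\<^sup>2 * G / 2) + k\<^sup>2 * exp (2 * a\<^sup>2 * G) = 0"
  proof -
    have "k * exp (3 * a\<^sup>2 * G / 2) = exp (a\<^sup>2 * G)" "k\<^sup>2 * exp (2 * a\<^sup>2 * G) = exp (a\<^sup>2 * G)"
      unfolding k_def power2_eq_square mult_exp_exp by (rule arg_cong[where f = exp], simp)+
    then show ?thesis by simp
  qed
  finally have lim: "(\<lambda>n. sqrt ((\<integral>x. (r n x)\<^sup>2 \<partial>M) ^ n - 2 * k * (\<integral>x. r n x * \<zeta> n x \<partial>M) ^ n + k\<^sup>2 * (\<integral>x. (\<zeta> n x)\<^sup>2 \<partial>M) ^ n)) \<longlonglongrightarrow> 0"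
    by simp
  show "\<forall>\<^sub>F n in sequentially. integrable (\<Pi>\<^sub>M j\<in>{..<n}. M) (L n) \<and> integrable (\<Pi>\<^sub>M j\<in>{..<n}. M) (E n)"
    using ev by eventually_elim (auto simp: L_def E[abs_def] intro!: integral_PiM_power)
  show "(\<lambda>n. \<integral>X. \<bar>L n X - E n X\<bar> \<partial>(\<Pi>\<^sub>M j\<in>{..<n}. M)) \<longlonglongrightarrow> 0"
  proof (rule Lim_null_comparison[OF _ lim], use ev in eventually_elim)
    case (elim n)
    let ?P = "\<Pi>\<^sub>M j\<in>{..<n}. M"
    have [measurable]: "r n \<in> borel_measurable M" using elim by simp
    have ps: "prob_space ?P" by (intro prob_space_PiM) unfold_locales
    have I1: "integrable ?P (\<lambda>X. \<Prod>j<n. (r n (X j))\<^sup>2)" "(\<integral>X. (\<Prod>j<n. (r n (X j))\<^sup>2) \<partial>?P) = (\<integral>x. (r n x)\<^sup>2 \<partial>M) ^ n"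
      using integral_PiM_power[where f = "\<lambda>x. (r n x)\<^sup>2" and n = n] elim by auto
    have I2: "integrable ?P (\<lambda>X. \<Prod>j<n. r n (X j) * \<zeta> n (X j))" "(\<integral>X. (\<Prod>j<n. r n (X j) * \<zeta> n (X j)) \<partial>?P) = (\<integral>x. r n x * \<zeta> n x \<partial>M) ^ n"
      using integral_PiM_power[where f = "\<lambda>x. r n x * \<zeta> n x" and n = n] elim by auto
    have I3: "integrable ?P (\<lambda>X. \<Prod>j<n. (\<zeta> n (X j))\<^sup>2)" "(\<integral>X. (\<Prod>j<n. (\<zeta> n (X j))\<^sup>2) \<partial>?P) = (\<integral>x. (\<zeta> n x)\<^sup>2 \<partial>M) ^ n"
      using integral_PiM_power[where f = "\<lambda>x. (\<zeta> n x)\<^sup>2" and n = n] elim by auto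
    have eq: "(L n X - E n X)\<^sup>2 = (\<Prod>j<n. (r n (X j))\<^sup>2) - 2 * k * (\<Prod>j<n. r n (X j) * \<zeta> n (X j)) + k\<^sup>2 * (\<Prod>j<n. (\<zeta> n (X j))\<^sup>2)" for X
      by (simp add: L_def E power2_diff power_mult_distrib prod_power_distrib prod.distrib)
    have "(\<integral>X. \<bar>L n X - E n X\<bar> \<partial>?P) \<le> sqrt (\<integral>X. (L n X - E n X)\<^sup>2 \<partial>?P)"
    proof (rule integral_abs_le_sqrt[OF ps])
      show "(\<lambda>X. L n X - E n X) \<in> borel_measurable ?P" by (simp add: L_def E)
      show "integrable ?P (\<lambda>X. (L n X - E n X)\<^sup>2)" unfolding eq using I1 I2 I3 by simp
    qed
    also have "(\<integral>X. (L n X - E n X)\<^sup>2 \<partial>?P) = (\<integral>x. (r n x)\<^sup>2 \<partial>M) ^ n - 2 * k * (\<integral>x. r n x * \<zeta> n x \<partial>M) ^ n + k\<^sup>2 * (\<integral>x. (\<zeta> n x)\<^sup>2 \<partial>M) ^ n"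
      unfolding eq using I1 I2 I3 by simp
    finally show ?case by simp
  qed
qed

section \<open>Symmetric positive definite matrices\<close>

lemma norm_matrix_vector_mult_le: "norm (A *v x) \<le> norm A * norm x" for A :: "real^'n^'m"
proof -
  have "norm (A *v x) = L2_set (\<lambda>i. norm ((A *v x) $ i)) UNIV"
    by (simp add: norm_vec_def)
  also have "\<dots> \<le> L2_set (\<lambda>i. norm (A $ i) * norm x) UNIV"
  proof (rule L2_set_mono)
    fix i
    have "(A *v x) $ i = A $ i \<bullet> x"
      by (simp add: matrix_vector_mult_def inner_vec_def)
    then show "norm ((A *v x) $ i) \<le> norm (A $ i) * norm x"
      using Cauchy_Schwarz_ineq2[of "A $ i" x] by simp
  qed simp
  also have "\<dots> = L2_set (\<lambda>i. norm (A $ i)) UNIV * norm x"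
    by (rule L2_set_left_distrib[symmetric]) simp
  also have "\<dots> = norm A * norm x"
    by (simp add: norm_vec_def[of A])
  finally show ?thesis .
qed

lemma symmetric_inner_matrix:
  fixes A :: "real^'n^'n"
  assumes "transpose A = A"
  shows "x \<bullet> (A *v y) = (A *v x) \<bullet> y"
  by (metis assms dot_lmul_matrix transpose_matrix_vector)

lemma spdD:
  assumes "S \<in> spd"
  shows "transpose S = S" "x \<noteq> 0 \<Longrightarrow> 0 < x \<bullet> (S *v x)"
  using assms by (auto simp: spd_def)

text \<open>The constant is the minimum of the form on the compact unit sphere. It is the
  quantitative version of definiteness on which the perturbation bounds rest.\<close>

lemma spd_coercive:
  assumes "S \<in> spd"
  obtains m where "m > 0" "\<And>x. m * (norm x)\<^sup>2 \<le> x \<bullet> (S *v x)"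
proof -
  have "compact (sphere (0::real^'n) 1)" "sphere (0::real^'n) 1 \<noteq> {}" by auto
  moreover have "continuous_on (sphere 0 1) (\<lambda>x. x \<bullet> (S *v x))"
    by (intro continuous_intros linear_continuous_on_compose[OF _ matrix_vector_mul_linear])
  ultimately obtain x0 where x0: "x0 \<in> sphere 0 1" "\<And>y. y \<in> sphere 0 1 \<Longrightarrow> x0 \<bullet> (S *v x0) \<le> y \<bullet> (S *v y)"
    using continuous_attains_inf[of "sphere 0 1" "\<lambda>x. x \<bullet> (S *v x)"] by blast
  define m where "m = x0 \<bullet> (S *v x0)"
  have "x0 \<noteq> 0" using x0(1) by auto
  then have "m > 0" using spdD(2)[OF assms] by (simp add: m_def)
  moreover have "m * (norm x)\<^sup>2 \<le> x \<bullet> (S *v x)" for x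
  proof (cases "x = 0")
    case False
    define y where "y = (1 / norm x) *\<^sub>R x"
    have "y \<in> sphere 0 1" using False by (simp add: y_def)
    then have "m \<le> y \<bullet> (S *v y)" using x0 by (simp add: m_def)
    also have "\<dots> = (x \<bullet> (S *v x)) / (norm x)\<^sup>2"
      by (simp add: y_def matrix_vector_mult_scaleR power2_eq_square)
    finally show ?thesis using False by (simp add: pos_le_divide_eq)
  qed simp
  ultimately show ?thesis using that by blast
qed

lemma spd_invertible:
  assumes "S \<in> spd"
  shows "invertible S"
proof -
  have "x = 0" if "S *v x = 0" for x
    using spdD(2)[OF assms, of x] that by auto
  then show ?thesis
    by (simp add: invertible_left_inverse matrix_left_invertible_ker)
qed

lemma matrix_inv_vector:
  fixes A :: "real^'n^'n"
  assumes "invertible A"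
  shows "A *v (matrix_inv A *v x) = x" "matrix_inv A *v (A *v x) = x"
  using someI_ex[OF assms[unfolded invertible_def]]
  by (simp_all add: matrix_vector_mul_assoc matrix_inv_def)

lemma spd_matrix_inv:
  assumes "S \<in> spd"
  shows "transpose (matrix_inv S) = matrix_inv S"
    and "x \<bullet> (matrix_inv S *v y) = (matrix_inv S *v x) \<bullet> y"
    and "0 \<le> x \<bullet> (matrix_inv S *v x)"
proof -
  note inv = matrix_inv_vector[OF spd_invertible[OF assms]]
  have "x \<bullet> (matrix_inv S *v y) = (matrix_inv S *v x) \<bullet> y" for x y
    using symmetric_inner_matrix[OF spdD(1)[OF assms], of "matrix_inv S *v x" "matrix_inv S *v y"]
    by (simp add: inv)
  note sym = this
  then show "x \<bullet> (matrix_inv S *v y) = (matrix_inv S *v x) \<bullet> y" .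
  have "transpose (matrix_inv S) *v x = matrix_inv S *v x" for x
    by (rule vector_eq_rdot[THEN iffD1]) (simp add: dot_lmul_matrix sym)
  then show "transpose (matrix_inv S) = matrix_inv S"
    by (metis matrix_of_matrix_vector_mul ext)
  show "0 \<le> x \<bullet> (matrix_inv S *v x)"
    using spdD(2)[OF assms, of "matrix_inv S *v x"] by (cases "matrix_inv S *v x = 0") (auto simp: inv inner_commute)
qed

text \<open>A perturbation smaller than the coercivity constant cannot change the sign of the form.
  Symmetry is a separate condition, as \<open>spd\<close> is open only within the symmetric
  matrices.\<close>

lemma spd_open:
  assumes "S \<in> spd"
  obtains d where "d > 0" "\<And>T. transpose T = T \<Longrightarrow> norm (T - S) < d \<Longrightarrow> T \<in> spd"
proof -
  obtain m where m: "m > 0" "\<And>x. m * (norm x)\<^sup>2 \<le> x \<bullet> (S *v x)" using spd_coercive[OF assms] by metis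
  have "T \<in> spd" if T: "transpose T = T" "norm (T - S) < m" for T
  proof -
    have "0 < x \<bullet> (T *v x)" if "x \<noteq> 0" for x
    proof -
      have "\<bar>x \<bullet> ((T - S) *v x)\<bar> \<le> norm x * norm ((T - S) *v x)" by (rule Cauchy_Schwarz_ineq2)
      also have "\<dots> \<le> norm x * (norm (T - S) * norm x)"
        by (intro mult_left_mono norm_matrix_vector_mult_le) auto
      also have "\<dots> < norm x * (m * norm x)"
        using T that by (intro mult_strict_left_mono mult_strict_right_mono) auto
      also have "\<dots> = m * (norm x)\<^sup>2" by (simp add: power2_eq_square)
      finally show ?thesis
        using m(2)[of x] by (simp add: matrix_vector_mult_diff_rdistrib inner_diff_right)
    qed
    then show ?thesis using T by (simp add: spd_def)
  qed
  then show ?thesis using m(1) that by blast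
qed

section \<open>The positive definite square root\<close>

lemma matrix_eq_0_iff_vector: "A = 0 \<longleftrightarrow> (\<forall>x. A *v x = 0)" for A :: "real^'n^'m"
  by (metis matrix_vector_mult_0 matrix_eq)

text \<open>For \<open>D = B - C\<close> the sum \<open>B ** D + D ** C\<close> is
  \<open>B ** B - C ** C = 0\<close>. Multiplying by \<open>D\<close> from the left and taking the
  trace leaves the quadratic forms of \<open>B\<close> and \<open>C\<close> summed over the columns
  of \<open>D\<close>; all are nonnegative, so every column vanishes.\<close>

lemma spd_sqrt_unique:
  fixes B C :: "real^'n^'n"
  assumes B: "B \<in> spd" and C: "C \<in> spd" and eq: "B ** B = C ** C"
  shows "B = C"
proof -
  define D where "D = B - C"
  have Dsym: "transpose D = D" using spdD(1)[OF B] spdD(1)[OF C] by (simp add: D_def transpose_def vec_eq_iff)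
  have BC: "(B ** D) + (D ** C) = 0"
  proof -
    have "(B ** D) *v x + (D ** C) *v x = (B ** B) *v x - (C ** C) *v x" for x
      by (simp add: D_def matrix_vector_mul_assoc[symmetric] matrix_vector_mult_diff_rdistrib matrix_vector_mult_diff_distrib)
    then show ?thesis
      by (simp add: matrix_eq_0_iff_vector matrix_vector_mult_add_rdistrib eq)
  qed
  have tr: "trace (D ** A ** D) = (\<Sum>i\<in>UNIV. (D *v axis i 1) \<bullet> (A *v (D *v axis i 1)))" for A :: "real^'n^'n"
  proof -
    have "(D ** A ** D) $ i $ i = (D *v axis i 1) \<bullet> (A *v (D *v axis i 1))" for i
    proof -
      have "(D ** A ** D) $ i $ i = axis i 1 \<bullet> ((D ** A ** D) *v axis i 1)"
        by (simp add: inner_axis' matrix_vector_mult_basis column_def)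
      also have "\<dots> = (D *v axis i 1) \<bullet> (A *v (D *v axis i 1))"
        by (simp add: symmetric_inner_matrix[OF Dsym] matrix_vector_mul_assoc[symmetric])
      finally show ?thesis .
    qed
    then show ?thesis by (simp add: trace_def)
  qed
  have "D ** ((B ** D) + (D ** C)) = 0" by (simp only: BC) (simp add: matrix_matrix_mult_def vec_eq_iff)
  then have "D ** B ** D + D ** D ** C = 0"
    by (simp add: matrix_add_ldistrib matrix_mul_assoc)
  then have "trace (D ** B ** D + D ** D ** C) = 0" by (simp add: trace_def)
  then have "trace (D ** B ** D) + trace (D ** D ** C) = 0"
    by (simp only: trace_add)
  moreover have "trace (D ** D ** C) = trace (D ** C ** D)"
    by (metis matrix_mul_assoc trace_mul_sym)
  ultimately have "(\<Sum>i\<in>UNIV. (D *v axis i 1) \<bullet> (B *v (D *v axis i 1))) + (\<Sum>i\<in>UNIV. (D *v axis i 1) \<bullet> (C *v (D *v axis i 1))) = 0"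
    by (simp add: tr)
  moreover have nn: "0 \<le> x \<bullet> (A *v x)" if "A \<in> spd" for A :: "real^'n^'n" and x
    using spdD(2)[OF that, of x] by (cases "x = 0") auto
  ultimately have "(\<Sum>i\<in>UNIV. (D *v axis i 1) \<bullet> (B *v (D *v axis i 1))) = 0"
    by (smt (verit, best) B C sum_nonneg)
  then have "(D *v axis i 1) \<bullet> (B *v (D *v axis i 1)) = 0" for i
    using nn[OF B] by (subst (asm) sum_nonneg_eq_0_iff) auto
  then have "D *v axis i 1 = 0" for i
    using spdD(2)[OF B] by (metis less_irrefl)
  then have "D = 0"
    by (simp add: vec_eq_iff matrix_vector_mult_basis column_def)
  then show ?thesis by (simp add: D_def)
qed

text \<open>Writing \<open>B\<close> as \<open>sqrt c\<close> times \<open>1 - Y\<close> turns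
  \<open>B ** B = A\<close> into the fixed-point equation \<open>Y = (T + Y\<^sup>2) / 2\<close>
  with \<open>T = 1 - A / c\<close>. It is solved by contraction among the self-adjoint operators of
  norm at most \<open>\<rho> < 1\<close>, and this norm bound is also what makes \<open>B\<close>
  positive definite.\<close>

lemma spd_sqrt_exists:
  fixes A :: "real^'n^'n"
  assumes A: "A \<in> spd"
  shows "\<exists>B. B \<in> spd \<and> B ** B = A"
proof -
  obtain m where m: "m > 0" "\<And>x. m * (norm x)\<^sup>2 \<le> x \<bullet> (A *v x)" using spd_coercive[OF A] by metis
  have mA: "m \<le> norm A"
  proof -
    define x :: "real^'n" where "x = axis undefined 1"
    have "m * 1 \<le> x \<bullet> (A *v x)" using m(2)[of x] by (simp add: x_def)
    also have "\<dots> \<le> norm x * norm (A *v x)" by (rule norm_cauchy_schwarz)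
    also have "\<dots> \<le> norm x * (norm A * norm x)" by (intro mult_left_mono norm_matrix_vector_mult_le) auto
    finally show ?thesis by (simp add: x_def)
  qed
  \<comment> \<open>This scaling gives
    \<open>(norm (A *v x))\<^sup>2 \<le> c * (x \<bullet> (A *v x))\<close>, from which the norm of
    \<open>T\<close> is at most \<open>q < 1\<close>.\<close>
  define c where "c = (norm A)\<^sup>2 / m"
  have nA: "norm A > 0" using m mA by linarith
  have c: "c > 0" using m nA by (simp add: c_def)
  have "m * m \<le> norm A * norm A" using m mA by (intro mult_mono) auto
  then have mc: "m / c \<le> 1" "0 < m / c" using m nA c by (simp_all add: c_def field_simps power2_eq_square)
  define q where "q = sqrt (1 - m / c)"
  have q: "0 \<le> q" "q < 1" using mc by (simp_all add: q_def)
  \<comment> \<open>The smaller root of \<open>\<rho>\<^sup>2 - 2 * \<rho> + q = 0\<close>: with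
    this radius \<open>F\<close> maps the ball into itself, and \<rho> is its contraction constant
    there.\<close>
  define \<rho> where "\<rho> = 1 - sqrt (1 - q)"
  have \<rho>: "0 \<le> \<rho>" "\<rho> < 1" using q by (simp_all add: \<rho>_def)
  have \<rho>q: "q + \<rho> * \<rho> = 2 * \<rho>"
  proof -
    have "(1 - \<rho>) * (1 - \<rho>) = 1 - q" using q by (simp add: \<rho>_def)
    then show ?thesis by (simp add: algebra_simps)
  qed
  define T where "T = Blinfun (\<lambda>x. x - (1 / c) *\<^sub>R (A *v x))"
  have T: "blinfun_apply T x = x - (1 / c) *\<^sub>R (A *v x)" for x
    unfolding T_def
    by (subst bounded_linear_Blinfun_apply)
      (auto intro!: bounded_linear_intros matrix_vector_mul_bounded_linear)
  have normT: "norm T \<le> q"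
  proof (rule norm_blinfun_bound[OF q(1)])
    fix x
    have "(norm (A *v x))\<^sup>2 \<le> (norm A * norm x)\<^sup>2"
      by (intro power_mono norm_matrix_vector_mult_le) auto
    also have "\<dots> = c * (m * (norm x)\<^sup>2)" using m by (simp add: c_def power_mult_distrib)
    also have "\<dots> \<le> c * (x \<bullet> (A *v x))" using c m by (intro mult_left_mono) auto
    finally have "(norm (A *v x))\<^sup>2 \<le> c * (x \<bullet> (A *v x))" .
    then have 1: "(norm (A *v x))\<^sup>2 / c\<^sup>2 \<le> (x \<bullet> (A *v x)) / c"
      using c by (simp add: field_simps power2_eq_square)
    have "(norm (blinfun_apply T x))\<^sup>2 = (norm x)\<^sup>2 - 2 * (x \<bullet> (A *v x)) / c + (norm (A *v x))\<^sup>2 / c\<^sup>2"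
      unfolding T power2_norm_eq_inner
      by (simp add: inner_diff_left inner_diff_right inner_commute power2_eq_square)
    also have "\<dots> \<le> (norm x)\<^sup>2 - (x \<bullet> (A *v x)) / c" using 1 by simp
    also have "\<dots> \<le> (norm x)\<^sup>2 - (m * (norm x)\<^sup>2) / c"
      using m(2)[of x] c by (simp add: divide_right_mono)
    also have "\<dots> = (q * norm x)\<^sup>2"
      using mc by (simp add: q_def power_mult_distrib left_diff_distrib)
    finally show "norm (blinfun_apply T x) \<le> q * norm x"
      by (rule power2_le_imp_le) (use q in simp)
  qed
  define F where "F = (\<lambda>Y. (1/2) *\<^sub>R (T + (Y o\<^sub>L Y)))"
  define K where "K = {Y :: (real^'n) \<Rightarrow>\<^sub>L (real^'n). norm Y \<le> \<rho> \<and> (\<forall>x y. x \<bullet> blinfun_apply Y y = blinfun_apply Y x \<bullet> y)}"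
  have "\<exists>!Y. Y \<in> K \<and> F Y = Y"
  proof (rule Banach_fix[OF complete_eq_closed[THEN iffD2] _ \<rho>])
    show "closed K"
      unfolding K_def
      by (intro closed_Collect_conj closed_Collect_le closed_Collect_all closed_Collect_eq continuous_intros)
    show "K \<noteq> {}" using \<rho> by (auto simp: K_def intro!: exI[of _ 0])
    show "F ` K \<subseteq> K"
    proof clarify
      fix Y assume Y: "Y \<in> K"
      have "norm (T + (Y o\<^sub>L Y)) \<le> q + \<rho> * \<rho>"
        using normT order_trans[OF norm_blinfun_compose mult_mono[of "norm Y" \<rho> "norm Y" \<rho>]] Y \<rho>
        by (intro order_trans[OF norm_triangle_ineq] add_mono) (auto simp: K_def)
      moreover have "x \<bullet> blinfun_apply (F Y) y = blinfun_apply (F Y) x \<bullet> y" for x y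
        using Y symmetric_inner_matrix[OF spdD(1)[OF A], of x y]
        by (simp add: F_def K_def T blinfun.bilinear_simps inner_add_left inner_add_right inner_diff_left inner_diff_right)
      ultimately show "F Y \<in> K" by (simp add: K_def F_def \<rho>q)
    qed
    show "dist (F Y) (F Z) \<le> \<rho> * dist Y Z" if "Y \<in> K" "Z \<in> K" for Y Z
    proof -
      have "F Y - F Z = (1/2) *\<^sub>R ((Y o\<^sub>L (Y - Z)) + ((Y - Z) o\<^sub>L Z))"
        by (rule blinfun_eqI) (simp add: F_def blinfun.bilinear_simps algebra_simps)
      then have "norm (F Y - F Z) \<le> (1/2) * (norm (Y o\<^sub>L (Y - Z)) + norm ((Y - Z) o\<^sub>L Z))"
        by (simp add: norm_triangle_ineq)
      also have "\<dots> \<le> (1/2) * (\<rho> * norm (Y - Z) + norm (Y - Z) * \<rho>)"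
        using that \<rho> by (intro mult_left_mono add_mono order_trans[OF norm_blinfun_compose] mult_mono) (auto simp: K_def)
      finally show ?thesis by (simp add: dist_norm)
    qed
  qed
  then obtain Y where Y: "Y \<in> K" "F Y = Y" by blast
  have Yx: "blinfun_apply Y (blinfun_apply Y x) = 2 *\<^sub>R blinfun_apply Y x - x + (1 / c) *\<^sub>R (A *v x)" for x
  proof -
    have "2 *\<^sub>R blinfun_apply Y x = 2 *\<^sub>R blinfun_apply (F Y) x" by (simp add: Y(2))
    also have "\<dots> = x - (1 / c) *\<^sub>R (A *v x) + blinfun_apply Y (blinfun_apply Y x)"
      by (simp add: F_def T blinfun.bilinear_simps)
    finally show ?thesis by (simp add: algebra_simps)
  qed
  define B where "B = matrix (\<lambda>x. sqrt c *\<^sub>R (x - blinfun_apply Y x))"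
  have B: "B *v x = sqrt c *\<^sub>R (x - blinfun_apply Y x)" for x
    unfolding B_def
    by (rule matrix_works, subst linear_matrix_vector_mul_eq, rule linearI)
      (simp_all add: algebra_simps blinfun.bilinear_simps)
  have "(B ** B) *v x = A *v x" for x
  proof -
    have "(B ** B) *v x = sqrt c *\<^sub>R (sqrt c *\<^sub>R (x - blinfun_apply Y x - (blinfun_apply Y x - blinfun_apply Y (blinfun_apply Y x))))"
      by (simp add: matrix_vector_mul_assoc[symmetric] B blinfun.bilinear_simps algebra_simps)
    also have "\<dots> = c *\<^sub>R ((1 / c) *\<^sub>R (A *v x))"
      using c by (simp add: Yx algebra_simps scaleR_2)
    finally show ?thesis using c by simp
  qed
  then have "B ** B = A" by (simp add: matrix_eq)
  moreover have "B \<in> spd"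
  proof -
    have "(transpose B *v x) \<bullet> y = (B *v x) \<bullet> y" for x y
      using Y(1) by (simp add: dot_lmul_matrix B K_def inner_diff_left inner_diff_right)
    then have "transpose B *v x = B *v x" for x
      using vector_eq_rdot by blast
    then have "transpose B = B" by (intro matrix_eq[THEN iffD2] allI)
    moreover have "0 < x \<bullet> (B *v x)" if "x \<noteq> 0" for x
    proof -
      have "x \<bullet> blinfun_apply Y x \<le> norm x * norm (blinfun_apply Y x)" by (rule norm_cauchy_schwarz)
      also have "\<dots> \<le> norm x * (\<rho> * norm x)"
        using Y(1) by (intro mult_left_mono order_trans[OF norm_blinfun] mult_right_mono) (auto simp: K_def)
      also have "\<dots> < norm x * (1 * norm x)"
        using that \<rho> by (intro mult_strict_left_mono mult_strict_right_mono) auto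
      also have "\<dots> = x \<bullet> x" by (simp add: norm_eq_sqrt_inner)
      finally show ?thesis using c by (simp add: B inner_diff_right)
    qed
    ultimately show ?thesis by (simp add: spd_def)
  qed
  ultimately show ?thesis by blast
qed

lemma spd_sqrt:
  assumes "S \<in> spd"
  shows "spd_sqrt S \<in> spd" "spd_sqrt S ** spd_sqrt S = S"
proof -
  have "\<exists>!B. B \<in> spd \<and> B ** B = S"
    using spd_sqrt_exists[OF assms] spd_sqrt_unique by metis
  from theI'[OF this] show "spd_sqrt S \<in> spd" "spd_sqrt S ** spd_sqrt S = S"
    by (auto simp: spd_sqrt_def)
qed

lemma spd_det: "S \<in> spd \<Longrightarrow> det S = (det (spd_sqrt S))\<^sup>2" "S \<in> spd \<Longrightarrow> 0 < det S"
proof -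
  assume S: "S \<in> spd"
  then show "det S = (det (spd_sqrt S))\<^sup>2"
    by (metis det_mul power2_eq_square spd_sqrt(2))
  then show "0 < det S"
    using spd_invertible[OF spd_sqrt(1)[OF S]] by (simp add: invertible_det_nz)
qed

text \<open>Removes the matrix root from the density. Only \<open>matrix_inv S\<close> remains,
  whose dependence on \<open>S\<close> is easy to differentiate and to bound.\<close>

lemma norm_spd_sqrt_inv:
  assumes S: "S \<in> spd"
  shows "(norm (matrix_inv (spd_sqrt S) *v x))\<^sup>2 = x \<bullet> (matrix_inv S *v x)"
proof -
  let ?B = "spd_sqrt S"
  note B = spd_sqrt[OF S]
  note inv = matrix_inv_vector[OF spd_invertible[OF B(1)]]
  have "S *v (matrix_inv ?B *v (matrix_inv ?B *v x)) = x"
    by (subst B(2)[symmetric]) (simp add: matrix_vector_mul_assoc[symmetric] inv)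
  then have "matrix_inv S *v x = matrix_inv ?B *v (matrix_inv ?B *v x)"
    using matrix_inv_vector(2)[OF spd_invertible[OF S]] by metis
  then show ?thesis
    by (simp add: power2_norm_eq_inner spd_matrix_inv(2)[OF B(1)])
qed

lemma spd_mat_1: "mat 1 \<in> spd"
  by (simp add: spd_def)

section \<open>Linear change of variables for Lebesgue measure\<close>

lemma nn_integral_lborel_shear:
  fixes f :: "real^'n \<Rightarrow> ennreal"
  assumes [measurable]: "f \<in> borel_measurable borel" and mn: "m \<noteq> n"
  shows "(\<integral>\<^sup>+x. f (x + (c * x $ n) *\<^sub>R axis m 1) \<partial>lborel) = (\<integral>\<^sup>+x. f x \<partial>lborel)"
proof -
  let ?e = "axis m 1 :: real^'n" and ?B = "Basis :: (real^'n) set"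
  interpret product_sigma_finite "\<lambda>_ :: real^'n. lborel :: real measure" ..
  have e: "?e \<in> ?B" by simp
  then have ins: "insert ?e (?B - {?e}) = ?B" by blast
  define v where "v = (\<lambda>g. \<Sum>b\<in>?B - {?e}. g b *\<^sub>R b)"
  have decomp: "(\<Sum>b\<in>?B. (g(?e := y)) b *\<^sub>R b) = y *\<^sub>R ?e + v g" for g and y :: real
    by (subst ins[symmetric], subst sum.insert) (auto simp: v_def intro!: sum.cong)
  \<comment> \<open>The integral along axis \<open>m\<close> is taken first. With the other
    coordinates fixed the shear is a translation of this axis, because \<open>x $ n\<close> does not
    vary along it.\<close>
  have *: "(\<integral>\<^sup>+x. h x \<partial>lborel) = (\<integral>\<^sup>+g. \<integral>\<^sup>+y. h (y *\<^sub>R ?e + v g) \<partial>lborel \<partial>(\<Pi>\<^sub>M b\<in>?B - {?e}. lborel))"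
    if [measurable]: "h \<in> borel_measurable borel" for h :: "real^'n \<Rightarrow> ennreal"
  proof -
    have "(\<integral>\<^sup>+x. h x \<partial>lborel) = (\<integral>\<^sup>+g. h (\<Sum>b\<in>?B. g b *\<^sub>R b) \<partial>(\<Pi>\<^sub>M b\<in>?B. lborel))"
      by (subst lborel_eq) (simp add: nn_integral_distr)
    also have "\<dots> = (\<integral>\<^sup>+g. h (\<Sum>b\<in>?B. g b *\<^sub>R b) \<partial>(\<Pi>\<^sub>M b\<in>insert ?e (?B - {?e}). lborel))"
      by (simp only: ins)
    also have "\<dots> = (\<integral>\<^sup>+g. \<integral>\<^sup>+y. h (\<Sum>b\<in>?B. (g(?e := y)) b *\<^sub>R b) \<partial>lborel \<partial>(\<Pi>\<^sub>M b\<in>?B - {?e}. lborel))"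
      by (rule product_nn_integral_insert) (simp_all add: ins)
    finally show ?thesis by (simp only: decomp)
  qed
  have "(\<integral>\<^sup>+x. f (x + (c * x $ n) *\<^sub>R ?e) \<partial>lborel) =
     (\<integral>\<^sup>+g. \<integral>\<^sup>+y. f (y *\<^sub>R ?e + v g + (c * (y *\<^sub>R ?e + v g) $ n) *\<^sub>R ?e) \<partial>lborel \<partial>(\<Pi>\<^sub>M b\<in>?B - {?e}. lborel))"
    by (rule *) measurable
  also have "\<dots> = (\<integral>\<^sup>+g. \<integral>\<^sup>+y. f (y *\<^sub>R ?e + v g) \<partial>lborel \<partial>(\<Pi>\<^sub>M b\<in>?B - {?e}. lborel))"
  proof (rule nn_integral_cong)
    fix g :: "real^'n \<Rightarrow> real"
    have "(\<integral>\<^sup>+y. f (y *\<^sub>R ?e + v g) \<partial>lborel) = (\<integral>\<^sup>+y. f ((c * v g $ n + 1 * y) *\<^sub>R ?e + v g) \<partial>lborel)"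
      by (subst nn_integral_real_affine[where c = 1 and t = "c * v g $ n"]) auto
    also have "\<dots> = (\<integral>\<^sup>+y. f (y *\<^sub>R ?e + v g + (c * (y *\<^sub>R ?e + v g) $ n) *\<^sub>R ?e) \<partial>lborel)"
      using mn by (intro nn_integral_cong arg_cong[where f = f]) (simp add: algebra_simps axis_def)
    finally show "(\<integral>\<^sup>+y. f (y *\<^sub>R ?e + v g + (c * (y *\<^sub>R ?e + v g) $ n) *\<^sub>R ?e) \<partial>lborel) = (\<integral>\<^sup>+y. f (y *\<^sub>R ?e + v g) \<partial>lborel)" ..
  qed
  also have "\<dots> = (\<integral>\<^sup>+x. f x \<partial>lborel)" by (rule *[symmetric]) measurable
  finally show ?thesis .
qed

lemma Basis_vec_range: "(Basis :: (real^'n) set) = range (\<lambda>i. axis i 1)"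
  by (auto simp: Basis_vec_def)

text \<open>Both sides are compatible with products of matrices, so elementary matrices suffice:
  diagonal ones, coordinate swaps and shears. Matrices with a zero row are excluded by
  invertibility.\<close>

lemma nn_integral_lborel_matrix:
  fixes A :: "real^'n^'n" and f :: "real^'n \<Rightarrow> ennreal"
  assumes "invertible A" "f \<in> borel_measurable borel"
  shows "(\<integral>\<^sup>+x. f x \<partial>lborel) = ennreal \<bar>det A\<bar> * (\<integral>\<^sup>+x. f (A *v x) \<partial>lborel)"
proof -
  have mv [measurable]: "(\<lambda>x. A *v x) \<in> borel_measurable borel" for A :: "real^'n^'n"
    by (intro borel_measurable_continuous_onI linear_continuous_on matrix_vector_mul_bounded_linear)
  \<comment> \<open>The integrand is quantified inside the induction, since the product case applies
    the hypothesis for \<open>B\<close> to \<open>\<lambda>x. f (A *v x)\<close>.\<close>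
  have "invertible A \<longrightarrow> (\<forall>f. f \<in> borel_measurable borel \<longrightarrow> (\<integral>\<^sup>+x. f x \<partial>lborel) = ennreal \<bar>det A\<bar> * (\<integral>\<^sup>+x. f (A *v x) \<partial>lborel))" for A :: "real^'n^'n"
  proof (induction A rule: induct_matrix_elementary, goal_cases)
    case (1 A B)
    show ?case
    proof (intro impI allI)
      fix f :: "real^'n \<Rightarrow> ennreal" assume inv: "invertible (A ** B)" and [measurable]: "f \<in> borel_measurable borel"
      have "invertible A" "invertible B" using inv by (auto simp: invertible_det_nz det_mul)
      then have "(\<integral>\<^sup>+x. f x \<partial>lborel) = ennreal \<bar>det A\<bar> * (ennreal \<bar>det B\<bar> * (\<integral>\<^sup>+x. f (A *v (B *v x)) \<partial>lborel))"
        using 1(1)[rule_format, of f] 1(2)[rule_format, of "\<lambda>x. f (A *v x)"] by simp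
      then show "(\<integral>\<^sup>+x. f x \<partial>lborel) = ennreal \<bar>det (A ** B)\<bar> * (\<integral>\<^sup>+x. f ((A ** B) *v x) \<partial>lborel)"
        by (simp add: matrix_vector_mul_assoc det_mul abs_mult ennreal_mult mult.assoc)
    qed
  next
    case (2 A i)
    then show ?case by (simp add: invertible_det_nz det_zero_row)
  next
    case (3 A)
    show ?case
    proof (intro impI allI)
      fix f :: "real^'n \<Rightarrow> ennreal" assume inv: "invertible A" and [measurable]: "f \<in> borel_measurable borel"
      have det: "det A = (\<Prod>i\<in>UNIV. A $ i $ i)" using 3 by (simp add: det_diagonal)
      define c where "c = (\<lambda>b. b \<bullet> (A *v b))"
      have c: "c (axis i 1) = A $ i $ i" for i
        by (simp add: c_def inner_axis' matrix_vector_mult_basis column_def)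
      have c0: "c b \<noteq> 0" if "b \<in> Basis" for b
        using that inv det by (auto simp: Basis_vec_range c invertible_det_nz)
      have Av: "A *v x = 0 + (\<Sum>b\<in>Basis. (c b * (x \<bullet> b)) *\<^sub>R b)" for x
      proof -
        have "(\<Sum>b\<in>Basis. (c b * (x \<bullet> b)) *\<^sub>R b) = (\<Sum>i\<in>UNIV. (A $ i $ i * x $ i) *\<^sub>R axis i 1)"
          unfolding Basis_vec_range by (subst sum.reindex) (auto simp: inj_on_def axis_eq_axis c inner_axis)
        also have "\<dots> = A *v x"
        proof (rule vec_eq_iff[THEN iffD2], intro allI)
          fix j
          have "(\<Sum>i\<in>UNIV. (A $ i $ i * x $ i) *\<^sub>R axis i 1) $ j = (\<Sum>i\<in>UNIV. ((A $ i $ i * x $ i) *\<^sub>R axis i 1) $ j)"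
            by simp
          also have "\<dots> = (\<Sum>i\<in>UNIV. if i = j then A $ j $ j * x $ j else 0)"
            by (intro sum.cong refl) (auto simp: axis_def)
          also have "\<dots> = A $ j $ j * x $ j" by simp
          also have "\<dots> = (\<Sum>i\<in>UNIV. if i = j then A $ j $ j * x $ j else 0)" by simp
          also have "\<dots> = (A *v x) $ j"
            unfolding matrix_vector_mult_def vec_lambda_beta by (intro sum.cong refl) (simp add: 3)
          finally show "(\<Sum>i\<in>UNIV. (A $ i $ i * x $ i) *\<^sub>R axis i 1) $ j = (A *v x) $ j" .
        qed
        finally show ?thesis by simp
      qed
      have L: "lborel = density (distr lborel borel (\<lambda>x. A *v x)) (\<lambda>_. (\<Prod>b\<in>Basis. \<bar>c b\<bar>))"
        unfolding Av by (rule lborel_affine_euclidean) (rule c0)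
      have "(\<integral>\<^sup>+x. f x \<partial>lborel) = (\<integral>\<^sup>+x. f x \<partial>density (distr lborel borel (\<lambda>x. A *v x)) (\<lambda>_. (\<Prod>b\<in>Basis. \<bar>c b\<bar>)))"
        by (rule arg_cong[where f = "\<lambda>M. nn_integral M f", OF L])
      also have "\<dots> = (\<Prod>b\<in>Basis. \<bar>c b\<bar>) * (\<integral>\<^sup>+x. f (A *v x) \<partial>lborel)"
        by (simp add: nn_integral_density nn_integral_distr nn_integral_cmult)
      also have "(\<Prod>b\<in>Basis. \<bar>c b\<bar>) = \<bar>det A\<bar>"
        unfolding Basis_vec_range det abs_prod
        by (subst prod.reindex) (simp_all only: inj_on_def axis_eq_axis c o_def, simp_all)
      finally show "(\<integral>\<^sup>+x. f x \<partial>lborel) = ennreal \<bar>det A\<bar> * (\<integral>\<^sup>+x. f (A *v x) \<partial>lborel)" .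
    qed
  next
    case (4 m n)
    let ?P = "(\<chi> i j. mat 1 $ i $ Transposition.transpose m n j) :: real^'n^'n"
    have iff: "i = Transposition.transpose m n j \<longleftrightarrow> j = Transposition.transpose m n i" for i j
      by (metis transpose_involutory)
    have all: "(\<forall>i. R i) \<longleftrightarrow> (\<forall>i. R (Transposition.transpose m n i))" for R
      by (metis transpose_involutory)
    have P: "(?P *v x) $ i = x $ Transposition.transpose m n i" for x i
    proof -
      have "(?P *v x) $ i = (\<Sum>j\<in>UNIV. if j = Transposition.transpose m n i then x $ j else 0)"
        unfolding matrix_vector_mult_def mat_def vec_lambda_beta
        by (intro sum.cong refl) (simp add: iff[of i])
      then show ?thesis by simp
    qed
    have det: "\<bar>det ?P\<bar> = 1"
      by (subst det_permute_columns) (auto simp: permutes_swap_id sign_def)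
    \<comment> \<open>A swap of coordinates pulls boxes back to boxes with the same side lengths up
      to order, and boxes determine \<open>lborel\<close>.\<close>
    have L: "lborel = distr lborel borel (\<lambda>x. ?P *v x)"
    proof (rule lborel_eqI)
      fix l u :: "real^'n" assume le: "\<And>b. b \<in> Basis \<Longrightarrow> l \<bullet> b \<le> u \<bullet> b"
      have leq: "l $ i \<le> u $ i" for i using le[of "axis i 1"] by (simp add: inner_axis)
      have "x \<in> (\<lambda>x. ?P *v x) -` box l u \<longleftrightarrow> x \<in> box (?P *v l) (?P *v u)" for x
        unfolding vimage_eq mem_box_cart P by (subst all) simp
      then have "(\<lambda>x. ?P *v x) -` box l u = box (?P *v l) (?P *v u)" by blast
      then have "emeasure (distr lborel borel (\<lambda>x. ?P *v x)) (box l u) = emeasure lborel (box (?P *v l) (?P *v u))"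
        by (subst emeasure_distr) auto
      also have "\<dots> = (\<Prod>b\<in>Basis. (?P *v u - ?P *v l) \<bullet> b)"
        using leq by (intro emeasure_lborel_box) (auto simp: Basis_vec_range inner_axis P)
      also have "(\<Prod>b\<in>Basis. (?P *v u - ?P *v l) \<bullet> b) = (\<Prod>i\<in>UNIV. u $ Transposition.transpose m n i - l $ Transposition.transpose m n i)"
        unfolding Basis_vec_range by (subst prod.reindex) (auto simp: inj_on_def axis_eq_axis inner_axis P)
      also have "\<dots> = (\<Prod>i\<in>UNIV. u $ i - l $ i)"
        by (rule prod.reindex_bij_betw[where h = "Transposition.transpose m n"]) simp
      also have "\<dots> = (\<Prod>b\<in>Basis. (u - l) \<bullet> b)"
        unfolding Basis_vec_range by (subst prod.reindex) (auto simp: inj_on_def axis_eq_axis inner_axis)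
      finally show "emeasure (distr lborel borel (\<lambda>x. ?P *v x)) (box l u) = (\<Prod>b\<in>Basis. (u - l) \<bullet> b)" .
    qed simp
    show ?case
    proof (intro impI allI)
      fix f :: "real^'n \<Rightarrow> ennreal" assume [measurable]: "f \<in> borel_measurable borel"
      have "(\<integral>\<^sup>+x. f x \<partial>lborel) = (\<integral>\<^sup>+x. f x \<partial>distr lborel borel (\<lambda>x. ?P *v x))"
        by (rule arg_cong[where f = "\<lambda>M. nn_integral M f", OF L])
      also have "\<dots> = (\<integral>\<^sup>+x. f (?P *v x) \<partial>lborel)"
        by (rule nn_integral_distr) measurable
      finally show "(\<integral>\<^sup>+x. f x \<partial>lborel) = ennreal \<bar>det ?P\<bar> * (\<integral>\<^sup>+x. f (?P *v x) \<partial>lborel)"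
        unfolding det by simp
    qed
  next
    case (5 m n c)
    let ?A = "(\<chi> i j. if i = m \<and> j = n then c else of_bool (i = j)) :: real^'n^'n"
    have Av: "?A *v x = x + (c * x $ n) *\<^sub>R axis m 1" for x
    proof (simp add: vec_eq_iff, intro allI)
      fix i
      have "(?A *v x) $ i = (\<Sum>j\<in>UNIV. (if j = n then (if i = m then c * x $ j else 0) else 0) + (if j = i then x $ j else 0))"
        unfolding matrix_vector_mult_def using 5 by (auto intro!: sum.cong)
      also have "\<dots> = x $ i + c * x $ n * axis m 1 $ i"
        by (simp add: sum.distrib axis_def)
      finally show "(?A *v x) $ i = x $ i + c * x $ n * axis m 1 $ i" .
    qed
    have "?A = (\<chi> k. if k = m then row m (mat 1) + c *s row n (mat 1) else row k (mat 1))"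
      using 5 by (auto simp: vec_eq_iff row_def mat_def)
    then have det: "det ?A = 1"
      using det_row_operation[OF 5, of "mat 1" c] by simp
    show ?case unfolding Av det using nn_integral_lborel_shear[OF _ 5] by simp
  qed
  then show ?thesis using assms by blast
qed

section \<open>The Student density\<close>

text \<open>The bracket of the density is \<open>quad / \<nu>\<close>. The powers of \<nu> taken out
  of it and out of \<open>pi * \<nu>\<close> combine to \<open>\<nu> powr (\<nu> / 2)\<close>,
  whence the last term.\<close>

definition log_norm_const :: "real \<Rightarrow> real \<Rightarrow> real" where
  "log_norm_const k \<nu> = ln (Gamma ((\<nu> + k) / 2)) - k / 2 * ln pi - ln (Gamma (\<nu> / 2)) + \<nu> / 2 * ln \<nu>"

text \<open>Adding \<nu>, instead of dividing by it, makes the dependence on \<nu> affine and keeps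
  the value at least \<nu> for positive definite scatter, so that \<open>ln\<close> and
  \<open>1 / u\<close> cause no trouble near 0.\<close>

definition quad :: "real^'k \<Rightarrow> real^'k^'k \<Rightarrow> real \<Rightarrow> real^'k \<Rightarrow> real" where
  "quad \<mu> \<Sigma> \<nu> x = \<nu> + (x - \<mu>) \<bullet> (matrix_inv \<Sigma> *v (x - \<mu>))"

lemma quad_ge: "\<Sigma> \<in> spd \<Longrightarrow> \<nu> \<le> quad \<mu> \<Sigma> \<nu> x"
  using spd_matrix_inv(3) by (simp add: quad_def)

lemma quad_pos: "\<Sigma> \<in> spd \<Longrightarrow> 0 < \<nu> \<Longrightarrow> 0 < quad \<mu> \<Sigma> \<nu> x"
  using quad_ge by (rule less_le_trans[rotated])

lemma student_density_eq:
  fixes \<mu> :: "real^'k"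
  assumes \<Sigma>: "\<Sigma> \<in> spd" and \<nu>: "0 < \<nu>"
  shows "student_density \<mu> \<Sigma> \<nu> x =
    exp (log_norm_const (real CARD('k)) \<nu> - ln (det \<Sigma>) / 2 - (\<nu> + real CARD('k)) / 2 * ln (quad \<mu> \<Sigma> \<nu> x))"
proof -
  define k where "k = real CARD('k)"
  have k: "k > 0" by (simp add: k_def)
  note u = quad_pos[OF \<Sigma> \<nu>, of \<mu> x]
  have G: "Gamma ((\<nu> + k) / 2) > 0" "Gamma (\<nu> / 2) > 0"
    using \<nu> k by (auto intro!: Gamma_real_pos)
  have eq: "1 + (norm (matrix_inv (spd_sqrt \<Sigma>) *v (x - \<mu>)))\<^sup>2 / \<nu> = quad \<mu> \<Sigma> \<nu> x / \<nu>"
    using \<nu> by (simp add: norm_spd_sqrt_inv[OF \<Sigma>] quad_def add_divide_distrib)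
  have "student_density \<mu> \<Sigma> \<nu> x =
     exp (ln (Gamma ((\<nu> + k) / 2))) / (exp (k / 2 * ln (pi * \<nu>)) * exp (ln (Gamma (\<nu> / 2)))) *
     exp (-1/2 * ln (det \<Sigma>)) * exp (- (\<nu> + k) / 2 * ln (quad \<mu> \<Sigma> \<nu> x / \<nu>))"
    unfolding student_density_def eq k_def[symmetric]
    using G u \<nu> spd_det(2)[OF \<Sigma>] by (simp add: powr_def)
  also have "\<dots> = exp (ln (Gamma ((\<nu> + k) / 2)) - (k / 2 * ln (pi * \<nu>) + ln (Gamma (\<nu> / 2)))
     + -1/2 * ln (det \<Sigma>) + - (\<nu> + k) / 2 * ln (quad \<mu> \<Sigma> \<nu> x / \<nu>))"
    by (simp only: exp_add exp_diff)
  also have "ln (Gamma ((\<nu> + k) / 2)) - (k / 2 * ln (pi * \<nu>) + ln (Gamma (\<nu> / 2)))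
     + -1/2 * ln (det \<Sigma>) + - (\<nu> + k) / 2 * ln (quad \<mu> \<Sigma> \<nu> x / \<nu>) =
     log_norm_const k \<nu> - ln (det \<Sigma>) / 2 - (\<nu> + k) / 2 * ln (quad \<mu> \<Sigma> \<nu> x)"
    using \<nu> u by (simp add: log_norm_const_def ln_mult ln_div field_simps)
  finally show ?thesis by (simp add: k_def)
qed

section \<open>The normalising constant of the spherical law\<close>

lemma nn_integral_Gamma_scaled:
  assumes a: "a > 0" and c: "c > (0::real)"
  shows "(\<integral>\<^sup>+t. ennreal (indicator {0..} t * t powr (a - 1) * exp (- (c * t))) \<partial>lborel) = ennreal (Gamma a * c powr (- a))"
proof -
  have "ennreal (Gamma a) = (\<integral>\<^sup>+t. ennreal (indicator {0..} t * t powr (a - 1) / exp t) \<partial>lborel)"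
    by (rule Gamma_conv_nn_integral_real[OF a])
  also have "\<dots> = \<bar>c\<bar> * (\<integral>\<^sup>+t. ennreal (indicator {0..} (0 + c * t) * (0 + c * t) powr (a - 1) / exp (0 + c * t)) \<partial>lborel)"
    using c by (intro nn_integral_real_affine) auto
  also have "\<dots> = (\<integral>\<^sup>+t. ennreal (c powr a) * ennreal (indicator {0..} t * t powr (a - 1) * exp (- (c * t))) \<partial>lborel)"
  proof -
    have *: "ennreal c * ennreal (indicator {0..} (0 + c * t) * (0 + c * t) powr (a - 1) / exp (0 + c * t)) =
       ennreal (c powr a) * ennreal (indicator {0..} t * t powr (a - 1) * exp (- (c * t)))" for t
    proof -
      have "c * c powr (a - 1) = c powr a" using c by (simp add: powr_mult_base)
      then have "c * (c * t) powr (a - 1) = c powr a * t powr (a - 1)" if "t \<ge> 0"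
        using c that by (simp add: powr_mult mult.assoc[symmetric])
      then show ?thesis
        using c by (cases "t \<ge> 0") (auto simp: indicator_def ennreal_mult'[symmetric] zero_le_mult_iff exp_minus divide_inverse mult.assoc[symmetric])
    qed
    have "ennreal \<bar>c\<bar> * (\<integral>\<^sup>+t. ennreal (indicator {0..} (0 + c * t) * (0 + c * t) powr (a - 1) / exp (0 + c * t)) \<partial>lborel) =
      (\<integral>\<^sup>+t. ennreal c * ennreal (indicator {0..} (0 + c * t) * (0 + c * t) powr (a - 1) / exp (0 + c * t)) \<partial>lborel)"
      using c by (subst nn_integral_cmult) auto
    then show ?thesis by (simp only: *)
  qed
  also have "\<dots> = ennreal (c powr a) * (\<integral>\<^sup>+t. ennreal (indicator {0..} t * t powr (a - 1) * exp (- (c * t))) \<partial>lborel)"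
    by (rule nn_integral_cmult) simp
  finally have eq: "ennreal (Gamma a) = \<dots>" .
  have "ennreal (Gamma a * c powr (- a)) = ennreal (c powr (- a)) * ennreal (Gamma a)"
    using a by (simp add: ennreal_mult'[symmetric] mult.commute Gamma_real_pos)
  also have "\<dots> = ennreal (c powr (- a) * c powr a) * (\<integral>\<^sup>+t. ennreal (indicator {0..} t * t powr (a - 1) * exp (- (c * t))) \<partial>lborel)"
    by (simp add: eq ennreal_mult' mult.assoc)
  also have "c powr (- a) * c powr a = 1"
    using c by (simp add: powr_minus)
  finally show ?thesis by simp
qed

lemma nn_integral_Gauss:
  assumes t: "t > (0::real)"
  shows "(\<integral>\<^sup>+x. ennreal (exp (- (t * x\<^sup>2))) \<partial>lborel) = ennreal (sqrt (pi / t))"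
proof -
  define \<sigma> where "\<sigma> = sqrt (1 / (2 * t))"
  have \<sigma>: "\<sigma> > 0" "2 * \<sigma>\<^sup>2 = 1 / t" using t by (simp_all add: \<sigma>_def)
  interpret N: prob_space "density lborel (normal_density 0 \<sigma>)"
    by (rule prob_space_normal_density[OF \<sigma>(1)])
  have nd: "ennreal (exp (- (t * x\<^sup>2))) = ennreal (sqrt (pi / t)) * ennreal (normal_density 0 \<sigma> x)" for x
  proof -
    have "2 * pi * \<sigma>\<^sup>2 = pi / t" using \<sigma>(2) by (metis (no_types, lifting) mult.assoc mult.commute times_divide_eq_right mult.right_neutral)
    moreover have "x\<^sup>2 / (2 * \<sigma>\<^sup>2) = t * x\<^sup>2" using t by (simp add: \<sigma>(2))
    ultimately show ?thesis
      using t by (simp add: normal_density_def ennreal_mult'[symmetric])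
  qed
  have "(\<integral>\<^sup>+x. ennreal (normal_density 0 \<sigma> x) \<partial>lborel) = 1"
    using N.emeasure_space_1 by (simp add: emeasure_density)
  then show ?thesis
    by (simp add: nd nn_integral_cmult)
qed

lemma nn_integral_Gauss_vec:
  assumes t: "t > (0::real)"
  shows "(\<integral>\<^sup>+(x :: real^'k). ennreal (exp (- (t * (norm x)\<^sup>2))) \<partial>lborel) = ennreal ((pi / t) powr (real CARD('k) / 2))"
proof -
  have "(norm x)\<^sup>2 = (\<Sum>b\<in>Basis. (x \<bullet> b)\<^sup>2)" for x :: "real^'k"
    by (subst power2_norm_eq_inner, subst euclidean_inner) (simp add: power2_eq_square)
  then have "exp (- (t * (norm x)\<^sup>2)) = (\<Prod>b\<in>Basis. exp (- (t * (x \<bullet> b)\<^sup>2)))" for x :: "real^'k"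
    by (simp only: exp_sum[OF finite_Basis, symmetric] sum_distrib_left sum_negf)
  then have "(\<integral>\<^sup>+(x :: real^'k). ennreal (exp (- (t * (norm x)\<^sup>2))) \<partial>lborel) =
     (\<integral>\<^sup>+(x :: real^'k). (\<Prod>b\<in>Basis. ennreal (exp (- (t * (x \<bullet> b)\<^sup>2)))) \<partial>lborel)"
    by (simp add: prod_ennreal)
  also have "\<dots> = (\<Prod>b\<in>(Basis :: (real^'k) set). \<integral>\<^sup>+x. ennreal (exp (- (t * x\<^sup>2))) \<partial>lborel)"
    by (rule nn_integral_lborel_prod[where f = "\<lambda>_ x. ennreal (exp (- (t * x\<^sup>2)))"]) auto
  also have "\<dots> = ennreal (sqrt (pi / t) ^ CARD('k))"
    using t by (simp add: nn_integral_Gauss ennreal_power)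
  also have "sqrt (pi / t) ^ CARD('k) = (pi / t) powr (real CARD('k) / 2)"
    using t by (simp add: powr_half_sqrt[symmetric] powr_realpow[symmetric] powr_powr)
  finally show ?thesis .
qed

lemma quad_standard: "quad 0 (mat 1) \<nu> x = \<nu> + (norm x)\<^sup>2"
proof -
  have "invertible (mat 1 :: real^'k^'k)" by (simp add: invertible_det_nz)
  from matrix_inv_vector(1)[OF this, of x] show ?thesis
    by (simp add: quad_def power2_norm_eq_inner)
qed

lemma student_density_nonneg: "\<Sigma> \<in> spd \<Longrightarrow> 0 < \<nu> \<Longrightarrow> 0 < student_density \<mu> \<Sigma> \<nu> x"
  by (simp add: student_density_eq)

lemma quad_measurable [measurable]: "quad \<mu> \<Sigma> \<nu> \<in> borel_measurable borel"
  unfolding quad_def[abs_def]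
  by (intro borel_measurable_continuous_onI continuous_intros linear_continuous_on_compose[OF _ matrix_vector_mul_linear])

lemma student_density_measurable [measurable]: "\<Sigma> \<in> spd \<Longrightarrow> 0 < \<nu> \<Longrightarrow> student_density \<mu> \<Sigma> \<nu> \<in> borel_measurable borel"
proof -
  assume "\<Sigma> \<in> spd" "0 < \<nu>"
  then have "student_density \<mu> \<Sigma> \<nu> = (\<lambda>x. exp (log_norm_const (real CARD('a)) \<nu> - ln (det \<Sigma>) / 2
      - (\<nu> + real CARD('a)) / 2 * ln (quad \<mu> \<Sigma> \<nu> x)))"
    by (intro ext student_density_eq)
  then show ?thesis by simp
qed

text \<open>The law is a Gaussian scale mixture: a Gamma integral writes
  \<open>(\<nu> + (norm x)\<^sup>2) powr (- a)\<close> as a mixture over t of Gaussian functions of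
  x. After exchanging the integrals, the Gaussian factor \<open>(pi / t) powr (k / 2)\<close> lowers
  the Gamma shape from \<open>a\<close> to \<open>\<nu> / 2\<close>, and a second Gamma integral
  remains.\<close>

lemma nn_integral_student_standard:
  assumes \<nu>: "0 < \<nu>"
  shows "(\<integral>\<^sup>+(x :: real^'k). ennreal (student_density 0 (mat 1) \<nu> x) \<partial>lborel) = 1"
proof -
  define k where "k = real CARD('k)"
  define a where "a = (\<nu> + k) / 2"
  have k: "k > 0" and a: "a > 0" using \<nu> by (simp_all add: k_def a_def add_pos_pos)
  have u: "0 < \<nu> + (norm x)\<^sup>2" for x :: "real^'k" using \<nu> by (simp add: add_pos_nonneg)
  define C where "C = exp (log_norm_const k \<nu>)"
  have C: "C = Gamma a * pi powr (- (k / 2)) * \<nu> powr (\<nu> / 2) / Gamma (\<nu> / 2)"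
  proof -
    have "Gamma a > 0" "Gamma (\<nu> / 2) > 0" using a \<nu> by (auto intro!: Gamma_real_pos)
    then have "exp (ln (Gamma a)) = Gamma a" "exp (ln (Gamma (\<nu> / 2))) = Gamma (\<nu> / 2)"
      "exp (\<nu> / 2 * ln \<nu>) = \<nu> powr (\<nu> / 2)" using \<nu> by (simp_all add: powr_def)
    moreover have "exp (k / 2 * ln pi) = inverse (pi powr (- (k / 2)))"
      by (simp add: powr_def exp_minus)
    ultimately show ?thesis
      unfolding C_def log_norm_const_def exp_add exp_diff a_def[symmetric]
      by (simp only: divide_inverse inverse_inverse_eq mult_ac)
  qed
  have dens: "student_density 0 (mat 1) \<nu> x = C * (\<nu> + (norm x)\<^sup>2) powr (- a)" for x :: "real^'k"
  proof -
    have "student_density 0 (mat 1) \<nu> x = exp (log_norm_const k \<nu> + - a * ln (\<nu> + (norm x)\<^sup>2))"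
      by (simp add: student_density_eq[OF spd_mat_1 \<nu>] quad_standard k_def a_def)
    then show ?thesis
      using u[of x] unfolding exp_add C_def[symmetric] by (simp add: powr_def)
  qed
  have "ennreal (Gamma a) * (\<integral>\<^sup>+(x :: real^'k). ennreal ((\<nu> + (norm x)\<^sup>2) powr (- a)) \<partial>lborel) =
      (\<integral>\<^sup>+(x :: real^'k). (\<integral>\<^sup>+t. ennreal (indicator {0..} t * t powr (a - 1) * exp (- ((\<nu> + (norm x)\<^sup>2) * t))) \<partial>lborel) \<partial>lborel)"
    unfolding nn_integral_Gamma_scaled[OF a u] using Gamma_real_pos[OF a]
    by (subst nn_integral_cmult[symmetric]) (simp_all add: ennreal_mult')
  also have "\<dots> = (\<integral>\<^sup>+t. (\<integral>\<^sup>+(x :: real^'k). ennreal (indicator {0..} t * t powr (a - 1) * exp (- ((\<nu> + (norm x)\<^sup>2) * t))) \<partial>lborel) \<partial>lborel)"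
    by (rule lborel_pair.Fubini'[symmetric]) measurable
  also have "\<dots> = (\<integral>\<^sup>+t. ennreal (pi powr (k / 2)) * ennreal (indicator {0..} t * t powr (\<nu> / 2 - 1) * exp (- (\<nu> * t))) \<partial>lborel)"
  proof (rule nn_integral_cong_AE)
    have "AE t in lborel. t \<noteq> (0::real)" by (rule AE_lborel_singleton)
    then show "AE t in lborel. (\<integral>\<^sup>+(x :: real^'k). ennreal (indicator {0..} t * t powr (a - 1) * exp (- ((\<nu> + (norm x)\<^sup>2) * t))) \<partial>lborel) =
       ennreal (pi powr (k / 2)) * ennreal (indicator {0..} t * t powr (\<nu> / 2 - 1) * exp (- (\<nu> * t)))"
    proof eventually_elim
      case (elim t)
      show ?case
      proof (cases "t > 0")
        case True
        have "(\<integral>\<^sup>+(x :: real^'k). ennreal (indicator {0..} t * t powr (a - 1) * exp (- ((\<nu> + (norm x)\<^sup>2) * t))) \<partial>lborel) =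
           (\<integral>\<^sup>+(x :: real^'k). ennreal (t powr (a - 1) * exp (- (\<nu> * t))) * ennreal (exp (- (t * (norm x)\<^sup>2))) \<partial>lborel)"
          using True by (intro nn_integral_cong) (simp add: ennreal_mult'[symmetric] mult.assoc mult_exp_exp algebra_simps)
        also have "\<dots> = ennreal (t powr (a - 1) * exp (- (\<nu> * t))) * ennreal ((pi / t) powr (k / 2))"
          using True by (simp add: nn_integral_cmult nn_integral_Gauss_vec k_def)
        also have "\<dots> = ennreal (pi powr (k / 2) * (t powr (\<nu> / 2 - 1) * exp (- (\<nu> * t))))"
        proof -
          have "t powr (a - 1) * (pi / t) powr (k / 2) = pi powr (k / 2) * (t powr (a - 1) / t powr (k / 2))"
            using True by (simp add: powr_divide)
          also have "t powr (a - 1) / t powr (k / 2) = t powr (\<nu> / 2 - 1)"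
            by (simp add: powr_diff[symmetric] a_def add_divide_distrib)
          finally show ?thesis
            by (simp add: ennreal_mult'[symmetric] mult_ac)
        qed
        finally show ?thesis using True by (simp add: ennreal_mult')
      qed (use elim in simp)
    qed
  qed
  also have "\<dots> = ennreal (pi powr (k / 2)) * ennreal (Gamma (\<nu> / 2) * \<nu> powr (- (\<nu> / 2)))"
    using \<nu> by (subst nn_integral_cmult) (simp_all add: nn_integral_Gamma_scaled)
  finally have I: "ennreal (Gamma a) * (\<integral>\<^sup>+(x :: real^'k). ennreal ((\<nu> + (norm x)\<^sup>2) powr (- a)) \<partial>lborel) =
     ennreal (pi powr (k / 2) * (Gamma (\<nu> / 2) * \<nu> powr (- (\<nu> / 2))))"
    by (simp add: ennreal_mult')
  have C': "C = C / Gamma a * Gamma a" using a by (simp add: Gamma_real_pos less_imp_neq[THEN not_sym])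
  have C0: "C / Gamma a \<ge> 0" using a by (simp add: C_def Gamma_real_pos less_imp_le)
  have "(\<integral>\<^sup>+(x :: real^'k). ennreal (student_density 0 (mat 1) \<nu> x) \<partial>lborel) = ennreal C * (\<integral>\<^sup>+(x :: real^'k). ennreal ((\<nu> + (norm x)\<^sup>2) powr (- a)) \<partial>lborel)"
    by (simp add: dens ennreal_mult' C_def nn_integral_cmult)
  also have "\<dots> = ennreal (C / Gamma a) * (ennreal (Gamma a) * (\<integral>\<^sup>+(x :: real^'k). ennreal ((\<nu> + (norm x)\<^sup>2) powr (- a)) \<partial>lborel))"
    by (subst C') (simp only: ennreal_mult'[OF C0] mult.assoc)
  also have "\<dots> = ennreal (C / Gamma a * (pi powr (k / 2) * (Gamma (\<nu> / 2) * \<nu> powr (- (\<nu> / 2)))))"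
    unfolding I using C0 by (simp only: ennreal_mult')
  also have "C / Gamma a * (pi powr (k / 2) * (Gamma (\<nu> / 2) * \<nu> powr (- (\<nu> / 2)))) = 1"
  proof -
    have "Gamma a \<noteq> 0" "Gamma (\<nu> / 2) \<noteq> 0" using a \<nu> by (auto intro!: less_imp_neq[THEN not_sym] Gamma_real_pos)
    then have "C / Gamma a * (pi powr (k / 2) * (Gamma (\<nu> / 2) * \<nu> powr (- (\<nu> / 2)))) =
       (pi powr (- (k / 2)) * pi powr (k / 2)) * (\<nu> powr (\<nu> / 2) * \<nu> powr (- (\<nu> / 2)))"
      by (simp add: C mult_ac)
    also have "\<dots> = 1" using \<nu> by (simp add: powr_minus)
    finally show ?thesis .
  qed
  finally show ?thesis by simp
qed

section \<open>Affine images and orthogonal invariance\<close>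

lemma nn_integral_lborel_translate:
  fixes f :: "'a::euclidean_space \<Rightarrow> ennreal"
  assumes [measurable]: "f \<in> borel_measurable borel"
  shows "(\<integral>\<^sup>+x. f (a + x) \<partial>lborel) = (\<integral>\<^sup>+x. f x \<partial>lborel)"
proof -
  have "(\<integral>\<^sup>+x. f x \<partial>lborel) = (\<integral>\<^sup>+x. f x \<partial>distr lborel borel ((+) a))"
    by (rule arg_cong[where f = "\<lambda>M. nn_integral M f", OF lborel_distr_plus[symmetric]])
  also have "\<dots> = (\<integral>\<^sup>+x. f (a + x) \<partial>lborel)" by (rule nn_integral_distr) simp_all
  finally show ?thesis ..
qed

lemma matrix_vector_mult_measurable [measurable]: "(\<lambda>x. A *v x) \<in> borel_measurable borel" for A :: "real^'n^'m"
  by (intro borel_measurable_continuous_onI linear_continuous_on matrix_vector_mul_bounded_linear)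

lemma quad_affine:
  assumes \<Sigma>: "\<Sigma> \<in> spd"
  shows "quad \<mu> \<Sigma> \<nu> (\<mu> + spd_sqrt \<Sigma> *v z) = \<nu> + (norm z)\<^sup>2"
  by (simp add: quad_def norm_spd_sqrt_inv[OF \<Sigma>, symmetric] matrix_inv_vector[OF spd_invertible[OF spd_sqrt(1)[OF \<Sigma>]]])

text \<open>Standardisation removes both parameters: moments of radial functions become independent
  of them, and scatter directions can be studied under a rotation invariant law.\<close>

lemma nn_integral_student_affine:
  fixes f :: "real^'k \<Rightarrow> ennreal"
  assumes \<Sigma>: "\<Sigma> \<in> spd" and \<nu>: "0 < \<nu>" and [measurable]: "f \<in> borel_measurable borel"
  shows "(\<integral>\<^sup>+x. f x \<partial>student \<mu> \<Sigma> \<nu>) = (\<integral>\<^sup>+z. f (\<mu> + spd_sqrt \<Sigma> *v z) \<partial>student 0 (mat 1) \<nu>)"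
proof -
  let ?B = "spd_sqrt \<Sigma>"
  have B: "invertible ?B" by (rule spd_invertible[OF spd_sqrt(1)[OF \<Sigma>]])
  have d: "\<bar>det ?B\<bar> > 0" using B by (simp add: invertible_det_nz)
  have [measurable]: "student_density \<mu> \<Sigma> \<nu> \<in> borel_measurable borel" "student_density 0 (mat 1) \<nu> \<in> borel_measurable (borel :: (real^'k) measure)"
    using \<Sigma> \<nu> spd_mat_1 by (auto intro!: student_density_measurable)
  have dens: "\<bar>det ?B\<bar> * student_density \<mu> \<Sigma> \<nu> (\<mu> + ?B *v z) = student_density 0 (mat 1) \<nu> z" for z
  proof -
    have "ln (det \<Sigma>) = 2 * ln \<bar>det ?B\<bar>"
    proof -
      have "det \<Sigma> = \<bar>det ?B\<bar>\<^sup>2" by (simp add: spd_det(1)[OF \<Sigma>])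
      then show ?thesis using d by (simp only: ln_realpow of_nat_numeral)
    qed
    then show ?thesis
      using d by (simp add: student_density_eq[OF \<Sigma> \<nu>] student_density_eq[OF spd_mat_1 \<nu>] quad_affine[OF \<Sigma>] quad_standard exp_diff)
  qed
  have "(\<integral>\<^sup>+x. f x \<partial>student \<mu> \<Sigma> \<nu>) = (\<integral>\<^sup>+x. ennreal (student_density \<mu> \<Sigma> \<nu> x) * f x \<partial>lborel)"
    unfolding student_def by (rule nn_integral_density) measurable
  also have "\<dots> = (\<integral>\<^sup>+x. ennreal (student_density \<mu> \<Sigma> \<nu> (\<mu> + x)) * f (\<mu> + x) \<partial>lborel)"
    by (rule nn_integral_lborel_translate[symmetric]) measurable
  also have "\<dots> = ennreal \<bar>det ?B\<bar> * (\<integral>\<^sup>+x. ennreal (student_density \<mu> \<Sigma> \<nu> (\<mu> + ?B *v x)) * f (\<mu> + ?B *v x) \<partial>lborel)"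
    by (rule nn_integral_lborel_matrix[OF B]) measurable
  also have "\<dots> = (\<integral>\<^sup>+x. ennreal \<bar>det ?B\<bar> * (ennreal (student_density \<mu> \<Sigma> \<nu> (\<mu> + ?B *v x)) * f (\<mu> + ?B *v x)) \<partial>lborel)"
    by (rule nn_integral_cmult[symmetric]) measurable
  also have "\<dots> = (\<integral>\<^sup>+x. ennreal (student_density 0 (mat 1) \<nu> x) * f (\<mu> + ?B *v x) \<partial>lborel)"
    by (intro nn_integral_cong) (simp add: ennreal_mult' mult.assoc[symmetric] flip: dens)
  also have "\<dots> = (\<integral>\<^sup>+z. f (\<mu> + ?B *v z) \<partial>student 0 (mat 1) \<nu>)"
    unfolding student_def by (rule nn_integral_density[symmetric]) measurable
  finally show ?thesis .
qed

lemma sets_student [measurable_cong, simp]: "sets (student \<mu> \<Sigma> \<nu>) = sets borel" "space (student \<mu> \<Sigma> \<nu>) = UNIV"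
  by (simp_all add: student_def)

lemma student_eq_distr:
  assumes "\<Sigma> \<in> spd" "0 < \<nu>"
  shows "student \<mu> \<Sigma> \<nu> = distr (student 0 (mat 1) \<nu>) borel (\<lambda>z. \<mu> + spd_sqrt \<Sigma> *v z)"
proof (rule measure_eqI)
  fix A assume "A \<in> sets (student \<mu> \<Sigma> \<nu>)"
  then have [measurable]: "A \<in> sets borel" by simp
  have "emeasure (student \<mu> \<Sigma> \<nu>) A = (\<integral>\<^sup>+x. indicator A x \<partial>student \<mu> \<Sigma> \<nu>)" by simp
  also have "\<dots> = (\<integral>\<^sup>+z. indicator A (\<mu> + spd_sqrt \<Sigma> *v z) \<partial>student 0 (mat 1) \<nu>)"
    using assms by (rule nn_integral_student_affine) measurable
  also have "\<dots> = (\<integral>\<^sup>+z. indicator A z \<partial>distr (student 0 (mat 1) \<nu>) borel (\<lambda>z. \<mu> + spd_sqrt \<Sigma> *v z))"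
    by (rule nn_integral_distr[symmetric]) measurable
  finally show "emeasure (student \<mu> \<Sigma> \<nu>) A = emeasure (distr (student 0 (mat 1) \<nu>) borel (\<lambda>z. \<mu> + spd_sqrt \<Sigma> *v z)) A"
    by simp
qed simp

lemma prob_space_student_standard: "0 < \<nu> \<Longrightarrow> prob_space (student 0 (mat 1) \<nu> :: (real^'k) measure)"
  by (rule prob_spaceI) (simp add: student_def emeasure_density spd_mat_1 nn_integral_student_standard)

lemma prob_space_student: "\<Sigma> \<in> spd \<Longrightarrow> 0 < \<nu> \<Longrightarrow> prob_space (student \<mu> \<Sigma> \<nu>)"
  by (subst student_eq_distr) (auto intro!: prob_space.prob_space_distr prob_space_student_standard)

lemma integral_student_affine:
  fixes f :: "real^'k \<Rightarrow> real"
  assumes "\<Sigma> \<in> spd" "0 < \<nu>" and [measurable]: "f \<in> borel_measurable borel"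
  shows "(\<integral>x. f x \<partial>student \<mu> \<Sigma> \<nu>) = (\<integral>z. f (\<mu> + spd_sqrt \<Sigma> *v z) \<partial>student 0 (mat 1) \<nu>)"
    and "integrable (student \<mu> \<Sigma> \<nu>) f \<longleftrightarrow> integrable (student 0 (mat 1) \<nu>) (\<lambda>z. f (\<mu> + spd_sqrt \<Sigma> *v z))"
  unfolding student_eq_distr[OF assms(1,2), of \<mu>] by (subst integral_distr integrable_distr_eq; simp)+

text \<open>The standard density depends on the norm alone, and an orthogonal map has determinant 1
  or -1. It is applied below to the central reflection, to sign flips and to coordinate
  swaps.\<close>

lemma integral_student_orthogonal:
  fixes f :: "real^'k \<Rightarrow> real" and T :: "real^'k \<Rightarrow> real^'k"
  assumes T: "orthogonal_transformation T" and \<nu>: "0 < \<nu>" and [measurable]: "f \<in> borel_measurable borel"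
  shows "(\<integral>z. f (T z) \<partial>student 0 (mat 1) \<nu>) = (\<integral>z. f z \<partial>student 0 (mat 1) \<nu>)"
proof -
  have lin: "linear T" using T by (simp add: orthogonal_transformation_def)
  have [measurable]: "T \<in> borel_measurable borel"
    using lin by (intro borel_measurable_continuous_onI linear_continuous_on) (simp add: linear_conv_bounded_linear)
  have Tm: "matrix T *v z = T z" for z
    by (rule matrix_works) (simp add: linear_matrix_vector_mul_eq lin)
  have det: "\<bar>det (matrix T)\<bar> = 1"
    using det_orthogonal_matrix[of "matrix T"] T by (auto simp: orthogonal_transformation_matrix)
  then have inv: "invertible (matrix T)" by (auto simp: invertible_det_nz)
  have d: "student_density 0 (mat 1) \<nu> (T z) = student_density 0 (mat 1) \<nu> z" for z
    using orthogonal_transformation_norm[OF T] by (simp add: student_density_eq[OF spd_mat_1 \<nu>] quad_standard)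
  have [measurable]: "student_density 0 (mat 1) \<nu> \<in> borel_measurable (borel :: (real^'k) measure)"
    using \<nu> spd_mat_1 by (auto intro!: student_density_measurable)
  have "student 0 (mat 1) \<nu> = distr (student 0 (mat 1) \<nu>) borel T"
  proof (rule measure_eqI)
    fix A :: "(real^'k) set" assume "A \<in> sets (student 0 (mat 1) \<nu>)"
    then have [measurable]: "A \<in> sets borel" by simp
    have "emeasure (student 0 (mat 1) \<nu>) A = (\<integral>\<^sup>+z. ennreal (student_density 0 (mat 1) \<nu> z) * indicator A z \<partial>lborel)"
      unfolding student_def by (rule emeasure_density) measurable
    also have "\<dots> = (\<integral>\<^sup>+z. ennreal (student_density 0 (mat 1) \<nu> z) * indicator A (T z) \<partial>lborel)"
      by (subst nn_integral_lborel_matrix[OF inv]) (simp_all add: Tm det d)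
    also have "\<dots> = (\<integral>\<^sup>+z. indicator A (T z) \<partial>student 0 (mat 1) \<nu>)"
      unfolding student_def by (rule nn_integral_density[symmetric]) measurable
    also have "\<dots> = (\<integral>\<^sup>+z. indicator A z \<partial>distr (student 0 (mat 1) \<nu>) borel T)"
      by (rule nn_integral_distr[symmetric]) measurable
    finally show "emeasure (student 0 (mat 1) \<nu>) A = emeasure (distr (student 0 (mat 1) \<nu>) borel T) A"
      by simp
  qed simp
  then have "(\<integral>z. f z \<partial>student 0 (mat 1) \<nu>) = (\<integral>z. f z \<partial>distr (student 0 (mat 1) \<nu>) borel T)"
    by (rule arg_cong[where f = "\<lambda>M. integral\<^sup>L M f"])
  then show ?thesis by (simp add: integral_distr)
qed

section \<open>Scores and likelihood ratios of the Student model\<close>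

lemma integral_student_odd:
  fixes g :: "real \<Rightarrow> real" and a :: "real^'k"
  assumes [measurable]: "g \<in> borel_measurable borel" and \<nu>: "0 < \<nu>"
  shows "(\<integral>z. g (norm z) * (a \<bullet> z) \<partial>student 0 (mat 1) \<nu>) = 0"
proof -
  have "orthogonal_transformation (\<lambda>z :: real^'k. - z)" by (simp add: orthogonal_transformation_neg)
  from integral_student_orthogonal[OF this \<nu>, of "\<lambda>z. g (norm z) * (a \<bullet> z)"] show ?thesis by simp
qed

lemma integral_student_off_diagonal:
  fixes g :: "real \<Rightarrow> real" and i j :: "'k :: finite"
  assumes [measurable]: "g \<in> borel_measurable borel" and \<nu>: "0 < \<nu>" and ij: "i \<noteq> j"
  shows "(\<integral>z. g (norm z) * (z $ i * z $ j) \<partial>student 0 (mat 1) \<nu>) = 0"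
proof -
  define T where "T = (\<lambda>z :: real^'k. \<chi> l. if l = i then - z $ l else z $ l)"
  have T: "orthogonal_transformation T"
    unfolding orthogonal_transformation_def
  proof (intro conjI allI)
    show "linear T" by (intro linearI) (auto simp: T_def vec_eq_iff)
    show "T v \<bullet> T w = v \<bullet> w" for v w by (auto simp: T_def inner_vec_def intro!: sum.cong)
  qed
  have "g (norm (T z)) * (T z $ i * T z $ j) = - (g (norm z) * (z $ i * z $ j))" for z
    using ij orthogonal_transformation_norm[OF T] by (simp add: T_def)
  with integral_student_orthogonal[OF T \<nu>, of "\<lambda>z. g (norm z) * (z $ i * z $ j)"] show ?thesis by simp
qed

lemma integral_student_diagonal:
  fixes g :: "real \<Rightarrow> real" and i j :: "'k :: finite"
  assumes [measurable]: "g \<in> borel_measurable borel" and \<nu>: "0 < \<nu>"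
  shows "(\<integral>z. g (norm z) * (z $ i * z $ i) \<partial>student 0 (mat 1) \<nu>) = (\<integral>z. g (norm z) * (z $ j * z $ j) \<partial>student 0 (mat 1) \<nu>)"
proof -
  define T where "T = (\<lambda>z :: real^'k. \<chi> l. z $ Transposition.transpose i j l)"
  have T: "orthogonal_transformation T"
    unfolding orthogonal_transformation_def
  proof (intro conjI allI)
    show "linear T" by (intro linearI) (auto simp: T_def vec_eq_iff)
    show "T v \<bullet> T w = v \<bullet> w" for v w
      unfolding T_def inner_vec_def vec_lambda_beta
      by (rule sum.reindex_bij_betw[where h = "Transposition.transpose i j"]) simp
  qed
  have "g (norm (T z)) * (T z $ i * T z $ i) = g (norm z) * (z $ j * z $ j)" for z
    using orthogonal_transformation_norm[OF T] by (simp add: T_def)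
  with integral_student_orthogonal[OF T \<nu>, of "\<lambda>z. g (norm z) * (z $ i * z $ i)"] show ?thesis by simp
qed

text \<open>Sign flips and coordinate swaps preserve the law, so the second-moment matrix weighted
  by \<open>g (norm z)\<close> is a multiple of the identity. The multiple is read off by summing
  the diagonal.\<close>

lemma integral_student_quadratic_form:
  fixes g :: "real \<Rightarrow> real" and M :: "real^'k^'k"
  assumes g [measurable]: "g \<in> borel_measurable borel" and \<nu>: "0 < \<nu>"
    and int: "integrable (student 0 (mat 1) \<nu>) (\<lambda>z :: real^'k. g (norm z) * (norm z)\<^sup>2)"
  shows "(\<integral>z. g (norm z) * (z \<bullet> (M *v z)) \<partial>student 0 (mat 1) \<nu>) =
    trace M / real CARD('k) * (\<integral>z. g (norm z) * (norm (z :: real^'k))\<^sup>2 \<partial>student 0 (mat 1) \<nu>)"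
proof -
  let ?P = "student 0 (mat 1) \<nu> :: (real^'k) measure"
  define I where "I = (\<lambda>i j. \<integral>z. g (norm z) * (z $ i * z $ j) \<partial>?P)"
  have int2: "integrable ?P (\<lambda>z. g (norm z) * (z $ i * z $ j))" for i j
  proof (rule Bochner_Integration.integrable_bound[OF int _ AE_I2])
    fix z :: "real^'k"
    have "\<bar>z $ i * z $ j\<bar> \<le> norm z * norm z"
      unfolding abs_mult by (intro mult_mono component_le_norm_cart) auto
    then show "norm (g (norm z) * (z $ i * z $ j)) \<le> norm (g (norm z) * (norm z)\<^sup>2)"
      by (simp add: abs_mult power2_eq_square mult_left_mono)
  qed measurable
  define i0 :: 'k where "i0 = undefined"
  have I: "I i j = (if i = j then I i0 i0 else 0)" for i j
  proof (cases "i = j")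
    case True
    then show ?thesis using integral_student_diagonal[OF g \<nu>, of i i0] by (simp only: I_def simp_thms if_True)
  next
    case False
    then show ?thesis using integral_student_off_diagonal[OF g \<nu> False] by (simp only: I_def simp_thms if_False)
  qed
  have "(\<integral>z. g (norm z) * (norm z)\<^sup>2 \<partial>?P) = (\<integral>z. (\<Sum>i\<in>UNIV. g (norm z) * (z $ i * z $ i)) \<partial>?P)"
    by (simp add: power2_norm_eq_inner inner_vec_def sum_distrib_left)
  also have "\<dots> = (\<Sum>i\<in>UNIV. I i i)"
    unfolding I_def using int2 by (intro Bochner_Integration.integral_sum) auto
  also have "\<dots> = (\<Sum>i\<in>(UNIV :: 'k set). I i0 i0)" by (intro sum.cong refl trans[OF I]) simp
  also have "\<dots> = real CARD('k) * I i0 i0" by simp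
  finally have n2: "(\<integral>z. g (norm z) * (norm z)\<^sup>2 \<partial>?P) = real CARD('k) * I i0 i0" .
  have "(\<integral>z. g (norm z) * (z \<bullet> (M *v z)) \<partial>?P) = (\<integral>z. (\<Sum>i\<in>UNIV. \<Sum>j\<in>UNIV. M $ i $ j * (g (norm z) * (z $ i * z $ j))) \<partial>?P)"
    by (simp add: inner_vec_def matrix_vector_mult_def sum_distrib_left mult_ac)
  also have "\<dots> = (\<Sum>i\<in>UNIV. \<integral>z. (\<Sum>j\<in>UNIV. M $ i $ j * (g (norm z) * (z $ i * z $ j))) \<partial>?P)"
    by (intro Bochner_Integration.integral_sum Bochner_Integration.integrable_sum integrable_mult_right int2)
  also have "\<dots> = (\<Sum>i\<in>UNIV. \<Sum>j\<in>UNIV. M $ i $ j * I i j)"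
    unfolding I_def by (intro sum.cong refl) (simp add: Bochner_Integration.integral_sum int2)
  also have "\<dots> = (\<Sum>i\<in>UNIV. \<Sum>j\<in>UNIV. if i = j then M $ i $ i * I i0 i0 else 0)"
    by (intro sum.cong refl) (subst I, simp)
  also have "\<dots> = trace M * I i0 i0"
    by (simp add: trace_def sum_distrib_right)
  finally show ?thesis by (simp add: n2)
qed

lemma quad_shift_measurable [measurable]: "(\<lambda>x. matrix_inv \<Sigma> *v (x - \<mu>)) \<in> borel_measurable borel"
  for \<Sigma> :: "real^'n^'m"
  using measurable_compose[of "\<lambda>x. x - \<mu>" borel borel "\<lambda>y. matrix_inv \<Sigma> *v y" borel] by simp

lemma integral_student_radial:
  fixes g :: "real \<Rightarrow> real" and \<mu> :: "real^'k"
  assumes [measurable]: "g \<in> borel_measurable borel" and \<Sigma>: "\<Sigma> \<in> spd" and \<nu>: "0 < \<nu>"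
  shows "(\<integral>x. g (quad \<mu> \<Sigma> \<nu> x) \<partial>student \<mu> \<Sigma> \<nu>) = (\<integral>z. g (\<nu> + (norm (z :: real^'k))\<^sup>2) \<partial>student 0 (mat 1) \<nu>)"
  by (subst integral_student_affine(1)[OF \<Sigma> \<nu>]) (simp_all add: quad_affine[OF \<Sigma>])

lemma spd_sqrt_inv_affine:
  assumes \<Sigma>: "\<Sigma> \<in> spd"
  shows "matrix_inv \<Sigma> *v (\<mu> + spd_sqrt \<Sigma> *v z - \<mu>) = matrix_inv (spd_sqrt \<Sigma>) *v z"
proof -
  let ?B = "spd_sqrt \<Sigma>"
  note inv = matrix_inv_vector[OF spd_invertible[OF spd_sqrt(1)[OF \<Sigma>]]]
  have "\<Sigma> *v (matrix_inv ?B *v z) = ?B *v (?B *v (matrix_inv ?B *v z))"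
    by (simp add: matrix_vector_mul_assoc spd_sqrt(2)[OF \<Sigma>] matrix_mul_assoc)
  then have "\<Sigma> *v (matrix_inv ?B *v z) = ?B *v z" by (simp add: inv)
  then show ?thesis
    using matrix_inv_vector(2)[OF spd_invertible[OF \<Sigma>], of "matrix_inv ?B *v z"] by simp
qed

text \<open>After standardisation the integrand is odd in z, while the law is symmetric about
  0.\<close>

lemma student_location_orthogonal:
  fixes g :: "real \<Rightarrow> real" and \<mu> :: "real^'k"
  assumes [measurable]: "g \<in> borel_measurable borel" and \<Sigma>: "\<Sigma> \<in> spd" and \<nu>: "0 < \<nu>"
  shows "(\<integral>x. g (quad \<mu> \<Sigma> \<nu> x) * (m \<bullet> (matrix_inv \<Sigma> *v (x - \<mu>))) \<partial>student \<mu> \<Sigma> \<nu>) = 0"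
proof -
  have "(\<integral>x. g (quad \<mu> \<Sigma> \<nu> x) * (m \<bullet> (matrix_inv \<Sigma> *v (x - \<mu>))) \<partial>student \<mu> \<Sigma> \<nu>) =
     (\<integral>z. g (\<nu> + (norm z)\<^sup>2) * ((matrix_inv (spd_sqrt \<Sigma>) *v m) \<bullet> z) \<partial>student 0 (mat 1) \<nu>)"
    by (subst integral_student_affine(1)[OF \<Sigma> \<nu>])
      (simp_all only: quad_affine[OF \<Sigma>] spd_sqrt_inv_affine[OF \<Sigma>] spd_matrix_inv(2)[OF spd_sqrt(1)[OF \<Sigma>]], measurable)
  also have "\<dots> = 0"
    using integral_student_odd[of "\<lambda>r. g (\<nu> + r\<^sup>2)"] \<nu> by simp
  finally show ?thesis .
qed

text \<open>By spherical symmetry only the scalar \<open>trace (\<Sigma>\<^sup>-\<^sup>1 H) / k\<close> of a scatter direction \<open>H\<close> is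
  seen by radial functions.\<close>

definition mean_direction :: "real^'k^'k \<Rightarrow> real^'k^'k \<Rightarrow> real" where
  "mean_direction \<Sigma> H = trace (matrix_inv (spd_sqrt \<Sigma>) ** H ** matrix_inv (spd_sqrt \<Sigma>)) / real CARD('k)"

lemma student_scatter_mean:
  fixes g :: "real \<Rightarrow> real" and \<mu> :: "real^'k"
  assumes g [measurable]: "g \<in> borel_measurable borel" and \<Sigma>: "\<Sigma> \<in> spd" and \<nu>: "0 < \<nu>"
    and int: "integrable (student \<mu> \<Sigma> \<nu>) (\<lambda>x. g (quad \<mu> \<Sigma> \<nu> x) * (quad \<mu> \<Sigma> \<nu> x - \<nu>))"
  shows "(\<integral>x. g (quad \<mu> \<Sigma> \<nu> x) * ((matrix_inv \<Sigma> *v (x - \<mu>)) \<bullet> (H *v (matrix_inv \<Sigma> *v (x - \<mu>)))) \<partial>student \<mu> \<Sigma> \<nu>) =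
     mean_direction \<Sigma> H * (\<integral>x. g (quad \<mu> \<Sigma> \<nu> x) * (quad \<mu> \<Sigma> \<nu> x - \<nu>) \<partial>student \<mu> \<Sigma> \<nu>)"
proof -
  let ?R = "matrix_inv (spd_sqrt \<Sigma>)"
  have [measurable]: "(\<lambda>x. H *v (matrix_inv \<Sigma> *v (x - \<mu>))) \<in> borel_measurable borel"
    by (rule measurable_compose[OF quad_shift_measurable matrix_vector_mult_measurable])
  have "(\<integral>x. g (quad \<mu> \<Sigma> \<nu> x) * ((matrix_inv \<Sigma> *v (x - \<mu>)) \<bullet> (H *v (matrix_inv \<Sigma> *v (x - \<mu>)))) \<partial>student \<mu> \<Sigma> \<nu>) =
     (\<integral>z. g (\<nu> + (norm z)\<^sup>2) * ((?R *v z) \<bullet> (H *v (?R *v z))) \<partial>student 0 (mat 1) \<nu>)"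
    by (subst integral_student_affine(1)[OF \<Sigma> \<nu>])
      (simp_all only: quad_affine[OF \<Sigma>] spd_sqrt_inv_affine[OF \<Sigma>], measurable)
  also have "\<dots> = (\<integral>z. g (\<nu> + (norm z)\<^sup>2) * (z \<bullet> ((?R ** H ** ?R) *v z)) \<partial>student 0 (mat 1) \<nu>)"
    by (simp add: spd_matrix_inv(2)[OF spd_sqrt(1)[OF \<Sigma>]] matrix_vector_mul_assoc[symmetric])
  also have "\<dots> = mean_direction \<Sigma> H * (\<integral>z. g (\<nu> + (norm (z :: real^'k))\<^sup>2) * (norm z)\<^sup>2 \<partial>student 0 (mat 1) \<nu>)"
    unfolding mean_direction_def
  proof (rule integral_student_quadratic_form[where g = "\<lambda>r. g (\<nu> + r\<^sup>2)"])
    show "integrable (student 0 (mat 1) \<nu>) (\<lambda>z :: real^'k. g (\<nu> + (norm z)\<^sup>2) * (norm z)\<^sup>2)"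
      using int by (subst (asm) integral_student_affine(2)[OF \<Sigma> \<nu>]) (simp_all add: quad_affine[OF \<Sigma>])
  qed (use \<nu> in simp_all)
  also have "(\<integral>z. g (\<nu> + (norm (z :: real^'k))\<^sup>2) * (norm z)\<^sup>2 \<partial>student 0 (mat 1) \<nu>) =
     (\<integral>x. g (quad \<mu> \<Sigma> \<nu> x) * (quad \<mu> \<Sigma> \<nu> x - \<nu>) \<partial>student \<mu> \<Sigma> \<nu>)"
    using integral_student_radial[of "\<lambda>u. g u * (u - \<nu>)" \<Sigma> \<nu> \<mu>] \<Sigma> \<nu> by simp
  finally show ?thesis .
qed

section \<open>Moments of the radial part\<close>

lemma integrable_student_quad_power:
  fixes \<mu> :: "real^'k"
  assumes \<Sigma>: "\<Sigma> \<in> spd" and \<nu>: "0 < \<nu>" and p: "2 * p < \<nu>" "0 \<le> p"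
  shows "integrable (student \<mu> \<Sigma> \<nu>) (\<lambda>x. quad \<mu> \<Sigma> \<nu> x powr p)"
proof -
  define k where "k = real CARD('k)"
  \<comment> \<open>Multiplying the density by the p-th power of \<open>quad\<close> amounts, in the
    exponent, to lowering the degrees of freedom by \<open>2 * p\<close>. Because
    \<open>\<nu>' \<le> \<nu>\<close>, the product is at most \<open>C\<close> times the density
    with \<nu>' degrees of freedom, whose mass is 1.\<close>
  define \<nu>' where "\<nu>' = \<nu> - 2 * p"
  have \<nu>': "0 < \<nu>'" "\<nu>' \<le> \<nu>" using p by (simp_all add: \<nu>'_def)
  define C where "C = exp (log_norm_const k \<nu> - log_norm_const k \<nu>')"
  have [measurable]: "student_density 0 (mat 1) \<nu> \<in> borel_measurable (borel :: (real^'k) measure)"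
     "student_density 0 (mat 1) \<nu>' \<in> borel_measurable (borel :: (real^'k) measure)"
    using \<nu> \<nu>' spd_mat_1 by (auto intro!: student_density_measurable)
  have le: "(\<nu> + (norm z)\<^sup>2) powr p * student_density 0 (mat 1) \<nu> z \<le> C * student_density 0 (mat 1) \<nu>' z" for z :: "real^'k"
  proof -
    have u: "0 < \<nu> + (norm z)\<^sup>2" "0 < \<nu>' + (norm z)\<^sup>2" using \<nu> \<nu>' by (simp_all add: add_pos_nonneg)
    have "p * ln (\<nu> + (norm z)\<^sup>2) + (log_norm_const k \<nu> - (\<nu> + k) / 2 * ln (\<nu> + (norm z)\<^sup>2)) =
      log_norm_const k \<nu> - (\<nu>' + k) / 2 * ln (\<nu> + (norm z)\<^sup>2)"
      by (simp add: \<nu>'_def field_simps)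
    also have "\<dots> \<le> log_norm_const k \<nu> - (\<nu>' + k) / 2 * ln (\<nu>' + (norm z)\<^sup>2)"
      using u \<nu>' by (intro diff_left_mono mult_left_mono) (simp_all add: k_def)
    finally have "p * ln (\<nu> + (norm z)\<^sup>2) + (log_norm_const k \<nu> - (\<nu> + k) / 2 * ln (\<nu> + (norm z)\<^sup>2)) \<le>
       (log_norm_const k \<nu> - log_norm_const k \<nu>') + (log_norm_const k \<nu>' - (\<nu>' + k) / 2 * ln (\<nu>' + (norm z)\<^sup>2))"
      by simp
    then have "exp (p * ln (\<nu> + (norm z)\<^sup>2)) * exp (log_norm_const k \<nu> - (\<nu> + k) / 2 * ln (\<nu> + (norm z)\<^sup>2)) \<le>
       C * exp (log_norm_const k \<nu>' - (\<nu>' + k) / 2 * ln (\<nu>' + (norm z)\<^sup>2))"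
      unfolding C_def mult_exp_exp by (simp only: exp_le_cancel_iff)
    then show ?thesis
      using u by (simp add: student_density_eq[OF spd_mat_1 \<nu>] student_density_eq[OF spd_mat_1 \<nu>'(1)] quad_standard k_def powr_def)
  qed
  have "(\<integral>\<^sup>+z. ennreal ((\<nu> + (norm (z :: real^'k))\<^sup>2) powr p) \<partial>student 0 (mat 1) \<nu>) =
      (\<integral>\<^sup>+z. ennreal (student_density 0 (mat 1) \<nu> z) * ennreal ((\<nu> + (norm (z :: real^'k))\<^sup>2) powr p) \<partial>lborel)"
    unfolding student_def by (rule nn_integral_density) measurable
  also have "\<dots> \<le> (\<integral>\<^sup>+z. ennreal C * ennreal (student_density 0 (mat 1) \<nu>' (z :: real^'k)) \<partial>lborel)"
  proof (rule nn_integral_mono)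
    fix z :: "real^'k"
    have "ennreal (student_density 0 (mat 1) \<nu> z) * ennreal ((\<nu> + (norm z)\<^sup>2) powr p) =
       ennreal ((\<nu> + (norm z)\<^sup>2) powr p * student_density 0 (mat 1) \<nu> z)"
      by (subst ennreal_mult') (simp_all add: mult.commute)
    also have "\<dots> \<le> ennreal (C * student_density 0 (mat 1) \<nu>' z)"
      by (rule ennreal_leI[OF le])
    also have "\<dots> = ennreal C * ennreal (student_density 0 (mat 1) \<nu>' z)"
      by (rule ennreal_mult') (simp add: C_def)
    finally show "ennreal (student_density 0 (mat 1) \<nu> z) * ennreal ((\<nu> + (norm z)\<^sup>2) powr p) \<le> ennreal C * ennreal (student_density 0 (mat 1) \<nu>' z)" .
  qed
  also have "\<dots> = ennreal C"
    by (simp add: nn_integral_cmult nn_integral_student_standard[OF \<nu>'(1)])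
  finally have fin: "(\<integral>\<^sup>+z. ennreal ((\<nu> + (norm (z :: real^'k))\<^sup>2) powr p) \<partial>student 0 (mat 1) \<nu>) < \<infinity>"
    by (rule le_less_trans) simp
  have "integrable (student 0 (mat 1) \<nu>) (\<lambda>z :: real^'k. (\<nu> + (norm z)\<^sup>2) powr p)"
    by (rule integrableI_nonneg) (use fin in auto)
  then show ?thesis
    by (subst integral_student_affine(2)[OF \<Sigma> \<nu>]) (simp_all add: quad_affine[OF \<Sigma>])
qed

text \<open>Only large values of \<open>quad\<close> matter: it is at least \<nu>, so a negative
  logarithm contributes no more than \<open>\<nu> powr (- p)\<close>.\<close>

lemma integrable_student_exp_ln:
  fixes \<mu> :: "real^'k"
  assumes \<Sigma>: "\<Sigma> \<in> spd" and \<nu>: "0 < \<nu>" and p: "2 * p < \<nu>" "0 \<le> p"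
  shows "integrable (student \<mu> \<Sigma> \<nu>) (\<lambda>x. exp (p * (1 + \<bar>ln (quad \<mu> \<Sigma> \<nu> x)\<bar>)))"
proof -
  interpret prob_space "student \<mu> \<Sigma> \<nu>" by (rule prob_space_student[OF \<Sigma> \<nu>])
  have "integrable (student \<mu> \<Sigma> \<nu>) (\<lambda>x. exp p * (quad \<mu> \<Sigma> \<nu> x powr p + \<nu> powr (- p)))"
    using integrable_student_quad_power[OF assms] by simp
  then show ?thesis
  proof (rule Bochner_Integration.integrable_bound[OF _ _ AE_I2])
    fix x
    have u: "0 < quad \<mu> \<Sigma> \<nu> x" "\<nu> \<le> quad \<mu> \<Sigma> \<nu> x" using quad_pos[OF \<Sigma> \<nu>] quad_ge[OF \<Sigma>] by auto
    have "exp (p * \<bar>ln (quad \<mu> \<Sigma> \<nu> x)\<bar>) \<le> quad \<mu> \<Sigma> \<nu> x powr p + \<nu> powr (- p)"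
    proof (cases "ln (quad \<mu> \<Sigma> \<nu> x) \<ge> 0")
      case True
      then show ?thesis using u by (simp add: powr_def)
    next
      case False
      then have "p * \<bar>ln (quad \<mu> \<Sigma> \<nu> x)\<bar> \<le> - p * ln \<nu>"
        using u \<nu> p by (simp add: mult_left_mono)
      then have "exp (p * \<bar>ln (quad \<mu> \<Sigma> \<nu> x)\<bar>) \<le> \<nu> powr (- p)"
        using \<nu> by (simp add: powr_def)
      then show ?thesis by (simp add: add_increasing)
    qed
    then have "exp p * exp (p * \<bar>ln (quad \<mu> \<Sigma> \<nu> x)\<bar>) \<le> exp p * (quad \<mu> \<Sigma> \<nu> x powr p + \<nu> powr (- p))"
      by (intro mult_left_mono) auto
    then show "norm (exp (p * (1 + \<bar>ln (quad \<mu> \<Sigma> \<nu> x)\<bar>))) \<le> norm (exp p * (quad \<mu> \<Sigma> \<nu> x powr p + \<nu> powr (- p)))"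
      by (simp add: distrib_left exp_add)
  qed measurable
qed

lemma power2_le_exp:
  fixes s :: real
  assumes "0 < p" "0 \<le> s"
  shows "s\<^sup>2 \<le> (2 / p)\<^sup>2 * exp (p * s)"
proof -
  have "p / 2 * s \<le> exp (p / 2 * s)" using exp_ge_add_one_self[of "p / 2 * s"] by linarith
  then have "(p / 2 * s)\<^sup>2 \<le> (exp (p / 2 * s))\<^sup>2" using assms by (intro power_mono) auto
  then have "(2 / p)\<^sup>2 * (p / 2 * s)\<^sup>2 \<le> (2 / p)\<^sup>2 * exp (p * s)"
    by (intro mult_left_mono) (simp_all add: exp_double[symmetric])
  then show ?thesis using assms by (simp add: power_mult_distrib power_divide)
qed

text \<open>The domination test used for squared ratio differences and for exponentially weighted
  radial scores. The square is absorbed into \<open>exp (p * s)\<close>, which raises the total rate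
  to \<open>3 * p / 2\<close>; integrability requires twice this rate to stay below \<nu>.\<close>

lemma integrable_student_log_bound:
  fixes \<mu> :: "real^'k"
  assumes \<Sigma>: "\<Sigma> \<in> spd" and \<nu>: "0 < \<nu>" and p: "3 * p < \<nu>" "0 < p"
    and m: "f \<in> borel_measurable borel"
    and f: "\<And>x. \<bar>f x\<bar> \<le> C * ((1 + \<bar>ln (quad \<mu> \<Sigma> \<nu> x)\<bar>)\<^sup>2 * exp (p / 2 * (1 + \<bar>ln (quad \<mu> \<Sigma> \<nu> x)\<bar>)))"
  shows "integrable (student \<mu> \<Sigma> \<nu>) f"
proof (rule Bochner_Integration.integrable_bound[OF _ _ AE_I2])
  define q where "q = 3 * p / 2"
  show "integrable (student \<mu> \<Sigma> \<nu>) (\<lambda>x. \<bar>C\<bar> * ((2 / p)\<^sup>2 * exp (q * (1 + \<bar>ln (quad \<mu> \<Sigma> \<nu> x)\<bar>))))"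
    using p by (intro integrable_mult_right integrable_student_exp_ln[OF \<Sigma> \<nu>]) (simp_all add: q_def)
  show "f \<in> borel_measurable (student \<mu> \<Sigma> \<nu>)" using m by simp
  fix x
  define s where "s = 1 + \<bar>ln (quad \<mu> \<Sigma> \<nu> x)\<bar>"
  have s: "0 \<le> s" by (simp add: s_def)
  have "\<bar>f x\<bar> \<le> \<bar>C\<bar> * (s\<^sup>2 * exp (p / 2 * s))"
    using order_trans[OF f[of x, folded s_def] mult_right_mono[OF abs_ge_self]] by simp
  also have "\<dots> \<le> \<bar>C\<bar> * (((2 / p)\<^sup>2 * exp (p * s)) * exp (p / 2 * s))"
    using power2_le_exp[OF p(2) s] by (intro mult_left_mono mult_right_mono) auto
  also have "\<dots> = \<bar>C\<bar> * ((2 / p)\<^sup>2 * exp (q * s))"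
    by (simp add: mult.assoc mult_exp_exp q_def algebra_simps)
  finally show "norm (f x) \<le> norm (\<bar>C\<bar> * ((2 / p)\<^sup>2 * exp (q * (1 + \<bar>ln (quad \<mu> \<Sigma> \<nu> x)\<bar>))))"
    by (simp add: s_def abs_mult)
qed

section \<open>Derivatives and Lipschitz bounds of the log density\<close>

lemma det_has_derivative:
  fixes \<Sigma> :: "real^'k^'k"
  shows "\<exists>D. (det has_derivative D) (at \<Sigma>)"
proof -
  have comp: "((\<lambda>S :: real^'k^'k. S $ i $ j) has_derivative (\<lambda>H. H $ i $ j)) (at \<Sigma>)" for i j
    by (intro bounded_linear_imp_has_derivative bounded_linear_compose[OF bounded_linear_vec_nth bounded_linear_vec_nth])
  have "((\<lambda>S :: real^'k^'k. \<Sum>p\<in>{p. p permutes UNIV}. of_int (sign p) * (\<Prod>i\<in>UNIV. S $ i $ p i)) has_derivative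
     (\<lambda>H. \<Sum>p\<in>{p. p permutes UNIV}. of_int (sign p) * (\<Sum>i\<in>UNIV. H $ i $ p i * (\<Prod>j\<in>UNIV - {i}. \<Sigma> $ j $ p j)))) (at \<Sigma>)"
    by (intro has_derivative_sum has_derivative_mult_right has_derivative_prod comp)
  then show ?thesis unfolding det_def[abs_def] by blast
qed

text \<open>For positive definite \<Sigma> this is \<open>trace (matrix_inv \<Sigma> ** H)\<close>
  in direction \<open>H\<close>, by Jacobi's formula. It is kept abstract here; what is required of
  it is extracted later from the centring of the scatter score.\<close>

definition ln_det_deriv :: "real^'k^'k \<Rightarrow> real^'k^'k \<Rightarrow> real" where
  "ln_det_deriv \<Sigma> = frechet_derivative (\<lambda>S. ln (det S)) (at \<Sigma>)"

lemma ln_det_has_derivative: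
  assumes "\<Sigma> \<in> spd"
  shows "((\<lambda>S. ln (det S)) has_derivative ln_det_deriv \<Sigma>) (at \<Sigma>)"
proof -
  obtain D where "(det has_derivative D) (at \<Sigma>)" using det_has_derivative by blast
  then have "((\<lambda>S. ln (det S)) has_derivative (\<lambda>H. D H * inverse (det \<Sigma>))) (at \<Sigma>)"
    using spd_det(2)[OF assms] by (auto intro!: derivative_eq_intros)
  then have "(\<lambda>S. ln (det S)) differentiable (at \<Sigma>)" by (auto simp: differentiable_def)
  then show ?thesis unfolding ln_det_deriv_def by (simp add: frechet_derivative_works)
qed

definition log_norm_deriv :: "real \<Rightarrow> real \<Rightarrow> real" where
  "log_norm_deriv k \<nu> = deriv (log_norm_const k) \<nu>"

lemma log_norm_has_derivative:
  assumes \<nu>: "0 < \<nu>" and k: "0 \<le> k"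
  shows "(log_norm_const k has_field_derivative log_norm_deriv k \<nu>) (at \<nu>)"
proof -
  have "(\<nu> + k) / 2 \<notin> \<int>\<^sub>\<le>\<^sub>0" "\<nu> / 2 \<notin> \<int>\<^sub>\<le>\<^sub>0"
    using \<nu> k by (auto elim!: nonpos_Ints_cases)
  moreover have "Gamma ((\<nu> + k) / 2) > 0" "Gamma (\<nu> / 2) > 0" using \<nu> k by (auto intro!: Gamma_real_pos)
  ultimately have "\<exists>D. (log_norm_const k has_field_derivative D) (at \<nu>)"
    unfolding log_norm_const_def[abs_def] using \<nu>
    by (intro exI) (auto intro!: derivative_eq_intros)
  then show ?thesis by (auto simp: log_norm_deriv_def DERIV_deriv_iff_field_differentiable field_differentiable_def)
qed

text \<open>A formula on the whole space of triples, so that it can be differentiated in every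
  matrix direction. It is the logarithm of the density where \<Sigma> is positive definite and \<nu>
  positive.\<close>

definition log_density :: "real^'k \<Rightarrow> (real^'k) \<times> (real^'k^'k) \<times> real \<Rightarrow> real" where
  "log_density x = (\<lambda>(\<mu>, \<Sigma>, \<nu>). log_norm_const (real CARD('k)) \<nu> - ln (det \<Sigma>) / 2
     - (\<nu> + real CARD('k)) / 2 * ln (quad \<mu> \<Sigma> \<nu> x))"

text \<open>The derivative of \<open>quad\<close> in its parameters. The last term stems from the
  derivative of matrix inversion, which is
  \<open>- (matrix_inv \<Sigma> ** H ** matrix_inv \<Sigma>)\<close> in direction
  \<open>H\<close>.\<close>

definition quad_deriv ::
    "real^'k \<Rightarrow> (real^'k) \<times> (real^'k^'k) \<times> real \<Rightarrow> (real^'k) \<times> (real^'k^'k) \<times> real \<Rightarrow> real" where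
  "quad_deriv x = (\<lambda>(\<mu>, \<Sigma>, \<nu>) (m, H, \<tau>). \<tau> - 2 * (m \<bullet> (matrix_inv \<Sigma> *v (x - \<mu>)))
     - (matrix_inv \<Sigma> *v (x - \<mu>)) \<bullet> (H *v (matrix_inv \<Sigma> *v (x - \<mu>))))"

text \<open>The derivative of \<open>log_density\<close> in direction \<open>(m, H, \<tau>)\<close>.
  Full matrices serve as scatter directions; half-vectorised coordinates enter only through
  \<open>score2_eq\<close>.\<close>

definition score ::
    "(real^'k) \<times> (real^'k^'k) \<times> real \<Rightarrow> (real^'k) \<times> (real^'k^'k) \<times> real \<Rightarrow> real^'k \<Rightarrow> real" where
  "score = (\<lambda>(\<mu>, \<Sigma>, \<nu>) (m, H, \<tau>) x. log_norm_deriv (real CARD('k)) \<nu> * \<tau> - ln_det_deriv \<Sigma> H / 2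
     - (\<tau> / 2 * ln (quad \<mu> \<Sigma> \<nu> x) + (\<nu> + real CARD('k)) / 2 * (quad_deriv x (\<mu>, \<Sigma>, \<nu>) (m, H, \<tau>) / quad \<mu> \<Sigma> \<nu> x)))"

definition Quad :: "real^'k \<Rightarrow> (real^'k) \<times> (real^'k^'k) \<times> real \<Rightarrow> real" where
  "Quad x = (\<lambda>(\<mu>, \<Sigma>, \<nu>). quad \<mu> \<Sigma> \<nu> x)"

lemma norm_triple_le:
  fixes h :: "'a::real_normed_vector \<times> 'b::real_normed_vector \<times> real"
  shows "norm (fst h) \<le> norm h" "norm (fst (snd h)) \<le> norm h" "\<bar>snd (snd h)\<bar> \<le> norm h"
proof -
  obtain a b c where h: "h = (a, b, c)" by (cases h)
  show "norm (fst h) \<le> norm h" "norm (fst (snd h)) \<le> norm h" "\<bar>snd (snd h)\<bar> \<le> norm h"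
    using norm_fst_le[of a "(b, c)"] norm_snd_le[of "(b, c)" a] norm_fst_le[of b c] norm_snd_le[of c b]
    by (simp_all add: h)
qed

text \<open>All errors are measured relative to \<open>quad\<close> and uniformly in x, which is
  what later makes \<open>ln (quad)\<close> uniformly Lipschitz in the parameter. The vectors
  \<open>w\<close> and \<open>w'\<close> solve linear systems with matrices \<Sigma> and
  \<open>\<Sigma> + H\<close>; coercivity bounds them and their difference by multiples of
  \<open>s = 1 + norm y\<close>, and \<open>s\<^sup>2\<close> is at most a multiple of
  \<open>quad\<close>.\<close>

lemma quad_perturbation:
  fixes \<mu> :: "real^'k"
  assumes \<Sigma>: "\<Sigma> \<in> spd" and \<nu>: "0 < \<nu>"
  obtains K d where "K > 0" "d > 0"
    "\<And>h x. norm h \<le> d \<Longrightarrow> \<bar>Quad x ((\<mu>, \<Sigma>, \<nu>) + h) - quad \<mu> \<Sigma> \<nu> x\<bar> \<le> K * norm h * quad \<mu> \<Sigma> \<nu> x"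
    "\<And>h x. norm h \<le> d \<Longrightarrow> \<bar>Quad x ((\<mu>, \<Sigma>, \<nu>) + h) - quad \<mu> \<Sigma> \<nu> x - quad_deriv x (\<mu>, \<Sigma>, \<nu>) h\<bar>
       \<le> K * (norm h)\<^sup>2 * quad \<mu> \<Sigma> \<nu> x"
proof -
  obtain m0 where m0: "m0 > 0" "\<And>x. m0 * (norm x)\<^sup>2 \<le> x \<bullet> (\<Sigma> *v x)" using spd_coercive[OF \<Sigma>] by metis
  define c where "c = 1 / m0"
  have c: "c > 0" "m0 * c = 1" using m0 by (simp_all add: c_def)
  \<comment> \<open>This radius keeps \<open>\<Sigma> + H\<close> coercive with constant
    \<open>m0 / 2\<close> and the location shift at most 1. As \<open>H\<close> ranges over all
    matrices, invertibility of \<open>\<Sigma> + H\<close> is drawn from coercivity.\<close>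
  define d where "d = min 1 (m0 / 2)"
  have d: "d > 0" "d \<le> 1" "d \<le> m0 / 2" using m0 by (simp_all add: d_def)
  define A where "A = norm \<Sigma>"
  \<comment> \<open>Chosen for \<open>s\<^sup>2 \<le> C0 * quad\<close>: the summand 1 in
    \<open>s\<close> is paid for by \<nu>, and \<open>norm y\<close> by the quadratic form.
    \<open>K\<close> below adds up the coefficients of the first and second order estimates, so that
    one constant serves both.\<close>
  define C0 where "C0 = 2 / \<nu> + 2 * A\<^sup>2 * c"
  have C0: "C0 > 0" using \<nu> c by (simp add: C0_def add_pos_nonneg)
  define K where "K = C0 * (1 + 3 * c + 2 * c\<^sup>2 + (1 + c) * (c * (1 + 2 * c)))"
  have K: "K > 0" using C0 c by (simp add: K_def add_pos_pos)
  have main: "\<bar>Quad x ((\<mu>, \<Sigma>, \<nu>) + h) - quad \<mu> \<Sigma> \<nu> x\<bar> \<le> K * norm h * quad \<mu> \<Sigma> \<nu> x \<and>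
     \<bar>Quad x ((\<mu>, \<Sigma>, \<nu>) + h) - quad \<mu> \<Sigma> \<nu> x - quad_deriv x (\<mu>, \<Sigma>, \<nu>) h\<bar> \<le> K * (norm h)\<^sup>2 * quad \<mu> \<Sigma> \<nu> x"
    if h: "norm h \<le> d" for h x
  proof -
    obtain m H \<tau> where hh: "h = (m, H, \<tau>)" by (cases h)
    define \<delta> where "\<delta> = norm h"
    have \<delta>: "norm m \<le> \<delta>" "norm H \<le> \<delta>" "\<bar>\<tau>\<bar> \<le> \<delta>" "0 \<le> \<delta>" "\<delta> \<le> d"
      using norm_triple_le[of h] h by (simp_all add: \<delta>_def hh)
    define y y' w w' where "y = x - \<mu>" and "y' = x - (\<mu> + m)" and "w = matrix_inv \<Sigma> *v y" and "w' = matrix_inv (\<Sigma> + H) *v y'"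
    have y': "y' = y - m" by (simp add: y_def y'_def)
    have H_le: "\<bar>v \<bullet> (H *v v)\<bar> \<le> \<delta> * (norm v)\<^sup>2" for v
    proof -
      have "\<bar>v \<bullet> (H *v v)\<bar> \<le> norm v * (norm H * norm v)"
        by (rule order_trans[OF Cauchy_Schwarz_ineq2]) (intro mult_left_mono norm_matrix_vector_mult_le norm_ge_zero)
      also have "\<dots> \<le> norm v * (\<delta> * norm v)" using \<delta> by (intro mult_left_mono mult_right_mono) auto
      finally show ?thesis by (simp add: power2_eq_square mult_ac)
    qed
    have coer: "m0 / 2 * (norm v)\<^sup>2 \<le> v \<bullet> ((\<Sigma> + H) *v v)" for v
    proof -
      have "\<delta> * (norm v)\<^sup>2 \<le> m0 / 2 * (norm v)\<^sup>2" using \<delta> d by (intro mult_right_mono) auto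
      then have "m0 * (norm v)\<^sup>2 - m0 / 2 * (norm v)\<^sup>2 \<le> v \<bullet> (\<Sigma> *v v) + v \<bullet> (H *v v)"
        using m0(2)[of v] H_le[of v] by linarith
      then show ?thesis by (simp add: matrix_vector_mult_add_rdistrib inner_add_right)
    qed
    have inv': "invertible (\<Sigma> + H)"
    proof -
      have "v = 0" if "(\<Sigma> + H) *v v = 0" for v
        using coer[of v] that m0(1) by (simp add: mult_le_0_iff)
      then show ?thesis by (simp add: invertible_left_inverse matrix_left_invertible_ker)
    qed
    have w: "\<Sigma> *v w = y" and w': "(\<Sigma> + H) *v w' = y'"
      by (simp_all add: w_def w'_def matrix_inv_vector[OF spd_invertible[OF \<Sigma>]] matrix_inv_vector[OF inv'])
    define s where "s = 1 + norm y"
    have s: "1 \<le> s" "norm y \<le> s" by (simp_all add: s_def)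
    have norm_bd: "norm v \<le> b" if "a * (norm v)\<^sup>2 \<le> norm v * (a * b)" "0 < a" "0 \<le> b" for v :: "real^'k" and a b
    proof (cases "v = 0")
      case False
      then have "a * norm v * norm v \<le> a * b * norm v" using that by (simp add: power2_eq_square mult_ac)
      then show ?thesis using False that by simp
    qed (use that in simp)
    have nw: "norm w \<le> c * s"
    proof (rule norm_bd[OF _ m0(1)])
      have "m0 * (norm w)\<^sup>2 \<le> w \<bullet> y" using m0(2)[of w] by (simp add: w)
      also have "\<dots> \<le> norm w * s" using s by (intro order_trans[OF norm_cauchy_schwarz] mult_left_mono) auto
      also have "\<dots> = norm w * (m0 * (c * s))" using c by (simp add: mult.assoc[symmetric])
      finally show "m0 * (norm w)\<^sup>2 \<le> norm w * (m0 * (c * s))" .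
    qed (use c s in simp)
    have nw': "norm w' \<le> 2 * c * s"
    proof (rule norm_bd[where a = "m0 / 2"])
      have "norm y' \<le> norm y + norm m" unfolding y' by (rule norm_triangle_ineq4)
      also have "\<dots> \<le> s" using \<delta> d by (simp add: s_def)
      finally have ny': "norm y' \<le> s" .
      have "m0 / 2 * (norm w')\<^sup>2 \<le> w' \<bullet> y'" using coer[of w'] by (simp add: w')
      also have "\<dots> \<le> norm w' * s" using ny' by (intro order_trans[OF norm_cauchy_schwarz] mult_left_mono) auto
      also have "\<dots> = norm w' * (m0 / 2 * (2 * c * s))" using c by (simp add: mult.assoc[symmetric])
      finally show "m0 / 2 * (norm w')\<^sup>2 \<le> norm w' * (m0 / 2 * (2 * c * s))" .
    qed (use c s m0 in simp_all)
    have nHw': "norm (H *v w') \<le> \<delta> * (2 * c * s)"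
      by (rule order_trans[OF norm_matrix_vector_mult_le]) (use \<delta> nw' in \<open>intro mult_mono; simp\<close>)
    have ndw: "norm (w' - w) \<le> c * (\<delta> * (1 + 2 * c) * s)"
    proof (rule norm_bd[OF _ m0(1)])
      \<comment> \<open>The difference of the two linear systems, as in the resolvent
        identity.\<close>
      have eq: "\<Sigma> *v (w' - w) = - (m + H *v w')"
        using w w' by (simp add: matrix_vector_mult_diff_distrib matrix_vector_mult_add_rdistrib y' algebra_simps)
      have "norm (m + H *v w') \<le> \<delta> + \<delta> * (2 * c * s)"
        using \<delta> nHw' by (intro order_trans[OF norm_triangle_ineq] add_mono)
      also have "\<dots> \<le> \<delta> * (1 + 2 * c) * s"
        using \<delta> s c mult_left_mono[of 1 s \<delta>] by (simp add: algebra_simps)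
      finally have n: "norm (m + H *v w') \<le> \<delta> * (1 + 2 * c) * s" .
      have "m0 * (norm (w' - w))\<^sup>2 \<le> (w' - w) \<bullet> (\<Sigma> *v (w' - w))" by (rule m0(2))
      also have "\<dots> \<le> norm (w' - w) * (\<delta> * (1 + 2 * c) * s)"
        using n norm_minus_cancel[of "m + H *v w'", folded eq]
        by (intro order_trans[OF norm_cauchy_schwarz] mult_left_mono) auto
      also have "\<dots> = norm (w' - w) * (m0 * (c * (\<delta> * (1 + 2 * c) * s)))" using c by (simp add: mult.assoc[symmetric])
      finally show "m0 * (norm (w' - w))\<^sup>2 \<le> norm (w' - w) * (m0 * (c * (\<delta> * (1 + 2 * c) * s)))" .
    qed (use c s \<delta> in simp)
    have u: "quad \<mu> \<Sigma> \<nu> x = \<nu> + w \<bullet> (\<Sigma> *v w)"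
      unfolding w by (simp add: quad_def y_def[symmetric] w_def[symmetric] inner_commute)
    have s2: "s\<^sup>2 \<le> C0 * quad \<mu> \<Sigma> \<nu> x"
    proof -
      have "norm y \<le> A * norm w" unfolding w[symmetric] A_def by (rule norm_matrix_vector_mult_le)
      then have "(norm y)\<^sup>2 \<le> (A * norm w)\<^sup>2" by (intro power_mono) auto
      also have "\<dots> = A\<^sup>2 * c * (m0 * (norm w)\<^sup>2)" using c by (simp add: power_mult_distrib mult_ac)
      also have "\<dots> \<le> A\<^sup>2 * c * (w \<bullet> (\<Sigma> *v w))" using m0(2)[of w] c by (intro mult_left_mono) auto
      finally have 1: "(norm y)\<^sup>2 \<le> A\<^sup>2 * c * (w \<bullet> (\<Sigma> *v w))" .
      have 2: "0 \<le> w \<bullet> (\<Sigma> *v w)" using m0(2)[of w] m0(1) by (meson mult_nonneg_nonneg less_imp_le order_trans zero_le_power2)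
      have "s\<^sup>2 \<le> 2 + 2 * (norm y)\<^sup>2"
        using zero_le_power2[of "1 - norm y"] by (simp add: s_def power2_eq_square algebra_simps)
      also have "\<dots> \<le> 2 + 2 * (A\<^sup>2 * c * (w \<bullet> (\<Sigma> *v w)))" using 1 by simp
      also have "\<dots> \<le> 2 + 2 * A\<^sup>2 * c * \<nu> + (2 / \<nu>) * (w \<bullet> (\<Sigma> *v w)) + 2 * (A\<^sup>2 * c * (w \<bullet> (\<Sigma> *v w)))"
        using \<nu> c 2 by simp
      also have "\<dots> = C0 * quad \<mu> \<Sigma> \<nu> x" using \<nu> by (simp add: C0_def u field_simps)
      finally show ?thesis .
    qed
    have sym: "w \<bullet> (\<Sigma> *v w') = (\<Sigma> *v w) \<bullet> w'" by (rule symmetric_inner_matrix[OF spdD(1)[OF \<Sigma>]])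
    have quad': "Quad x ((\<mu>, \<Sigma>, \<nu>) + h) = \<nu> + \<tau> + y' \<bullet> w'"
      by (simp add: Quad_def hh quad_def w'_def y'_def)
    \<comment> \<open>An exact identity, obtained by pairing \<open>w\<close> with the equation for
      \<open>w'\<close>. Replacing \<open>w'\<close> by \<open>w\<close> gives the derivative, and
      the remainder in \<open>id2\<close> gains a second small factor from
      \<open>w' - w\<close>.\<close>
    have id1: "Quad x ((\<mu>, \<Sigma>, \<nu>) + h) - quad \<mu> \<Sigma> \<nu> x = \<tau> - m \<bullet> (w' + w) - w \<bullet> (H *v w')"
    proof -
      have "w \<bullet> y' = w \<bullet> (\<Sigma> *v w') + w \<bullet> (H *v w')"
        unfolding w'[symmetric] by (simp add: matrix_vector_mult_add_rdistrib inner_add_right)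
      then have "w \<bullet> y - w \<bullet> m = y \<bullet> w' + w \<bullet> (H *v w')"
        unfolding sym w y' by (simp add: inner_diff_right)
      then show ?thesis
        unfolding quad' u w y' by (simp add: inner_diff_left inner_add_right inner_commute algebra_simps)
    qed
    have qd: "quad_deriv x (\<mu>, \<Sigma>, \<nu>) h = \<tau> - 2 * (m \<bullet> w) - w \<bullet> (H *v w)"
      by (simp add: quad_deriv_def hh w_def y_def)
    have id2: "Quad x ((\<mu>, \<Sigma>, \<nu>) + h) - quad \<mu> \<Sigma> \<nu> x - quad_deriv x (\<mu>, \<Sigma>, \<nu>) h = - (m \<bullet> (w' - w)) - w \<bullet> (H *v (w' - w))"
      unfolding id1 qd by (simp add: inner_add_right inner_diff_right matrix_vector_mult_diff_distrib)
    have abs1: "\<bar>m \<bullet> v\<bar> \<le> \<delta> * b" if "norm v \<le> b" for v b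
      by (rule order_trans[OF Cauchy_Schwarz_ineq2]) (use \<delta> that in \<open>intro mult_mono; simp\<close>)
    have abs2: "\<bar>w \<bullet> (H *v v)\<bar> \<le> c * s * (\<delta> * b)" if "norm v \<le> b" for v b
    proof (rule order_trans[OF Cauchy_Schwarz_ineq2], rule mult_mono[OF nw])
      show "norm (H *v v) \<le> \<delta> * b"
        by (rule order_trans[OF norm_matrix_vector_mult_le]) (use \<delta> that in \<open>intro mult_mono; simp\<close>)
    qed (use c s in simp_all)
    have ss: "s \<le> s\<^sup>2" "1 \<le> s\<^sup>2" using s by (simp_all add: power2_eq_square mult_le_cancel_left1 mult_ge1_I)
    have "norm (w' + w) \<le> 3 * c * s" using norm_triangle_ineq[of w' w] nw nw' by linarith
    note a1 = abs1[OF this] and a2 = abs2[OF nw'] and a3 = abs1[OF ndw] and a4 = abs2[OF ndw]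
    have "\<bar>Quad x ((\<mu>, \<Sigma>, \<nu>) + h) - quad \<mu> \<Sigma> \<nu> x\<bar> \<le> \<delta> + \<delta> * (3 * c * s) + c * s * (\<delta> * (2 * c * s))"
      unfolding id1 using a1 a2 \<delta>(3) by linarith
    also have "\<dots> \<le> \<delta> * s\<^sup>2 + \<delta> * (3 * c * s\<^sup>2) + \<delta> * (2 * c\<^sup>2 * s\<^sup>2)"
    proof -
      have "\<delta> * 1 \<le> \<delta> * s\<^sup>2" "\<delta> * (3 * c * s) \<le> \<delta> * (3 * c * s\<^sup>2)"
        using \<delta> c ss by (intro mult_left_mono; simp)+
      then show ?thesis by (simp add: power2_eq_square mult_ac)
    qed
    also have "\<dots> = \<delta> * (1 + 3 * c + 2 * c\<^sup>2) * s\<^sup>2" by (simp add: algebra_simps)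
    also have "\<dots> \<le> \<delta> * (1 + 3 * c + 2 * c\<^sup>2 + (1 + c) * (c * (1 + 2 * c))) * (C0 * quad \<mu> \<Sigma> \<nu> x)"
      using \<delta> c s2 by (intro mult_mono) (auto intro!: add_nonneg_nonneg)
    finally have r1: "\<bar>Quad x ((\<mu>, \<Sigma>, \<nu>) + h) - quad \<mu> \<Sigma> \<nu> x\<bar> \<le> K * \<delta> * quad \<mu> \<Sigma> \<nu> x"
      by (simp add: K_def mult_ac)
    have "\<bar>Quad x ((\<mu>, \<Sigma>, \<nu>) + h) - quad \<mu> \<Sigma> \<nu> x - quad_deriv x (\<mu>, \<Sigma>, \<nu>) h\<bar> \<le>
      \<delta> * (c * (\<delta> * (1 + 2 * c) * s)) + c * s * (\<delta> * (c * (\<delta> * (1 + 2 * c) * s)))"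
      unfolding id2 using a3 a4 by linarith
    also have "\<dots> \<le> \<delta>\<^sup>2 * (c * (1 + 2 * c)) * s\<^sup>2 + \<delta>\<^sup>2 * (c * (c * (1 + 2 * c))) * s\<^sup>2"
    proof -
      have "\<delta>\<^sup>2 * (c * (1 + 2 * c)) * s \<le> \<delta>\<^sup>2 * (c * (1 + 2 * c)) * s\<^sup>2"
        using c ss by (intro mult_left_mono) auto
      then show ?thesis by (simp add: power2_eq_square mult_ac)
    qed
    also have "\<dots> = \<delta>\<^sup>2 * ((1 + c) * (c * (1 + 2 * c))) * s\<^sup>2" by (simp add: algebra_simps)
    also have "\<dots> \<le> \<delta>\<^sup>2 * (1 + 3 * c + 2 * c\<^sup>2 + (1 + c) * (c * (1 + 2 * c))) * (C0 * quad \<mu> \<Sigma> \<nu> x)"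
      using \<delta> c s2 by (intro mult_mono) (auto intro!: add_nonneg_nonneg)
    finally have r2: "\<bar>Quad x ((\<mu>, \<Sigma>, \<nu>) + h) - quad \<mu> \<Sigma> \<nu> x - quad_deriv x (\<mu>, \<Sigma>, \<nu>) h\<bar> \<le> K * \<delta>\<^sup>2 * quad \<mu> \<Sigma> \<nu> x"
      by (simp add: K_def mult_ac)
    show ?thesis using r1 r2 by (simp add: \<delta>_def)
  qed
  show ?thesis using that[OF K d(1)] main by blast
qed

lemma Quad_has_derivative:
  assumes \<Sigma>: "\<Sigma> \<in> spd" and \<nu>: "0 < \<nu>"
  shows "(Quad x has_derivative quad_deriv x (\<mu>, \<Sigma>, \<nu>)) (at (\<mu>, \<Sigma>, \<nu>))"
proof -
  have lin: "linear (quad_deriv x (\<mu>, \<Sigma>, \<nu>))"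
    by (rule linearI) (auto simp: quad_deriv_def split_beta inner_add_left inner_add_right matrix_vector_mult_add_rdistrib
        scaleR_matrix_vector_assoc[symmetric] algebra_simps)
  obtain K d where K: "K > 0" "d > 0"
    "\<And>h x. norm h \<le> d \<Longrightarrow> \<bar>Quad x ((\<mu>, \<Sigma>, \<nu>) + h) - quad \<mu> \<Sigma> \<nu> x - quad_deriv x (\<mu>, \<Sigma>, \<nu>) h\<bar>
       \<le> K * (norm h)\<^sup>2 * quad \<mu> \<Sigma> \<nu> x"
    using quad_perturbation[OF assms] by metis
  define C where "C = K * quad \<mu> \<Sigma> \<nu> x"
  have C: "C > 0" using K quad_pos[OF assms] by (simp add: C_def)
  show ?thesis
    unfolding has_derivative_at_alt
  proof (intro conjI allI impI)
    show "bounded_linear (quad_deriv x (\<mu>, \<Sigma>, \<nu>))" using lin by (simp add: linear_conv_bounded_linear)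
    fix e :: real assume e: "e > 0"
    show "\<exists>d>0. \<forall>y. norm (y - (\<mu>, \<Sigma>, \<nu>)) < d \<longrightarrow>
        norm (Quad x y - Quad x (\<mu>, \<Sigma>, \<nu>) - quad_deriv x (\<mu>, \<Sigma>, \<nu>) (y - (\<mu>, \<Sigma>, \<nu>))) \<le> e * norm (y - (\<mu>, \<Sigma>, \<nu>))"
    proof (intro exI[of _ "min d (e / C)"] conjI allI impI)
      show "0 < min d (e / C)" using K e C by simp
      fix y assume y: "norm (y - (\<mu>, \<Sigma>, \<nu>)) < min d (e / C)"
      define h where "h = y - (\<mu>, \<Sigma>, \<nu>)"
      have "\<bar>Quad x ((\<mu>, \<Sigma>, \<nu>) + h) - quad \<mu> \<Sigma> \<nu> x - quad_deriv x (\<mu>, \<Sigma>, \<nu>) h\<bar> \<le> (C * norm h) * norm h"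
        using K(3)[of h x] y by (simp add: h_def C_def power2_eq_square mult_ac)
      also have "\<dots> \<le> e * norm h"
        using y C by (intro mult_right_mono) (simp_all add: h_def pos_less_divide_eq mult.commute)
      finally show "norm (Quad x y - Quad x (\<mu>, \<Sigma>, \<nu>) - quad_deriv x (\<mu>, \<Sigma>, \<nu>) (y - (\<mu>, \<Sigma>, \<nu>))) \<le> e * norm (y - (\<mu>, \<Sigma>, \<nu>))"
        by (simp add: h_def Quad_def)
    qed
  qed
qed

lemma log_density_has_derivative:
  fixes \<mu> :: "real^'k"
  assumes \<Sigma>: "\<Sigma> \<in> spd" and \<nu>: "0 < \<nu>"
  shows "((\<lambda>\<theta>. log_norm_const (real CARD('k)) (snd (snd \<theta>)) - ln (det (fst (snd \<theta>))) / 2) has_derivative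
      (\<lambda>h. log_norm_deriv (real CARD('k)) \<nu> * snd (snd h) - ln_det_deriv \<Sigma> (fst (snd h)) / 2)) (at (\<mu>, \<Sigma>, \<nu>))"
    and "(log_density x has_derivative (\<lambda>h. score (\<mu>, \<Sigma>, \<nu>) h x)) (at (\<mu>, \<Sigma>, \<nu>))"
proof -
  let ?k = "real CARD('k)" and ?\<theta> = "(\<mu>, \<Sigma>, \<nu>)"
  have 1: "((\<lambda>\<theta>. log_norm_const ?k (snd (snd \<theta>))) has_derivative (\<lambda>h. log_norm_deriv ?k \<nu> * snd (snd h))) (at ?\<theta>)"
  proof -
    have "(log_norm_const ?k has_derivative (\<lambda>t. log_norm_deriv ?k \<nu> * t)) (at (snd (snd ?\<theta>)))"
      using log_norm_has_derivative[OF \<nu>, of ?k] by (simp add: has_field_derivative_def)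
    moreover have "((\<lambda>\<theta>. snd (snd \<theta>)) has_derivative (\<lambda>h. snd (snd h))) (at ?\<theta>)"
      by (auto intro!: derivative_eq_intros)
    ultimately show ?thesis by (rule has_derivative_compose[rotated])
  qed
  have 2: "((\<lambda>\<theta>. ln (det (fst (snd \<theta>)))) has_derivative (\<lambda>h. ln_det_deriv \<Sigma> (fst (snd h)))) (at ?\<theta>)"
  proof -
    have "((\<lambda>S. ln (det S)) has_derivative ln_det_deriv \<Sigma>) (at (fst (snd ?\<theta>)))"
      using ln_det_has_derivative[OF \<Sigma>] by simp
    moreover have "((\<lambda>\<theta>. fst (snd \<theta>)) has_derivative (\<lambda>h. fst (snd h))) (at ?\<theta>)"
      by (auto intro!: derivative_eq_intros)
    ultimately show ?thesis by (rule has_derivative_compose[rotated])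
  qed
  show 3: "((\<lambda>\<theta>. log_norm_const ?k (snd (snd \<theta>)) - ln (det (fst (snd \<theta>))) / 2) has_derivative
      (\<lambda>h. log_norm_deriv ?k \<nu> * snd (snd h) - ln_det_deriv \<Sigma> (fst (snd h)) / 2)) (at ?\<theta>)"
    by (rule has_derivative_diff[OF 1 bounded_linear.has_derivative[OF bounded_linear_divide 2]])
  have q: "0 < Quad x ?\<theta>" using quad_pos[OF assms] by (simp add: Quad_def)
  have 4: "((\<lambda>\<theta>. ln (Quad x \<theta>)) has_derivative (\<lambda>h. quad_deriv x ?\<theta> h * inverse (Quad x ?\<theta>))) (at ?\<theta>)"
    by (rule has_derivative_ln[OF q Quad_has_derivative[OF assms]])
  have 5: "((\<lambda>\<theta>. (snd (snd \<theta>) + ?k) / 2) has_derivative (\<lambda>h. snd (snd h) / 2)) (at ?\<theta>)"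
    by (auto intro!: derivative_eq_intros)
  have 6: "((\<lambda>\<theta>. log_norm_const ?k (snd (snd \<theta>)) - ln (det (fst (snd \<theta>))) / 2 - (snd (snd \<theta>) + ?k) / 2 * ln (Quad x \<theta>)) has_derivative
     (\<lambda>h. log_norm_deriv ?k \<nu> * snd (snd h) - ln_det_deriv \<Sigma> (fst (snd h)) / 2 -
       ((snd (snd ?\<theta>) + ?k) / 2 * (quad_deriv x ?\<theta> h * inverse (Quad x ?\<theta>)) + snd (snd h) / 2 * ln (Quad x ?\<theta>)))) (at ?\<theta>)"
    by (rule has_derivative_diff[OF 3 has_derivative_mult[OF 5 4]])
  have 7: "log_density x = (\<lambda>\<theta>. log_norm_const ?k (snd (snd \<theta>)) - ln (det (fst (snd \<theta>))) / 2 - (snd (snd \<theta>) + ?k) / 2 * ln (Quad x \<theta>))"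
    by (auto simp: log_density_def Quad_def fun_eq_iff)
  have 8: "(\<lambda>h. score ?\<theta> h x) = (\<lambda>h. log_norm_deriv ?k \<nu> * snd (snd h) - ln_det_deriv \<Sigma> (fst (snd h)) / 2 -
       ((snd (snd ?\<theta>) + ?k) / 2 * (quad_deriv x ?\<theta> h * inverse (Quad x ?\<theta>)) + snd (snd h) / 2 * ln (Quad x ?\<theta>)))"
  proof
    fix h :: "(real^'k) \<times> (real^'k^'k) \<times> real"
    obtain m H \<tau> where h: "h = (m, H, \<tau>)" by (cases h)
    show "score ?\<theta> h x = log_norm_deriv ?k \<nu> * snd (snd h) - ln_det_deriv \<Sigma> (fst (snd h)) / 2 -
       ((snd (snd ?\<theta>) + ?k) / 2 * (quad_deriv x ?\<theta> h * inverse (Quad x ?\<theta>)) + snd (snd h) / 2 * ln (Quad x ?\<theta>))"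
      by (simp only: h score_def Quad_def prod.case fst_conv snd_conv divide_inverse add.commute)
  qed
  show "(log_density x has_derivative (\<lambda>h. score ?\<theta> h x)) (at ?\<theta>)"
    unfolding 7 8 by (rule 6)
qed

lemma has_derivative_local_Lipschitz:
  assumes "(f has_derivative f') (at x)"
  obtains C d where "C > 0" "d > 0" "\<And>h. norm h \<le> d \<Longrightarrow> norm (f (x + h) - f x) \<le> C * norm h"
proof -
  have bl: "bounded_linear f'" and "\<forall>e>0. \<exists>d>0. \<forall>y. norm (y - x) < d \<longrightarrow> norm (f y - f x - f' (y - x)) \<le> e * norm (y - x)"
    using assms by (auto simp: has_derivative_at_alt)
  then obtain d where d: "d > 0" "\<And>y. norm (y - x) < d \<Longrightarrow> norm (f y - f x - f' (y - x)) \<le> 1 * norm (y - x)"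
    by (meson zero_less_one)
  obtain B where B: "B > 0" "\<And>h. norm (f' h) \<le> norm h * B" using bounded_linear.pos_bounded[OF bl] by blast
  show thesis
  proof (rule that[of "1 + B" "d / 2"])
    fix h :: 'a assume "norm h \<le> d / 2"
    then have "norm (f (x + h) - f x - f' h) \<le> norm h" using d(2)[of "x + h"] d(1) by simp
    moreover have "norm (f (x + h) - f x) \<le> norm (f (x + h) - f x - f' h) + norm (f' h)"
      using norm_triangle_ineq[of "f (x + h) - f x - f' h" "f' h"] by simp
    ultimately show "norm (f (x + h) - f x) \<le> (1 + B) * norm h" using B(2)[of h] by (simp add: algebra_simps)
  qed (use d B in auto)
qed

text \<open>With \<open>q = b / a\<close>, the upper bound is \<open>ln q \<le> q - 1\<close> and
  the lower one the same inequality for \<open>1 / q\<close>; the factor 2 comes from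
  \<open>q \<ge> 1 / 2\<close>.\<close>

lemma abs_ln_diff_le:
  fixes a b :: real
  assumes "0 < a" "\<bar>b - a\<bar> \<le> e * a" "e \<le> 1 / 2"
  shows "0 < b" "\<bar>ln b - ln a\<bar> \<le> 2 * e"
proof -
  have e0: "0 \<le> e" using assms by (metis abs_ge_zero order_trans zero_le_mult_iff not_less)
  have eh: "e * a \<le> a / 2" using assms mult_right_mono[of e "1/2" a] by simp
  then show b: "0 < b" using assms by linarith
  have r: "\<bar>b / a - 1\<bar> \<le> e" using assms by (simp add: abs_le_iff field_simps)
  define q where "q = b / a"
  have q: "q > 0" "\<bar>q - 1\<bar> \<le> e" using b assms r by (auto simp: q_def)
  have "a \<le> 2 * b" using eh assms by linarith
  then have q2: "q \<ge> 1 / 2" using assms by (simp add: q_def pos_le_divide_eq)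
  have l: "ln b - ln a = ln q" using b assms by (simp add: q_def ln_div)
  have "ln q \<le> q - 1" using q by (intro ln_le_minus_one) simp
  moreover have "- ln q \<le> 2 * e"
  proof -
    have "- ln q = ln (1 / q)" using q by (simp add: ln_div)
    also have "\<dots> \<le> 1 / q - 1" using q by (intro ln_le_minus_one) simp
    also have "\<dots> = (1 - q) / q" using q by (simp add: field_simps)
    also have "\<dots> \<le> 2 * e"
    proof -
      have "1 - q \<le> e" using q by linarith
      also have "e \<le> 2 * e * q" using q2 e0 mult_left_mono[of "1/2" q "2 * e"] by simp
      finally show ?thesis using q by (simp add: pos_divide_le_eq)
    qed
    finally show ?thesis .
  qed
  ultimately show "\<bar>ln b - ln a\<bar> \<le> 2 * e" unfolding l using q e0 by linarith
qed

text \<open>Only a change of \<nu> multiplies the unbounded \<open>ln (quad)\<close>; all other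
  changes are bounded uniformly in x. Ratios of neighbouring densities therefore stay below a small
  power of \<open>quad\<close> or of its inverse, up to a constant.\<close>

lemma log_density_Lipschitz:
  fixes \<mu> :: "real^'k"
  assumes \<Sigma>: "\<Sigma> \<in> spd" and \<nu>: "0 < \<nu>"
  obtains K d where "K > 0" "d > 0"
    "\<And>h x. norm h \<le> d \<Longrightarrow> \<bar>log_density x ((\<mu>, \<Sigma>, \<nu>) + h) - log_density x (\<mu>, \<Sigma>, \<nu>)\<bar> \<le> K * norm h * (1 + \<bar>ln (quad \<mu> \<Sigma> \<nu> x)\<bar>)"
proof -
  let ?k = "real CARD('k)" and ?\<theta> = "(\<mu>, \<Sigma>, \<nu>)"
  define G where "G = (\<lambda>\<theta> :: (real^'k) \<times> (real^'k^'k) \<times> real. log_norm_const ?k (snd (snd \<theta>)) - ln (det (fst (snd \<theta>))) / 2)"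
  obtain C1 d1 where 1: "C1 > 0" "d1 > 0" "\<And>h. norm h \<le> d1 \<Longrightarrow> norm (G (?\<theta> + h) - G ?\<theta>) \<le> C1 * norm h"
    using has_derivative_local_Lipschitz[OF log_density_has_derivative(1)[OF assms, of \<mu>]] unfolding G_def by metis
  obtain C2 d2 where 2: "C2 > 0" "d2 > 0"
    "\<And>h x. norm h \<le> d2 \<Longrightarrow> \<bar>Quad x (?\<theta> + h) - quad \<mu> \<Sigma> \<nu> x\<bar> \<le> C2 * norm h * quad \<mu> \<Sigma> \<nu> x"
    using quad_perturbation[OF assms] by metis
  define d where "d = min (min d1 d2) (1 / (2 * C2))"
  define \<kappa> where "\<kappa> = (\<nu> + ?k) / 2"
  have \<kappa>: "\<kappa> > 0" using \<nu> by (simp add: \<kappa>_def add_pos_nonneg)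
  show thesis
  proof (rule that[of "C1 + 1 + 2 * C2 * \<kappa>" d])
    show "0 < C1 + 1 + 2 * C2 * \<kappa>" using 1 2 \<kappa> by (intro add_pos_pos mult_pos_pos) auto
    show "0 < d" using 1 2 by (simp add: d_def)
    fix h :: "(real^'k) \<times> (real^'k^'k) \<times> real" and x assume h: "norm h \<le> d"
    define \<tau> where "\<tau> = snd (snd h)"
    have \<tau>: "\<bar>\<tau>\<bar> \<le> norm h" unfolding \<tau>_def by (rule norm_triple_le)
    have half: "C2 * norm h \<le> 1 / 2"
      using h 2 mult_left_mono[of "norm h" "1 / (2 * C2)" C2] by (simp add: d_def)
    have h1: "norm h \<le> d1" "norm h \<le> d2" using h by (simp_all add: d_def)
    define u u' where "u = quad \<mu> \<Sigma> \<nu> x" and "u' = Quad x (?\<theta> + h)"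
    have lnu: "\<bar>ln u' - ln u\<bar> \<le> 2 * (C2 * norm h)"
      using abs_ln_diff_le(2)[OF quad_pos[OF assms] 2(3)[OF h1(2)] half] by (simp add: u_def u'_def)
    have ld: "log_density x \<theta> = G \<theta> - (snd (snd \<theta>) + ?k) / 2 * ln (Quad x \<theta>)" for \<theta>
      by (cases \<theta>) (simp add: log_density_def G_def Quad_def)
    have "log_density x (?\<theta> + h) - log_density x ?\<theta> = (G (?\<theta> + h) - G ?\<theta>) - \<tau> / 2 * ln u' - \<kappa> * (ln u' - ln u)"
      by (simp add: ld u_def u'_def \<tau>_def \<kappa>_def Quad_def[of x] split_beta algebra_simps add_divide_distrib)
    then have "\<bar>log_density x (?\<theta> + h) - log_density x ?\<theta>\<bar> \<le> \<bar>G (?\<theta> + h) - G ?\<theta>\<bar> + \<bar>\<tau> / 2 * ln u'\<bar> + \<bar>\<kappa> * (ln u' - ln u)\<bar>"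
      by linarith
    also have "\<dots> \<le> C1 * norm h * (1 + \<bar>ln u\<bar>) + 1 * norm h * (1 + \<bar>ln u\<bar>) + 2 * C2 * \<kappa> * norm h * (1 + \<bar>ln u\<bar>)"
    proof (intro add_mono)
      have g1: "a \<le> a * (1 + \<bar>ln u\<bar>)" if "0 \<le> a" for a using that by (simp add: mult_le_cancel_left1)
      show "\<bar>G (?\<theta> + h) - G ?\<theta>\<bar> \<le> C1 * norm h * (1 + \<bar>ln u\<bar>)"
        using order_trans[OF 1(3)[OF h1(1)] g1[of "C1 * norm h"]] 1(1) by simp
      have "\<bar>ln u'\<bar> \<le> 1 + \<bar>ln u\<bar>" using lnu half by linarith
      then have "\<bar>\<tau>\<bar> * \<bar>ln u'\<bar> \<le> norm h * (1 + \<bar>ln u\<bar>)" using \<tau> by (intro mult_mono) auto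
      moreover have "\<bar>\<tau>\<bar> * \<bar>ln u'\<bar> / 2 \<le> \<bar>\<tau>\<bar> * \<bar>ln u'\<bar>" by simp
      ultimately have "\<bar>\<tau>\<bar> * \<bar>ln u'\<bar> / 2 \<le> norm h * (1 + \<bar>ln u\<bar>)" by linarith
      then show "\<bar>\<tau> / 2 * ln u'\<bar> \<le> 1 * norm h * (1 + \<bar>ln u\<bar>)"
        by (simp add: abs_mult)
      have "\<kappa> * \<bar>ln u' - ln u\<bar> \<le> \<kappa> * (2 * (C2 * norm h))" using lnu \<kappa> by (intro mult_left_mono) auto
      also have "\<dots> = 2 * C2 * \<kappa> * norm h" by simp
      also have "\<dots> \<le> 2 * C2 * \<kappa> * norm h * (1 + \<bar>ln u\<bar>)" using 2 \<kappa> by (intro g1) auto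
      finally show "\<bar>\<kappa> * (ln u' - ln u)\<bar> \<le> 2 * C2 * \<kappa> * norm h * (1 + \<bar>ln u\<bar>)"
        using \<kappa> by (simp add: abs_mult)
    qed
    also have "\<dots> = (C1 + 1 + 2 * C2 * \<kappa>) * norm h * (1 + \<bar>ln u\<bar>)" by (simp add: algebra_simps)
    finally show "\<bar>log_density x (?\<theta> + h) - log_density x ?\<theta>\<bar> \<le> (C1 + 1 + 2 * C2 * \<kappa>) * norm h * (1 + \<bar>ln (quad \<mu> \<Sigma> \<nu> x)\<bar>)"
      by (simp add: u_def)
  qed
qed

text \<open>Stated along arbitrary sequences with a limiting direction, since neither the bounded
  sequence of tail parameters nor the values of an estimator follow a straight path.\<close>

lemma has_derivative_sequential:
  fixes f :: "'a::real_normed_vector \<Rightarrow> real"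
  assumes f: "(f has_derivative f') (at x)" and lim: "(\<lambda>n. a n *\<^sub>R (y n - x)) \<longlonglongrightarrow> t" and y: "y \<longlonglongrightarrow> x"
    and a: "\<And>n. 0 \<le> a n"
  shows "(\<lambda>n. a n * (f (y n) - f x)) \<longlonglongrightarrow> f' t"
proof -
  have bl: "bounded_linear f'" and alt: "\<And>e. e > 0 \<Longrightarrow> \<exists>d>0. \<forall>y. norm (y - x) < d \<longrightarrow> norm (f y - f x - f' (y - x)) \<le> e * norm (y - x)"
    using f by (auto simp: has_derivative_at_alt)
  interpret bounded_linear f' by fact
  have l1: "(\<lambda>n. f' (a n *\<^sub>R (y n - x))) \<longlonglongrightarrow> f' t"
    using lim by (rule tendsto)
  have "(\<lambda>n. a n * (f (y n) - f x) - f' (a n *\<^sub>R (y n - x))) \<longlonglongrightarrow> 0"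
  proof (rule LIMSEQ_I)
    fix e :: real assume e: "e > 0"
    define T where "T = norm t + 1"
    have T: "T > 0" by (simp add: T_def add_nonneg_pos)
    have "\<forall>\<^sub>F n in sequentially. norm (a n *\<^sub>R (y n - x)) < T"
      using tendsto_norm[OF lim] by (rule order_tendstoD) (simp add: T_def)
    moreover obtain d where d: "d > 0" "\<And>y. norm (y - x) < d \<Longrightarrow> norm (f y - f x - f' (y - x)) \<le> e / (2 * T) * norm (y - x)"
      using alt[of "e / (2 * T)"] e T by auto
    have "\<forall>\<^sub>F n in sequentially. norm (y n - x) < d"
      using y d(1) by (simp add: tendsto_iff dist_norm)
    ultimately have "\<forall>\<^sub>F n in sequentially. norm (a n * (f (y n) - f x) - f' (a n *\<^sub>R (y n - x)) - 0) < e"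
    proof eventually_elim
      case (elim n)
      have "a n * (f (y n) - f x) - f' (a n *\<^sub>R (y n - x)) = a n * (f (y n) - f x - f' (y n - x))"
        by (simp add: scale right_diff_distrib)
      then have "norm (a n * (f (y n) - f x) - f' (a n *\<^sub>R (y n - x)) - 0) = a n * norm (f (y n) - f x - f' (y n - x))"
        using a[of n] by (simp add: abs_mult)
      also have "\<dots> \<le> a n * (e / (2 * T) * norm (y n - x))"
        using d(2)[of "y n"] elim a by (intro mult_left_mono) auto
      also have "\<dots> = e / (2 * T) * norm (a n *\<^sub>R (y n - x))" using a[of n] by simp
      also have "\<dots> \<le> e / (2 * T) * T" using elim e T by (intro mult_left_mono) auto
      also have "\<dots> < e" using e T by simp
      finally show ?case .
    qed
    then show "\<exists>N. \<forall>n\<ge>N. norm (a n * (f (y n) - f x) - f' (a n *\<^sub>R (y n - x)) - 0) < e"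
      by (simp add: eventually_sequentially)
  qed
  from tendsto_add[OF this l1] show ?thesis by simp
qed

section \<open>Likelihood ratios of local alternatives\<close>

lemma log_density_measurable [measurable]: "(\<lambda>x. log_density x \<theta>) \<in> borel_measurable borel"
  by (cases \<theta>) (simp add: log_density_def)

lemma linear_score_measurable [measurable]: "score \<theta> h \<in> borel_measurable borel"
proof -
  obtain \<mu> \<Sigma> \<nu> m H \<tau> where t: "\<theta> = (\<mu>, \<Sigma>, \<nu>)" "h = (m, H, \<tau>)" by (metis prod.exhaust)
  have [measurable]: "(\<lambda>x. H *v (matrix_inv \<Sigma> *v (x - \<mu>))) \<in> borel_measurable borel"
    by (rule measurable_compose[OF quad_shift_measurable matrix_vector_mult_measurable])
  show ?thesis unfolding t score_def quad_deriv_def by simp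
qed

lemma student_density_log_density:
  "\<Sigma> \<in> spd \<Longrightarrow> 0 < \<nu> \<Longrightarrow> student_density \<mu> \<Sigma> \<nu> x = exp (log_density x (\<mu>, \<Sigma>, \<nu>))"
  by (simp add: student_density_eq log_density_def)

definition likelihood_ratio ::
    "(real^'k) \<times> (real^'k^'k) \<times> real \<Rightarrow> (real^'k) \<times> (real^'k^'k) \<times> real \<Rightarrow> real^'k \<Rightarrow> real" where
  "likelihood_ratio \<theta> \<theta>' x = exp (log_density x \<theta>' - log_density x \<theta>)"

lemma likelihood_ratio_measurable [measurable]: "likelihood_ratio \<theta> \<theta>' \<in> borel_measurable borel"
  unfolding likelihood_ratio_def[abs_def] by measurable

lemma student_eq_density:
  assumes "\<Sigma> \<in> spd" "0 < \<nu>" "\<Sigma>' \<in> spd" "0 < \<nu>'"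
  shows "student \<mu>' \<Sigma>' \<nu>' = density (student \<mu> \<Sigma> \<nu>) (likelihood_ratio (\<mu>, \<Sigma>, \<nu>) (\<mu>', \<Sigma>', \<nu>'))"
proof -
  have [measurable]: "student_density \<mu> \<Sigma> \<nu> \<in> borel_measurable borel" using assms by simp
  have "density (student \<mu> \<Sigma> \<nu>) (likelihood_ratio (\<mu>, \<Sigma>, \<nu>) (\<mu>', \<Sigma>', \<nu>')) =
     density lborel (\<lambda>x. ennreal (student_density \<mu> \<Sigma> \<nu> x) * ennreal (likelihood_ratio (\<mu>, \<Sigma>, \<nu>) (\<mu>', \<Sigma>', \<nu>') x))"
    unfolding student_def by (rule density_density_eq) measurable
  also have "(\<lambda>x. ennreal (student_density \<mu> \<Sigma> \<nu> x) * ennreal (likelihood_ratio (\<mu>, \<Sigma>, \<nu>) (\<mu>', \<Sigma>', \<nu>') x)) =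
     (\<lambda>x. ennreal (student_density \<mu>' \<Sigma>' \<nu>' x))"
    using assms by (simp add: fun_eq_iff student_density_log_density likelihood_ratio_def ennreal_mult'[symmetric] mult_exp_exp)
  finally show ?thesis by (simp add: student_def)
qed

lemma likelihood_ratio_integral:
  assumes "\<Sigma> \<in> spd" "0 < \<nu>" "\<Sigma>' \<in> spd" "0 < \<nu>'"
  shows "integrable (student \<mu> \<Sigma> \<nu>) (likelihood_ratio (\<mu>, \<Sigma>, \<nu>) (\<mu>', \<Sigma>', \<nu>'))"
    and "(\<integral>x. likelihood_ratio (\<mu>, \<Sigma>, \<nu>) (\<mu>', \<Sigma>', \<nu>') x \<partial>student \<mu> \<Sigma> \<nu>) = 1"
proof -
  interpret P: prob_space "student \<mu>' \<Sigma>' \<nu>'" using assms by (intro prob_space_student)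
  have pos: "0 \<le> likelihood_ratio (\<mu>, \<Sigma>, \<nu>) (\<mu>', \<Sigma>', \<nu>') x" for x by (simp add: likelihood_ratio_def)
  have "emeasure (student \<mu>' \<Sigma>' \<nu>') UNIV = 1" using P.emeasure_space_1 by simp
  then have nn: "(\<integral>\<^sup>+x. ennreal (likelihood_ratio (\<mu>, \<Sigma>, \<nu>) (\<mu>', \<Sigma>', \<nu>') x) \<partial>student \<mu> \<Sigma> \<nu>) = 1"
    unfolding student_eq_density[OF assms, of \<mu>' \<mu>] by (simp add: emeasure_density)
  show "integrable (student \<mu> \<Sigma> \<nu>) (likelihood_ratio (\<mu>, \<Sigma>, \<nu>) (\<mu>', \<Sigma>', \<nu>'))"
    by (rule integrableI_nonneg) (use pos nn in auto)
  show "(\<integral>x. likelihood_ratio (\<mu>, \<Sigma>, \<nu>) (\<mu>', \<Sigma>', \<nu>') x \<partial>student \<mu> \<Sigma> \<nu>) = 1"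
    using pos nn by (subst integral_eq_nn_integral) auto
qed

definition valid :: "(real^'k) \<times> (real^'k^'k) \<times> real \<Rightarrow> bool" where
  "valid = (\<lambda>(\<mu>, \<Sigma>, \<nu>). \<Sigma> \<in> spd \<and> 0 < \<nu>)"

lemma scaled_convergent_imp:
  fixes y :: "nat \<Rightarrow> 'a::real_normed_vector"
  assumes "(\<lambda>n. sqrt (real n) *\<^sub>R (y n - x)) \<longlonglongrightarrow> t"
  shows "y \<longlonglongrightarrow> x"
proof -
  have "(\<lambda>n. 1 / sqrt (real n)) \<longlonglongrightarrow> 0" by real_asymp
  from tendsto_scaleR[OF this assms] have "(\<lambda>n. (1 / sqrt (real n)) *\<^sub>R sqrt (real n) *\<^sub>R (y n - x)) \<longlonglongrightarrow> 0" by simp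
  moreover have "\<forall>\<^sub>F n in sequentially. (1 / sqrt (real n)) *\<^sub>R sqrt (real n) *\<^sub>R (y n - x) = y n - x"
    using eventually_gt_at_top[of 0] by eventually_elim simp
  ultimately have "(\<lambda>n. y n - x) \<longlonglongrightarrow> 0" using Lim_transform_eventually by fastforce
  then show ?thesis using LIM_zero_cancel by blast
qed

text \<open>Pointwise convergence is the chain rule; the Lipschitz bound for the log density
  supplies a square integrable majorant of logarithmic times small exponential growth.\<close>

lemma student_local_ratio:
  fixes \<mu> :: "real^'k"
  assumes \<Sigma>: "\<Sigma> \<in> spd" and \<nu>: "0 < \<nu>"
    and lim: "(\<lambda>n. sqrt (real n) *\<^sub>R (\<theta> n - (\<mu>, \<Sigma>, \<nu>))) \<longlonglongrightarrow> t"
    and valid: "\<forall>\<^sub>F n in sequentially. valid (\<theta> n)"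
  shows "local_ratio (student \<mu> \<Sigma> \<nu>) (\<lambda>n. likelihood_ratio (\<mu>, \<Sigma>, \<nu>) (\<theta> n)) (score (\<mu>, \<Sigma>, \<nu>) t)"
proof -
  let ?\<theta> = "(\<mu>, \<Sigma>, \<nu>)"
  let ?P = "student \<mu> \<Sigma> \<nu>"
  interpret P: prob_space ?P by (rule prob_space_student[OF \<Sigma> \<nu>])
  have to: "\<theta> \<longlonglongrightarrow> ?\<theta>" by (rule scaled_convergent_imp[OF lim])
  obtain K d where K: "K > 0" "d > 0"
    "\<And>h x. norm h \<le> d \<Longrightarrow> \<bar>log_density x (?\<theta> + h) - log_density x ?\<theta>\<bar> \<le> K * norm h * (1 + \<bar>ln (quad \<mu> \<Sigma> \<nu> x)\<bar>)"
    using log_density_Lipschitz[OF \<Sigma> \<nu>] by metis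
  define p where "p = \<nu> / 6"
  have p: "3 * p < \<nu>" "0 < p" using \<nu> by (simp_all add: p_def)
  define T where "T = norm t + 1"
  have T: "T > 0" by (simp add: T_def add_nonneg_pos)
  have evT: "\<forall>\<^sub>F n in sequentially. norm (sqrt (real n) *\<^sub>R (\<theta> n - ?\<theta>)) < T"
    using tendsto_norm[OF lim] by (rule order_tendstoD) (simp add: T_def)
  have evd: "\<forall>\<^sub>F n in sequentially. norm (\<theta> n - ?\<theta>) < min d (p / (4 * K))"
    using to K p by (intro tendstoD[OF to, unfolded dist_norm]) simp
  define B where "B = (\<lambda>x. T * K * ((1 + \<bar>ln (quad \<mu> \<Sigma> \<nu> x)\<bar>) * exp (p / 4 * (1 + \<bar>ln (quad \<mu> \<Sigma> \<nu> x)\<bar>))))"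
  have [measurable]: "B \<in> borel_measurable borel" unfolding B_def by measurable
  have "L2_conv ?P (\<lambda>n x. sqrt (real n) * (likelihood_ratio ?\<theta> (\<theta> n) x - 1)) (score ?\<theta> t)"
  proof (rule L2_conv_dominated)
    show "integrable ?P (\<lambda>x. (B x)\<^sup>2)"
    proof (rule integrable_student_log_bound[OF \<Sigma> \<nu> p])
      show "\<bar>(B x)\<^sup>2\<bar> \<le> (T * K)\<^sup>2 * ((1 + \<bar>ln (quad \<mu> \<Sigma> \<nu> x)\<bar>)\<^sup>2 * exp (p / 2 * (1 + \<bar>ln (quad \<mu> \<Sigma> \<nu> x)\<bar>)))" for x
        by (simp add: B_def power_mult_distrib exp_double[symmetric])
    qed measurable
    show "\<forall>\<^sub>F n in sequentially. \<forall>x\<in>space ?P. \<bar>sqrt (real n) * (likelihood_ratio ?\<theta> (\<theta> n) x - 1)\<bar> \<le> B x"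
      using evT evd
    proof eventually_elim
      case (elim n)
      have "\<bar>sqrt (real n) * (likelihood_ratio ?\<theta> (\<theta> n) x - 1)\<bar> \<le> B x" for x
      proof -
        define l where "l = log_density x (\<theta> n) - log_density x ?\<theta>"
        define h where "h = \<theta> n - ?\<theta>"
        define s where "s = 1 + \<bar>ln (quad \<mu> \<Sigma> \<nu> x)\<bar>"
        have s: "0 \<le> s" by (simp add: s_def)
        have l: "\<bar>l\<bar> \<le> K * norm h * s" using K(3)[of h x] elim by (simp add: l_def h_def s_def)
        have "K * norm h \<le> p / 4" using elim K by (simp add: h_def field_simps)
        then have l2: "\<bar>l\<bar> \<le> p / 4 * s" using l mult_right_mono[OF _ s] by (meson order_trans)
        have "\<bar>sqrt (real n) * (likelihood_ratio ?\<theta> (\<theta> n) x - 1)\<bar> = sqrt (real n) * \<bar>exp l - 1\<bar>"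
          by (simp add: likelihood_ratio_def l_def abs_mult)
        also have "\<dots> \<le> sqrt (real n) * (\<bar>l\<bar> * exp \<bar>l\<bar>)" by (intro mult_left_mono abs_exp_minus_1_le) simp
        also have "\<dots> \<le> sqrt (real n) * ((K * norm h * s) * exp (p / 4 * s))"
          using l l2 K s by (intro mult_left_mono mult_mono) auto
        also have "\<dots> = norm (sqrt (real n) *\<^sub>R h) * (K * (s * exp (p / 4 * s)))" by simp
        also have "\<dots> \<le> T * (K * (s * exp (p / 4 * s)))"
          using elim K s by (intro mult_right_mono) (auto simp: h_def)
        finally show ?thesis by (simp add: B_def s_def mult.assoc)
      qed
      then show ?case by blast
    qed
    show "(\<lambda>n. sqrt (real n) * (likelihood_ratio ?\<theta> (\<theta> n) x - 1)) \<longlonglongrightarrow> score ?\<theta> t x" for x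
    proof -
      have "((\<lambda>\<theta>'. exp (log_density x \<theta>' - log_density x ?\<theta>)) has_derivative (\<lambda>h. exp (log_density x ?\<theta> - log_density x ?\<theta>) * score ?\<theta> h x)) (at ?\<theta>)"
        by (rule has_derivative_exp[THEN has_derivative_eq_rhs], rule has_derivative_diff[OF log_density_has_derivative(2)[OF \<Sigma> \<nu>] has_derivative_const]) simp
      from has_derivative_sequential[OF this lim to] show ?thesis
        by (simp add: likelihood_ratio_def)
    qed
  qed simp_all
  moreover have "\<forall>\<^sub>F n in sequentially. likelihood_ratio ?\<theta> (\<theta> n) \<in> borel_measurable ?P \<and>
      (\<forall>x\<in>space ?P. 0 \<le> likelihood_ratio ?\<theta> (\<theta> n) x) \<and> integrable ?P (likelihood_ratio ?\<theta> (\<theta> n)) \<and>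
      (\<integral>x. likelihood_ratio ?\<theta> (\<theta> n) x \<partial>?P) = 1"
    using valid
  proof eventually_elim
    case (elim n)
    obtain \<mu>' \<Sigma>' \<nu>' where t: "\<theta> n = (\<mu>', \<Sigma>', \<nu>')" by (metis prod.exhaust)
    then show ?case
      using elim likelihood_ratio_integral[OF \<Sigma> \<nu>, of \<Sigma>' \<nu>' \<mu> \<mu>']
      by (auto simp: valid_def likelihood_ratio_def[of _ _ "_ :: real^'k"])
  qed
  ultimately show ?thesis by (simp add: local_ratio_def)
qed

section \<open>The score blocks in half-vectorised coordinates\<close>

lemma score_linear: "linear (\<lambda>h. score (\<mu>, \<Sigma>, \<nu>) h x)" if "\<Sigma> \<in> spd" "0 < \<nu>"
  using has_derivative_linear[OF log_density_has_derivative(2)[OF that]] .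

lemma unvech_symmetric: "transpose (unvech v) = unvech v"
  by (simp add: transpose_def unvech_def vec_eq_iff min.commute max.commute)

lemma unvech_linear: "linear unvech"
  by (rule linearI) (simp_all add: unvech_def vec_eq_iff)

lemma score3_eq:
  assumes \<Sigma>: "\<Sigma> \<in> spd" and \<nu>: "0 < \<nu>"
  shows "score3 \<mu> \<Sigma> \<nu> x = score (\<mu>, \<Sigma>, \<nu>) (0, 0, 1) x"
proof -
  have "((\<lambda>t. (\<mu>, \<Sigma>, t)) has_derivative (\<lambda>t. (0, 0, t))) (at \<nu>)"
    by (auto intro!: derivative_eq_intros)
  from has_derivative_compose[OF this log_density_has_derivative(2)[OF \<Sigma> \<nu>]]
  have "((\<lambda>t. log_density x (\<mu>, \<Sigma>, t)) has_derivative (\<lambda>t. score (\<mu>, \<Sigma>, \<nu>) (0, 0, t) x)) (at \<nu>)" .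
  moreover have "(\<lambda>t. score (\<mu>, \<Sigma>, \<nu>) (0, 0, t) x) = (*) (score (\<mu>, \<Sigma>, \<nu>) (0, 0, 1) x)"
  proof
    fix t
    show "score (\<mu>, \<Sigma>, \<nu>) (0, 0, t) x = score (\<mu>, \<Sigma>, \<nu>) (0, 0, 1) x * t"
      using linear_scale[OF score_linear[OF \<Sigma> \<nu>, of \<mu> x], of t "(0, 0, 1)"] by (simp add: mult.commute)
  qed
  ultimately have "((\<lambda>t. log_density x (\<mu>, \<Sigma>, t)) has_field_derivative score (\<mu>, \<Sigma>, \<nu>) (0, 0, 1) x) (at \<nu>)"
    unfolding has_field_derivative_def by (simp only:)
  then have "((\<lambda>t. ln (student_density \<mu> \<Sigma> t x)) has_field_derivative score (\<mu>, \<Sigma>, \<nu>) (0, 0, 1) x) (at \<nu>)"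
    by (rule has_field_derivative_transform_within_open[of _ _ _ "{0<..}"])
      (use \<Sigma> \<nu> in \<open>auto simp: student_density_log_density\<close>)
  then show ?thesis unfolding score3_def by (rule DERIV_imp_deriv)
qed

text \<open>A symmetric matrix close to \<Sigma> is positive definite, so near
  \<open>vech \<Sigma>\<close> the differentiated function is \<open>log_density\<close> composed
  with the linear map \<open>unvech\<close>, which counts off-diagonal entries twice. The gradient
  is the Riesz representative of that derivative.\<close>

lemma score2_eq:
  fixes \<mu> :: "real^'k::{finite, linorder}"
  assumes \<Sigma>: "\<Sigma> \<in> spd" and \<nu>: "0 < \<nu>"
  shows "v \<bullet> score2 \<mu> \<Sigma> \<nu> x = score (\<mu>, \<Sigma>, \<nu>) (0, unvech v, 0) x"
proof -
  define f where "f = (\<lambda>v. ln (student_density \<mu> (unvech v) \<nu> x))"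
  define L where "L = (\<lambda>v. score (\<mu>, \<Sigma>, \<nu>) (0, unvech v, 0) x)"
  have uv: "unvech (vech \<Sigma>) = \<Sigma>" by (rule unvech_vech[OF spdD(1)[OF \<Sigma>]])
  have bl: "bounded_linear (unvech :: _ \<Rightarrow> 'k rmat)" using unvech_linear by (simp add: linear_conv_bounded_linear)
  have "((\<lambda>v. (\<mu>, unvech v, \<nu>)) has_derivative (\<lambda>v. (0, unvech v, 0))) (at (vech \<Sigma>))"
    by (intro has_derivative_Pair has_derivative_const bounded_linear_imp_has_derivative[OF bl])
  moreover have "(log_density x has_derivative (\<lambda>h. score (\<mu>, \<Sigma>, \<nu>) h x)) (at (\<mu>, unvech (vech \<Sigma>), \<nu>))"
    unfolding uv by (rule log_density_has_derivative(2)[OF \<Sigma> \<nu>])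
  ultimately have "((\<lambda>v. log_density x (\<mu>, unvech v, \<nu>)) has_derivative L) (at (vech \<Sigma>))"
    unfolding L_def by (rule has_derivative_compose)
  moreover obtain d where d: "d > 0" "\<And>T. transpose T = T \<Longrightarrow> norm (T - \<Sigma>) < d \<Longrightarrow> T \<in> spd"
    using spd_open[OF \<Sigma>] by metis
  have "open {v. norm (unvech v - \<Sigma>) < d}"
    by (intro open_Collect_less continuous_intros linear_continuous_on[OF bl])
  ultimately have "(f has_derivative L) (at (vech \<Sigma>))"
  proof (rule has_derivative_transform_within_open)
    show "vech \<Sigma> \<in> {v. norm (unvech v - \<Sigma>) < d}" using d(1) by (simp add: uv)
    show "log_density x (\<mu>, unvech v, \<nu>) = f v" if "v \<in> {v. norm (unvech v - \<Sigma>) < d}" for v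
      using d(2)[OF unvech_symmetric] that \<nu> by (simp add: f_def student_density_log_density)
  qed
  note fL = this
  have lin: "linear L" using has_derivative_linear[OF fL] .
  define D where "D = (\<Sum>b\<in>Basis. L b *\<^sub>R b)"
  have LD: "L h = h \<bullet> D" for h
  proof -
    have "h \<bullet> D = (\<Sum>b\<in>Basis. (h \<bullet> b) * L b)" by (simp add: D_def inner_sum_right mult.commute)
    also have "\<dots> = L (\<Sum>b\<in>Basis. (h \<bullet> b) *\<^sub>R b)" by (simp add: linear_sum[OF lin] linear_scale[OF lin])
    finally show ?thesis by (simp add: euclidean_representation)
  qed
  have "GDERIV f (vech \<Sigma>) :> D"
    using fL unfolding gderiv_def by (rule has_derivative_eq_rhs) (simp add: LD fun_eq_iff)
  moreover have "D' = D" if "GDERIV f (vech \<Sigma>) :> D'" for D'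
  proof -
    have "(\<lambda>h. h \<bullet> D') = (\<lambda>h. h \<bullet> D)"
      using that \<open>GDERIV f (vech \<Sigma>) :> D\<close> unfolding gderiv_def by (rule has_derivative_unique)
    then have "\<forall>h. h \<bullet> D' = h \<bullet> D" by (blast dest: fun_cong)
    then show ?thesis by (simp only: vector_eq_ldot)
  qed
  ultimately have "gradient f (vech \<Sigma>) = D"
    unfolding gradient_def by (intro the_equality)
  then have "score2 \<mu> \<Sigma> \<nu> x = D" by (simp only: score2_def f_def)
  then have "v \<bullet> score2 \<mu> \<Sigma> \<nu> x = L v" by (simp only: LD)
  then show ?thesis by (simp only: L_def)
qed

section \<open>The efficient score\<close>

text \<open>Turns a vanishing variance into an identity that may be evaluated at chosen
  points.\<close>

lemma continuous_AE_zero: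
  fixes f :: "'a::euclidean_space \<Rightarrow> real"
  assumes f: "continuous_on UNIV f" and ae: "AE x in lborel. f x = 0"
  shows "f x = 0"
proof -
  have op: "open {x. f x \<noteq> 0}"
    by (intro open_Collect_neq f continuous_on_const)
  then have "{x. f x \<noteq> 0} \<in> null_sets lborel"
    using ae by (subst (asm) AE_iff_null[where M = lborel]) (auto simp: Collect_neg_eq[symmetric])
  then have "negligible {x. f x \<noteq> 0}"
    by (simp add: negligible_iff_null_sets null_sets_completionI)
  then have "{x. f x \<noteq> 0} = {}" using op open_not_negligible by blast
  then show ?thesis by blast
qed

lemma AE_student_iff:
  assumes "\<Sigma> \<in> spd" "0 < \<nu>"
  shows "(AE x in student \<mu> \<Sigma> \<nu>. Q x) \<longleftrightarrow> (AE x in lborel. Q x)"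
proof -
  have [measurable]: "student_density \<mu> \<Sigma> \<nu> \<in> borel_measurable borel" using assms by simp
  show ?thesis
    unfolding student_def by (subst AE_density) (simp_all add: student_density_nonneg[OF assms])
qed

lemma eventually_valid:
  assumes \<Sigma>: "\<Sigma> \<in> spd" and \<nu>: "0 < \<nu>" and lim: "\<theta> \<longlonglongrightarrow> (\<mu>, \<Sigma>, \<nu>)"
    and sym: "\<forall>\<^sub>F n in sequentially. transpose (fst (snd (\<theta> n))) = fst (snd (\<theta> n))"
  shows "\<forall>\<^sub>F n in sequentially. valid (\<theta> n)"
proof -
  obtain d where d: "d > 0" "\<And>T. transpose T = T \<Longrightarrow> norm (T - \<Sigma>) < d \<Longrightarrow> T \<in> spd"
    using spd_open[OF \<Sigma>] by metis
  have "(\<lambda>n. fst (snd (\<theta> n))) \<longlonglongrightarrow> fst (snd (\<mu>, \<Sigma>, \<nu>))" "(\<lambda>n. snd (snd (\<theta> n))) \<longlonglongrightarrow> snd (snd (\<mu>, \<Sigma>, \<nu>))"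
    by (intro tendsto_intros lim)+
  then have 1: "\<forall>\<^sub>F n in sequentially. norm (fst (snd (\<theta> n)) - \<Sigma>) < d" and 2: "\<forall>\<^sub>F n in sequentially. 0 < snd (snd (\<theta> n))"
    using d \<nu> by (auto simp: tendsto_iff dist_norm intro: order_tendstoD)
  show ?thesis
    using 1 2 sym by eventually_elim (auto simp: valid_def split_beta intro: d)
qed

lemma local_path_limit:
  fixes x t :: "'a::real_normed_vector"
  shows "(\<lambda>n. sqrt (real n) *\<^sub>R (x + (1 / sqrt (real n)) *\<^sub>R t - x)) \<longlonglongrightarrow> t"
proof -
  have "\<forall>\<^sub>F n in sequentially. t = sqrt (real n) *\<^sub>R (x + (1 / sqrt (real n)) *\<^sub>R t - x)"
    using eventually_gt_at_top[of 0] by eventually_elim simp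
  then show ?thesis by (rule Lim_transform_eventually[OF tendsto_const])
qed

lemma score_local_ratio:
  assumes \<Sigma>: "\<Sigma> \<in> spd" and \<nu>: "0 < \<nu>" and H: "transpose (fst (snd t)) = fst (snd t)"
  shows "local_ratio (student \<mu> \<Sigma> \<nu>) (\<lambda>n. likelihood_ratio (\<mu>, \<Sigma>, \<nu>) ((\<mu>, \<Sigma>, \<nu>) + (1 / sqrt (real n)) *\<^sub>R t)) (score (\<mu>, \<Sigma>, \<nu>) t)"
proof (rule student_local_ratio[OF \<Sigma> \<nu> local_path_limit])
  have "transpose (A + B) = transpose A + transpose B" for A B :: "real^'a^'a" by (simp add: transpose_def vec_eq_iff)
  then show "\<forall>\<^sub>F n in sequentially. valid ((\<mu>, \<Sigma>, \<nu>) + (1 / sqrt (real n)) *\<^sub>R t)"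
    using spdD(1)[OF \<Sigma>] H
    by (intro eventually_valid[OF \<Sigma> \<nu> scaled_convergent_imp[OF local_path_limit]]) (simp add: transpose_scalar)
qed

text \<open>Mean and variance are read off from mean-square differentiability along the straight
  path in direction \<open>t\<close>, whose scatter part must be symmetric for the path to stay in
  the parameter space.\<close>

lemma score_moments:
  fixes \<mu> :: "real^'k"
  assumes \<Sigma>: "\<Sigma> \<in> spd" and \<nu>: "0 < \<nu>" and H: "transpose (fst (snd t)) = fst (snd t)"
  shows "(\<integral>x. score (\<mu>, \<Sigma>, \<nu>) t x \<partial>student \<mu> \<Sigma> \<nu>) = 0"
    and "integrable (student \<mu> \<Sigma> \<nu>) (\<lambda>x. (score (\<mu>, \<Sigma>, \<nu>) t x)\<^sup>2)"
    and "integrable (student \<mu> \<Sigma> \<nu>) (score (\<mu>, \<Sigma>, \<nu>) t)"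
proof -
  interpret prob_space "student \<mu> \<Sigma> \<nu>" by (rule prob_space_student[OF \<Sigma> \<nu>])
  note lr = score_local_ratio[OF assms, of \<mu>]
  show "(\<integral>x. score (\<mu>, \<Sigma>, \<nu>) t x \<partial>student \<mu> \<Sigma> \<nu>) = 0" by (rule local_ratio_score_mean[OF lr])
  show sq: "integrable (student \<mu> \<Sigma> \<nu>) (\<lambda>x. (score (\<mu>, \<Sigma>, \<nu>) t x)\<^sup>2)"
    using lr by (simp add: local_ratio_def L2_conv_def)
  show "integrable (student \<mu> \<Sigma> \<nu>) (score (\<mu>, \<Sigma>, \<nu>) t)"
    by (rule square_integrable_imp_integrable[OF _ sq]) simp
qed

text \<open>With \<open>u = quad\<close>, the tail score, the scatter score in direction \<Sigma>
  and the efficient score all have this form, and the form is stable under the linear combination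
  that produces the last from the other two.\<close>

definition log_radial :: "real \<Rightarrow> real \<Rightarrow> real \<Rightarrow> real \<Rightarrow> real" where
  "log_radial a l b u = a + l * ln u + b / u"

lemma log_radial_measurable [measurable]: "log_radial a l b \<in> borel_measurable borel"
  unfolding log_radial_def[abs_def] by measurable

lemma log_radial_bound:
  assumes "0 < \<nu>" "\<nu> \<le> u"
  shows "\<bar>log_radial a l b u\<bar> \<le> (\<bar>a\<bar> + \<bar>l\<bar> + \<bar>b\<bar> / \<nu>) * (1 + \<bar>ln u\<bar>)"
proof -
  have "\<bar>b / u\<bar> \<le> \<bar>b\<bar> / \<nu>" using assms by (simp add: abs_divide frac_le)
  then have "\<bar>log_radial a l b u\<bar> \<le> \<bar>a\<bar> + \<bar>l\<bar> * \<bar>ln u\<bar> + \<bar>b\<bar> / \<nu>"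
    unfolding log_radial_def by (simp only: abs_mult[symmetric])
  also have "\<dots> \<le> (\<bar>a\<bar> + \<bar>l\<bar> + \<bar>b\<bar> / \<nu>) * (1 + \<bar>ln u\<bar>)"
    using assms by (simp add: algebra_simps)
  finally show ?thesis .
qed

lemma log_radial_integrable:
  fixes \<mu> :: "real^'k"
  assumes \<Sigma>: "\<Sigma> \<in> spd" and \<nu>: "0 < \<nu>"
  shows "\<exists>c>0. integrable (student \<mu> \<Sigma> \<nu>) (\<lambda>x. (log_radial a l b (quad \<mu> \<Sigma> \<nu> x))\<^sup>2 * exp (c * \<bar>log_radial a l b (quad \<mu> \<Sigma> \<nu> x)\<bar>))"
    and "integrable (student \<mu> \<Sigma> \<nu>) (\<lambda>x. (log_radial a l b (quad \<mu> \<Sigma> \<nu> x))\<^sup>2)"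
    and "integrable (student \<mu> \<Sigma> \<nu>) (\<lambda>x. log_radial a l b (quad \<mu> \<Sigma> \<nu> x))"
proof -
  interpret prob_space "student \<mu> \<Sigma> \<nu>" by (rule prob_space_student[OF \<Sigma> \<nu>])
  define C where "C = \<bar>a\<bar> + \<bar>l\<bar> + \<bar>b\<bar> / \<nu> + 1"
  have C: "C > 0" using \<nu> by (simp add: C_def add_nonneg_pos)
  have bd: "\<bar>log_radial a l b (quad \<mu> \<Sigma> \<nu> x)\<bar> \<le> C * (1 + \<bar>ln (quad \<mu> \<Sigma> \<nu> x)\<bar>)" for x
  proof (rule order_trans[OF log_radial_bound[OF \<nu> quad_ge[OF \<Sigma>]]])
    show "(\<bar>a\<bar> + \<bar>l\<bar> + \<bar>b\<bar> / \<nu>) * (1 + \<bar>ln (quad \<mu> \<Sigma> \<nu> x)\<bar>) \<le> C * (1 + \<bar>ln (quad \<mu> \<Sigma> \<nu> x)\<bar>)"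
      by (intro mult_right_mono) (simp_all add: C_def)
  qed
  define p where "p = \<nu> / 6"
  have p: "3 * p < \<nu>" "0 < p" using \<nu> by (simp_all add: p_def)
  \<comment> \<open>Converts the bound \<open>C * s\<close> on the function into the exponent
    \<open>p / 2 * s\<close> that \<open>integrable_student_log_bound\<close> admits.\<close>
  define c where "c = p / (2 * C)"
  have c: "c > 0" using p C by (simp add: c_def)
  have int: "integrable (student \<mu> \<Sigma> \<nu>) (\<lambda>x. (log_radial a l b (quad \<mu> \<Sigma> \<nu> x))\<^sup>2 * exp (c * \<bar>log_radial a l b (quad \<mu> \<Sigma> \<nu> x)\<bar>))"
  proof (rule integrable_student_log_bound[OF \<Sigma> \<nu> p])
    fix x
    define s where "s = 1 + \<bar>ln (quad \<mu> \<Sigma> \<nu> x)\<bar>"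
    define f where "f = log_radial a l b (quad \<mu> \<Sigma> \<nu> x)"
    have f: "\<bar>f\<bar> \<le> C * s" using bd by (simp add: f_def s_def)
    have "f\<^sup>2 \<le> (C * s)\<^sup>2" using f power_mono[OF f abs_ge_zero, of 2] by simp
    moreover have "c * \<bar>f\<bar> \<le> p / 2 * s"
      using mult_left_mono[OF f, of c] c C by (simp add: c_def field_simps)
    ultimately have "f\<^sup>2 * exp (c * \<bar>f\<bar>) \<le> (C * s)\<^sup>2 * exp (p / 2 * s)"
      by (intro mult_mono) auto
    then show "\<bar>f\<^sup>2 * exp (c * \<bar>f\<bar>)\<bar> \<le> C\<^sup>2 * (s\<^sup>2 * exp (p / 2 * s))"
      by (simp add: power_mult_distrib mult.assoc)
  qed measurable
  show "\<exists>c>0. integrable (student \<mu> \<Sigma> \<nu>) (\<lambda>x. (log_radial a l b (quad \<mu> \<Sigma> \<nu> x))\<^sup>2 * exp (c * \<bar>log_radial a l b (quad \<mu> \<Sigma> \<nu> x)\<bar>))"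
    using int c by blast
  show sq: "integrable (student \<mu> \<Sigma> \<nu>) (\<lambda>x. (log_radial a l b (quad \<mu> \<Sigma> \<nu> x))\<^sup>2)"
  proof (rule Bochner_Integration.integrable_bound[OF int _ AE_I2])
    fix x
    have "(log_radial a l b (quad \<mu> \<Sigma> \<nu> x))\<^sup>2 * 1 \<le> (log_radial a l b (quad \<mu> \<Sigma> \<nu> x))\<^sup>2 * exp (c * \<bar>log_radial a l b (quad \<mu> \<Sigma> \<nu> x)\<bar>)"
      using c by (intro mult_left_mono) auto
    then show "norm ((log_radial a l b (quad \<mu> \<Sigma> \<nu> x))\<^sup>2) \<le> norm ((log_radial a l b (quad \<mu> \<Sigma> \<nu> x))\<^sup>2 * exp (c * \<bar>log_radial a l b (quad \<mu> \<Sigma> \<nu> x)\<bar>))"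
      by simp
  qed measurable
  show "integrable (student \<mu> \<Sigma> \<nu>) (\<lambda>x. log_radial a l b (quad \<mu> \<Sigma> \<nu> x))"
    by (rule square_integrable_imp_integrable[OF _ sq]) simp
qed

section \<open>Location, scatter and tail scores\<close>

lemma score_location: "score (\<mu>, \<Sigma>, \<nu>) (m, 0, 0) x = (\<nu> + real CARD('k)) / quad \<mu> \<Sigma> \<nu> x * (m \<bullet> (matrix_inv \<Sigma> *v (x - \<mu>)))"
  if "\<Sigma> \<in> spd" for \<mu> :: "real^'k"
proof -
  have "ln_det_deriv \<Sigma> 0 = 0" by (rule linear_0[OF has_derivative_linear[OF ln_det_has_derivative[OF that]]])
  then have "score (\<mu>, \<Sigma>, \<nu>) (m, 0, 0) x = - ((\<nu> + real CARD('k)) / 2 * (- (2 * (m \<bullet> (matrix_inv \<Sigma> *v (x - \<mu>)))) / quad \<mu> \<Sigma> \<nu> x))"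
    unfolding score_def quad_deriv_def by simp
  then show ?thesis by simp
qed

lemma score_scatter: "score (\<mu>, \<Sigma>, \<nu>) (0, H, 0) x = - ln_det_deriv \<Sigma> H / 2 +
    (\<nu> + real CARD('k)) / 2 * ((matrix_inv \<Sigma> *v (x - \<mu>)) \<bullet> (H *v (matrix_inv \<Sigma> *v (x - \<mu>)))) / quad \<mu> \<Sigma> \<nu> x"
  for \<mu> :: "real^'k"
  by (simp add: score_def quad_deriv_def)

lemma score_tail: "score (\<mu>, \<Sigma>, \<nu>) (0, 0, 1) x =
    log_radial (log_norm_deriv (real CARD('k)) \<nu>) (- (1 / 2)) (- ((\<nu> + real CARD('k)) / 2)) (quad \<mu> \<Sigma> \<nu> x)"
  if "\<Sigma> \<in> spd" for \<mu> :: "real^'k"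
  using linear_0[OF has_derivative_linear[OF ln_det_has_derivative[OF that]]]
  by (simp add: score_def quad_deriv_def log_radial_def)

lemma scatter_direction_self:
  assumes \<Sigma>: "\<Sigma> \<in> spd"
  shows "(matrix_inv \<Sigma> *v (x - \<mu>)) \<bullet> (\<Sigma> *v (matrix_inv \<Sigma> *v (x - \<mu>))) = quad \<mu> \<Sigma> \<nu> x - \<nu>"
  by (simp add: quad_def matrix_inv_vector[OF spd_invertible[OF \<Sigma>]] inner_commute)

lemma student_inverse_quad_integrable:
  fixes \<mu> :: "real^'k"
  assumes \<Sigma>: "\<Sigma> \<in> spd" and \<nu>: "0 < \<nu>"
  shows "integrable (student \<mu> \<Sigma> \<nu>) (\<lambda>x. 1 / quad \<mu> \<Sigma> \<nu> x)"
  using log_radial_integrable(3)[OF assms, of \<mu> 0 0 1] by (simp add: log_radial_def)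

text \<open>In direction \<Sigma> the quadratic form is \<open>quad - \<nu>\<close>, so the score is
  a constant minus \<open>\<kappa> * \<nu> / quad\<close>. The constant is determined by mean 0 and
  involves only the moment \<open>e\<close> of the standard law, hence is the same for all \<mu> and
  \<Sigma>.\<close>

lemma score_scatter_self:
  fixes \<mu> :: "real^'k"
  assumes \<Sigma>: "\<Sigma> \<in> spd" and \<nu>: "0 < \<nu>"
  defines "\<kappa> \<equiv> (\<nu> + real CARD('k)) / 2" and "e \<equiv> (\<integral>z. 1 / (\<nu> + (norm (z :: real^'k))\<^sup>2) \<partial>student 0 (mat 1) \<nu>)"
  shows "score (\<mu>, \<Sigma>, \<nu>) (0, \<Sigma>, 0) x = log_radial (\<kappa> * \<nu> * e) 0 (- (\<kappa> * \<nu>)) (quad \<mu> \<Sigma> \<nu> x)"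
proof -
  let ?P = "student \<mu> \<Sigma> \<nu>"
  interpret prob_space ?P by (rule prob_space_student[OF \<Sigma> \<nu>])
  define a where "a = - ln_det_deriv \<Sigma> \<Sigma> / 2 + \<kappa>"
  have eq: "score (\<mu>, \<Sigma>, \<nu>) (0, \<Sigma>, 0) x = a - \<kappa> * \<nu> * (1 / quad \<mu> \<Sigma> \<nu> x)" for x
  proof -
    have "quad \<mu> \<Sigma> \<nu> x \<noteq> 0" using quad_pos[OF \<Sigma> \<nu>, of \<mu> x] by simp
    then show ?thesis
      unfolding score_scatter scatter_direction_self[OF \<Sigma>, where \<nu> = \<nu>] by (simp add: a_def \<kappa>_def field_simps)
  qed
  have "0 = (\<integral>x. score (\<mu>, \<Sigma>, \<nu>) (0, \<Sigma>, 0) x \<partial>?P)"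
    using score_moments(1)[OF \<Sigma> \<nu>, of "(0, \<Sigma>, 0)" \<mu>] spdD(1)[OF \<Sigma>] by simp
  also have "\<dots> = a - \<kappa> * \<nu> * (\<integral>x. 1 / quad \<mu> \<Sigma> \<nu> x \<partial>?P)"
    unfolding eq using student_inverse_quad_integrable[OF \<Sigma> \<nu>, of \<mu>]
    by (subst Bochner_Integration.integral_diff) (simp_all only: integrable_const integrable_mult_right integral_mult_right_zero, use prob_space in simp)
  also have "(\<integral>x. 1 / quad \<mu> \<Sigma> \<nu> x \<partial>?P) = e"
    using integral_student_radial[of "\<lambda>u. 1 / u" \<Sigma> \<nu> \<mu>] \<Sigma> \<nu> by (simp add: e_def)
  finally show ?thesis unfolding eq by (simp add: log_radial_def)
qed

text \<open>Spherical symmetry settles the quadratic term of the scatter score. Its constant term is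
  proportional to \<open>mean_direction\<close> as well: this follows by testing with the radial
  function 1, where the integral is 0. The remaining factor is identified by taking the direction
  \<Sigma>, whose \<open>mean_direction\<close> is 1.\<close>

lemma radial_score_scatter:
  fixes \<mu> :: "real^'k"
  assumes \<Sigma>: "\<Sigma> \<in> spd" and \<nu>: "0 < \<nu>" and H: "transpose H = H"
  shows "(\<integral>x. log_radial a l b (quad \<mu> \<Sigma> \<nu> x) * score (\<mu>, \<Sigma>, \<nu>) (0, H, 0) x \<partial>student \<mu> \<Sigma> \<nu>) =
     mean_direction \<Sigma> H * (\<integral>x. log_radial a l b (quad \<mu> \<Sigma> \<nu> x) * score (\<mu>, \<Sigma>, \<nu>) (0, \<Sigma>, 0) x \<partial>student \<mu> \<Sigma> \<nu>)"
proof -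
  let ?P = "student \<mu> \<Sigma> \<nu>" and ?u = "quad \<mu> \<Sigma> \<nu>"
  interpret prob_space ?P by (rule prob_space_student[OF \<Sigma> \<nu>])
  define \<kappa> where "\<kappa> = (\<nu> + real CARD('k)) / 2"
  have \<kappa>: "\<kappa> > 0" using \<nu> by (simp add: \<kappa>_def add_pos_nonneg)
  define v where "v = (\<lambda>x. (?u x - \<nu>) / ?u x)"
  have v_eq: "v x = 1 - \<nu> / ?u x" for x
    using quad_pos[OF \<Sigma> \<nu>, of \<mu> x] by (simp add: v_def field_simps)
  have key: "(\<integral>x. log_radial a l b (?u x) * score (\<mu>, \<Sigma>, \<nu>) (0, S, 0) x \<partial>?P) =
     - ln_det_deriv \<Sigma> S / 2 * (\<integral>x. log_radial a l b (?u x) \<partial>?P) + \<kappa> * (mean_direction \<Sigma> S * (\<integral>x. log_radial a l b (?u x) * v x \<partial>?P))"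
    if S: "transpose S = S" for S a l b
  proof -
    let ?g = "\<lambda>x. log_radial a l b (?u x)"
    have ig: "integrable ?P ?g" by (rule log_radial_integrable(3)[OF \<Sigma> \<nu>])
    have isc: "integrable ?P (\<lambda>x. ?g x * score (\<mu>, \<Sigma>, \<nu>) (0, S, 0) x)"
      using score_moments(2)[OF \<Sigma> \<nu>, of "(0, S, 0)" \<mu>] S
      by (intro integrable_mult_L2 log_radial_integrable(2)[OF \<Sigma> \<nu>]) simp_all
    have iv: "integrable ?P (\<lambda>x. ?g x * v x)"
    proof (rule Bochner_Integration.integrable_bound[OF ig _ AE_I2])
      fix x
      have "0 \<le> v x" "v x \<le> 1" using quad_pos[OF \<Sigma> \<nu>, of \<mu> x] quad_ge[OF \<Sigma>, of \<nu> \<mu> x] \<nu> by (simp_all add: v_def)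
      then show "norm (?g x * v x) \<le> norm (?g x)" by (simp add: abs_mult mult_left_le)
    qed (simp add: v_def)
    let ?q = "\<lambda>x. (matrix_inv \<Sigma> *v (x - \<mu>)) \<bullet> (S *v (matrix_inv \<Sigma> *v (x - \<mu>)))"
    have eq: "?g x * score (\<mu>, \<Sigma>, \<nu>) (0, S, 0) x = - ln_det_deriv \<Sigma> S / 2 * ?g x + \<kappa> * (?g x / ?u x * ?q x)" for x
    proof -
      have "g * (- D / 2 + \<kappa> * q / w) = - D / 2 * g + \<kappa> * (g / w * q)" for g D q w :: real
        by (simp add: distrib_left right_diff_distrib mult_ac)
      then show ?thesis unfolding score_scatter \<kappa>_def[symmetric] .
    qed
    have iq: "integrable ?P (\<lambda>x. \<kappa> * (?g x / ?u x * ?q x))"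
    proof -
      have "integrable ?P (\<lambda>x. ?g x * score (\<mu>, \<Sigma>, \<nu>) (0, S, 0) x - (- ln_det_deriv \<Sigma> S / 2 * ?g x))"
        using ig isc by (intro Bochner_Integration.integrable_diff) auto
      then show ?thesis unfolding eq by simp
    qed
    have "(\<integral>x. ?g x * score (\<mu>, \<Sigma>, \<nu>) (0, S, 0) x \<partial>?P) = (\<integral>x. - ln_det_deriv \<Sigma> S / 2 * ?g x \<partial>?P) + (\<integral>x. \<kappa> * (?g x / ?u x * ?q x) \<partial>?P)"
      unfolding eq using ig iq by (intro Bochner_Integration.integral_add) auto
    also have "(\<integral>x. \<kappa> * (?g x / ?u x * ?q x) \<partial>?P) = \<kappa> * (\<integral>x. ?g x / ?u x * ?q x \<partial>?P)"
      by (rule integral_mult_right_zero)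
    also have "(\<integral>x. ?g x / ?u x * ?q x \<partial>?P) = mean_direction \<Sigma> S * (\<integral>x. ?g x / ?u x * (?u x - \<nu>) \<partial>?P)"
      by (rule student_scatter_mean[OF _ \<Sigma> \<nu>, where g = "\<lambda>u. log_radial a l b u / u"]) (use iv in \<open>simp_all add: v_def\<close>)
    finally show ?thesis by (simp add: v_def)
  qed
  have lr1: "log_radial 1 0 0 u = 1" for u by (simp add: log_radial_def)
  define V where "V = (\<integral>x. v x \<partial>?P)"
  have D: "ln_det_deriv \<Sigma> S / 2 = \<kappa> * mean_direction \<Sigma> S * V" if S: "transpose S = S" for S
    using key[OF S, of 1 0 0] score_moments(1)[OF \<Sigma> \<nu>, of "(0, S, 0)" \<mu>] S prob_space by (simp add: lr1 V_def)
  define W where "W = \<kappa> * ((\<integral>x. log_radial a l b (?u x) * v x \<partial>?P) - V * (\<integral>x. log_radial a l b (?u x) \<partial>?P))"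
  have gen: "(\<integral>x. log_radial a l b (?u x) * score (\<mu>, \<Sigma>, \<nu>) (0, S, 0) x \<partial>?P) = mean_direction \<Sigma> S * W" if S: "transpose S = S" for S
    unfolding key[OF S] W_def using D[OF S] by (simp add: algebra_simps)
  have "mean_direction \<Sigma> \<Sigma> = 1"
  proof -
    let ?B = "spd_sqrt \<Sigma>"
    note inv = matrix_inv_vector[OF spd_invertible[OF spd_sqrt(1)[OF \<Sigma>]]]
    have "(matrix_inv ?B ** \<Sigma> ** matrix_inv ?B) *v z = mat 1 *v z" for z
    proof -
      have "\<Sigma> *v (matrix_inv ?B *v z) = ?B *v (?B *v (matrix_inv ?B *v z))"
        by (simp add: matrix_vector_mul_assoc spd_sqrt(2)[OF \<Sigma>] matrix_mul_assoc)
      then show ?thesis by (simp add: matrix_vector_mul_assoc[symmetric] inv)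
    qed
    then have "matrix_inv ?B ** \<Sigma> ** matrix_inv ?B = mat 1" by (simp only: matrix_eq) simp
    then show ?thesis by (simp add: mean_direction_def trace_I)
  qed
  then show ?thesis using gen[OF H] gen[OF spdD(1)[OF \<Sigma>]] by simp
qed

text \<open>Zero variance makes the continuous score vanish at every point. The point \<mu> removes
  the constant term, the other points the quadratic form, and polarisation removes \<open>H\<close>.
  This yields the invertibility of \<open>fisher22\<close>.\<close>

lemma score_scatter_nondegenerate:
  fixes \<mu> :: "real^'k"
  assumes \<Sigma>: "\<Sigma> \<in> spd" and \<nu>: "0 < \<nu>" and H: "transpose H = H"
    and zero: "(\<integral>x. (score (\<mu>, \<Sigma>, \<nu>) (0, H, 0) x)\<^sup>2 \<partial>student \<mu> \<Sigma> \<nu>) = 0"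
  shows "H = 0"
proof -
  let ?f = "\<lambda>x. score (\<mu>, \<Sigma>, \<nu>) (0, H, 0) x"
  have "AE x in student \<mu> \<Sigma> \<nu>. (?f x)\<^sup>2 = 0"
    using zero score_moments(2)[OF \<Sigma> \<nu>, of "(0, H, 0)" \<mu>] H by (subst (asm) integral_nonneg_eq_0_iff_AE) auto
  then have ae: "AE x in lborel. ?f x = 0" by (simp add: AE_student_iff[OF \<Sigma> \<nu>])
  have cont: "continuous_on UNIV ?f"
  proof -
    have "continuous_on UNIV (\<lambda>x. matrix_inv \<Sigma> *v (x - \<mu>))" "continuous_on UNIV (\<lambda>x. H *v (matrix_inv \<Sigma> *v (x - \<mu>)))"
      by (intro linear_continuous_on_compose[OF _ matrix_vector_mul_linear] continuous_intros)+
    moreover have "quad \<mu> \<Sigma> \<nu> x \<noteq> 0" for x using quad_pos[OF \<Sigma> \<nu>, of \<mu> x] by simp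
    ultimately show ?thesis
      unfolding score_scatter by (intro continuous_intros) (auto simp: quad_def intro!: continuous_intros)
  qed
  have f0: "?f x = 0" for x by (rule continuous_AE_zero[OF cont ae])
  have D0: "ln_det_deriv \<Sigma> H = 0" using f0[of \<mu>] by (simp add: score_scatter)
  have q0: "w \<bullet> (H *v w) = 0" for w
  proof -
    have "matrix_inv \<Sigma> *v (\<mu> + \<Sigma> *v w - \<mu>) = w" by (simp add: matrix_inv_vector[OF spd_invertible[OF \<Sigma>]])
    then show ?thesis
      using f0[of "\<mu> + \<Sigma> *v w"] D0 quad_pos[OF \<Sigma> \<nu>, of \<mu> "\<mu> + \<Sigma> *v w"] \<nu>
      by (simp add: score_scatter add_nonneg_eq_0_iff)
  qed
  have "a \<bullet> (H *v b) = 0" for a b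
  proof -
    have "(a + b) \<bullet> (H *v (a + b)) = 2 * (a \<bullet> (H *v b))"
      using q0[of a] q0[of b] symmetric_inner_matrix[OF H, of b a]
      by (simp add: matrix_vector_right_distrib inner_add_left inner_add_right inner_commute)
    then show ?thesis using q0 by simp
  qed
  then have "H *v b = 0" for b by (metis inner_eq_zero_iff)
  then show ?thesis by (simp add: matrix_eq_0_iff_vector)
qed

lemma unvech_eq_0: "unvech v = 0 \<Longrightarrow> v = 0"
proof -
  assume 0: "unvech v = 0"
  have "v $ p = 0" for p
  proof -
    have "fst (Rep_upper p) \<le> snd (Rep_upper p)" using Rep_upper[of p] by auto
    then have "unvech v $ fst (Rep_upper p) $ snd (Rep_upper p) = v $ p"
      by (simp add: unvech_def Rep_upper_inverse min_def max_def split_beta)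
    then show ?thesis using 0 by simp
  qed
  then show ?thesis by (simp add: vec_eq_iff)
qed

lemma inner_cov_sum:
  fixes f :: "'a \<Rightarrow> real^'n"
  assumes "\<And>p q. integrable M (\<lambda>x. f x $ p * g x)"
  shows "(\<integral>x. (v \<bullet> f x) * g x \<partial>M) = (\<Sum>p\<in>UNIV. v $ p * (\<integral>x. f x $ p * g x \<partial>M))"
proof -
  have "(\<integral>x. (v \<bullet> f x) * g x \<partial>M) = (\<integral>x. (\<Sum>p\<in>UNIV. v $ p * (f x $ p * g x)) \<partial>M)"
    by (simp add: inner_vec_def sum_distrib_right mult.assoc)
  also have "\<dots> = (\<Sum>p\<in>UNIV. \<integral>x. v $ p * (f x $ p * g x) \<partial>M)"
    using assms by (intro Bochner_Integration.integral_sum integrable_mult_right)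
  finally show ?thesis by simp
qed

text \<open>By \<open>radial_score_scatter\<close> the covariances of any scatter score with
  \<open>s0\<close> and with \<open>h0\<close> are the same multiple of two scalar moments. Hence
  \<open>c *\<^sub>R vech \<Sigma>\<close> solves the normal equations, and the projection of the
  tail score on all scatter scores is \<open>c\<close> times the single one in direction \<Sigma>.
  The constants stand before the quantifiers over \<mu> and \<Sigma>, being moments under the
  standard law; the argument of type \<open>itself\<close> fixes the dimension.\<close>

lemma efficient_score:
  fixes \<nu> :: real and k :: "'k::{finite, linorder} itself"
  assumes \<nu>: "0 < \<nu>"
  shows "\<exists>a b c G. 0 < G \<and> (\<forall>(\<mu> :: 'k rvec) \<Sigma>. \<Sigma> \<in> spd \<longrightarrow>
    (\<forall>n X. eff_central3 n \<mu> \<Sigma> \<nu> X = 1 / sqrt (real n) * (\<Sum>j<n. log_radial a (- (1 / 2)) b (quad \<mu> \<Sigma> \<nu> (X j)))) \<and>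
    eff_fisher33 \<mu> \<Sigma> \<nu> = G \<and>
    (\<integral>x. log_radial a (- (1 / 2)) b (quad \<mu> \<Sigma> \<nu> x) \<partial>student \<mu> \<Sigma> \<nu>) = 0 \<and>
    (\<integral>x. (log_radial a (- (1 / 2)) b (quad \<mu> \<Sigma> \<nu> x))\<^sup>2 \<partial>student \<mu> \<Sigma> \<nu>) = G \<and>
    (\<forall>x. score (\<mu>, \<Sigma>, \<nu>) (0, - c *\<^sub>R \<Sigma>, 1) x = log_radial a (- (1 / 2)) b (quad \<mu> \<Sigma> \<nu> x)) \<and>
    (\<forall>m H \<tau>. transpose H = H \<longrightarrow>
      (\<integral>x. log_radial a (- (1 / 2)) b (quad \<mu> \<Sigma> \<nu> x) * score (\<mu>, \<Sigma>, \<nu>) (m, H, \<tau>) x \<partial>student \<mu> \<Sigma> \<nu>) = \<tau> * G))"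
proof -
  define \<kappa> where "\<kappa> = (\<nu> + real CARD('k)) / 2"
  define e where "e = (\<integral>z. 1 / (\<nu> + (norm (z :: 'k rvec))\<^sup>2) \<partial>student 0 (mat 1) \<nu>)"
  define s0 where "s0 = log_radial (\<kappa> * \<nu> * e) 0 (- (\<kappa> * \<nu>))"
  define h0 where "h0 = log_radial (log_norm_deriv (real CARD('k)) \<nu>) (- (1 / 2)) (- \<kappa>)"
  define E where "E = (\<lambda>f. \<integral>z. (f :: real \<Rightarrow> real) (\<nu> + (norm (z :: 'k rvec))\<^sup>2) \<partial>student 0 (mat 1) \<nu>)"
  \<comment> \<open>The regression coefficient of the tail score \<open>h0\<close> on the scatter
    score \<open>s0\<close>; \<open>a\<close> and \<open>b\<close> are then the coefficients of
    \<open>h0 - c * s0\<close>.\<close>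
  define c where "c = E (\<lambda>u. h0 u * s0 u) / E (\<lambda>u. s0 u * s0 u)"
  define a b where "a = log_norm_deriv (real CARD('k)) \<nu> - c * (\<kappa> * \<nu> * e)" and "b = - \<kappa> + c * (\<kappa> * \<nu>)"
  define \<psi> where "\<psi> = log_radial a (- (1 / 2)) b"
  have [measurable]: "s0 \<in> borel_measurable borel" "h0 \<in> borel_measurable borel" "\<psi> \<in> borel_measurable borel"
    by (simp_all add: s0_def h0_def \<psi>_def)
  have \<psi>: "\<psi> u = h0 u - c * s0 u" for u
    by (simp add: \<psi>_def h0_def s0_def log_radial_def a_def b_def algebra_simps diff_divide_distrib add_divide_distrib)
  define G where "G = E (\<lambda>u. (\<psi> u)\<^sup>2)"
  have main: "0 < G \<and>
    (\<forall>n X. eff_central3 n \<mu> \<Sigma> \<nu> X = 1 / sqrt (real n) * (\<Sum>j<n. \<psi> (quad \<mu> \<Sigma> \<nu> (X j)))) \<and>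
    eff_fisher33 \<mu> \<Sigma> \<nu> = G \<and>
    (\<integral>x. \<psi> (quad \<mu> \<Sigma> \<nu> x) \<partial>student \<mu> \<Sigma> \<nu>) = 0 \<and>
    (\<integral>x. (\<psi> (quad \<mu> \<Sigma> \<nu> x))\<^sup>2 \<partial>student \<mu> \<Sigma> \<nu>) = G \<and>
    (\<forall>x. score (\<mu>, \<Sigma>, \<nu>) (0, - c *\<^sub>R \<Sigma>, 1) x = \<psi> (quad \<mu> \<Sigma> \<nu> x)) \<and>
    (\<forall>m H \<tau>. transpose H = H \<longrightarrow>
      (\<integral>x. \<psi> (quad \<mu> \<Sigma> \<nu> x) * score (\<mu>, \<Sigma>, \<nu>) (m, H, \<tau>) x \<partial>student \<mu> \<Sigma> \<nu>) = \<tau> * G)"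
    if \<Sigma>: "\<Sigma> \<in> spd" for \<mu> :: "'k rvec" and \<Sigma>
  proof -
    let ?P = "student \<mu> \<Sigma> \<nu>" and ?u = "quad \<mu> \<Sigma> \<nu>"
    interpret prob_space ?P by (rule prob_space_student[OF \<Sigma> \<nu>])
    have Esc: "(\<integral>x. f (?u x) \<partial>?P) = E f" if [measurable]: "f \<in> borel_measurable borel" for f
      unfolding E_def by (rule integral_student_radial[OF that \<Sigma> \<nu>])
    have sc: "score (\<mu>, \<Sigma>, \<nu>) (0, \<Sigma>, 0) x = s0 (?u x)" for x
      unfolding s0_def e_def \<kappa>_def by (rule score_scatter_self[OF \<Sigma> \<nu>])
    have st: "score (\<mu>, \<Sigma>, \<nu>) (0, 0, 1) x = h0 (?u x)" for x
      unfolding h0_def \<kappa>_def by (rule score_tail[OF \<Sigma>])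
    note lin = score_linear[OF \<Sigma> \<nu>, of \<mu>]
    have sq: "integrable ?P (\<lambda>x. (s0 (?u x))\<^sup>2)" "integrable ?P (\<lambda>x. (h0 (?u x))\<^sup>2)" "integrable ?P (\<lambda>x. (\<psi> (?u x))\<^sup>2)"
      unfolding s0_def h0_def \<psi>_def by (rule log_radial_integrable(2)[OF \<Sigma> \<nu>])+
    have pr: "integrable ?P (\<lambda>x. h0 (?u x) * s0 (?u x))" "integrable ?P (\<lambda>x. s0 (?u x) * s0 (?u x))"
      "integrable ?P (\<lambda>x. \<psi> (?u x) * h0 (?u x))" "integrable ?P (\<lambda>x. \<psi> (?u x) * s0 (?u x))" "integrable ?P (\<lambda>x. \<psi> (?u x) * \<psi> (?u x))"
      using sq by (intro integrable_mult_L2; simp)+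
    define Ehs Ess where "Ehs = (\<integral>x. h0 (?u x) * s0 (?u x) \<partial>?P)" and "Ess = (\<integral>x. s0 (?u x) * s0 (?u x) \<partial>?P)"
    have c: "c = Ehs / Ess"
      unfolding c_def Ehs_def Ess_def by (subst (1 2) Esc[symmetric]) simp_all
    have Ess0: "Ess \<noteq> 0"
    proof
      assume "Ess = 0"
      then have "(\<integral>x. (score (\<mu>, \<Sigma>, \<nu>) (0, \<Sigma>, 0) x)\<^sup>2 \<partial>?P) = 0" by (simp add: sc Ess_def power2_eq_square)
      from score_scatter_nondegenerate[OF \<Sigma> \<nu> spdD(1)[OF \<Sigma>] this] have "\<Sigma> = 0" .
      then show False using spdD(2)[OF \<Sigma>, of "axis undefined 1"] by simp
    qed
    have G: "(\<integral>x. (\<psi> (?u x))\<^sup>2 \<partial>?P) = G" unfolding G_def by (rule Esc) simp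
    have Eps: "(\<integral>x. \<psi> (?u x) * s0 (?u x) \<partial>?P) = 0"
    proof -
      have "(\<integral>x. \<psi> (?u x) * s0 (?u x) \<partial>?P) = (\<integral>x. h0 (?u x) * s0 (?u x) - c * (s0 (?u x) * s0 (?u x)) \<partial>?P)"
        by (simp add: \<psi> left_diff_distrib mult.assoc)
      also have "\<dots> = Ehs - c * Ess" using pr by (simp add: Ehs_def Ess_def)
      finally show ?thesis using c Ess0 by simp
    qed
    \<comment> \<open>The functions \<open>h0\<close> and \<psi> differ by \<open>c * s0\<close>, to
      which \<psi> is orthogonal.\<close>
    have Eph: "(\<integral>x. \<psi> (?u x) * h0 (?u x) \<partial>?P) = G"
    proof -
      have "(\<integral>x. \<psi> (?u x) * h0 (?u x) \<partial>?P) = (\<integral>x. \<psi> (?u x) * \<psi> (?u x) + c * (\<psi> (?u x) * s0 (?u x)) \<partial>?P)"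
        by (simp add: \<psi> algebra_simps)
      also have "\<dots> = G" using pr Eps G by (simp add: power2_eq_square)
      finally show ?thesis .
    qed
    have scH: "score (\<mu>, \<Sigma>, \<nu>) (0, - c *\<^sub>R \<Sigma>, 1) x = \<psi> (?u x)" for x
    proof -
      have "(0 :: 'k rvec, - c *\<^sub>R \<Sigma>, 1 :: real) = (- c) *\<^sub>R (0, \<Sigma>, 0) + (0, 0, 1)" by simp
      then have "score (\<mu>, \<Sigma>, \<nu>) (0, - c *\<^sub>R \<Sigma>, 1) x = (- c) *\<^sub>R score (\<mu>, \<Sigma>, \<nu>) (0, \<Sigma>, 0) x + score (\<mu>, \<Sigma>, \<nu>) (0, 0, 1) x"
        by (simp only: linear_add[OF lin] linear_scale[OF lin])
      then show ?thesis by (simp add: sc st \<psi>)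
    qed
    have sym: "transpose (fst (snd (0, - c *\<^sub>R \<Sigma>, 1 :: real))) = fst (snd (0 :: 'k rvec, - c *\<^sub>R \<Sigma>, 1 :: real))"
      using spdD(1)[OF \<Sigma>] by (simp only: fst_conv snd_conv transpose_scalar)
    have mean: "(\<integral>x. \<psi> (?u x) \<partial>?P) = 0"
      using score_moments(1)[OF \<Sigma> \<nu> sym, of \<mu>] by (simp only: scH)
    have orth: "(\<integral>x. \<psi> (?u x) * score (\<mu>, \<Sigma>, \<nu>) (m, H, \<tau>) x \<partial>?P) = \<tau> * G" if H: "transpose H = H" for m H \<tau>
    proof -
      have "(m, H, \<tau>) = (m, 0, 0) + (0, H, 0) + \<tau> *\<^sub>R (0, 0, 1)" by simp
      then have dec: "score (\<mu>, \<Sigma>, \<nu>) (m, H, \<tau>) x = score (\<mu>, \<Sigma>, \<nu>) (m, 0, 0) x + score (\<mu>, \<Sigma>, \<nu>) (0, H, 0) x + \<tau> * h0 (?u x)" for x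
        by (simp only: linear_add[OF lin] linear_scale[OF lin] st real_scaleR_def)
      have i: "integrable ?P (\<lambda>x. \<psi> (?u x) * score (\<mu>, \<Sigma>, \<nu>) (m, 0, 0) x)" "integrable ?P (\<lambda>x. \<psi> (?u x) * score (\<mu>, \<Sigma>, \<nu>) (0, H, 0) x)"
        using sq score_moments(2)[OF \<Sigma> \<nu>, of "(m, 0, 0)" \<mu>] score_moments(2)[OF \<Sigma> \<nu>, of "(0, H, 0)" \<mu>] H
        by (intro integrable_mult_L2; simp add: transpose_def vec_eq_iff)+
      have "(\<integral>x. \<psi> (?u x) * score (\<mu>, \<Sigma>, \<nu>) (m, H, \<tau>) x \<partial>?P) =
         (\<integral>x. \<psi> (?u x) * score (\<mu>, \<Sigma>, \<nu>) (m, 0, 0) x + \<psi> (?u x) * score (\<mu>, \<Sigma>, \<nu>) (0, H, 0) x + \<tau> * (\<psi> (?u x) * h0 (?u x)) \<partial>?P)"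
        unfolding dec by (simp add: algebra_simps)
      also have "\<dots> = (\<integral>x. \<psi> (?u x) * score (\<mu>, \<Sigma>, \<nu>) (m, 0, 0) x \<partial>?P) + (\<integral>x. \<psi> (?u x) * score (\<mu>, \<Sigma>, \<nu>) (0, H, 0) x \<partial>?P) + \<tau> * G"
        using i pr Eph by simp
      also have "(\<integral>x. \<psi> (?u x) * score (\<mu>, \<Sigma>, \<nu>) (m, 0, 0) x \<partial>?P) = 0"
        using student_location_orthogonal[of "\<lambda>u. \<psi> u * ((\<nu> + real CARD('k)) / u)" \<Sigma> \<nu> \<mu> m] \<Sigma> \<nu>
        by (simp add: score_location[OF \<Sigma>] mult.assoc)
      also have "(\<integral>x. \<psi> (?u x) * score (\<mu>, \<Sigma>, \<nu>) (0, H, 0) x \<partial>?P) = 0"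
        unfolding \<psi>_def radial_score_scatter[OF \<Sigma> \<nu> H] using Eps by (simp add: sc \<psi>_def)
      finally show ?thesis by simp
    qed
    \<comment> \<open>If \<open>G\<close> were 0, \<psi> would vanish at every value of
      \<open>quad\<close>, that is on all \<open>t \<ge> \<nu>\<close>; but its logarithmic term
      sends it to minus infinity.\<close>
    have Gpos: "0 < G"
    proof -
      have "0 \<le> G" unfolding G[symmetric] by simp
      moreover have "G \<noteq> 0"
      proof
        assume "G = 0"
        then have "AE x in ?P. (\<psi> (?u x))\<^sup>2 = 0"
          using G integral_nonneg_eq_0_iff_AE[OF sq(3)] by simp
        then have ae: "AE x in lborel. \<psi> (?u x) = 0" by (simp add: AE_student_iff[OF \<Sigma> \<nu>])
        have u0: "?u x \<noteq> 0" "0 < ?u x" for x using quad_pos[OF \<Sigma> \<nu>, of \<mu> x] by auto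
        have "continuous_on UNIV ?u"
          unfolding quad_def[abs_def] by (intro continuous_intros linear_continuous_on_compose[OF _ matrix_vector_mul_linear])
        then have "continuous_on UNIV (\<lambda>x. \<psi> (?u x))"
          unfolding \<psi>_def log_radial_def using u0 by (intro continuous_intros) auto
        then have z: "\<psi> (?u x) = 0" for x by (rule continuous_AE_zero[OF _ ae])
        have "\<psi> t = 0" if t: "\<nu> \<le> t" for t
        proof -
          define z where "z = sqrt (t - \<nu>) *\<^sub>R (axis undefined 1 :: 'k rvec)"
          have "(norm z)\<^sup>2 = t - \<nu>" using t by (simp add: z_def power_mult_distrib)
          then show ?thesis using z[of "\<mu> + spd_sqrt \<Sigma> *v z"] by (simp add: quad_affine[OF \<Sigma>])
        qed
        then have "\<forall>\<^sub>F t in at_top. \<psi> t = 0" by (auto intro: eventually_mono[OF eventually_ge_at_top[of \<nu>]])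
        then have "(\<psi> \<longlongrightarrow> 0) at_top" by (rule tendsto_eventually)
        moreover have "filterlim (\<lambda>t. a + - (1 / 2) * ln t + b / t) at_bot at_top" by real_asymp
        then have "filterlim \<psi> at_bot at_top" by (simp add: \<psi>_def log_radial_def[abs_def])
        ultimately show False
          using not_tendsto_and_filterlim_at_infinity[of at_top \<psi> 0] filterlim_at_bot_imp_at_infinity by fastforce
      qed
      ultimately show ?thesis by simp
    qed
    have symU: "transpose (fst (snd (0 :: 'k rvec, unvech v :: 'k rmat, 0 :: real))) = fst (snd (0 :: 'k rvec, unvech v :: 'k rmat, 0 :: real))" for v
      by (simp only: fst_conv snd_conv unvech_symmetric)
    have comp: "score2 \<mu> \<Sigma> \<nu> x $ p = score (\<mu>, \<Sigma>, \<nu>) (0, unvech (axis p 1), 0) x" for x p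
      using score2_eq[OF \<Sigma> \<nu>, of "axis p 1" \<mu> x] by (simp add: inner_axis')
    have i2: "integrable ?P (\<lambda>x. score2 \<mu> \<Sigma> \<nu> x $ p * score2 \<mu> \<Sigma> \<nu> x $ q)" for p q
      unfolding comp by (intro integrable_mult_L2 score_moments(2)[OF \<Sigma> \<nu> symU]) simp_all
    have i3: "integrable ?P (\<lambda>x. score2 \<mu> \<Sigma> \<nu> x $ p * h0 (?u x))" for p
      unfolding comp by (intro integrable_mult_L2 score_moments(2)[OF \<Sigma> \<nu> symU] sq) simp_all
    have m2: "(\<integral>x. score2 \<mu> \<Sigma> \<nu> x $ p \<partial>?P) = 0" for p
      unfolding comp by (rule score_moments(1)[OF \<Sigma> \<nu> symU])
    have sym0: "transpose (fst (snd (0 :: 'k rvec, 0 :: 'k rmat, 1 :: real))) = fst (snd (0 :: 'k rvec, 0 :: 'k rmat, 1 :: real))"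
      by (simp add: transpose_def vec_eq_iff)
    have m3: "(\<integral>x. score3 \<mu> \<Sigma> \<nu> x \<partial>?P) = 0"
      unfolding score3_eq[OF \<Sigma> \<nu>] by (rule score_moments(1)[OF \<Sigma> \<nu> sym0])
    have f22: "fisher22 \<mu> \<Sigma> \<nu> $ p $ q = (\<integral>x. score2 \<mu> \<Sigma> \<nu> x $ p * score2 \<mu> \<Sigma> \<nu> x $ q \<partial>?P)" for p q
      by (simp add: fisher22_def cov_def m2)
    have f23: "fisher23 \<mu> \<Sigma> \<nu> $ p = (\<integral>x. score2 \<mu> \<Sigma> \<nu> x $ p * h0 (?u x) \<partial>?P)" for p
      using m2 m3 by (simp add: fisher23_def cov_def score3_eq[OF \<Sigma> \<nu>] st)
    have f33: "fisher33 \<mu> \<Sigma> \<nu> = (\<integral>x. h0 (?u x) * h0 (?u x) \<partial>?P)"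
      using m3 by (simp add: fisher33_def cov_def score3_eq[OF \<Sigma> \<nu>] st)
    have F22: "v \<bullet> (fisher22 \<mu> \<Sigma> \<nu> *v w) = (\<integral>x. score (\<mu>, \<Sigma>, \<nu>) (0, unvech v, 0) x * score (\<mu>, \<Sigma>, \<nu>) (0, unvech w, 0) x \<partial>?P)" for v w
    proof -
      have iw: "integrable ?P (\<lambda>x. score2 \<mu> \<Sigma> \<nu> x $ p * (w \<bullet> score2 \<mu> \<Sigma> \<nu> x))" for p
        unfolding comp score2_eq[OF \<Sigma> \<nu>] by (intro integrable_mult_L2 score_moments(2)[OF \<Sigma> \<nu> symU]) simp_all
      have "(\<integral>x. score (\<mu>, \<Sigma>, \<nu>) (0, unvech v, 0) x * score (\<mu>, \<Sigma>, \<nu>) (0, unvech w, 0) x \<partial>?P) =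
        (\<integral>x. (v \<bullet> score2 \<mu> \<Sigma> \<nu> x) * (w \<bullet> score2 \<mu> \<Sigma> \<nu> x) \<partial>?P)" by (simp only: score2_eq[OF \<Sigma> \<nu>])
      also have "\<dots> = (\<Sum>p\<in>UNIV. v $ p * (\<integral>x. score2 \<mu> \<Sigma> \<nu> x $ p * (w \<bullet> score2 \<mu> \<Sigma> \<nu> x) \<partial>?P))"
        by (rule inner_cov_sum) (rule iw)
      also have "\<dots> = (\<Sum>p\<in>UNIV. v $ p * (fisher22 \<mu> \<Sigma> \<nu> *v w) $ p)"
      proof (intro sum.cong refl arg_cong2[where f = "(*)"])
        fix p
        have "(\<integral>x. score2 \<mu> \<Sigma> \<nu> x $ p * (w \<bullet> score2 \<mu> \<Sigma> \<nu> x) \<partial>?P) = (\<integral>x. (w \<bullet> score2 \<mu> \<Sigma> \<nu> x) * score2 \<mu> \<Sigma> \<nu> x $ p \<partial>?P)"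
          by (simp only: mult.commute)
        also have "\<dots> = (\<Sum>q\<in>UNIV. w $ q * (\<integral>x. score2 \<mu> \<Sigma> \<nu> x $ q * score2 \<mu> \<Sigma> \<nu> x $ p \<partial>?P))"
          by (rule inner_cov_sum) (rule i2)
        also have "\<dots> = (fisher22 \<mu> \<Sigma> \<nu> *v w) $ p"
          unfolding matrix_vector_mult_def vec_lambda_beta f22 by (intro sum.cong refl) (simp only: mult.commute)
        finally show "(\<integral>x. score2 \<mu> \<Sigma> \<nu> x $ p * (w \<bullet> score2 \<mu> \<Sigma> \<nu> x) \<partial>?P) = (fisher22 \<mu> \<Sigma> \<nu> *v w) $ p" .
      qed
      finally show ?thesis by (simp only: inner_vec_def inner_real_def)
    qed
    have F23: "v \<bullet> fisher23 \<mu> \<Sigma> \<nu> = (\<integral>x. score (\<mu>, \<Sigma>, \<nu>) (0, unvech v, 0) x * h0 (?u x) \<partial>?P)" for v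
    proof -
      have "(\<integral>x. score (\<mu>, \<Sigma>, \<nu>) (0, unvech v, 0) x * h0 (?u x) \<partial>?P) = (\<integral>x. (v \<bullet> score2 \<mu> \<Sigma> \<nu> x) * h0 (?u x) \<partial>?P)"
        by (simp only: score2_eq[OF \<Sigma> \<nu>])
      also have "\<dots> = (\<Sum>p\<in>UNIV. v $ p * (\<integral>x. score2 \<mu> \<Sigma> \<nu> x $ p * h0 (?u x) \<partial>?P))"
        by (rule inner_cov_sum) (rule i3)
      finally show ?thesis by (simp only: inner_vec_def inner_real_def f23)
    qed
    define F where "F = fisher22 \<mu> \<Sigma> \<nu>"
    have Fsym: "x \<bullet> (F *v y) = (F *v x) \<bullet> y" for x y
      using F22[of x y] F22[of y x] by (simp add: F_def mult.commute inner_commute)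
    have Finv: "invertible F"
    proof -
      have "v = 0" if "F *v v = 0" for v
      proof -
        have "(\<integral>x. (score (\<mu>, \<Sigma>, \<nu>) (0, unvech v, 0) x)\<^sup>2 \<partial>?P) = 0"
          using F22[of v v] that by (simp add: F_def power2_eq_square)
        then have "unvech v = (0 :: 'k rmat)" by (rule score_scatter_nondegenerate[OF \<Sigma> \<nu> unvech_symmetric])
        then show ?thesis by (rule unvech_eq_0)
      qed
      then show ?thesis by (simp add: invertible_left_inverse matrix_left_invertible_ker)
    qed
    note Fi = matrix_inv_vector[OF Finv]
    have uvS: "unvech (vech \<Sigma>) = \<Sigma>" by (rule unvech_vech[OF spdD(1)[OF \<Sigma>]])
    \<comment> \<open>The normal equations of the projection: paired with \<open>v\<close>, both
      sides equal \<open>mean_direction \<Sigma> (unvech v) * Ehs\<close>.\<close>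
    have Fv: "F *v (c *\<^sub>R vech \<Sigma>) = fisher23 \<mu> \<Sigma> \<nu>"
    proof (rule vector_eq_ldot[THEN iffD1], intro allI)
      fix v
      have "v \<bullet> (F *v vech \<Sigma>) = (\<integral>x. s0 (?u x) * score (\<mu>, \<Sigma>, \<nu>) (0, unvech v, 0) x \<partial>?P)"
        unfolding F_def F22 uvS sc by (simp only: mult.commute)
      also have "\<dots> = mean_direction \<Sigma> (unvech v) * Ess"
        unfolding s0_def radial_score_scatter[OF \<Sigma> \<nu> unvech_symmetric] unfolding sc Ess_def s0_def ..
      finally have 1: "v \<bullet> (F *v vech \<Sigma>) = mean_direction \<Sigma> (unvech v) * Ess" .
      have "v \<bullet> fisher23 \<mu> \<Sigma> \<nu> = (\<integral>x. h0 (?u x) * score (\<mu>, \<Sigma>, \<nu>) (0, unvech v, 0) x \<partial>?P)"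
        unfolding F23 by (simp only: mult.commute)
      also have "\<dots> = mean_direction \<Sigma> (unvech v) * Ehs"
        unfolding h0_def radial_score_scatter[OF \<Sigma> \<nu> unvech_symmetric] unfolding sc Ehs_def h0_def ..
      finally show "v \<bullet> (F *v (c *\<^sub>R vech \<Sigma>)) = v \<bullet> fisher23 \<mu> \<Sigma> \<nu>"
        using 1 c Ess0 by (simp add: matrix_vector_mult_scaleR)
    qed
    have proj: "fisher23 \<mu> \<Sigma> \<nu> \<bullet> (matrix_inv F *v z) = c * (vech \<Sigma> \<bullet> z)" for z
    proof -
      have "fisher23 \<mu> \<Sigma> \<nu> \<bullet> (matrix_inv F *v z) = (c *\<^sub>R vech \<Sigma>) \<bullet> (F *v (matrix_inv F *v z))"
        by (simp only: Fsym Fv)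
      then show ?thesis by (simp add: Fi)
    qed
    have ec: "eff_central3 n \<mu> \<Sigma> \<nu> X = 1 / sqrt (real n) * (\<Sum>j<n. \<psi> (?u (X j)))" for n X
    proof -
      have "vech \<Sigma> \<bullet> central2 n \<mu> \<Sigma> \<nu> X = 1 / sqrt (real n) * (\<Sum>j<n. s0 (?u (X j)))"
        by (simp add: central2_def inner_sum_right score2_eq[OF \<Sigma> \<nu>] uvS sc)
      then have "eff_central3 n \<mu> \<Sigma> \<nu> X = 1 / sqrt (real n) * (\<Sum>j<n. h0 (?u (X j))) - c * (1 / sqrt (real n) * (\<Sum>j<n. s0 (?u (X j))))"
        unfolding eff_central3_def F_def[symmetric] proj by (simp add: central3_def score3_eq[OF \<Sigma> \<nu>] st)
      also have "\<dots> = 1 / sqrt (real n) * (\<Sum>j<n. \<psi> (?u (X j)))"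
        by (simp add: \<psi> sum_subtractf sum_distrib_left[symmetric] diff_divide_distrib)
      finally show ?thesis .
    qed
    have ef: "eff_fisher33 \<mu> \<Sigma> \<nu> = G"
    proof -
      have "vech \<Sigma> \<bullet> fisher23 \<mu> \<Sigma> \<nu> = Ehs"
        unfolding F23 uvS sc Ehs_def by (simp only: mult.commute)
      then have "eff_fisher33 \<mu> \<Sigma> \<nu> = (\<integral>x. h0 (?u x) * h0 (?u x) \<partial>?P) - c * Ehs"
        unfolding eff_fisher33_def F_def[symmetric] proj f33 by simp
      also have "\<dots> = (\<integral>x. h0 (?u x) * h0 (?u x) - c * (h0 (?u x) * s0 (?u x)) \<partial>?P)"
        using pr sq by (simp add: Ehs_def power2_eq_square)
      also have "\<dots> = (\<integral>x. \<psi> (?u x) * h0 (?u x) \<partial>?P)" by (simp add: \<psi> algebra_simps)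
      finally show ?thesis using Eph by simp
    qed
    show ?thesis using Gpos ec ef mean G scH orth by blast
  qed
  have "0 < G" using main[OF spd_mat_1, of 0] by blast
  then show ?thesis using main unfolding \<psi>_def by blast
qed

section \<open>Plugging in an estimator\<close>

text \<open>With \<nu> fixed, a small relative change of \<open>quad\<close> moves
  \<open>ln (quad)\<close> and \<open>1 / quad\<close> by bounded amounts. The estimate is therefore
  uniform in x, and mean-square convergence follows without further moments.\<close>

lemma log_radial_quad_Lipschitz:
  fixes \<mu> :: "real^'k"
  assumes \<Sigma>: "\<Sigma> \<in> spd" and \<nu>: "0 < \<nu>"
  obtains C d where "0 < C" "0 < d"
    "\<And>v x. snd v \<in> spd \<Longrightarrow> norm (v - (\<mu>, \<Sigma>)) \<le> d \<Longrightarrow>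
       \<bar>log_radial a l b (quad (fst v) (snd v) \<nu> x) - log_radial a l b (quad \<mu> \<Sigma> \<nu> x)\<bar> \<le> C * norm (v - (\<mu>, \<Sigma>))"
proof -
  obtain K d where K: "K > 0" "d > 0"
    "\<And>h x. norm h \<le> d \<Longrightarrow> \<bar>Quad x ((\<mu>, \<Sigma>, \<nu>) + h) - quad \<mu> \<Sigma> \<nu> x\<bar> \<le> K * norm h * quad \<mu> \<Sigma> \<nu> x"
    using quad_perturbation[OF \<Sigma> \<nu>] by metis
  show thesis
  proof (rule that[of "\<bar>l\<bar> * (2 * K) + \<bar>b\<bar> * K / \<nu> + 1" "min d (1 / (2 * K))"])
    show "0 < \<bar>l\<bar> * (2 * K) + \<bar>b\<bar> * K / \<nu> + 1" using K \<nu> by (simp add: add_nonneg_pos)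
    show "0 < min d (1 / (2 * K))" using K by simp
    fix v :: "(real^'k) \<times> (real^'k^'k)" and x
    assume v: "snd v \<in> spd" "norm (v - (\<mu>, \<Sigma>)) \<le> min d (1 / (2 * K))"
    define h where "h = (fst v - \<mu>, snd v - \<Sigma>, 0 :: real)"
    define \<delta> where "\<delta> = norm (v - (\<mu>, \<Sigma>))"
    have h: "norm h = \<delta>" by (cases v) (simp add: h_def \<delta>_def norm_Pair)
    define u u' where "u = quad \<mu> \<Sigma> \<nu> x" and "u' = quad (fst v) (snd v) \<nu> x"
    have u: "0 < u" "\<nu> \<le> u" "0 < u'" "\<nu> \<le> u'"
      using quad_pos[OF \<Sigma> \<nu>] quad_ge[OF \<Sigma>] quad_pos[OF v(1) \<nu>] quad_ge[OF v(1)] by (auto simp: u_def u'_def)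
    have "Quad x ((\<mu>, \<Sigma>, \<nu>) + h) = u'" by (simp add: h_def Quad_def u'_def)
    then have du: "\<bar>u' - u\<bar> \<le> K * \<delta> * u" using K(3)[of h x] v(2) by (simp add: h \<delta>_def[symmetric] u_def)
    have half: "K * \<delta> \<le> 1 / 2"
      using v(2) K mult_left_mono[of \<delta> "1 / (2 * K)" K] by (simp add: \<delta>_def)
    have ln: "\<bar>ln u' - ln u\<bar> \<le> 2 * (K * \<delta>)" by (rule abs_ln_diff_le(2)[OF u(1) du half])
    have inv: "\<bar>1 / u' - 1 / u\<bar> \<le> K * \<delta> / \<nu>"
    proof -
      have "\<bar>1 / u' - 1 / u\<bar> = \<bar>u' - u\<bar> / (u * u')"
        using u by (simp add: divide_simps abs_mult abs_minus_commute)
      also have "\<dots> \<le> (K * \<delta> * u) / (u * u')" using du u by (intro divide_right_mono) auto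
      also have "\<dots> = K * \<delta> / u'" using u by simp
      also have "\<dots> \<le> K * \<delta> / \<nu>" using u \<nu> K by (intro divide_left_mono) (auto simp: \<delta>_def)
      finally show ?thesis .
    qed
    have "log_radial a l b u' - log_radial a l b u = l * (ln u' - ln u) + b * (1 / u' - 1 / u)"
      by (simp add: log_radial_def algebra_simps)
    then have "\<bar>log_radial a l b u' - log_radial a l b u\<bar> \<le> \<bar>l\<bar> * \<bar>ln u' - ln u\<bar> + \<bar>b\<bar> * \<bar>1 / u' - 1 / u\<bar>"
      by (metis abs_mult abs_triangle_ineq)
    also have "\<dots> \<le> \<bar>l\<bar> * (2 * (K * \<delta>)) + \<bar>b\<bar> * (K * \<delta> / \<nu>)"
      using ln inv by (intro add_mono mult_left_mono) auto
    also have "\<dots> \<le> (\<bar>l\<bar> * (2 * K) + \<bar>b\<bar> * K / \<nu> + 1) * \<delta>"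
      by (simp add: algebra_simps \<delta>_def)
    finally show "\<bar>log_radial a l b (quad (fst v) (snd v) \<nu> x) - log_radial a l b (quad \<mu> \<Sigma> \<nu> x)\<bar> \<le>
        (\<bar>l\<bar> * (2 * K) + \<bar>b\<bar> * K / \<nu> + 1) * norm (v - (\<mu>, \<Sigma>))"
      by (simp add: u_def u'_def \<delta>_def)
  qed
qed

lemma L2_conv_uniform:
  assumes "prob_space M" and F [measurable]: "F \<in> borel_measurable M" "integrable M (\<lambda>x. (F x)\<^sup>2)"
    and f: "\<forall>\<^sub>F n in sequentially. f n \<in> borel_measurable M \<and> (\<forall>x\<in>space M. \<bar>f n x - F x\<bar> \<le> e n)"
    and e: "e \<longlonglongrightarrow> (0::real)"
  shows "L2_conv M f F"
proof -
  interpret prob_space M by fact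
  have bdd: "\<forall>\<^sub>F n in sequentially. e n < 1" using e by (rule order_tendstoD) simp
  show ?thesis
  proof (rule L2_conv_dominated[where B = "\<lambda>x. \<bar>F x\<bar> + 1"])
    show "\<forall>\<^sub>F n in sequentially. f n \<in> borel_measurable M" using f by eventually_elim simp
    show "\<forall>\<^sub>F n in sequentially. \<forall>x\<in>space M. \<bar>f n x\<bar> \<le> \<bar>F x\<bar> + 1"
      using f bdd by eventually_elim (smt (verit, best))
    have "integrable M (\<lambda>x. (\<bar>F x\<bar> + 1 * 1)\<^sup>2)"
      using F by (intro integrable_power2_lincomb) auto
    then show "integrable M (\<lambda>x. (\<bar>F x\<bar> + 1)\<^sup>2)" by simp
    fix x assume x: "x \<in> space M"
    have "(\<lambda>n. f n x - F x) \<longlonglongrightarrow> 0"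
      by (rule Lim_null_comparison[OF _ e]) (use f x in \<open>auto elim: eventually_mono\<close>)
    then show "(\<lambda>n. f n x) \<longlonglongrightarrow> F x" by (rule LIM_zero_cancel)
  qed (use F in auto)
qed

text \<open>Fixes the constants supplied by \<open>efficient_score\<close> once for all \<mu> and
  \<Sigma>; in particular, inserting an estimate leaves the efficient information at
  \<open>G\<close>.\<close>

locale efficient_tail_score =
  fixes \<nu> a b c G :: real
  assumes \<nu>: "0 < \<nu>" and G: "0 < G"
    and eff: "\<And>(\<mu> :: ('k :: {finite, linorder}) rvec) \<Sigma>. \<Sigma> \<in> spd \<Longrightarrow>
    (\<forall>n X. eff_central3 n \<mu> \<Sigma> \<nu> X = 1 / sqrt (real n) * (\<Sum>j<n. log_radial a (- (1 / 2)) b (quad \<mu> \<Sigma> \<nu> (X j)))) \<and>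
    eff_fisher33 \<mu> \<Sigma> \<nu> = G \<and>
    (\<integral>x. log_radial a (- (1 / 2)) b (quad \<mu> \<Sigma> \<nu> x) \<partial>student \<mu> \<Sigma> \<nu>) = 0 \<and>
    (\<integral>x. (log_radial a (- (1 / 2)) b (quad \<mu> \<Sigma> \<nu> x))\<^sup>2 \<partial>student \<mu> \<Sigma> \<nu>) = G \<and>
    (\<forall>x. score (\<mu>, \<Sigma>, \<nu>) (0, - c *\<^sub>R \<Sigma>, 1) x = log_radial a (- (1 / 2)) b (quad \<mu> \<Sigma> \<nu> x)) \<and>
    (\<forall>m H \<tau>. transpose H = H \<longrightarrow>
      (\<integral>x. log_radial a (- (1 / 2)) b (quad \<mu> \<Sigma> \<nu> x) * score (\<mu>, \<Sigma>, \<nu>) (m, H, \<tau>) x \<partial>student \<mu> \<Sigma> \<nu>) = \<tau> * G)"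
begin

section \<open>Replacing the parameter by a nearby deterministic point\<close>

definition psi :: "'k rvec \<Rightarrow> 'k rmat \<Rightarrow> 'k rvec \<Rightarrow> real" where
  "psi \<mu> \<Sigma> x = log_radial a (- (1 / 2)) b (quad \<mu> \<Sigma> \<nu> x)"

definition Tn :: "nat \<Rightarrow> 'k rvec \<times> 'k rmat \<Rightarrow> (nat \<Rightarrow> 'k rvec) \<Rightarrow> real" where
  "Tn n v X = 1 / sqrt (real n) * (\<Sum>j<n. psi (fst v) (snd v) (X j))"

lemma psi_measurable [measurable]: "psi \<mu> \<Sigma> \<in> borel_measurable borel"
  unfolding psi_def[abs_def] by measurable

lemma psi_facts:
  assumes "\<Sigma> \<in> spd"
  shows "eff_central3 n \<mu> \<Sigma> \<nu> X = Tn n (\<mu>, \<Sigma>) X" "eff_fisher33 \<mu> \<Sigma> \<nu> = G"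
    "(\<integral>x. psi \<mu> \<Sigma> x \<partial>student \<mu> \<Sigma> \<nu>) = 0" "(\<integral>x. (psi \<mu> \<Sigma> x)\<^sup>2 \<partial>student \<mu> \<Sigma> \<nu>) = G"
    "score (\<mu>, \<Sigma>, \<nu>) (0, - c *\<^sub>R \<Sigma>, 1) x = psi \<mu> \<Sigma> x"
    "transpose H = H \<Longrightarrow> (\<integral>x. psi \<mu> \<Sigma> x * score (\<mu>, \<Sigma>, \<nu>) (m, H, \<tau>) x \<partial>student \<mu> \<Sigma> \<nu>) = \<tau> * G"
    "integrable (student \<mu> \<Sigma> \<nu>) (\<lambda>x. (psi \<mu> \<Sigma> x)\<^sup>2)" "integrable (student \<mu> \<Sigma> \<nu>) (psi \<mu> \<Sigma>)"
    "\<exists>c>0. integrable (student \<mu> \<Sigma> \<nu>) (\<lambda>x. (psi \<mu> \<Sigma> x)\<^sup>2 * exp (c * \<bar>psi \<mu> \<Sigma> x\<bar>))"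
  using eff[OF assms] log_radial_integrable[OF assms \<nu>] by (simp_all add: psi_def[abs_def] Tn_def)

text \<open>The difference is a normalised sum whose summands tend to 0 in mean square, so only its
  mean is at stake. The perturbed score \<open>g n\<close> is centred under its own law, so its
  scaled mean under the base law is minus the inner product of \<open>g n\<close> with
  \<open>sqrt n * (r n - 1)\<close>. That product tends to the covariance of \<open>psi\<close> with
  a location and scatter score, which is 0.\<close>

lemma Tn_conv_path:
  assumes \<Sigma>: "\<Sigma> \<in> spd" and lim: "(\<lambda>n. sqrt (real n) *\<^sub>R (v n - (\<mu>, \<Sigma>))) \<longlonglongrightarrow> t"
    and v: "\<forall>\<^sub>F n in sequentially. snd (v n) \<in> spd" and e: "0 < e"
  shows "(\<lambda>n. measure (student_sample n \<mu> \<Sigma> \<nu>) {X \<in> space (student_sample n \<mu> \<Sigma> \<nu>). e \<le> \<bar>Tn n (v n) X - Tn n (\<mu>, \<Sigma>) X\<bar>}) \<longlonglongrightarrow> 0"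
proof -
  let ?P = "student \<mu> \<Sigma> \<nu>"
  interpret P: prob_space ?P by (rule prob_space_student[OF \<Sigma> \<nu>])
  obtain C d where C: "0 < C" "0 < d" "\<And>v x. snd v \<in> spd \<Longrightarrow> norm (v - (\<mu>, \<Sigma>)) \<le> d \<Longrightarrow> \<bar>psi (fst v) (snd v) x - psi \<mu> \<Sigma> x\<bar> \<le> C * norm (v - (\<mu>, \<Sigma>))"
    using log_radial_quad_Lipschitz[OF \<Sigma> \<nu>] unfolding psi_def by metis
  have vto: "v \<longlonglongrightarrow> (\<mu>, \<Sigma>)" by (rule scaled_convergent_imp[OF lim])
  have n0: "(\<lambda>n. norm (v n - (\<mu>, \<Sigma>))) \<longlonglongrightarrow> 0"
    using vto by (simp add: tendsto_norm_zero_iff LIM_zero_iff)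
  have evd: "\<forall>\<^sub>F n in sequentially. norm (v n - (\<mu>, \<Sigma>)) < d" using n0 by (rule order_tendstoD) (rule C)
  have en: "(\<lambda>n. C * norm (v n - (\<mu>, \<Sigma>))) \<longlonglongrightarrow> 0" using tendsto_mult_left[OF n0, of C] by simp
  define g where "g = (\<lambda>n x. psi (fst (v n)) (snd (v n)) x)"
  have ev: "\<forall>\<^sub>F n in sequentially. g n \<in> borel_measurable ?P \<and> (\<forall>x\<in>space ?P. \<bar>g n x - psi \<mu> \<Sigma> x\<bar> \<le> C * norm (v n - (\<mu>, \<Sigma>)))"
    using evd v by eventually_elim (auto simp: g_def intro!: C(3))
  have gL: "L2_conv ?P g (psi \<mu> \<Sigma>)"
    by (rule L2_conv_uniform[OF P.prob_space_axioms _ _ ev en]) (use psi_facts[OF \<Sigma>] in simp_all)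
  define \<theta> where "\<theta> = (\<lambda>n. (fst (v n), snd (v n), \<nu>))"
  define s where "s = (fst t, snd t, 0 :: real)"
  have \<theta>lim: "(\<lambda>n. sqrt (real n) *\<^sub>R (\<theta> n - (\<mu>, \<Sigma>, \<nu>))) \<longlonglongrightarrow> s"
  proof -
    have "(\<lambda>n. (fst (sqrt (real n) *\<^sub>R (v n - (\<mu>, \<Sigma>))), snd (sqrt (real n) *\<^sub>R (v n - (\<mu>, \<Sigma>))), 0 :: real)) \<longlonglongrightarrow> s"
      unfolding s_def by (intro tendsto_intros lim)
    then show ?thesis by (simp add: \<theta>_def fst_diff snd_diff)
  qed
  have valid: "\<forall>\<^sub>F n in sequentially. valid (\<theta> n)" using v by eventually_elim (simp add: \<theta>_def valid_def \<nu>)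
  define r where "r = (\<lambda>n. likelihood_ratio (\<mu>, \<Sigma>, \<nu>) (\<theta> n))"
  have lr: "local_ratio ?P r (score (\<mu>, \<Sigma>, \<nu>) s)" unfolding r_def by (rule student_local_ratio[OF \<Sigma> \<nu> \<theta>lim valid])
  \<comment> \<open>The orthogonality relation concerns symmetric directions; \<open>t\<close> is
    symmetric as a limit of differences of symmetric matrices.\<close>
  have symt: "transpose (snd t) = snd t"
  proof -
    have "(\<lambda>n. transpose (snd (sqrt (real n) *\<^sub>R (v n - (\<mu>, \<Sigma>))))) \<longlonglongrightarrow> transpose (snd t)"
      unfolding transpose_def by (intro tendsto_intros lim)
    moreover have "\<forall>\<^sub>F n in sequentially. transpose (snd (sqrt (real n) *\<^sub>R (v n - (\<mu>, \<Sigma>)))) = snd (sqrt (real n) *\<^sub>R (v n - (\<mu>, \<Sigma>)))"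
      using v
    proof eventually_elim
      case (elim n)
      then show ?case using spdD(1)[OF elim] spdD(1)[OF \<Sigma>] by (simp add: transpose_def vec_eq_iff snd_diff)
    qed
    ultimately have "(\<lambda>n. snd (sqrt (real n) *\<^sub>R (v n - (\<mu>, \<Sigma>)))) \<longlonglongrightarrow> transpose (snd t)"
      by (rule Lim_transform_eventually)
    then show ?thesis using tendsto_snd[OF lim] LIMSEQ_unique by blast
  qed
  have "(\<lambda>n. \<integral>x. g n x * (sqrt (real n) * (r n x - 1)) \<partial>?P) \<longlonglongrightarrow> (\<integral>x. psi \<mu> \<Sigma> x * score (\<mu>, \<Sigma>, \<nu>) s x \<partial>?P)"
    using lr by (intro L2_conv_inner[OF gL]) (simp add: local_ratio_def)
  also have "(\<integral>x. psi \<mu> \<Sigma> x * score (\<mu>, \<Sigma>, \<nu>) s x \<partial>?P) = 0"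
    using psi_facts(6)[OF \<Sigma> symt, of \<mu> "fst t" 0] by (simp add: s_def)
  finally have l1: "(\<lambda>n. \<integral>x. g n x * (sqrt (real n) * (r n x - 1)) \<partial>?P) \<longlonglongrightarrow> 0" .
  define f where "f = (\<lambda>n x. g n x - psi \<mu> \<Sigma> x)"
  have l2: "(\<lambda>n. sqrt (real n) * (\<integral>x. f n x \<partial>?P)) \<longlonglongrightarrow> - 0"
  proof (rule Lim_transform_eventually[OF tendsto_minus[OF l1]], use v gL[unfolded L2_conv_def, THEN conjunct2, THEN conjunct2, THEN conjunct1] local_ratioD[OF lr] lr[unfolded local_ratio_def L2_conv_def, THEN conjunct1, THEN conjunct2, THEN conjunct2, THEN conjunct1] in eventually_elim)
    case (elim n)
    note \<Sigma>n = elim(1) and gm = elim(2)[THEN conjunct1] elim(2)[THEN conjunct2]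
      and rm = elim(4)[THEN conjunct1] elim(4)[THEN conjunct2]
    have ig: "integrable ?P (g n)"
      by (rule P.square_integrable_imp_integrable[OF gm])
    have igr: "integrable ?P (\<lambda>x. g n x * (sqrt (real n) * (r n x - 1)))"
      by (rule integrable_mult_L2[OF gm(1) rm(1) gm(2) rm(2)])
    have "0 = (\<integral>x. g n x \<partial>student (fst (v n)) (snd (v n)) \<nu>)"
      unfolding g_def by (rule psi_facts(3)[OF \<Sigma>n, symmetric])
    also have "student (fst (v n)) (snd (v n)) \<nu> = density ?P (r n)"
      unfolding r_def \<theta>_def by (rule student_eq_density[OF \<Sigma> \<nu> \<Sigma>n \<nu>])
    also have "(\<integral>x. g n x \<partial>density ?P (r n)) = (\<integral>x. r n x *\<^sub>R g n x \<partial>?P)"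
      using elim(3) gm(1) by (intro integral_density AE_I2) blast+
    also have "\<dots> = (\<integral>x. r n x * g n x \<partial>?P)" by simp
    finally have z: "(\<integral>x. r n x * g n x \<partial>?P) = 0" ..
    have "(\<integral>x. g n x * (sqrt (real n) * (r n x - 1)) \<partial>?P) + (\<integral>x. sqrt (real n) * g n x \<partial>?P) = (\<integral>x. sqrt (real n) * (r n x * g n x) \<partial>?P)"
      unfolding Bochner_Integration.integral_add[OF igr integrable_mult_right[OF ig], symmetric]
      by (intro Bochner_Integration.integral_cong refl) (simp add: algebra_simps)
    then have "(\<integral>x. g n x * (sqrt (real n) * (r n x - 1)) \<partial>?P) + sqrt (real n) * (\<integral>x. g n x \<partial>?P) = 0"
      using z by simp
    moreover have "(\<integral>x. f n x \<partial>?P) = (\<integral>x. g n x \<partial>?P)"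
      unfolding f_def using ig psi_facts(3,8)[OF \<Sigma>] by simp
    ultimately show ?case by simp
  qed
  have l3: "(\<lambda>n. \<integral>x. (f n x)\<^sup>2 \<partial>?P) \<longlonglongrightarrow> 0"
    using gL by (simp add: L2_conv_def f_def)
  have "(\<lambda>n. ((\<integral>x. (f n x)\<^sup>2 \<partial>?P) + (sqrt (real n) * (\<integral>x. f n x \<partial>?P))\<^sup>2) / e\<^sup>2) \<longlonglongrightarrow> (0 + (- 0)\<^sup>2) / e\<^sup>2"
    by (intro tendsto_intros l2 l3) (use e in simp)
  then have lim0: "(\<lambda>n. ((\<integral>x. (f n x)\<^sup>2 \<partial>?P) + (sqrt (real n) * (\<integral>x. f n x \<partial>?P))\<^sup>2) / e\<^sup>2) \<longlonglongrightarrow> 0" by simp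
  show ?thesis
  proof (rule Lim_null_comparison[OF _ lim0], use eventually_gt_at_top[of 0] L2_conv_diff_integrable[OF gL] in eventually_elim)
    case (elim n)
    have eq: "Tn n (v n) X - Tn n (\<mu>, \<Sigma>) X = 1 / sqrt (real n) * (\<Sum>j<n. f n (X j))" for X
      by (simp add: f_def g_def Tn_def sum_subtractf diff_divide_distrib)
    have "measure (student_sample n \<mu> \<Sigma> \<nu>) {X \<in> space (student_sample n \<mu> \<Sigma> \<nu>). e \<le> \<bar>Tn n (v n) X - Tn n (\<mu>, \<Sigma>) X\<bar>}
      \<le> ((\<integral>x. (f n x)\<^sup>2 \<partial>?P) + (sqrt (real n) * (\<integral>x. f n x \<partial>?P))\<^sup>2) / e\<^sup>2"
      unfolding eq student_sample_def
      by (rule P.PiM_sum_Chebyshev) (use elim e in \<open>simp_all add: f_def g_def\<close>)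
    then show ?case unfolding real_norm_def by (subst abs_of_nonneg) (rule measure_nonneg)
  qed
qed

text \<open>Uniformity is required because the values of an estimator move with n. A failure would
  produce bad points along a subsequence; compactness of the rescaled ball makes their directions
  converge after a further selection, and \<open>Tn_conv_path\<close> then contradicts them.\<close>

lemma Tn_conv_ball:
  assumes \<Sigma>: "\<Sigma> \<in> spd" and e: "0 < e" and \<eta>: "0 < \<eta>" and r: "0 < r"
  shows "\<forall>\<^sub>F n in sequentially. \<forall>v. snd v \<in> spd \<longrightarrow> v \<in> cball (\<mu>, \<Sigma>) (r / sqrt (real n)) \<longrightarrow>
     measure (student_sample n \<mu> \<Sigma> \<nu>) {X \<in> space (student_sample n \<mu> \<Sigma> \<nu>). e \<le> \<bar>Tn n v X - Tn n (\<mu>, \<Sigma>) X\<bar>} < \<eta>"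
proof (rule ccontr)
  define q where "q = (\<lambda>n v. measure (student_sample n \<mu> \<Sigma> \<nu>) {X \<in> space (student_sample n \<mu> \<Sigma> \<nu>). e \<le> \<bar>Tn n v X - Tn n (\<mu>, \<Sigma>) X\<bar>})"
  assume "\<not> ?thesis"
  then have "\<exists>\<^sub>F n in sequentially. \<exists>v. snd v \<in> spd \<and> v \<in> cball (\<mu>, \<Sigma>) (r / sqrt (real n)) \<and> \<eta> \<le> q n v"
    by (simp add: q_def not_eventually not_less)
  then have "\<exists>\<^sub>F n in sequentially. 0 < n \<and> (\<exists>v. snd v \<in> spd \<and> v \<in> cball (\<mu>, \<Sigma>) (r / sqrt (real n)) \<and> \<eta> \<le> q n v)"
    using eventually_gt_at_top[of 0] by (rule frequently_eventually_conj)
  then have "\<forall>m. \<exists>n>m. 0 < n \<and> (\<exists>v. snd v \<in> spd \<and> v \<in> cball (\<mu>, \<Sigma>) (r / sqrt (real n)) \<and> \<eta> \<le> q n v)"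
    by (simp add: frequently_sequentially) (meson less_le_trans lessI)
  then obtain N :: "nat \<Rightarrow> nat" where N: "strict_mono N"
    "\<And>i. 0 < N i \<and> (\<exists>v. snd v \<in> spd \<and> v \<in> cball (\<mu>, \<Sigma>) (r / sqrt (real (N i))) \<and> \<eta> \<le> q (N i) v)"
    using infinite_enumerate[of "{n. 0 < n \<and> (\<exists>v. snd v \<in> spd \<and> v \<in> cball (\<mu>, \<Sigma>) (r / sqrt (real n)) \<and> \<eta> \<le> q n v)}"]
    unfolding infinite_nat_iff_unbounded by auto
  then obtain V where V: "\<And>i. snd (V i) \<in> spd" "\<And>i. V i \<in> cball (\<mu>, \<Sigma>) (r / sqrt (real (N i)))" "\<And>i. \<eta> \<le> q (N i) (V i)"
    by metis
  define w where "w = (\<lambda>i. sqrt (real (N i)) *\<^sub>R (V i - (\<mu>, \<Sigma>)))"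
  have "w i \<in> cball 0 r" for i
    using V(2)[of i] N(2)[of i] by (simp add: w_def dist_norm norm_minus_commute pos_le_divide_eq mult.commute)
  moreover have "compact (cball (0 :: 'k rvec \<times> 'k rmat) r)" by (rule compact_cball)
  ultimately obtain t \<sigma> where \<sigma>: "strict_mono \<sigma>" "(w \<circ> \<sigma>) \<longlonglongrightarrow> t"
    unfolding compact_def by meson
  define M where "M = N \<circ> \<sigma>"
  have M: "strict_mono M" using N(1) \<sigma>(1) by (simp add: M_def strict_mono_o)
  have Mpos: "0 < M i" for i using N(2) by (simp add: M_def)
  define i' where "i' = inv M"
  have i': "i' (M i) = i" for i using strict_mono_imp_inj_on[OF M] by (simp add: i'_def)
  \<comment> \<open>Off the subsequence the gaps are filled by the straight path in the limiting
    direction, so that the full sequence has direction \<open>t\<close>.\<close>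
  define v where "v = (\<lambda>n. if n \<in> range M then V (\<sigma> (i' n)) else (\<mu>, \<Sigma>) + (1 / sqrt (real n)) *\<^sub>R t)"
  have vM: "v (M i) = V (\<sigma> i)" for i by (simp add: v_def i')
  have lim: "(\<lambda>n. sqrt (real n) *\<^sub>R (v n - (\<mu>, \<Sigma>))) \<longlonglongrightarrow> t"
  proof (rule tendstoI)
    fix \<epsilon> :: real assume \<epsilon>: "\<epsilon> > 0"
    obtain I where I: "\<And>i. i \<ge> I \<Longrightarrow> dist ((w \<circ> \<sigma>) i) t < \<epsilon>" using \<sigma>(2) \<epsilon> by (auto simp: lim_sequentially)
    have "dist (sqrt (real n) *\<^sub>R (v n - (\<mu>, \<Sigma>))) t < \<epsilon>" if n: "n > M I" for n
    proof (cases "n \<in> range M")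
      case True
      then obtain i where i: "n = M i" by blast
      then have "I \<le> i" using n strict_mono_less[OF M] by simp
      show ?thesis using I[OF \<open>I \<le> i\<close>] unfolding i vM by (simp add: w_def M_def)
    next
      case False
      then show ?thesis using n \<epsilon> by (simp add: v_def)
    qed
    then show "\<forall>\<^sub>F n in sequentially. dist (sqrt (real n) *\<^sub>R (v n - (\<mu>, \<Sigma>))) t < \<epsilon>"
      by (rule eventually_mono[OF eventually_gt_at_top[of "M I"]])
  qed
  have symt: "transpose (snd t) = snd t"
  proof -
    have sw: "transpose (snd (w i)) = snd (w i)" for i
      using spdD(1)[OF V(1)[of i]] spdD(1)[OF \<Sigma>] by (simp add: w_def transpose_def vec_eq_iff snd_diff)
    have "(\<lambda>i. transpose (snd ((w \<circ> \<sigma>) i))) \<longlonglongrightarrow> transpose (snd t)"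
      unfolding transpose_def by (intro tendsto_intros \<sigma>)
    then have "(\<lambda>i. snd ((w \<circ> \<sigma>) i)) \<longlonglongrightarrow> transpose (snd t)" by (simp add: sw)
    then show ?thesis using tendsto_snd[OF \<sigma>(2)] LIMSEQ_unique by blast
  qed
  have "(\<lambda>n. (fst (v n), snd (v n), \<nu>)) \<longlonglongrightarrow> (fst (\<mu>, \<Sigma>), snd (\<mu>, \<Sigma>), \<nu>)"
    by (intro tendsto_intros scaled_convergent_imp[OF lim])
  then have "(\<lambda>n. (fst (v n), snd (v n), \<nu>)) \<longlonglongrightarrow> (\<mu>, \<Sigma>, \<nu>)" by simp
  then have "\<forall>\<^sub>F n in sequentially. valid (fst (v n), snd (v n), \<nu>)"
  proof (rule eventually_valid[OF \<Sigma> \<nu>], intro always_eventually allI)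
    fix n
    have "transpose (snd (v n)) = snd (v n)"
      using spdD(1)[OF V(1)] spdD(1)[OF \<Sigma>] symt
      by (simp add: v_def transpose_def vec_eq_iff)
    then show "transpose (fst (snd (fst (v n), snd (v n), \<nu>))) = fst (snd (fst (v n), snd (v n), \<nu>))" by simp
  qed
  then have "\<forall>\<^sub>F n in sequentially. snd (v n) \<in> spd" by eventually_elim (simp add: valid_def)
  from Tn_conv_path[OF \<Sigma> lim this e] have "(\<lambda>n. q n (v n)) \<longlonglongrightarrow> 0" by (simp add: q_def)
  then have "(\<lambda>i. q (M i) (v (M i))) \<longlonglongrightarrow> 0"
    using LIMSEQ_subseq_LIMSEQ[OF _ M] by (fastforce simp: o_def)
  then have "\<forall>\<^sub>F i in sequentially. q (M i) (v (M i)) < \<eta>" by (rule order_tendstoD) (rule \<eta>)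
  then obtain i where "q (M i) (v (M i)) < \<eta>" using eventually_happens' sequentially_bot by blast
  then show False using V(3)[of "\<sigma> i"] by (simp add: vM) (simp add: M_def)
qed

end

section \<open>Measurability of the plugged-in statistic\<close>

lemma sets_student_sample [measurable_cong, simp]:
  "sets (student_sample n \<mu> \<Sigma> \<nu>) = sets (sample_space n)"
  "space (student_sample n \<mu> \<Sigma> \<nu>) = space (sample_space n)"
proof -
  show "sets (student_sample n \<mu> \<Sigma> \<nu>) = sets (sample_space n)"
    unfolding student_sample_def by (rule sets_PiM_cong) auto
  then show "space (student_sample n \<mu> \<Sigma> \<nu>) = space (sample_space n)" by (rule sets_eq_imp_space_eq)
qed

lemma prob_space_student_sample:
  "\<Sigma> \<in> spd \<Longrightarrow> 0 < \<nu> \<Longrightarrow> prob_space (student_sample n \<mu> \<Sigma> \<nu>)"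
  unfolding student_sample_def by (intro prob_space_PiM prob_space_student)

lemma borel_measurable_vec_nth [measurable]:
  fixes f :: "'a \<Rightarrow> 'b::topological_space^'n"
  assumes "f \<in> M \<rightarrow>\<^sub>M borel"
  shows "(\<lambda>x. f x $ i) \<in> M \<rightarrow>\<^sub>M borel"
  using assms by (rule measurable_compose) (intro borel_measurable_continuous_onI continuous_intros)

lemma borel_measurable_det:
  fixes A :: "'a \<Rightarrow> real^'n^'n"
  assumes "\<And>i j. (\<lambda>x. A x $ i $ j) \<in> borel_measurable M"
  shows "(\<lambda>x. det (A x)) \<in> borel_measurable M"
  unfolding det_def using assms by (intro borel_measurable_sum borel_measurable_times borel_measurable_const borel_measurable_prod)

text \<open>Serves measurability at an estimated matrix: Cramer's rule exhibits the components as
  quotients of polynomials in the entries.\<close>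

lemma matrix_inv_cramer:
  fixes A :: "real^'n^'n"
  assumes "invertible A"
  shows "(matrix_inv A *v b) $ k = det (\<chi> i j. if j = k then b $ i else A $ i $ j) / det A"
  using cramer_lemma[where A = A and x = "matrix_inv A *v b" and k = k] assms
  unfolding matrix_inv_vector(1)[OF assms, of b] by (simp add: invertible_det_nz eq_divide_eq)

lemma borel_measurable_quad:
  fixes m :: "'a \<Rightarrow> real^'k" and S :: "'a \<Rightarrow> real^'k^'k"
  assumes [measurable]: "m \<in> borel_measurable M" "S \<in> borel_measurable M" "x \<in> borel_measurable M"
    and S: "\<And>\<omega>. \<omega> \<in> space M \<Longrightarrow> S \<omega> \<in> spd"
  shows "(\<lambda>\<omega>. quad (m \<omega>) (S \<omega>) \<nu> (x \<omega>)) \<in> borel_measurable M"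
proof -
  have d [measurable]: "(\<lambda>\<omega>. det (S \<omega>)) \<in> borel_measurable M"
    by (rule borel_measurable_det) measurable
  have c [measurable]: "(\<lambda>\<omega>. det ((\<chi> i j. if j = k then (x \<omega> - m \<omega>) $ i else S \<omega> $ i $ j) :: real^'k^'k)) \<in> borel_measurable M" for k
  proof (rule borel_measurable_det)
    fix i j
    show "(\<lambda>\<omega>. (\<chi> i j. if j = k then (x \<omega> - m \<omega>) $ i else S \<omega> $ i $ j) $ i $ j) \<in> borel_measurable M"
      by (cases "j = k") (simp_all del: vector_minus_component)
  qed
  have "(\<lambda>\<omega>. \<nu> + (\<Sum>k\<in>UNIV. (x \<omega> - m \<omega>) $ k * (det ((\<chi> i j. if j = k then (x \<omega> - m \<omega>) $ i else S \<omega> $ i $ j) :: real^'k^'k) / det (S \<omega>)))) \<in> borel_measurable M"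
    by (intro borel_measurable_add borel_measurable_const borel_measurable_sum borel_measurable_times borel_measurable_divide c d) measurable
  also have "?this \<longleftrightarrow> ?thesis"
    using S by (intro measurable_cong) (simp add: quad_def inner_vec_def matrix_inv_cramer spd_invertible)
  finally show ?thesis .
qed

section \<open>Characteristic functions and weak convergence\<close>

lemma cmod_iexp_diff_le: "cmod (iexp x - iexp y) \<le> \<bar>x - y\<bar>"
proof -
  have "iexp x - iexp y = iexp y * (iexp (x - y) - 1)"
    by (simp add: exp_add[symmetric] algebra_simps)
  then show ?thesis using iexp_approx1[of "x - y" 0] by (simp add: norm_mult)
qed

text \<open>Where the variables differ by less than \<open>e\<close> the integrands differ by at
  most \<open>\<bar>u\<bar> * e\<close>, elsewhere by at most 2. This carries closeness in
  probability over to characteristic functions, as in Slutsky's lemma.\<close>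

lemma (in prob_space) char_diff_le:
  assumes [measurable]: "X \<in> borel_measurable M" "Y \<in> borel_measurable M" and e: "0 \<le> e"
  shows "cmod (char (distr M borel X) u - char (distr M borel Y) u)
    \<le> \<bar>u\<bar> * e + 2 * measure M {\<omega> \<in> space M. e \<le> \<bar>X \<omega> - Y \<omega>\<bar>}"
proof -
  let ?A = "{\<omega> \<in> space M. e \<le> \<bar>X \<omega> - Y \<omega>\<bar>}"
  have [measurable]: "?A \<in> sets M" by measurable
  have i: "integrable M (\<lambda>\<omega>. iexp (u * X \<omega>))" "integrable M (\<lambda>\<omega>. iexp (u * Y \<omega>))"
    by (rule integrable_iexp; measurable)+
  have "char (distr M borel X) u - char (distr M borel Y) u = (\<integral>\<omega>. iexp (u * X \<omega>) - iexp (u * Y \<omega>) \<partial>M)"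
    unfolding Bochner_Integration.integral_diff[OF i] by (simp add: char_def integral_distr)
  also have "cmod \<dots> \<le> (\<integral>\<omega>. \<bar>u\<bar> * e + 2 * indicator ?A \<omega> \<partial>M)"
  proof (rule order_trans[OF integral_norm_bound integral_mono])
    show "integrable M (\<lambda>\<omega>. cmod (iexp (u * X \<omega>) - iexp (u * Y \<omega>)))"
      using i by (intro integrable_norm Bochner_Integration.integrable_diff)
    show "integrable M (\<lambda>\<omega>. \<bar>u\<bar> * e + 2 * indicator ?A \<omega> :: real)" by (auto intro!: integrable_real_indicator simp: emeasure_eq_measure)
    fix \<omega> assume \<omega>: "\<omega> \<in> space M"
    show "cmod (iexp (u * X \<omega>) - iexp (u * Y \<omega>)) \<le> \<bar>u\<bar> * e + 2 * indicator ?A \<omega>"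
    proof (cases "\<omega> \<in> ?A")
      case True
      have "cmod (iexp (u * X \<omega>) - iexp (u * Y \<omega>)) \<le> cmod (iexp (u * X \<omega>)) + cmod (iexp (u * Y \<omega>))"
        by (rule norm_triangle_ineq4)
      also have "\<dots> = 2" by simp
      also have "\<dots> \<le> \<bar>u\<bar> * e + 2 * indicator ?A \<omega>" using True e by simp
      finally show ?thesis .
    next
      case False
      then have "\<bar>X \<omega> - Y \<omega>\<bar> \<le> e" using \<omega> by auto
      then have "\<bar>u * X \<omega> - u * Y \<omega>\<bar> \<le> \<bar>u\<bar> * e"
        unfolding right_diff_distrib[symmetric] abs_mult by (rule mult_left_mono) simp
      then show ?thesis using cmod_iexp_diff_le[of "u * X \<omega>" "u * Y \<omega>"] False by simp
    qed
  qed
  also have "\<dots> = \<bar>u\<bar> * e + 2 * measure M ?A"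
    by (subst Bochner_Integration.integral_add) (auto simp: emeasure_eq_measure prob_space intro!: integrable_real_indicator)
  finally show ?thesis .
qed

lemma levy_continuity_eventually:
  assumes M: "\<forall>\<^sub>F n in sequentially. real_distribution (M n)" and M': "real_distribution M'"
    and conv: "\<And>u. (\<lambda>n. char (M n) u) \<longlonglongrightarrow> char M' u"
  shows "weak_conv_m M M'"
    and "A \<in> sets borel \<Longrightarrow> M' (frontier A) = 0 \<Longrightarrow> (\<lambda>n. measure (M n) A) \<longlonglongrightarrow> measure M' A"
proof -
  \<comment> \<open>Terms that fail to be distributions, finitely many by hypothesis, are replaced
    by the limit law, which leaves convergence untouched.\<close>
  define N where "N = (\<lambda>n. if real_distribution (M n) then M n else M')"
  have ev: "\<forall>\<^sub>F n in sequentially. N n = M n" using M by eventually_elim (simp add: N_def)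
  have N: "real_distribution (N n)" for n using M' by (simp add: N_def)
  have w: "weak_conv_m N M'"
  proof (rule levy_continuity[OF N M'])
    show "(\<lambda>n. char (N n) u) \<longlonglongrightarrow> char M' u" for u
      by (rule Lim_transform_eventually[OF conv]) (use ev in eventually_elim, simp)
  qed
  show "weak_conv_m M M'"
    unfolding weak_conv_m_def weak_conv_def
  proof (intro allI impI)
    fix x assume "isCont (cdf M') x"
    then have "(\<lambda>n. cdf (N n) x) \<longlonglongrightarrow> cdf M' x" using w by (simp add: weak_conv_m_def weak_conv_def)
    then show "(\<lambda>n. cdf (M n) x) \<longlonglongrightarrow> cdf M' x"
      by (rule Lim_transform_eventually) (use ev in eventually_elim, simp)
  qed
  assume "A \<in> sets borel" "M' (frontier A) = 0"
  then have "(\<lambda>n. measure (N n) A) \<longlonglongrightarrow> measure M' A"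
    by (rule weak_conv_imp_continuity_set_conv[OF N M' w])
  then show "(\<lambda>n. measure (M n) A) \<longlonglongrightarrow> measure M' A"
    by (rule Lim_transform_eventually) (use ev in eventually_elim, simp)
qed

lemma real_distribution_normal: "0 < \<sigma> \<Longrightarrow> real_distribution (density lborel (normal_density m \<sigma>))"
  by (simp add: real_distribution_def real_distribution_axioms_def prob_space_normal_density)

lemma normal_eq_distr:
  assumes "c \<noteq> 0"
  shows "density lborel (normal_density m \<bar>c\<bar>) = distr std_normal_distribution borel (\<lambda>x. m + c * x)"
proof -
  interpret prob_space std_normal_distribution by (rule prob_space_normal_density) simp
  have "distributed std_normal_distribution lborel (\<lambda>x. x) std_normal_density"
    by (simp add: distributed_def distr_id2)
  from normal_density_affine[OF this, of c m] assms
  have "distributed std_normal_distribution lborel (\<lambda>x. m + c * x) (normal_density m \<bar>c\<bar>)" by simp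
  then have "distr std_normal_distribution lborel (\<lambda>x. m + c * x) = density lborel (normal_density m \<bar>c\<bar>)"
    by (simp add: distributed_def)
  moreover have "distr std_normal_distribution lborel (\<lambda>x. m + c * x) = distr std_normal_distribution borel (\<lambda>x. m + c * x)"
    by (rule distr_cong) auto
  ultimately show ?thesis by simp
qed

lemma char_normal: "char (density lborel (normal_density m 1)) u = exp (\<i> * of_real (u * m) - of_real (u\<^sup>2 / 2))"
proof -
  have "char (density lborel (normal_density m 1)) u = char (distr std_normal_distribution borel (\<lambda>x. m + 1 * x)) u"
    using normal_eq_distr[of 1 m] by simp
  also have "\<dots> = (\<integral>x. iexp (u * (m + 1 * x)) \<partial>std_normal_distribution)"
    unfolding char_def by (rule integral_distr) measurable
  also have "\<dots> = (\<integral>x. iexp (u * m) * iexp (u * x) \<partial>std_normal_distribution)"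
    by (simp add: exp_add[symmetric] algebra_simps)
  also have "\<dots> = iexp (u * m) * char std_normal_distribution u"
    by (simp add: char_def)
  also have "\<dots> = iexp (u * m) * exp (of_real (- (u\<^sup>2 / 2)))"
    by (simp only: char_std_normal_distribution exp_of_real minus_divide_left)
  also have "\<dots> = exp (\<i> * of_real (u * m) - of_real (u\<^sup>2 / 2))"
    by (simp add: exp_add[symmetric])
  finally show ?thesis .
qed

context efficient_tail_score
begin

section \<open>Inserting the discretised estimator\<close>

lemma Tn_measurable [measurable]: "Tn n v \<in> borel_measurable (sample_space n)"
  unfolding Tn_def[abs_def] by measurable

lemma Tn_est_measurable:
  assumes [measurable]: "f \<in> sample_space n \<rightarrow>\<^sub>M borel" and f: "f ` space (sample_space n) \<subseteq> UNIV \<times> spd"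
  shows "(\<lambda>X. Tn n (f X) X) \<in> borel_measurable (sample_space n)"
proof -
  have [measurable]: "(\<lambda>X. quad (fst (f X)) (snd (f X)) \<nu> (X j)) \<in> borel_measurable (sample_space n)" if "j \<in> {..<n}" for j
    using that
  proof (intro borel_measurable_quad)
    show "(\<lambda>X. fst (f X)) \<in> borel_measurable (sample_space n)" "(\<lambda>X. snd (f X)) \<in> borel_measurable (sample_space n)"
      by (rule measurable_compose[OF assms(1)], intro borel_measurable_continuous_onI continuous_intros)+
  qed (use f in \<open>force+\<close>)
  show ?thesis unfolding Tn_def psi_def by measurable
qed

text \<open>When the estimator lies within \<open>C / sqrt n\<close> of the parameter it takes one
  of at most \<open>B\<close> values, and \<open>Tn_conv_ball\<close> controls the statistic at each
  of them. These values may depend on n; only their number is bounded.\<close>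

lemma plug_in:
  fixes est :: "nat \<Rightarrow> (nat \<Rightarrow> 'k rvec) \<Rightarrow> 'k rvec \<times> 'k rmat"
  assumes est: "is_estimator est" "root_n_consistent (UNIV \<times> spd) (null_model \<nu>) est"
      "locally_asymp_discrete (UNIV \<times> spd) (null_model \<nu>) est"
    and \<Sigma>: "\<Sigma> \<in> spd" and e: "0 < e"
  shows "(\<lambda>n. measure (student_sample n \<mu> \<Sigma> \<nu>) {X \<in> space (student_sample n \<mu> \<Sigma> \<nu>). e \<le> \<bar>Tn n (est n X) X - Tn n (\<mu>, \<Sigma>) X\<bar>}) \<longlonglongrightarrow> 0"
proof (rule LIMSEQ_I)
  fix \<epsilon> :: real assume \<epsilon>: "0 < \<epsilon>"
  let ?\<theta> = "(\<mu>, \<Sigma>)"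
  let ?P = "\<lambda>n. student_sample n \<mu> \<Sigma> \<nu>"
  have \<theta>: "?\<theta> \<in> UNIV \<times> spd" using \<Sigma> by simp
  have null: "null_model \<nu> ?\<theta> = ?P" by (simp add: null_model_def)
  have "bounded_in_prob ?P (\<lambda>n \<omega>. sqrt (real n) *\<^sub>R (est n \<omega> - ?\<theta>))"
    using bspec[OF est(2)[unfolded root_n_consistent_def] \<theta>] unfolding null .
  then obtain C0 where C0: "\<forall>\<^sub>F n in sequentially. measure (?P n) {X \<in> space (?P n). norm (sqrt (real n) *\<^sub>R (est n X - ?\<theta>)) > C0} \<le> \<epsilon> / 3"
    using \<epsilon> unfolding bounded_in_prob_def by (meson divide_pos_pos zero_less_numeral)
  \<comment> \<open>Discreteness is available for positive radii, and \<open>C0\<close> need not be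
    positive.\<close>
  define C where "C = max C0 1"
  have C: "0 < C" "C0 \<le> C" by (simp_all add: C_def)
  obtain B :: nat where B: "\<forall>\<^sub>F n in sequentially.
        finite (est n ` space (?P n) \<inter> cball ?\<theta> (C / sqrt (real n))) \<and>
        card (est n ` space (?P n) \<inter> cball ?\<theta> (C / sqrt (real n))) \<le> B"
    using bspec[OF est(3)[unfolded locally_asymp_discrete_def] \<theta>] C(1) unfolding null by blast
  \<comment> \<open>One third of \<epsilon> is spent on the values inside the ball and one third on
    the estimator leaving it; \<open>B + 1\<close> keeps the quotient meaningful for
    \<open>B = 0\<close>.\<close>
  define \<eta> where "\<eta> = \<epsilon> / (3 * (real B + 1))"
  have \<eta>: "0 < \<eta>" "real B * \<eta> \<le> \<epsilon> / 3" using \<epsilon> by (auto simp: \<eta>_def field_simps)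
  have "\<forall>\<^sub>F n in sequentially. norm (measure (?P n) {X \<in> space (?P n). e \<le> \<bar>Tn n (est n X) X - Tn n ?\<theta> X\<bar>} - 0) < \<epsilon>"
    using eventually_gt_at_top[of 0] C0 B Tn_conv_ball[OF \<Sigma> e \<eta>(1) C(1), of \<mu>]
  proof eventually_elim
    case (elim n)
    interpret P: prob_space "?P n" by (rule prob_space_student_sample[OF \<Sigma> \<nu>])
    have sp: "est n ` space (?P n) \<subseteq> UNIV \<times> spd" and [measurable]: "est n \<in> sample_space n \<rightarrow>\<^sub>M borel"
      using est(1) elim(1) by (simp_all add: is_estimator_def)
    define V where "V = est n ` space (?P n) \<inter> cball ?\<theta> (C / sqrt (real n))"
    have V: "finite V" "card V \<le> B" using elim(3) by (simp_all add: V_def)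
    define D where "D = (\<lambda>v. {X \<in> space (?P n). e \<le> \<bar>Tn n v X - Tn n ?\<theta> X\<bar>})"
    define E where "E = {X \<in> space (?P n). norm (sqrt (real n) *\<^sub>R (est n X - ?\<theta>)) > C0}"
    have D [measurable]: "D v \<in> sets (?P n)" for v unfolding D_def by measurable
    have [measurable]: "E \<in> sets (?P n)" unfolding E_def by measurable
    have [measurable]: "(\<Union>v\<in>V. D v) \<in> sets (?P n)" using V(1) by (rule sets.finite_UN) measurable
    have "{X \<in> space (?P n). e \<le> \<bar>Tn n (est n X) X - Tn n ?\<theta> X\<bar>} \<subseteq> E \<union> (\<Union>v\<in>V. D v)"
    proof
      fix X assume X: "X \<in> {X \<in> space (?P n). e \<le> \<bar>Tn n (est n X) X - Tn n ?\<theta> X\<bar>}"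
      show "X \<in> E \<union> (\<Union>v\<in>V. D v)"
      proof (cases "X \<in> E")
        case False
        then have "sqrt (real n) * norm (est n X - ?\<theta>) \<le> C" using X C(2) by (auto simp: E_def)
        then have "est n X \<in> V" using X elim(1)
          by (auto simp: V_def dist_norm norm_minus_commute pos_le_divide_eq mult.commute)
        then show ?thesis using X by (auto simp: D_def)
      qed simp
    qed
    then have "measure (?P n) {X \<in> space (?P n). e \<le> \<bar>Tn n (est n X) X - Tn n ?\<theta> X\<bar>} \<le> measure (?P n) (E \<union> (\<Union>v\<in>V. D v))"
      by (rule P.finite_measure_mono) (use V in measurable)
    also have "\<dots> \<le> measure (?P n) E + measure (?P n) (\<Union>v\<in>V. D v)"
      by (rule measure_Un_le) measurable
    also have "measure (?P n) (\<Union>v\<in>V. D v) \<le> (\<Sum>v\<in>V. measure (?P n) (D v))"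
      by (rule P.finite_measure_subadditive_finite[OF V(1)]) (use D in blast)
    also have "\<dots> \<le> (\<Sum>v\<in>V. \<eta>)"
    proof (rule sum_mono)
      fix v assume "v \<in> V"
      then have "snd v \<in> spd" "v \<in> cball ?\<theta> (C / sqrt (real n))" using sp by (auto simp: V_def)
      then show "measure (?P n) (D v) \<le> \<eta>" using elim(4) unfolding D_def by (blast intro: less_imp_le)
    qed
    also have "\<dots> = real (card V) * \<eta>" by simp
    also have "\<dots> \<le> real B * \<eta>" using V \<eta> by (intro mult_right_mono) auto
    finally show ?case using elim(2) \<eta>(2) \<epsilon> by (auto simp: E_def)
  qed
  then show "\<exists>N. \<forall>n\<ge>N. norm (measure (?P n) {X \<in> space (?P n). e \<le> \<bar>Tn n (est n X) X - Tn n ?\<theta> X\<bar>} - 0) < \<epsilon>"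
    by (simp add: eventually_sequentially)
qed

lemma Q_stat_eq:
  fixes est :: "nat \<Rightarrow> (nat \<Rightarrow> 'k rvec) \<Rightarrow> 'k rvec \<times> 'k rmat"
  assumes "is_estimator est" "1 \<le> n" "X \<in> space (sample_space n)"
  shows "Q_stat \<nu> est n X = Tn n (est n X) X / sqrt G"
proof -
  have "snd (est n X) \<in> spd" using assms unfolding is_estimator_def by force
  then show ?thesis using psi_facts(1,2) by (simp add: Q_stat_def split_beta)
qed

lemma Q_stat_measurable:
  fixes est :: "nat \<Rightarrow> (nat \<Rightarrow> 'k rvec) \<Rightarrow> 'k rvec \<times> 'k rmat"
  assumes est: "is_estimator est" "1 \<le> n"
  shows "Q_stat \<nu> est n \<in> borel_measurable (sample_space n)"
proof -
  have "(\<lambda>X. Tn n (est n X) X / sqrt G) \<in> borel_measurable (sample_space n)"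
    by (rule borel_measurable_divide[OF Tn_est_measurable borel_measurable_const]) (use est in \<open>auto simp: is_estimator_def\<close>)
  also have "?this \<longleftrightarrow> ?thesis" by (rule measurable_cong) (simp add: Q_stat_eq[OF est])
  finally show ?thesis .
qed

end

section \<open>Limit law and power of the test\<close>

context efficient_tail_score
begin

lemma local_path_student:
  assumes \<Sigma>: "\<Sigma> \<in> spd"
    and lim: "(\<lambda>n. sqrt (real n) *\<^sub>R ((\<mu>' n, \<Sigma>' n, \<nu>' n) - (\<mu>, \<Sigma>, \<nu>))) \<longlonglongrightarrow> (m, H, \<tau>)"
    and valid: "\<forall>\<^sub>F n in sequentially. \<Sigma>' n \<in> spd \<and> 0 < \<nu>' n"
  shows "local_ratio (student \<mu> \<Sigma> \<nu>) (\<lambda>n. likelihood_ratio (\<mu>, \<Sigma>, \<nu>) (\<mu>' n, \<Sigma>' n, \<nu>' n)) (score (\<mu>, \<Sigma>, \<nu>) (m, H, \<tau>))"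
    and "\<forall>\<^sub>F n in sequentially. student_sample n (\<mu>' n) (\<Sigma>' n) (\<nu>' n) =
      (\<Pi>\<^sub>M j\<in>{..<n}. density (student \<mu> \<Sigma> \<nu>) (likelihood_ratio (\<mu>, \<Sigma>, \<nu>) (\<mu>' n, \<Sigma>' n, \<nu>' n)))"
proof -
  show "local_ratio (student \<mu> \<Sigma> \<nu>) (\<lambda>n. likelihood_ratio (\<mu>, \<Sigma>, \<nu>) (\<mu>' n, \<Sigma>' n, \<nu>' n)) (score (\<mu>, \<Sigma>, \<nu>) (m, H, \<tau>))"
    by (rule student_local_ratio[OF \<Sigma> \<nu> lim]) (use valid in \<open>simp add: valid_def\<close>)
  show "\<forall>\<^sub>F n in sequentially. student_sample n (\<mu>' n) (\<Sigma>' n) (\<nu>' n) =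
      (\<Pi>\<^sub>M j\<in>{..<n}. density (student \<mu> \<Sigma> \<nu>) (likelihood_ratio (\<mu>, \<Sigma>, \<nu>) (\<mu>' n, \<Sigma>' n, \<nu>' n)))"
    using valid
  proof eventually_elim
    case (elim n)
    then show ?case unfolding student_sample_def
      by (subst student_eq_density[OF \<Sigma> \<nu>, of "\<Sigma>' n" "\<nu>' n" "\<mu>' n"]) simp_all
  qed
qed

text \<open>Negligibility of the plug-in error is a hypothesis here rather than a consequence of
  consistency, so that the lemma also covers the constant estimator \<open>(\<mu>, \<Sigma>)\<close>
  used in \<open>local_power_bound\<close>.\<close>

lemma char_Q_stat:
  fixes est :: "nat \<Rightarrow> (nat \<Rightarrow> 'k rvec) \<Rightarrow> 'k rvec \<times> 'k rmat"
  assumes est: "is_estimator est"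
    and plug_in: "\<And>e. 0 < e \<Longrightarrow> (\<lambda>n. measure (student_sample n \<mu> \<Sigma> \<nu>)
      {X \<in> space (student_sample n \<mu> \<Sigma> \<nu>). e \<le> \<bar>Tn n (est n X) X - Tn n (\<mu>, \<Sigma>) X\<bar>}) \<longlonglongrightarrow> 0"
    and \<Sigma>: "\<Sigma> \<in> spd" and H: "transpose H = H"
    and lim: "(\<lambda>n. sqrt (real n) *\<^sub>R ((\<mu>' n, \<Sigma>' n, \<nu>' n) - (\<mu>, \<Sigma>, \<nu>))) \<longlonglongrightarrow> (m, H, \<tau>)"
    and valid: "\<forall>\<^sub>F n in sequentially. \<Sigma>' n \<in> spd \<and> 0 < \<nu>' n"
  shows "(\<lambda>n. char (distr (student_sample n (\<mu>' n) (\<Sigma>' n) (\<nu>' n)) borel (Q_stat \<nu> est n)) u)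
    \<longlonglongrightarrow> char (density lborel (normal_density (\<tau> * sqrt G) 1)) u"
proof -
  let ?M = "student \<mu> \<Sigma> \<nu>"
  interpret M: prob_space ?M by (rule prob_space_student[OF \<Sigma> \<nu>])
  define r where "r = (\<lambda>n. likelihood_ratio (\<mu>, \<Sigma>, \<nu>) (\<mu>' n, \<Sigma>' n, \<nu>' n))"
  define P where "P = (\<lambda>n. student_sample n (\<mu>' n) (\<Sigma>' n) (\<nu>' n))"
  have lr: "local_ratio ?M r (score (\<mu>, \<Sigma>, \<nu>) (m, H, \<tau>))"
    and P: "\<forall>\<^sub>F n in sequentially. P n = (\<Pi>\<^sub>M j\<in>{..<n}. density ?M (r n))"
    using local_path_student[OF \<Sigma> lim valid] by (simp_all add: r_def P_def)
  define S where "S = (\<lambda>n X. Tn n (\<mu>, \<Sigma>) X / sqrt G)"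
  define Q where "Q = (\<lambda>n X. Tn n (est n X) X / sqrt G)"
  have [measurable]: "S n \<in> borel_measurable (sample_space n)" for n unfolding S_def by measurable
  have S_eq: "S n X = 1 / sqrt (real n) * (\<Sum>j<n. psi \<mu> \<Sigma> (X j) / sqrt G)" for n X
    by (simp add: S_def Tn_def sum_divide_distrib mult.commute)
  have "(\<lambda>n. char (distr (\<Pi>\<^sub>M j\<in>{..<n}. density ?M (r n)) borel (S n)) u)
      \<longlonglongrightarrow> exp (\<i> * of_real (u * (\<integral>x. psi \<mu> \<Sigma> x / sqrt G * score (\<mu>, \<Sigma>, \<nu>) (m, H, \<tau>) x \<partial>?M))
        - of_real (u\<^sup>2 * (\<integral>x. (psi \<mu> \<Sigma> x / sqrt G)\<^sup>2 \<partial>?M) / 2))"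
    unfolding S_eq[abs_def]
    by (rule M.char_under_local_ratio[OF lr]) (use psi_facts[OF \<Sigma>] in \<open>simp_all add: power_divide\<close>)
  also have "(\<integral>x. psi \<mu> \<Sigma> x / sqrt G * score (\<mu>, \<Sigma>, \<nu>) (m, H, \<tau>) x \<partial>?M) = \<tau> * G / sqrt G"
    using psi_facts(6)[OF \<Sigma> H] by simp
  also have "\<dots> = \<tau> * sqrt G" using G by (simp add: real_div_sqrt flip: times_divide_eq_right)
  also have "(\<integral>x. (psi \<mu> \<Sigma> x / sqrt G)\<^sup>2 \<partial>?M) = 1" using psi_facts(4)[OF \<Sigma>] G by (simp add: power_divide)
  finally have "(\<lambda>n. char (distr (\<Pi>\<^sub>M j\<in>{..<n}. density ?M (r n)) borel (S n)) u) \<longlonglongrightarrow> char (density lborel (normal_density (\<tau> * sqrt G) 1)) u"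
    by (simp add: char_normal)
  then have cS: "(\<lambda>n. char (distr (P n) borel (S n)) u) \<longlonglongrightarrow> char (density lborel (normal_density (\<tau> * sqrt G) 1)) u"
    by (rule Lim_transform_eventually) (use P in eventually_elim, simp)
  have pr: "(\<lambda>n. measure (P n) {X \<in> space (P n). e \<le> \<bar>Q n X - S n X\<bar>}) \<longlonglongrightarrow> 0" if e: "0 < e" for e
  proof -
    \<comment> \<open>The plug-in error is known to be negligible under the null law only;
      contiguity transfers this to the alternative.\<close>
    define A where "A = (\<lambda>n. {X \<in> space (sample_space n). e * sqrt G \<le> \<bar>Tn n (est n X) X - Tn n (\<mu>, \<Sigma>) X\<bar>})"
    have "(\<lambda>n. measure (\<Pi>\<^sub>M j\<in>{..<n}. density ?M (r n)) (A n)) \<longlonglongrightarrow> 0"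
    proof (rule M.contiguity[OF lr])
      show "\<forall>\<^sub>F n in sequentially. A n \<in> sets (\<Pi>\<^sub>M j\<in>{..<n}. ?M)"
        using eventually_ge_at_top[of 1]
      proof eventually_elim
        case (elim n)
        then have [measurable]: "(\<lambda>X. Tn n (est n X) X) \<in> borel_measurable (sample_space n)"
          using est by (intro Tn_est_measurable) (auto simp: is_estimator_def)
        have "A n \<in> sets (sample_space n)" unfolding A_def by measurable
        then show ?case unfolding student_sample_def[symmetric] sets_student_sample .
      qed
      show "(\<lambda>n. measure (\<Pi>\<^sub>M j\<in>{..<n}. ?M) (A n)) \<longlonglongrightarrow> 0"
        using plug_in[of "e * sqrt G"] e G unfolding student_sample_def[symmetric] by (simp add: A_def)
    qed
    then have "(\<lambda>n. measure (P n) (A n)) \<longlonglongrightarrow> 0"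
      by (rule Lim_transform_eventually) (use P in eventually_elim, simp)
    moreover have "A n = {X \<in> space (P n). e \<le> \<bar>Q n X - S n X\<bar>}" for n
      using G by (simp add: A_def P_def Q_def S_def pos_le_divide_eq flip: diff_divide_distrib)
    ultimately show ?thesis by simp
  qed
  have "(\<lambda>n. char (distr (P n) borel (Q_stat \<nu> est n)) u - char (distr (P n) borel (S n)) u) \<longlonglongrightarrow> 0"
  proof (rule LIMSEQ_I)
    fix \<epsilon> :: real assume \<epsilon>: "0 < \<epsilon>"
    \<comment> \<open>The two parts of \<open>char_diff_le\<close> receive
      \<open>\<epsilon> / 2\<close> each: \<open>\<bar>u\<bar> * e\<close>, and twice a probability
      below \<open>\<epsilon> / 4\<close>.\<close>
    define e where "e = \<epsilon> / (2 * (\<bar>u\<bar> + 1))"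
    have e: "0 < e" using \<epsilon> by (simp add: e_def)
    have "\<bar>u\<bar> * e \<le> (\<bar>u\<bar> + 1) * e" using e by simp
    also have "\<dots> = \<epsilon> / 2" by (simp add: e_def field_simps)
    finally have ue: "\<bar>u\<bar> * e \<le> \<epsilon> / 2" .
    have "\<forall>\<^sub>F n in sequentially. measure (P n) {X \<in> space (P n). e \<le> \<bar>Q n X - S n X\<bar>} < \<epsilon> / 4"
      by (rule order_tendstoD(2)[OF pr[OF e]]) (use \<epsilon> in simp)
    then have "\<forall>\<^sub>F n in sequentially. norm (char (distr (P n) borel (Q_stat \<nu> est n)) u - char (distr (P n) borel (S n)) u - 0) < \<epsilon>"
      using valid eventually_ge_at_top[of 1]
    proof eventually_elim
      case (elim n)
      interpret Pn: prob_space "P n" unfolding P_def by (rule prob_space_student_sample) (use elim in auto)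
      have [measurable]: "Q_stat \<nu> est n \<in> borel_measurable (P n)"
        using Q_stat_measurable[OF est elim(3)] by (simp add: P_def cong: measurable_cong_sets)
      have [measurable]: "S n \<in> borel_measurable (P n)"
        by (simp add: P_def cong: measurable_cong_sets)
      have "{X \<in> space (P n). e \<le> \<bar>Q_stat \<nu> est n X - S n X\<bar>} = {X \<in> space (P n). e \<le> \<bar>Q n X - S n X\<bar>}"
        by (intro Collect_cong conj_cong refl) (simp add: Q_stat_eq[OF est elim(3)] Q_def P_def)
      then have "norm (char (distr (P n) borel (Q_stat \<nu> est n)) u - char (distr (P n) borel (S n)) u)
        \<le> \<bar>u\<bar> * e + 2 * measure (P n) {X \<in> space (P n). e \<le> \<bar>Q n X - S n X\<bar>}"
        using Pn.char_diff_le[of "Q_stat \<nu> est n" "S n" e u] e by simp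
      then show ?case using ue elim(1) by simp
    qed
    then show "\<exists>N. \<forall>n\<ge>N. norm (char (distr (P n) borel (Q_stat \<nu> est n)) u - char (distr (P n) borel (S n)) u - 0) < \<epsilon>"
      by (simp add: eventually_sequentially)
  qed
  from tendsto_add[OF this cS] show ?thesis by (simp add: P_def)
qed

lemma Q_stat_limit:
  fixes est :: "nat \<Rightarrow> (nat \<Rightarrow> 'k rvec) \<Rightarrow> 'k rvec \<times> 'k rmat"
  assumes est: "is_estimator est"
    and plug_in: "\<And>e. 0 < e \<Longrightarrow> (\<lambda>n. measure (student_sample n \<mu> \<Sigma> \<nu>)
      {X \<in> space (student_sample n \<mu> \<Sigma> \<nu>). e \<le> \<bar>Tn n (est n X) X - Tn n (\<mu>, \<Sigma>) X\<bar>}) \<longlonglongrightarrow> 0"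
    and \<Sigma>: "\<Sigma> \<in> spd" and H: "transpose H = H"
    and lim: "(\<lambda>n. sqrt (real n) *\<^sub>R ((\<mu>' n, \<Sigma>' n, \<nu>' n) - (\<mu>, \<Sigma>, \<nu>))) \<longlonglongrightarrow> (m, H, \<tau>)"
    and valid: "\<forall>\<^sub>F n in sequentially. \<Sigma>' n \<in> spd \<and> 0 < \<nu>' n"
  shows "asymp_normal (\<lambda>n. student_sample n (\<mu>' n) (\<Sigma>' n) (\<nu>' n)) (Q_stat \<nu> est) (\<tau> * sqrt G) 1"
    and "(\<lambda>n. \<integral>X. of_bool (z < \<bar>Q_stat \<nu> est n X\<bar>) \<partial>student_sample n (\<mu>' n) (\<Sigma>' n) (\<nu>' n))
      \<longlonglongrightarrow> measure (density lborel (normal_density (\<tau> * sqrt G) 1)) {x. z < \<bar>x\<bar>}"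
proof -
  let ?N = "density lborel (normal_density (\<tau> * sqrt G) 1)"
  define P where "P = (\<lambda>n. student_sample n (\<mu>' n) (\<Sigma>' n) (\<nu>' n))"
  have ev: "\<forall>\<^sub>F n in sequentially. real_distribution (distr (P n) borel (Q_stat \<nu> est n))"
    using valid eventually_ge_at_top[of 1]
  proof eventually_elim
    case (elim n)
    interpret Pn: prob_space "P n" unfolding P_def by (rule prob_space_student_sample) (use elim in auto)
    show ?case
      by (rule Pn.real_distribution_distr)
        (use Q_stat_measurable[OF est elim(2)] in \<open>simp add: P_def cong: measurable_cong_sets\<close>)
  qed
  have "(\<lambda>n. char (distr (P n) borel (Q_stat \<nu> est n)) u) \<longlonglongrightarrow> char ?N u" for u
    unfolding P_def by (rule char_Q_stat[OF est plug_in \<Sigma> H lim valid])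
  note conv = levy_continuity_eventually[OF ev real_distribution_normal[OF zero_less_one] this]
  show "asymp_normal P (Q_stat \<nu> est) (\<tau> * sqrt G) 1"
    using conv(1) by (simp add: asymp_normal_def)
  have cl: "closed {x :: real. z \<le> \<bar>x\<bar>}" by (intro closed_Collect_le continuous_intros)
  have op: "open {x :: real. z < \<bar>x\<bar>}" by (intro open_Collect_less continuous_intros)
  \<comment> \<open>The rejection region is a continuity set of the limit law, so weak convergence
    gives convergence of the power.\<close>
  have fr: "frontier {x :: real. z < \<bar>x\<bar>} \<subseteq> {z, - z}"
  proof -
    have "closure {x :: real. z < \<bar>x\<bar>} \<subseteq> {x. z \<le> \<bar>x\<bar>}"
      by (rule closure_minimal) (use cl in auto)
    then show ?thesis unfolding frontier_def interior_open[OF op] by auto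
  qed
  have "frontier {x :: real. z < \<bar>x\<bar>} \<in> null_sets lborel"
    by (rule finite_imp_null_set_lborel[OF finite_subset[OF fr]]) simp
  then have "?N (frontier {x :: real. z < \<bar>x\<bar>}) = 0"
    by (subst emeasure_density) (auto simp: null_sets_def nn_integral_null_set intro!: nn_integral_null_set)
  then have lm: "(\<lambda>n. measure (distr (P n) borel (Q_stat \<nu> est n)) {x. z < \<bar>x\<bar>}) \<longlonglongrightarrow> measure ?N {x. z < \<bar>x\<bar>}"
    by (intro conv(2)) simp_all
  have "\<forall>\<^sub>F n in sequentially. measure (distr (P n) borel (Q_stat \<nu> est n)) {x. z < \<bar>x\<bar>} = (\<integral>X. of_bool (z < \<bar>Q_stat \<nu> est n X\<bar>) \<partial>P n)"
    using eventually_ge_at_top[of 1]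
  proof eventually_elim
    case (elim n)
    have [measurable]: "Q_stat \<nu> est n \<in> borel_measurable (P n)"
      using Q_stat_measurable[OF est elim] by (simp add: P_def cong: measurable_cong_sets)
    let ?A = "Q_stat \<nu> est n -` {x. z < \<bar>x\<bar>} \<inter> space (P n)"
    have "measure (distr (P n) borel (Q_stat \<nu> est n)) {x. z < \<bar>x\<bar>} = measure (P n) ?A"
      by (rule measure_distr) measurable
    also have "\<dots> = (\<integral>X. indicator ?A X \<partial>P n)" by simp
    also have "\<dots> = (\<integral>X. of_bool (z < \<bar>Q_stat \<nu> est n X\<bar>) \<partial>P n)"
      by (intro Bochner_Integration.integral_cong refl) (simp add: indicator_def)
    finally show ?case .
  qed
  from Lim_transform_eventually[OF lm this]
  show "(\<lambda>n. \<integral>X. of_bool (z < \<bar>Q_stat \<nu> est n X\<bar>) \<partial>P n) \<longlonglongrightarrow> measure ?N {x. z < \<bar>x\<bar>}" .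
qed

end

section \<open>The quantile of the standard normal law\<close>

lemma std_normal_upper_quantile:
  assumes p: "0 < p" "p < 1 / 2"
  shows "measure std_normal_distribution {x. std_normal_upper_quantile p < \<bar>x\<bar>} = 2 * p"
    and "0 < std_normal_upper_quantile p"
proof -
  let ?N = "std_normal_distribution"
  interpret N: real_distribution ?N by (rule real_distribution_normal) simp
  have pt: "measure ?N {x} = 0" for x
    by (simp add: measure_def emeasure_density nn_integral_null_set)
  have F: "measure ?N {z<..} = 1 - cdf ?N z" for z
    using N.prob_compl[of "{..z}"] by (simp add: cdf_def Compl_eq_Diff_UNIV[symmetric])
  have reflect: "measure ?N (uminus -` A) = measure ?N A" if "A \<in> sets borel" for A
  proof -
    have "?N = distr ?N borel (\<lambda>x. - x)" using normal_eq_distr[of "-1" 0] by simp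
    then have "measure ?N A = measure (distr ?N borel (\<lambda>x. - x)) A" by (rule arg_cong)
    also have "\<dots> = measure ?N (uminus -` A)" using that by (simp add: measure_distr)
    finally show ?thesis ..
  qed
  \<comment> \<open>Strict monotonicity gives the uniqueness demanded by the definite description of
    the quantile; existence is the intermediate value theorem for the distribution function.\<close>
  have mono: "measure ?N {z'<..} < measure ?N {z<..}" if "z < z'" for z z'
  proof -
    have "measure ?N {z<..z'} \<noteq> 0"
    proof
      assume "measure ?N {z<..z'} = 0"
      then have "{z<..z'} \<in> null_sets ?N" by (simp add: null_sets_def N.emeasure_eq_measure)
      moreover have "std_normal_density x \<noteq> 0" for x using normal_density_pos[of 1 0 x] by simp
      ultimately have "AE x in lborel. x \<notin> {z<..z'}" by (simp add: null_sets_density_iff)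
      moreover have "(AE x in lborel. x \<notin> {z<..z'}) \<longleftrightarrow> emeasure lborel {z<..z'} = 0"
        by (rule AE_iff_measurable) auto
      ultimately have "emeasure lborel {z<..z'} = 0" by blast
      then show False using that by simp
    qed
    then show ?thesis using N.cdf_diff_eq[OF that] by (simp add: F) (smt (verit) measure_nonneg)
  qed
  have half: "measure ?N {0<..} = 1 / 2"
  proof -
    have "measure ?N {..<0} = measure ?N {0<..}" using reflect[of "{0<..}"] by (simp add: vimage_def lessThan_def)
    moreover have "measure ?N ({..<0} \<union> {0} \<union> {0<..}) = measure ?N ({..<0} \<union> {0}) + measure ?N {0<..}"
      by (rule N.finite_measure_Union) auto
    moreover have "measure ?N ({..<0} \<union> {0}) = measure ?N {..<0} + measure ?N {0}"
      by (rule N.finite_measure_Union) auto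
    moreover have "{..<0} \<union> {0} \<union> {0<..} = (UNIV :: real set)" by auto
    ultimately show ?thesis using pt N.prob_space by simp
  qed
  have "\<exists>z. cdf ?N z = 1 - p"
  proof -
    obtain b where b: "cdf ?N b > 1 - p"
      using order_tendstoD(1)[OF N.cdf_lim_at_top_prob, of "1 - p"] p eventually_happens' trivial_limit_at_top_linorder by fastforce
    obtain a where a: "cdf ?N a < 1 - p"
      using order_tendstoD(2)[OF N.cdf_lim_at_bot, of "1 - p"] p eventually_happens' trivial_limit_at_bot_linorder by fastforce
    have ab: "a \<le> b" using a b N.cdf_nondecreasing[of b a] by force
    have "\<forall>x. isCont (cdf ?N) x" using N.isCont_cdf pt by simp
    then show ?thesis using IVT[of "cdf ?N" a "1 - p" b] a b ab by auto
  qed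
  then obtain z where "cdf ?N z = 1 - p" by blast
  then have z: "measure ?N {z<..} = p" by (simp add: F)
  have q: "std_normal_upper_quantile p = z"
    unfolding std_normal_upper_quantile_def
  proof (rule the_equality)
    fix z' assume "measure ?N {z'<..} = p"
    then show "z' = z" using mono[of z z'] mono[of z' z] z by (cases z z' rule: linorder_cases) auto
  qed (rule z)
  show z0: "0 < std_normal_upper_quantile p"
    using mono[of z 0] half z p unfolding q by (cases z "0 :: real" rule: linorder_cases) auto
  \<comment> \<open>As \<open>z\<close> is positive, the two tails are disjoint, and by reflection
    each has mass \<open>p\<close>.\<close>
  have "{x. z < \<bar>x\<bar>} = {z<..} \<union> uminus -` {z<..}" using z0 q by (auto simp: abs_if)
  moreover have "measure ?N ({z<..} \<union> uminus -` {z<..}) = measure ?N {z<..} + measure ?N (uminus -` {z<..})"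
    by (rule N.finite_measure_Union) (use z0 q in \<open>auto intro!: measurable_sets_borel[of uminus borel]\<close>)
  ultimately show "measure ?N {x. std_normal_upper_quantile p < \<bar>x\<bar>} = 2 * p"
    using reflect[of "{z<..}"] z q by simp
qed

section \<open>Maximinity\<close>

lemma integrable_mult_test:
  fixes L :: "'a \<Rightarrow> real"
  assumes "integrable M L" "\<phi> \<in> borel_measurable M" "\<And>x. x \<in> space M \<Longrightarrow> \<phi> x \<in> {0..1::real}"
  shows "integrable M (\<lambda>x. L x * \<phi> x)"
proof (rule Bochner_Integration.integrable_bound[OF assms(1)])
  show "AE x in M. norm (L x * \<phi> x) \<le> norm (L x)"
    using assms(3) by (intro AE_I2) (auto simp: abs_mult mult_left_le)
qed (use assms in simp)

text \<open>\<open>L1\<close> and \<open>L2\<close> are the likelihood ratios of two alternatives, \<open>E1\<close> and \<open>E2\<close> their Gaussian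
  approximations; \<open>\<phi>'\<close> rejects when the mixture of the latter exceeds \<open>\<kappa>\<close>.\<close>

lemma (in prob_space) Neyman_Pearson_mixture:
  assumes L: "integrable M L1" "integrable M L2" and E: "integrable M E1" "integrable M E2"
    and t: "\<phi> \<in> borel_measurable M" "\<And>x. x \<in> space M \<Longrightarrow> \<phi> x \<in> {0..1::real}"
    and t': "\<phi>' \<in> borel_measurable M" "\<And>x. x \<in> space M \<Longrightarrow> \<phi>' x \<in> {0..1::real}"
    and sign: "\<And>x. x \<in> space M \<Longrightarrow> (\<phi> x - \<phi>' x) * ((E1 x + E2 x) / 2 - \<kappa>) \<le> 0"
  shows "((\<integral>x. L1 x * \<phi> x \<partial>M) + (\<integral>x. L2 x * \<phi> x \<partial>M)) / 2
    \<le> ((\<integral>x. L1 x * \<phi>' x \<partial>M) + (\<integral>x. L2 x * \<phi>' x \<partial>M)) / 2 + \<kappa> * ((\<integral>x. \<phi> x \<partial>M) - (\<integral>x. \<phi>' x \<partial>M))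
      + ((\<integral>x. \<bar>L1 x - E1 x\<bar> \<partial>M) + (\<integral>x. \<bar>L2 x - E2 x\<bar> \<partial>M)) / 2"
proof -
  have one: "integrable M (\<lambda>x. 1 :: real)" by simp
  have p: "integrable M \<phi>" "integrable M \<phi>'"
    using integrable_mult_test[OF one t] integrable_mult_test[OF one t'] by simp_all
  have q: "integrable M (\<lambda>x. \<bar>L1 x - E1 x\<bar>)" "integrable M (\<lambda>x. \<bar>L2 x - E2 x\<bar>)"
    using L E by (auto intro!: integrable_abs Bochner_Integration.integrable_diff)
  note i = integrable_mult_test[OF L(1) t] integrable_mult_test[OF L(2) t]
    integrable_mult_test[OF L(1) t'] integrable_mult_test[OF L(2) t'] p q
  have "(\<integral>x. (L1 x * \<phi> x + L2 x * \<phi> x) / 2 \<partial>M)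
    \<le> (\<integral>x. (L1 x * \<phi>' x + L2 x * \<phi>' x) / 2 + \<kappa> * (\<phi> x - \<phi>' x) + (\<bar>L1 x - E1 x\<bar> + \<bar>L2 x - E2 x\<bar>) / 2 \<partial>M)"
  proof (rule integral_mono)
    fix x assume x: "x \<in> space M"
    define d where "d = \<phi> x - \<phi>' x"
    have d: "\<bar>d\<bar> \<le> 1" using t(2)[OF x] t'(2)[OF x] by (auto simp: d_def)
    have le: "(L - E) * d \<le> \<bar>L - E\<bar>" for L E :: real
    proof -
      have "(L - E) * d \<le> \<bar>L - E\<bar> * \<bar>d\<bar>" by (metis abs_ge_self abs_mult)
      also have "\<dots> \<le> \<bar>L - E\<bar> * 1" using d by (intro mult_left_mono) auto
      finally show ?thesis by simp
    qed
    \<comment> \<open>Each ratio is split into its Gaussian form and an error: the sign condition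
      governs the first, and the second is controlled because \<open>d\<close> is a difference of
      two test values.\<close>
    have "(L1 x * d + L2 x * d) / 2 = ((L1 x - E1 x) * d + (L2 x - E2 x) * d) / 2 + d * ((E1 x + E2 x) / 2 - \<kappa>) + \<kappa> * d"
      by (simp add: field_simps)
    also have "\<dots> \<le> (\<bar>L1 x - E1 x\<bar> + \<bar>L2 x - E2 x\<bar>) / 2 + 0 + \<kappa> * d"
      by (intro add_mono divide_right_mono le sign[OF x, folded d_def]) auto
    finally show "(L1 x * \<phi> x + L2 x * \<phi> x) / 2 \<le> (L1 x * \<phi>' x + L2 x * \<phi>' x) / 2 + \<kappa> * (\<phi> x - \<phi>' x) + (\<bar>L1 x - E1 x\<bar> + \<bar>L2 x - E2 x\<bar>) / 2"
      by (simp add: d_def field_simps)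
  qed (use i in simp_all)
  then show ?thesis using i by simp
qed

text \<open>Both laws are translates of one that is invariant under reflection. The alternatives
  \<open>h\<close> and \<open>- h\<close> are thus equally hard for the two-sided region, and the
  mean of its two powers equals each of them.\<close>

lemma normal_two_sided_symmetric:
  "measure (density lborel (normal_density (- m) 1)) {x. z < \<bar>x\<bar>} = measure (density lborel (normal_density m 1)) {x. z < \<bar>x\<bar>}"
proof -
  have "measure (density lborel (normal_density (- m) 1)) {x. z < \<bar>x\<bar>} = measure std_normal_distribution {x. z < \<bar>x - m\<bar>}"
    using normal_eq_distr[of 1 "- m"] by (simp add: measure_distr)
  also have "\<dots> = measure (density lborel (normal_density m 1)) {x. z < \<bar>x\<bar>}"
    using normal_eq_distr[of "-1" m] by (simp add: measure_distr abs_minus_commute)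
  finally show ?thesis .
qed

lemma cosh_abs_le: "cosh x \<le> cosh y \<longleftrightarrow> \<bar>x\<bar> \<le> \<bar>y\<bar>" for x y :: real
  using cosh_real_nonneg_le_iff[of "\<bar>x\<bar>" "\<bar>y\<bar>"] by simp

context efficient_tail_score
begin

section \<open>Least favourable local alternatives\<close>

lemma local_alternative_path:
  fixes \<mu> m :: "'k rvec" and \<Sigma> H :: "'k rmat"
  assumes \<Sigma>: "\<Sigma> \<in> spd" and H: "transpose H = H"
  shows "(\<lambda>n. sqrt (real n) *\<^sub>R ((\<mu> + (1 / sqrt (real n)) *\<^sub>R m, \<Sigma> + (1 / sqrt (real n)) *\<^sub>R H, \<nu> + (1 / sqrt (real n)) * \<tau>) - (\<mu>, \<Sigma>, \<nu>))) \<longlonglongrightarrow> (m, H, \<tau>)"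
    and "\<forall>\<^sub>F n in sequentially. \<Sigma> + (1 / sqrt (real n)) *\<^sub>R H \<in> spd \<and> 0 < \<nu> + (1 / sqrt (real n)) * \<tau>"
proof -
  have eq: "(\<mu> + (1 / sqrt (real n)) *\<^sub>R m, \<Sigma> + (1 / sqrt (real n)) *\<^sub>R H, \<nu> + (1 / sqrt (real n)) * \<tau>) = (\<mu>, \<Sigma>, \<nu>) + (1 / sqrt (real n)) *\<^sub>R (m, H, \<tau>)" for n
    by simp
  show lim: "(\<lambda>n. sqrt (real n) *\<^sub>R ((\<mu> + (1 / sqrt (real n)) *\<^sub>R m, \<Sigma> + (1 / sqrt (real n)) *\<^sub>R H, \<nu> + (1 / sqrt (real n)) * \<tau>) - (\<mu>, \<Sigma>, \<nu>))) \<longlonglongrightarrow> (m, H, \<tau>)"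
    unfolding eq by (rule local_path_limit)
  have "\<forall>\<^sub>F n in sequentially. valid (\<mu> + (1 / sqrt (real n)) *\<^sub>R m, \<Sigma> + (1 / sqrt (real n)) *\<^sub>R H, \<nu> + (1 / sqrt (real n)) * \<tau>)"
  proof (rule eventually_valid[OF \<Sigma> \<nu> scaled_convergent_imp[OF lim]], intro always_eventually allI)
    fix n
    show "transpose (fst (snd (\<mu> + (1 / sqrt (real n)) *\<^sub>R m, \<Sigma> + (1 / sqrt (real n)) *\<^sub>R H, \<nu> + (1 / sqrt (real n)) * \<tau>))) =
      fst (snd (\<mu> + (1 / sqrt (real n)) *\<^sub>R m, \<Sigma> + (1 / sqrt (real n)) *\<^sub>R H, \<nu> + (1 / sqrt (real n)) * \<tau>))"
      using spdD(1)[OF \<Sigma>] H by (simp add: transpose_def vec_eq_iff)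
  qed
  then show "\<forall>\<^sub>F n in sequentially. \<Sigma> + (1 / sqrt (real n)) *\<^sub>R H \<in> spd \<and> 0 < \<nu> + (1 / sqrt (real n)) * \<tau>"
    by (simp add: valid_def)
qed

text \<open>In this direction the full score is \<open>h\<close> times the efficient score.\<close>

definition least_favourable :: "'k rmat \<Rightarrow> real \<Rightarrow> 'k rvec \<times> 'k rmat \<times> real" where
  "least_favourable \<Sigma> h = (0, (- (h * c)) *\<^sub>R \<Sigma>, h)"

text \<open>The score of this path is \<open>h * psi\<close>, so \<open>likelihood_ratio_L1\<close>
  applies with \<open>a = h\<close>, and the approximation depends on the sample through
  \<open>Tn\<close> alone. The ratio is passed on only by its properties, the last of which rewrites
  expectations under the alternative.\<close>

lemma least_favourable_ratio:
  fixes \<mu> :: "'k rvec" and \<Sigma> :: "'k rmat" and h :: real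
  assumes \<Sigma>: "\<Sigma> \<in> spd"
  defines "M \<equiv> student \<mu> \<Sigma> \<nu>"
  defines "P \<equiv> \<lambda>n. case least_favourable \<Sigma> h of (m, H, \<tau>) \<Rightarrow> student_sample n (\<mu> + (1 / sqrt (real n)) *\<^sub>R m) (\<Sigma> + (1 / sqrt (real n)) *\<^sub>R H) (\<nu> + (1 / sqrt (real n)) * \<tau>)"
    and "E \<equiv> \<lambda>n X. exp (h * Tn n (\<mu>, \<Sigma>) X - h\<^sup>2 * G / 2)"
  obtains L where "(\<lambda>n. \<integral>X. \<bar>L n X - E n X\<bar> \<partial>student_sample n \<mu> \<Sigma> \<nu>) \<longlonglongrightarrow> 0"
    "\<forall>\<^sub>F n in sequentially. integrable (student_sample n \<mu> \<Sigma> \<nu>) (L n) \<and> integrable (student_sample n \<mu> \<Sigma> \<nu>) (E n)"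
    "\<forall>\<^sub>F n in sequentially. \<forall>f \<in> borel_measurable (sample_space n). (\<integral>X. f X \<partial>P n) = (\<integral>X. L n X * f X \<partial>student_sample n \<mu> \<Sigma> \<nu>)"
proof -
  interpret M: prob_space M unfolding M_def by (rule prob_space_student[OF \<Sigma> \<nu>])
  define H where "H = (- (h * c)) *\<^sub>R \<Sigma>"
  have H: "transpose H = H" using spdD(1)[OF \<Sigma>] by (simp only: H_def transpose_scalar)
  note path = local_alternative_path(1)[OF \<Sigma> H, of \<mu> 0 h] local_alternative_path(2)[OF \<Sigma> H, of h]
  define r where "r = (\<lambda>n. likelihood_ratio (\<mu>, \<Sigma>, \<nu>) (\<mu> + (1 / sqrt (real n)) *\<^sub>R 0, \<Sigma> + (1 / sqrt (real n)) *\<^sub>R H, \<nu> + (1 / sqrt (real n)) * h))"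
  have P: "P n = student_sample n (\<mu> + (1 / sqrt (real n)) *\<^sub>R 0) (\<Sigma> + (1 / sqrt (real n)) *\<^sub>R H) (\<nu> + (1 / sqrt (real n)) * h)" for n
    by (simp add: P_def least_favourable_def H_def)
  have sc: "score (\<mu>, \<Sigma>, \<nu>) (0, H, h) = (\<lambda>x. h * psi \<mu> \<Sigma> x)"
  proof
    fix x
    have "(0, H, h) = h *\<^sub>R (0 :: 'k rvec, - c *\<^sub>R \<Sigma>, 1 :: real)" by (simp add: H_def)
    then have "score (\<mu>, \<Sigma>, \<nu>) (0, H, h) x = score (\<mu>, \<Sigma>, \<nu>) (h *\<^sub>R (0 :: 'k rvec, - c *\<^sub>R \<Sigma>, 1 :: real)) x" by (rule arg_cong)
    also have "\<dots> = h *\<^sub>R score (\<mu>, \<Sigma>, \<nu>) (0 :: 'k rvec, - c *\<^sub>R \<Sigma>, 1 :: real) x"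
      by (rule linear_scale[OF score_linear[OF \<Sigma> \<nu>]])
    finally show "score (\<mu>, \<Sigma>, \<nu>) (0, H, h) x = h * psi \<mu> \<Sigma> x" using psi_facts(5)[OF \<Sigma>] by simp
  qed
  have lr: "local_ratio M r (\<lambda>x. h * psi \<mu> \<Sigma> x)"
    using local_path_student(1)[OF \<Sigma> path] unfolding sc by (simp add: M_def r_def)
  have ev: "\<forall>\<^sub>F n in sequentially. P n = (\<Pi>\<^sub>M j\<in>{..<n}. density M (r n))"
    using local_path_student(2)[OF \<Sigma> path] unfolding P M_def r_def .
  obtain d where d: "0 < d" "integrable M (\<lambda>x. (psi \<mu> \<Sigma> x)\<^sup>2 * exp (d * \<bar>psi \<mu> \<Sigma> x\<bar>))"
    using psi_facts(9)[OF \<Sigma>] unfolding M_def by blast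
  have pm: "psi \<mu> \<Sigma> \<in> borel_measurable M" by (simp add: M_def)
  have p0: "(\<integral>x. psi \<mu> \<Sigma> x \<partial>M) = 0" and p2: "(\<integral>x. (psi \<mu> \<Sigma> x)\<^sup>2 \<partial>M) = G"
    unfolding M_def by (rule psi_facts[OF \<Sigma>])+
  have S: "student_sample n \<mu> \<Sigma> \<nu> = (\<Pi>\<^sub>M j\<in>{..<n}. M)" for n by (simp add: student_sample_def M_def)
  note L1 = M.likelihood_ratio_L1[OF pm d p0 lr, unfolded p2, folded S]
  show thesis
  proof (rule that[of "\<lambda>n X. \<Prod>j<n. r n (X j)"])
    show "(\<lambda>n. \<integral>X. \<bar>(\<Prod>j<n. r n (X j)) - E n X\<bar> \<partial>student_sample n \<mu> \<Sigma> \<nu>) \<longlonglongrightarrow> 0"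
      using L1(1) by (simp add: E_def Tn_def)
    show "\<forall>\<^sub>F n in sequentially. integrable (student_sample n \<mu> \<Sigma> \<nu>) (\<lambda>X. \<Prod>j<n. r n (X j)) \<and> integrable (student_sample n \<mu> \<Sigma> \<nu>) (E n)"
      using L1(2) by (simp add: E_def Tn_def)
    show "\<forall>\<^sub>F n in sequentially. \<forall>f \<in> borel_measurable (sample_space n).
      (\<integral>X. f X \<partial>P n) = (\<integral>X. (\<Prod>j<n. r n (X j)) * f X \<partial>student_sample n \<mu> \<Sigma> \<nu>)"
      using ev local_ratioD[OF lr]
    proof eventually_elim
      case (elim n)
      have [measurable]: "r n \<in> borel_measurable M" and r: "\<And>x. x \<in> space M \<Longrightarrow> 0 \<le> r n x" "(\<integral>x. r n x \<partial>M) = 1" "integrable M (r n)"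
        using elim(2) by blast+
      show ?case
      proof
        fix f :: "(nat \<Rightarrow> 'k rvec) \<Rightarrow> real" assume f: "f \<in> borel_measurable (sample_space n)"
        have fm: "f \<in> borel_measurable (\<Pi>\<^sub>M j\<in>{..<n}. M)"
          using f unfolding S[symmetric] by (simp cong: measurable_cong_sets)
        have "P n = density (\<Pi>\<^sub>M j\<in>{..<n}. M) (\<lambda>X. \<Prod>j<n. r n (X j))"
          unfolding elim(1) by (rule M.PiM_density) (use r in auto)
        then have "(\<integral>X. f X \<partial>P n) = (\<integral>X. f X \<partial>density (\<Pi>\<^sub>M j\<in>{..<n}. M) (\<lambda>X. \<Prod>j<n. r n (X j)))" by simp
        also have "\<dots> = (\<integral>X. (\<Prod>j<n. r n (X j)) *\<^sub>R f X \<partial>(\<Pi>\<^sub>M j\<in>{..<n}. M))"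
        proof (rule integral_density[OF fm])
          show "AE X in \<Pi>\<^sub>M j\<in>{..<n}. M. 0 \<le> (\<Prod>j<n. r n (X j))"
            by (intro AE_I2 prod_nonneg) (auto simp: space_PiM PiE_def Pi_def intro!: r(1))
        qed measurable
        finally show "(\<integral>X. f X \<partial>P n) = (\<integral>X. (\<Prod>j<n. r n (X j)) * f X \<partial>student_sample n \<mu> \<Sigma> \<nu>)"
          by (simp add: S)
      qed
    qed
  qed
qed

lemma power_at_local_alternatives:
  fixes \<mu> m :: "'k rvec" and \<Sigma> H :: "'k rmat"
  assumes est: "is_estimator est"
    and plug_in: "\<And>e. 0 < e \<Longrightarrow> (\<lambda>n. measure (student_sample n \<mu> \<Sigma> \<nu>)
      {X \<in> space (student_sample n \<mu> \<Sigma> \<nu>). e \<le> \<bar>Tn n (est n X) X - Tn n (\<mu>, \<Sigma>) X\<bar>}) \<longlonglongrightarrow> 0"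
    and \<Sigma>: "\<Sigma> \<in> spd" and H: "transpose H = H"
  shows "(\<lambda>n. \<integral>X. of_bool (z < \<bar>Q_stat \<nu> est n X\<bar>) \<partial>student_sample n (\<mu> + (1 / sqrt (real n)) *\<^sub>R m) (\<Sigma> + (1 / sqrt (real n)) *\<^sub>R H) (\<nu> + (1 / sqrt (real n)) * \<tau>))
    \<longlonglongrightarrow> measure (density lborel (normal_density (\<tau> * sqrt G) 1)) {x. z < \<bar>x\<bar>}"
  by (rule Q_stat_limit(2)[OF est plug_in \<Sigma> H local_alternative_path(1)[OF \<Sigma> H] local_alternative_path(2)[OF \<Sigma> H]])

text \<open>In the Gaussian approximation, the two-sided test with known
  \<open>(\<mu>, \<Sigma>)\<close> is the Neyman--Pearson test of this single null law against the
  equal mixture of the alternatives \<open>h\<close> and \<open>- h\<close>. A competitor with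
  larger limiting power at both would beat it against the mixture.\<close>

lemma local_power_bound:
  fixes \<mu> :: "'k rvec" and \<Sigma> :: "'k rmat" and \<phi> :: "nat \<Rightarrow> (nat \<Rightarrow> 'k rvec) \<Rightarrow> real"
  assumes \<Sigma>: "\<Sigma> \<in> spd" and level: "asymp_level \<nu> \<alpha> \<phi>"
    and z: "0 \<le> z" "measure std_normal_distribution {x. z < \<bar>x\<bar>} = \<alpha>"
  shows "min (local_power \<mu> \<Sigma> \<nu> \<phi> (least_favourable \<Sigma> h)) (local_power \<mu> \<Sigma> \<nu> \<phi> (least_favourable \<Sigma> (- h)))
    \<le> ereal (measure (density lborel (normal_density (h * sqrt G) 1)) {x. z < \<bar>x\<bar>})" (is "_ \<le> ereal ?\<beta>")
proof (rule ccontr)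
  define pow where "pow = (\<lambda>(\<phi> :: nat \<Rightarrow> (nat \<Rightarrow> 'k rvec) \<Rightarrow> real) h n. case least_favourable \<Sigma> h of (m, H, \<tau>) \<Rightarrow>
    \<integral>X. \<phi> n X \<partial>student_sample n (\<mu> + (1 / sqrt (real n)) *\<^sub>R m) (\<Sigma> + (1 / sqrt (real n)) *\<^sub>R H) (\<nu> + (1 / sqrt (real n)) * \<tau>))"
  define P0 where "P0 = (\<lambda>n. student_sample n \<mu> \<Sigma> \<nu>)"
  have lp: "local_power \<mu> \<Sigma> \<nu> \<phi> (least_favourable \<Sigma> h) = liminf (\<lambda>n. ereal (pow \<phi> h n))" for h
    by (simp add: local_power_def pow_def least_favourable_def)
  \<comment> \<open>A constant estimator turns \<open>Q_stat\<close> into the statistic with known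
    parameters and makes the plug-in error 0.\<close>
  define est where "est = (\<lambda>(n :: nat) (X :: nat \<Rightarrow> 'k rvec). (\<mu>, \<Sigma>))"
  have est: "is_estimator est" using \<Sigma> by (auto simp: is_estimator_def est_def)
  have plug: "(\<lambda>n. measure (student_sample n \<mu> \<Sigma> \<nu>)
      {X \<in> space (student_sample n \<mu> \<Sigma> \<nu>). e \<le> \<bar>Tn n (est n X) X - Tn n (\<mu>, \<Sigma>) X\<bar>}) \<longlonglongrightarrow> 0" if "0 < e" for e
    using that by (simp add: est_def)
  define \<psi> where "\<psi> = (\<lambda>n X. of_bool (z < \<bar>Q_stat \<nu> est n X\<bar>) :: real)"
  have Q: "Q_stat \<nu> est n X = Tn n (\<mu>, \<Sigma>) X / sqrt G" if "1 \<le> n" "X \<in> space (sample_space n)" for n X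
    using Q_stat_eq[OF est that] by (simp add: est_def)
  have pow\<psi>: "pow \<psi> h \<longlonglongrightarrow> measure (density lborel (normal_density (h * sqrt G) 1)) {x. z < \<bar>x\<bar>}" for h
  proof -
    have "transpose ((- (h * c)) *\<^sub>R \<Sigma>) = (- (h * c)) *\<^sub>R \<Sigma>" by (simp only: transpose_scalar spdD(1)[OF \<Sigma>])
    from power_at_local_alternatives[where \<mu> = \<mu> and z = z and m = 0 and \<tau> = h, OF est plug \<Sigma> this]
    show ?thesis by (simp add: pow_def[abs_def] \<psi>_def least_favourable_def)
  qed
  have null\<psi>: "(\<lambda>n. \<integral>X. \<psi> n X \<partial>P0 n) \<longlonglongrightarrow> \<alpha>"
    using pow\<psi>[of 0] z by (simp add: pow_def[abs_def] least_favourable_def P0_def)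
  assume "\<not> ?thesis"
  then have gt: "ereal ?\<beta> < local_power \<mu> \<Sigma> \<nu> \<phi> (least_favourable \<Sigma> h)" "ereal ?\<beta> < local_power \<mu> \<Sigma> \<nu> \<phi> (least_favourable \<Sigma> (- h))"
    by (simp_all add: not_le)
  obtain b1 where b1: "?\<beta> < b1" "ereal b1 < local_power \<mu> \<Sigma> \<nu> \<phi> (least_favourable \<Sigma> h)"
    using ereal_dense2[OF gt(1)] by auto
  obtain b2 where b2: "?\<beta> < b2" "ereal b2 < local_power \<mu> \<Sigma> \<nu> \<phi> (least_favourable \<Sigma> (- h))"
    using ereal_dense2[OF gt(2)] by auto
  define b where "b = min b1 b2"
  have b: "?\<beta> < b" using b1 b2 by (simp add: b_def)
  have ev1: "\<forall>\<^sub>F n in sequentially. b < pow \<phi> h n" "\<forall>\<^sub>F n in sequentially. b < pow \<phi> (- h) n"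
    using less_LiminfD[OF b1(2)[unfolded lp]] less_LiminfD[OF b2(2)[unfolded lp]] by (auto simp: b_def elim: eventually_mono)
  \<comment> \<open>The value of the mixture of Gaussian ratios on the boundary of the rejection
    region, where the absolute value of \<open>Tn\<close> is \<open>sqrt G * z\<close>.\<close>
  define \<kappa> where "\<kappa> = exp (- (h\<^sup>2 * G / 2)) * cosh (h * sqrt G * z)"
  have \<kappa>: "0 < \<kappa>" by (simp add: \<kappa>_def)
  \<comment> \<open>The level of \<phi> holds only in the limit. The slack \<epsilon> enters the
    bound as \<open>\<kappa> * \<epsilon>\<close>, which is half of the supposed excess of
    \<open>b\<close> over the claimed bound.\<close>
  define \<epsilon> where "\<epsilon> = (b - ?\<beta>) / (2 * \<kappa>)"
  have \<epsilon>: "0 < \<epsilon>" using b \<kappa> by (simp add: \<epsilon>_def)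
  have "limsup (\<lambda>n. ereal (\<integral>X. \<phi> n X \<partial>P0 n)) \<le> ereal \<alpha>" using level \<Sigma> by (simp add: asymp_level_def P0_def)
  also have "\<dots> < ereal (\<alpha> + \<epsilon>)" using \<epsilon> by simp
  finally have ev0: "\<forall>\<^sub>F n in sequentially. (\<integral>X. \<phi> n X \<partial>P0 n) < \<alpha> + \<epsilon>"
    by (auto dest: Limsup_lessD)
  define E where "E = (\<lambda>h n X. exp (h * Tn n (\<mu>, \<Sigma>) X - h\<^sup>2 * G / 2))"
  \<comment> \<open>The properties are bundled for each \<open>h\<close>, so that a single choice
    function yields the ratios for both \<open>h\<close> and \<open>- h\<close>.\<close>
  define good where "good = (\<lambda>h L. (\<lambda>n. \<integral>X. \<bar>L n X - E h n X\<bar> \<partial>P0 n) \<longlonglongrightarrow> 0 \<and>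
    (\<forall>\<^sub>F n in sequentially. integrable (P0 n) (L n) \<and> integrable (P0 n) (E h n)) \<and>
    (\<forall>\<^sub>F n in sequentially. \<forall>\<phi>. \<phi> n \<in> borel_measurable (sample_space n) \<longrightarrow> pow \<phi> h n = (\<integral>X. L n X * \<phi> n X \<partial>P0 n)))"
  have "\<exists>L. good h L" for h
  proof -
    from least_favourable_ratio[where \<mu> = \<mu> and h = h, OF \<Sigma>] obtain L where L: "(\<lambda>n. \<integral>X. \<bar>L n X - E h n X\<bar> \<partial>P0 n) \<longlonglongrightarrow> 0"
    "\<forall>\<^sub>F n in sequentially. integrable (P0 n) (L n) \<and> integrable (P0 n) (E h n)"
    "\<forall>\<^sub>F n in sequentially. \<forall>f \<in> borel_measurable (sample_space n). (\<integral>X. f X \<partial>(case least_favourable \<Sigma> h of (m, H, \<tau>) \<Rightarrow> student_sample n (\<mu> + (1 / sqrt (real n)) *\<^sub>R m) (\<Sigma> + (1 / sqrt (real n)) *\<^sub>R H) (\<nu> + (1 / sqrt (real n)) * \<tau>))) = (\<integral>X. L n X * f X \<partial>P0 n)"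
      unfolding E_def P0_def by blast
    show ?thesis unfolding good_def
      by (rule exI[of _ L], intro conjI L(1,2)) (use L(3) in \<open>eventually_elim, simp add: pow_def least_favourable_def\<close>)
  qed
  then obtain L where "\<And>h. good h (L h)" by metis
  then have L: "\<And>h. (\<lambda>n. \<integral>X. \<bar>L h n X - E h n X\<bar> \<partial>P0 n) \<longlonglongrightarrow> 0"
    "\<And>h. \<forall>\<^sub>F n in sequentially. integrable (P0 n) (L h n) \<and> integrable (P0 n) (E h n)"
    "\<And>h. \<forall>\<^sub>F n in sequentially. \<forall>\<phi>. \<phi> n \<in> borel_measurable (sample_space n) \<longrightarrow> pow \<phi> h n = (\<integral>X. L h n X * \<phi> n X \<partial>P0 n)"
    unfolding good_def by blast+
  \<comment> \<open>An upper bound for the mean power of \<phi> at the two alternatives, whose limit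
    lies strictly below \<open>b\<close>.\<close>
  define R where "R = (\<lambda>n. (pow \<psi> h n + pow \<psi> (- h) n) / 2 + \<kappa> * (\<alpha> + \<epsilon> - (\<integral>X. \<psi> n X \<partial>P0 n))
    + ((\<integral>X. \<bar>L h n X - E h n X\<bar> \<partial>P0 n) + (\<integral>X. \<bar>L (- h) n X - E (- h) n X\<bar> \<partial>P0 n)) / 2)"
  have "\<forall>\<^sub>F n in sequentially. b \<le> R n"
    using eventually_ge_at_top[of 1] ev1 ev0 L(2)[of h] L(2)[of "- h"] L(3)[of h] L(3)[of "- h"]
  proof eventually_elim
    case (elim n)
    interpret P0: prob_space "P0 n" unfolding P0_def by (rule prob_space_student_sample[OF \<Sigma> \<nu>])
    have "\<phi> n \<in> borel_measurable (sample_space n) \<and> \<phi> n ` space (sample_space n) \<subseteq> {0..1}"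
      using level elim(1) unfolding asymp_level_def is_test_def by blast
    then have \<phi>: "\<phi> n \<in> borel_measurable (sample_space n)" "\<And>X. X \<in> space (P0 n) \<Longrightarrow> \<phi> n X \<in> {0..1}"
      unfolding P0_def sets_student_sample by blast+
    have [measurable]: "Q_stat \<nu> est n \<in> borel_measurable (sample_space n)" by (rule Q_stat_measurable[OF est elim(1)])
    have \<psi>m: "\<psi> n \<in> borel_measurable (sample_space n)"
      unfolding \<psi>_def of_bool_def by measurable
    have \<psi>: "\<psi> n \<in> borel_measurable (sample_space n)" "\<And>X. X \<in> space (P0 n) \<Longrightarrow> \<psi> n X \<in> {0..1}"
      by (rule \<psi>m) (simp add: \<psi>_def)
    have m: "\<phi> n \<in> borel_measurable (P0 n)" "\<psi> n \<in> borel_measurable (P0 n)"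
      using \<phi>(1) \<psi>(1) by (simp_all add: P0_def cong: measurable_cong_sets)
    have sign: "(\<phi> n X - \<psi> n X) * ((E h n X + E (- h) n X) / 2 - \<kappa>) \<le> 0" if X: "X \<in> space (P0 n)" for X
    proof -
      define T where "T = Tn n (\<mu>, \<Sigma>) X"
      have mix: "(E h n X + E (- h) n X) / 2 = exp (- (h\<^sup>2 * G / 2)) * cosh (h * T)"
      proof -
        have ex: "exp (x - y) = exp (- y) * exp x" for x y :: real by (simp flip: exp_add)
        show ?thesis unfolding E_def T_def[symmetric] ex cosh_field_def by (simp add: distrib_left)
      qed
      have \<psi>X: "\<psi> n X = of_bool (sqrt G * z < \<bar>T\<bar>)"
        using Q[OF elim(1)] X G by (simp add: \<psi>_def P0_def T_def pos_less_divide_eq mult.commute)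
      have diff: "(E h n X + E (- h) n X) / 2 - \<kappa> = exp (- (h\<^sup>2 * G / 2)) * (cosh (h * T) - cosh (h * sqrt G * z))"
        by (simp add: mix \<kappa>_def right_diff_distrib)
      have zz: "\<bar>h * sqrt G * z\<bar> = \<bar>h\<bar> * (sqrt G * z)" using z(1) G by (simp add: abs_mult)
      show ?thesis
      proof (cases "sqrt G * z < \<bar>T\<bar>")
        case True
        then have "cosh (h * sqrt G * z) \<le> cosh (h * T)"
          unfolding cosh_abs_le zz by (simp add: abs_mult mult_left_mono)
        then show ?thesis
          unfolding diff using True \<phi>(2)[OF X] by (intro mult_nonpos_nonneg) (simp_all add: \<psi>X)
      next
        case False
        then have "cosh (h * T) \<le> cosh (h * sqrt G * z)"
          unfolding cosh_abs_le zz by (simp add: abs_mult mult_left_mono)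
        then show ?thesis
          unfolding diff using False \<phi>(2)[OF X] by (intro mult_nonneg_nonpos) (simp_all add: \<psi>X mult_le_0_iff)
      qed
    qed
    have "b \<le> (pow \<phi> h n + pow \<phi> (- h) n) / 2" using elim(2,3) by simp
    also have "\<dots> \<le> (pow \<psi> h n + pow \<psi> (- h) n) / 2 + \<kappa> * ((\<integral>X. \<phi> n X \<partial>P0 n) - (\<integral>X. \<psi> n X \<partial>P0 n))
      + ((\<integral>X. \<bar>L h n X - E h n X\<bar> \<partial>P0 n) + (\<integral>X. \<bar>L (- h) n X - E (- h) n X\<bar> \<partial>P0 n)) / 2"
      unfolding mp[OF spec[OF elim(7), of \<phi>] \<phi>(1)] mp[OF spec[OF elim(7), of \<psi>] \<psi>(1)]
        mp[OF spec[OF elim(8), of \<phi>] \<phi>(1)] mp[OF spec[OF elim(8), of \<psi>] \<psi>(1)]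
      using elim(5,6) m \<phi>(2) \<psi>(2) sign by (intro P0.Neyman_Pearson_mixture) blast+
    also have "\<dots> \<le> R n"
      unfolding R_def using elim(4) \<kappa> by (intro add_mono mult_left_mono diff_mono order_refl) auto
    finally show ?case .
  qed
  moreover have "R \<longlonglongrightarrow> (?\<beta> + ?\<beta>) / 2 + \<kappa> * (\<alpha> + \<epsilon> - \<alpha>) + (0 + 0) / 2"
    unfolding R_def using pow\<psi>[of "- h"] pow\<psi>[of h] normal_two_sided_symmetric[of "h * sqrt G" z]
    by (intro tendsto_intros null\<psi> L(1)) simp_all
  ultimately have "b \<le> (?\<beta> + ?\<beta>) / 2 + \<kappa> * (\<alpha> + \<epsilon> - \<alpha>) + (0 + 0) / 2"
    by (intro tendsto_lowerbound[of R _ sequentially]) auto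
  also have "\<dots> = ?\<beta> + (b - ?\<beta>) / 2" using \<kappa> by (simp add: \<epsilon>_def)
  finally show False using b by (simp add: field_simps)
qed

section \<open>Level and maximinity of the test\<close>

lemma tail_weight_test_level:
  fixes est :: "nat \<Rightarrow> (nat \<Rightarrow> 'k rvec) \<Rightarrow> 'k rvec \<times> 'k rmat"
  assumes est: "is_estimator est" "root_n_consistent (UNIV \<times> spd) (null_model \<nu>) est"
      "locally_asymp_discrete (UNIV \<times> spd) (null_model \<nu>) est"
    and \<alpha>: "0 < \<alpha>" "\<alpha> < 1"
  shows "asymp_level \<nu> \<alpha> (tail_weight_test \<nu> \<alpha> est)"
  unfolding asymp_level_def
proof (intro conjI allI ballI)
  let ?z = "std_normal_upper_quantile (\<alpha> / 2)"
  show "is_test (tail_weight_test \<nu> \<alpha> est)"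
    unfolding is_test_def
  proof (intro allI impI conjI)
    fix n :: nat assume n: "1 \<le> n"
    have [measurable]: "Q_stat \<nu> est n \<in> borel_measurable (sample_space n)" by (rule Q_stat_measurable[OF est(1) n])
    show "tail_weight_test \<nu> \<alpha> est n \<in> borel_measurable (sample_space n)"
      unfolding tail_weight_test_def[abs_def] of_bool_def by measurable
    show "tail_weight_test \<nu> \<alpha> est n ` space (sample_space n) \<subseteq> {0..1}" by (auto simp: tail_weight_test_def)
  qed
  fix \<mu> :: "'k rvec" and \<Sigma> :: "'k rmat" assume \<Sigma>: "\<Sigma> \<in> spd"
  have "transpose (0 :: 'k rmat) = 0" by (simp add: transpose_def vec_eq_iff)
  \<comment> \<open>The null law is the local alternative in direction 0, so the level is a special
    case of the power formula.\<close>
  from power_at_local_alternatives[where \<mu> = \<mu> and z = ?z and m = 0 and \<tau> = 0, OF est(1) plug_in[OF est \<Sigma>] \<Sigma> this]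
  have "(\<lambda>n. \<integral>X. tail_weight_test \<nu> \<alpha> est n X \<partial>student_sample n \<mu> \<Sigma> \<nu>) \<longlonglongrightarrow> \<alpha>"
    using std_normal_upper_quantile(1)[of "\<alpha> / 2"] \<alpha> by (simp add: tail_weight_test_def)
  then have "limsup (\<lambda>n. ereal (\<integral>X. tail_weight_test \<nu> \<alpha> est n X \<partial>student_sample n \<mu> \<Sigma> \<nu>)) = ereal \<alpha>"
    by (intro lim_imp_Limsup) simp_all
  then show "limsup (\<lambda>n. ereal (\<integral>X. tail_weight_test \<nu> \<alpha> est n X \<partial>student_sample n \<mu> \<Sigma> \<nu>)) \<le> ereal \<alpha>" by simp
qed

lemma tail_weight_test_maximin:
  fixes est :: "nat \<Rightarrow> (nat \<Rightarrow> 'k rvec) \<Rightarrow> 'k rvec \<times> 'k rmat"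
  assumes est: "is_estimator est" "root_n_consistent (UNIV \<times> spd) (null_model \<nu>) est"
      "locally_asymp_discrete (UNIV \<times> spd) (null_model \<nu>) est"
    and \<alpha>: "0 < \<alpha>" "\<alpha> < 1"
  shows "locally_asymp_maximin \<nu> \<alpha> (tail_weight_test \<nu> \<alpha> est)"
  unfolding locally_asymp_maximin_def
proof (intro conjI allI ballI impI tail_weight_test_level[OF est \<alpha>])
  fix \<mu> :: "'k rvec" and \<Sigma> :: "'k rmat" and r :: real and \<phi> :: "nat \<Rightarrow> (nat \<Rightarrow> 'k rvec) \<Rightarrow> real"
  assume \<Sigma>: "\<Sigma> \<in> spd" and r: "0 < r" and \<phi>: "asymp_level \<nu> \<alpha> \<phi>"
  let ?z = "std_normal_upper_quantile (\<alpha> / 2)"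
  have z: "0 \<le> ?z" "measure std_normal_distribution {x. ?z < \<bar>x\<bar>} = \<alpha>"
    using std_normal_upper_quantile[of "\<alpha> / 2"] \<alpha> by simp_all
  show "(INF t\<in>local_alternatives r. local_power \<mu> \<Sigma> \<nu> \<phi> t) \<le> (INF t\<in>local_alternatives r. local_power \<mu> \<Sigma> \<nu> (tail_weight_test \<nu> \<alpha> est) t)"
  proof (rule INF_greatest)
    fix t :: "'k rvec \<times> 'k rmat \<times> real" assume t: "t \<in> local_alternatives r"
    obtain m H h where th: "t = (m, H, h)" by (cases t)
    have H: "transpose H = H" and h: "r \<le> \<bar>h\<bar>" using t by (simp_all add: local_alternatives_def th)
    have "local_power \<mu> \<Sigma> \<nu> (tail_weight_test \<nu> \<alpha> est) t = ereal (measure (density lborel (normal_density (h * sqrt G) 1)) {x. ?z < \<bar>x\<bar>})"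
      using power_at_local_alternatives[where \<mu> = \<mu> and z = ?z and m = m and \<tau> = h, OF est(1) plug_in[OF est \<Sigma>] \<Sigma> H]
      by (auto simp: local_power_def th tail_weight_test_def intro!: lim_imp_Liminf)
    note power = this
    \<comment> \<open>Membership in \<open>local_alternatives\<close> constrains \<open>m\<close>
      not at all and the scatter part only by symmetry. So both least favourable points belong to
      the set as soon as their last component has the modulus of \<open>h\<close>.\<close>
    have low: "(INF t\<in>local_alternatives r. local_power \<mu> \<Sigma> \<nu> \<phi> t) \<le> local_power \<mu> \<Sigma> \<nu> \<phi> (least_favourable \<Sigma> h')" if "\<bar>h'\<bar> = \<bar>h\<bar>" for h'
    proof (rule INF_lower)
      have "transpose ((- (h' * c)) *\<^sub>R \<Sigma>) = (- (h' * c)) *\<^sub>R \<Sigma>" by (simp only: transpose_scalar spdD(1)[OF \<Sigma>])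
      then show "least_favourable \<Sigma> h' \<in> local_alternatives r"
        using that h by (simp add: local_alternatives_def least_favourable_def)
    qed
    have "(INF t\<in>local_alternatives r. local_power \<mu> \<Sigma> \<nu> \<phi> t)
      \<le> min (local_power \<mu> \<Sigma> \<nu> \<phi> (least_favourable \<Sigma> h)) (local_power \<mu> \<Sigma> \<nu> \<phi> (least_favourable \<Sigma> (- h)))"
      by (intro min.boundedI low) simp_all
    also have "\<dots> \<le> local_power \<mu> \<Sigma> \<nu> (tail_weight_test \<nu> \<alpha> est) t"
      unfolding power by (rule local_power_bound[OF \<Sigma> \<phi> z])
    finally show "(INF t\<in>local_alternatives r. local_power \<mu> \<Sigma> \<nu> \<phi> t) \<le> local_power \<mu> \<Sigma> \<nu> (tail_weight_test \<nu> \<alpha> est) t" .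
  qed
qed

end

theorem theorem2:
  fixes \<nu>0 \<alpha> :: real
    and \<mu>hat :: "nat \<Rightarrow> (nat \<Rightarrow> 'k rvec) \<Rightarrow> ('k :: {finite, linorder}) rvec"
    and \<Sigma>hat :: "nat \<Rightarrow> (nat \<Rightarrow> 'k rvec) \<Rightarrow> 'k rmat"
  defines "est \<equiv> \<lambda>n X. (\<mu>hat n X, \<Sigma>hat n X)"
  assumes "\<nu>0 > 0" and "0 < \<alpha>" and "\<alpha> < 1"
    and "is_estimator est"
    and "root_n_consistent (UNIV \<times> spd) (null_model \<nu>0) est"
    and "locally_asymp_discrete (UNIV \<times> spd) (null_model \<nu>0) est"
  shows
    "(\<forall>\<mu>. \<forall>\<Sigma>\<in>spd. asymp_normal (\<lambda>n. student_sample n \<mu> \<Sigma> \<nu>0) (Q_stat \<nu>0 est) 0 1)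
   \<and> (\<forall>\<mu>. \<forall>\<Sigma>\<in>spd. \<forall>\<tau> \<tau>3.
        Bseq \<tau> \<longrightarrow> (\<forall>n\<ge>1. \<nu>0 + (1 / sqrt (real n)) * \<tau> n > 0) \<longrightarrow> \<tau> \<longlonglongrightarrow> \<tau>3 \<longrightarrow>
        asymp_normal (\<lambda>n. student_sample n \<mu> \<Sigma> (\<nu>0 + (1 / sqrt (real n)) * \<tau> n)) (Q_stat \<nu>0 est)
          (\<tau>3 * sqrt (eff_fisher33 \<mu> \<Sigma> \<nu>0)) 1)
   \<and> asymp_level \<nu>0 \<alpha> (tail_weight_test \<nu>0 \<alpha> est)
   \<and> locally_asymp_maximin \<nu>0 \<alpha> (tail_weight_test \<nu>0 \<alpha> est)"
proof -
  note est = assms(5-7)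
  obtain a b c G where eff0: "0 < G" "\<And>(\<mu> :: 'k rvec) \<Sigma>. \<Sigma> \<in> spd \<Longrightarrow>
    (\<forall>n X. eff_central3 n \<mu> \<Sigma> \<nu>0 X = 1 / sqrt (real n) * (\<Sum>j<n. log_radial a (- (1 / 2)) b (quad \<mu> \<Sigma> \<nu>0 (X j)))) \<and>
    eff_fisher33 \<mu> \<Sigma> \<nu>0 = G \<and>
    (\<integral>x. log_radial a (- (1 / 2)) b (quad \<mu> \<Sigma> \<nu>0 x) \<partial>student \<mu> \<Sigma> \<nu>0) = 0 \<and>
    (\<integral>x. (log_radial a (- (1 / 2)) b (quad \<mu> \<Sigma> \<nu>0 x))\<^sup>2 \<partial>student \<mu> \<Sigma> \<nu>0) = G \<and>
    (\<forall>x. score (\<mu>, \<Sigma>, \<nu>0) (0, - c *\<^sub>R \<Sigma>, 1) x = log_radial a (- (1 / 2)) b (quad \<mu> \<Sigma> \<nu>0 x)) \<and>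
    (\<forall>m H \<tau>. transpose H = H \<longrightarrow>
      (\<integral>x. log_radial a (- (1 / 2)) b (quad \<mu> \<Sigma> \<nu>0 x) * score (\<mu>, \<Sigma>, \<nu>0) (m, H, \<tau>) x \<partial>student \<mu> \<Sigma> \<nu>0) = \<tau> * G)"
    using efficient_score[OF assms(2), where 'k = 'k] by blast
  interpret efficient_tail_score \<nu>0 a b c G
    by unfold_locales (fact assms(2), fact eff0(1), rule eff0(2))
  have path: "asymp_normal (\<lambda>n. student_sample n \<mu> \<Sigma> (\<nu>0 + (1 / sqrt (real n)) * \<tau> n)) (Q_stat \<nu>0 est) (\<tau>3 * sqrt G) 1"
    if \<Sigma>: "\<Sigma> \<in> spd" and pos: "\<forall>n\<ge>1. \<nu>0 + (1 / sqrt (real n)) * \<tau> n > 0" and lim: "\<tau> \<longlonglongrightarrow> \<tau>3"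
    for \<mu> :: "'k rvec" and \<Sigma> :: "'k rmat" and \<tau> \<tau>3
  proof (rule Q_stat_limit(1)[OF est(1) plug_in[OF est \<Sigma>] \<Sigma>])
    show "transpose (0 :: 'k rmat) = 0" by (simp add: transpose_def vec_eq_iff)
    have "(\<lambda>n. (0, 0, \<tau> n)) \<longlonglongrightarrow> (0 :: 'k rvec, 0 :: 'k rmat, \<tau>3)" by (intro tendsto_intros lim)
    moreover have "\<forall>\<^sub>F n in sequentially. (0, 0, \<tau> n) = sqrt (real n) *\<^sub>R ((\<mu>, \<Sigma>, \<nu>0 + (1 / sqrt (real n)) * \<tau> n) - (\<mu>, \<Sigma>, \<nu>0))"
      using eventually_gt_at_top[of 0] by eventually_elim simp
    ultimately show "(\<lambda>n. sqrt (real n) *\<^sub>R ((\<mu>, \<Sigma>, \<nu>0 + (1 / sqrt (real n)) * \<tau> n) - (\<mu>, \<Sigma>, \<nu>0))) \<longlonglongrightarrow> (0 :: 'k rvec, 0 :: 'k rmat, \<tau>3)"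
      by (rule Lim_transform_eventually)
    show "\<forall>\<^sub>F n in sequentially. \<Sigma> \<in> spd \<and> 0 < \<nu>0 + (1 / sqrt (real n)) * \<tau> n"
      using eventually_ge_at_top[of 1] by eventually_elim (use \<Sigma> pos in simp)
  qed
  show ?thesis
  proof (intro conjI allI ballI impI)
    \<comment> \<open>The null law is the path with constant \<tau> = 0.\<close>
    show "asymp_normal (\<lambda>n. student_sample n \<mu> \<Sigma> \<nu>0) (Q_stat \<nu>0 est) 0 1" if "\<Sigma> \<in> spd" for \<mu> :: "'k rvec" and \<Sigma> :: "'k rmat"
      using path[OF that, of "\<lambda>_. 0" 0 \<mu>] assms(2) by simp
    show "asymp_normal (\<lambda>n. student_sample n \<mu> \<Sigma> (\<nu>0 + (1 / sqrt (real n)) * \<tau> n)) (Q_stat \<nu>0 est)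
        (\<tau>3 * sqrt (eff_fisher33 \<mu> \<Sigma> \<nu>0)) 1"
      if \<Sigma>: "\<Sigma> \<in> spd" and \<tau>: "\<forall>n\<ge>1. \<nu>0 + (1 / sqrt (real n)) * \<tau> n > 0" "\<tau> \<longlonglongrightarrow> \<tau>3"
      for \<mu> :: "'k rvec" and \<Sigma> :: "'k rmat" and \<tau> \<tau>3
      using path[OF \<Sigma> \<tau>, of \<mu>] unfolding psi_facts(2)[OF \<Sigma>] .
    show "asymp_level \<nu>0 \<alpha> (tail_weight_test \<nu>0 \<alpha> est)"
      by (rule tail_weight_test_level[OF est assms(3,4)])
    show "locally_asymp_maximin \<nu>0 \<alpha> (tail_weight_test \<nu>0 \<alpha> est)"
      by (rule tail_weight_test_maximin[OF est assms(3,4)])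
  qed
qed

end
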